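(* Let $\mathcal I$ be an ideal on $\omega$. (1) Under CH, the following conditions are equivalent: (a) $\mathcal I\not\le_K\mathrm{Fin}^2$ ($\mathcal I\not\le_{KB}\mathrm{Fin}^2$, or $\mathcal I\not\le_P\mathrm{Fin}^2$, respectively); (b) there exists an $\mathcal I$-ultrafilter (weak $\mathcal I$-ultrafilter, or $\mathcal I$-point, respectively) which is not a P-point. (2) If $\mathcal I$ is a tall Borel ideal, then the following conditions are equivalent: (a) it is consistent that there exists an $\mathcal I$-ultrafilter (weak $\mathcal I$-ultrafilter, or $\mathcal I$-point, respectively) which is not a P-point; (b) under CH, there exists an $\mathcal I$-ultrafilter (weak $\mathcal I$-ultrafilter, or $\mathcal I$-point, respectively) which is not a P-point.
   Context: An ideal on a set $X$ is a family of subsets of $X$ closed under finite unions and subsets, containing all finite subsets of $X$ and not containing $X$. An ideal on $\omega$ is tall if every infinite subset of $\omega$ contains an infinite member of the ideal. Borel refers to the topology of $\mathcal P(\omega)\cong\{0,1\}^\omega$. $\mathrm{Fin}^2=\{A\subseteq\omega\times\omega:$ for all but finitely many $n$ the section $\{k:(n,k)\in A\}$ is finite$\}$. For ideals $\mathcal I$ on $X$ and $\mathcal K$ on $Y$, $\mathcal I\le_K\mathcal K$ ($\mathcal I\le_{KB}\mathcal K$, $\mathcal I\le_P\mathcal K$) means that there is a function (a finite-to-one function, a one-to-one function, respectively) $f:Y\to X$ with $f^{-1}[B]\in\mathcal K$ for all $B\in\mathcal I$. Ultrafilters on $\omega$ contain all cofinite sets; $\mathcal U^*=\{\omega\setminus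 A:A\in\mathcal U\}$. $\mathcal U$ is an $\mathcal I$-ultrafilter (weak $\mathcal I$-ultrafilter, $\mathcal I$-point) if $\mathcal I\not\le_K\mathcal U^*$ ($\mathcal I\not\le_{KB}\mathcal U^*$, $\mathcal I\not\le_P\mathcal U^*$, respectively). $\mathcal U$ is a P-point if for every countable $\mathcal A\subseteq\mathcal U^*$ there is $B\in\mathcal U$ with $A\cap B$ finite for all $A\in\mathcal A$. "It is consistent that $\varphi$" means that $\varphi$ is consistent with ZFC, Borel ideals being understood through their Borel definitions (codes); "under CH, $\varphi$" means that CH implies $\varphi$.
   Formalization: In (2), "consistent" means true in some well-founded model of ZFC containing the Borel code and all countable ordinals; such a model is assumed to exist; "under CH" means that CH implies the claim in the universe and in all such models. *)

theory Defs
  imports "HOL-Analysis.Analysis" "HOL-Library.Equipollence"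
begin

section \<open>Ideals, reductions and ultrafilters\<close>

text \<open>An ideal on a set \<open>X\<close> is a family over a type \<open>'x\<close> playing the role of \<open>X\<close>; only
  \<open>X = \<omega>\<close> (type \<^typ>\<open>nat\<close>) and \<open>X = \<omega> \<times> \<omega>\<close> (type \<^typ>\<open>nat \<times> nat\<close>) occur.\<close>

definition ideal_on :: "'x set set \<Rightarrow> bool" where
  "ideal_on I \<longleftrightarrow>
     (\<forall>A\<in>I. \<forall>B\<in>I. A \<union> B \<in> I) \<and>
     (\<forall>A\<in>I. \<forall>B. B \<subseteq> A \<longrightarrow> B \<in> I) \<and>
     (\<forall>A. finite A \<longrightarrow> A \<in> I) \<and>
     UNIV \<notin> I"

definition tall :: "nat set set \<Rightarrow> bool" where
  "tall I \<longleftrightarrow> (\<forall>A. infinite A \<longrightarrow> (\<exists>B\<in>I. infinite B \<and> B \<subseteq> A))"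

text \<open>Borel in the Cantor space: \<^typ>\<open>nat \<Rightarrow> bool\<close> carries the product topology of the
  discrete space \<^typ>\<open>bool\<close>.\<close>

definition borel_family :: "nat set set \<Rightarrow> bool" where
  "borel_family I \<longleftrightarrow> (\<lambda>A n. n \<in> A) ` I \<in> sets (borel :: (nat \<Rightarrow> bool) measure)"

definition Fin2 :: "(nat \<times> nat) set set" where
  "Fin2 = {A. finite {n. infinite {k. (n, k) \<in> A}}}"

datatype reduction = Katetov | Katetov_Blass | One_to_One

fun admissible :: "reduction \<Rightarrow> ('y \<Rightarrow> 'x) \<Rightarrow> bool" where
  "admissible Katetov f \<longleftrightarrow> True"
| "admissible Katetov_Blass f \<longleftrightarrow> (\<forall>x. finite (f -` {x}))"
| "admissible One_to_One f \<longleftrightarrow> inj f"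

definition reduces :: "reduction \<Rightarrow> 'x set set \<Rightarrow> 'y set set \<Rightarrow> bool" where
  "reduces r I K \<longleftrightarrow> (\<exists>f :: 'y \<Rightarrow> 'x. admissible r f \<and> (\<forall>B\<in>I. f -` B \<in> K))"

definition ultrafilter :: "nat set set \<Rightarrow> bool" where
  "ultrafilter U \<longleftrightarrow>
     {} \<notin> U \<and>
     (\<forall>A\<in>U. \<forall>B. A \<subseteq> B \<longrightarrow> B \<in> U) \<and>
     (\<forall>A\<in>U. \<forall>B\<in>U. A \<inter> B \<in> U) \<and>
     (\<forall>A. A \<in> U \<or> - A \<in> U) \<and>
     (\<forall>A. finite (- A) \<longrightarrow> A \<in> U)"

definition dual :: "nat set set \<Rightarrow> nat set set" where
  "dual U = uminus ` U"

text \<open>\<open>I\<close>-ultrafilters, weak \<open>I\<close>-ultrafilters and \<open>I\<close>-points, according to \<open>r\<close>.\<close>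

definition I_ultra :: "reduction \<Rightarrow> nat set set \<Rightarrow> nat set set \<Rightarrow> bool" where
  "I_ultra r I U \<longleftrightarrow> ultrafilter U \<and> \<not> reduces r I (dual U)"

definition P_point :: "nat set set \<Rightarrow> bool" where
  "P_point U \<longleftrightarrow> ultrafilter U \<and>
     (\<forall>\<A>. \<A> \<subseteq> dual U \<longrightarrow> countable \<A> \<longrightarrow> (\<exists>B\<in>U. \<forall>A\<in>\<A>. finite (A \<inter> B)))"

definition ex_ultra_not_P :: "reduction \<Rightarrow> nat set set \<Rightarrow> bool" where
  "ex_ultra_not_P r I \<longleftrightarrow> (\<exists>U. I_ultra r I U \<and> \<not> P_point U)"

definition CH :: bool where
  "CH \<longleftrightarrow> (\<forall>A :: real set. countable A \<or> A \<approx> (UNIV :: real set))"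

section \<open>Borel codes\<close>

text \<open>Every Borel set is obtained from the subbasic clopen sets \<open>{x. k \<in> x}\<close> by iterating
  the single operation "complement of a countable union".\<close>

datatype borel_code = Basic nat | Nor "nat \<Rightarrow> borel_code"

primrec borel_set :: "borel_code \<Rightarrow> nat set set" where
  "borel_set (Basic k) = {x. k \<in> x}"
| "borel_set (Nor f) = {x. \<forall>i. x \<notin> borel_set (f i)}"

section \<open>Structures for the language of set theory\<close>

text \<open>First-order formulas with de Bruijn indices, needed only for the two axiom schemas.\<close>

datatype fm = Mem nat nat | Eq nat nat | Nand fm fm | All fm

primrec sat :: "'m set \<Rightarrow> ('m \<Rightarrow> 'm \<Rightarrow> bool) \<Rightarrow> fm \<Rightarrow> (nat \<Rightarrow> 'm) \<Rightarrow> bool" where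
  "sat D E (Mem i j) e \<longleftrightarrow> E (e i) (e j)"
| "sat D E (Eq i j) e \<longleftrightarrow> e i = e j"
| "sat D E (Nand p q) e \<longleftrightarrow> \<not> (sat D E p e \<and> sat D E q e)"
| "sat D E (All p) e \<longleftrightarrow> (\<forall>x\<in>D. sat D E p (case_nat x e))"

text \<open>The predicates of the following locale are truth in the structure \<open>(D, \<epsilon>)\<close> of
  first-order formulas of set theory: all quantifiers that belong to the formula range over
  \<open>D\<close>. The exceptions, which describe the structure from outside, are \<open>standard\<close>,
  \<open>represents\<close>, the argument \<open>n\<close> of \<open>num n\<close> (a formula for each fixed \<open>n\<close>), and the
  quantification over \<open>fm\<close> and over assignments in the schemas.\<close>

locale set_structure =
  fixes D :: "'m set"
    and mem :: "'m \<Rightarrow> 'm \<Rightarrow> bool"  (infix "\<epsilon>" 50)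
begin

definition sub :: "'m \<Rightarrow> 'm \<Rightarrow> bool" where
  "sub a b \<longleftrightarrow> (\<forall>x\<in>D. x \<epsilon> a \<longrightarrow> x \<epsilon> b)"

definition is_empty :: "'m \<Rightarrow> bool" where
  "is_empty a \<longleftrightarrow> (\<forall>x\<in>D. \<not> x \<epsilon> a)"

definition upair :: "'m \<Rightarrow> 'm \<Rightarrow> 'm \<Rightarrow> bool" where
  "upair c a b \<longleftrightarrow> (\<forall>x\<in>D. x \<epsilon> c \<longleftrightarrow> x = a \<or> x = b)"

definition opair :: "'m \<Rightarrow> 'm \<Rightarrow> 'm \<Rightarrow> bool" where
  "opair p a b \<longleftrightarrow> (\<exists>u\<in>D. \<exists>v\<in>D. upair u a a \<and> upair v a b \<and> upair p u v)"

definition big_union :: "'m \<Rightarrow> 'm \<Rightarrow> bool" where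
  "big_union b a \<longleftrightarrow> (\<forall>x\<in>D. x \<epsilon> b \<longleftrightarrow> (\<exists>y\<in>D. y \<epsilon> a \<and> x \<epsilon> y))"

definition powerset_of :: "'m \<Rightarrow> 'm \<Rightarrow> bool" where
  "powerset_of b a \<longleftrightarrow> (\<forall>x\<in>D. x \<epsilon> b \<longleftrightarrow> sub x a)"

definition inter_of :: "'m \<Rightarrow> 'm \<Rightarrow> 'm \<Rightarrow> bool" where
  "inter_of c a b \<longleftrightarrow> (\<forall>x\<in>D. x \<epsilon> c \<longleftrightarrow> x \<epsilon> a \<and> x \<epsilon> b)"

definition diff_of :: "'m \<Rightarrow> 'm \<Rightarrow> 'm \<Rightarrow> bool" where
  "diff_of c a b \<longleftrightarrow> (\<forall>x\<in>D. x \<epsilon> c \<longleftrightarrow> x \<epsilon> a \<and> \<not> x \<epsilon> b)"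

definition succ_of :: "'m \<Rightarrow> 'm \<Rightarrow> bool" where
  "succ_of b a \<longleftrightarrow> (\<forall>x\<in>D. x \<epsilon> b \<longleftrightarrow> x \<epsilon> a \<or> x = a)"

definition is_inductive :: "'m \<Rightarrow> bool" where
  "is_inductive w \<longleftrightarrow>
     (\<exists>z\<in>D. is_empty z \<and> z \<epsilon> w) \<and>
     (\<forall>n\<in>D. n \<epsilon> w \<longrightarrow> (\<exists>s\<in>D. succ_of s n \<and> s \<epsilon> w))"

definition omega :: "'m \<Rightarrow> bool" where
  "omega w \<longleftrightarrow> is_inductive w \<and> (\<forall>v\<in>D. is_inductive v \<longrightarrow> sub w v)"

definition transitive_set :: "'m \<Rightarrow> bool" where
  "transitive_set a \<longleftrightarrow> (\<forall>x\<in>D. x \<epsilon> a \<longrightarrow> sub x a)"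

definition ordinal :: "'m \<Rightarrow> bool" where
  "ordinal a \<longleftrightarrow> transitive_set a \<and> (\<forall>x\<in>D. x \<epsilon> a \<longrightarrow> transitive_set x)"

definition app :: "'m \<Rightarrow> 'm \<Rightarrow> 'm \<Rightarrow> bool" where
  "app f x y \<longleftrightarrow> (\<exists>p\<in>D. opair p x y \<and> p \<epsilon> f)"

definition function_on :: "'m \<Rightarrow> 'm \<Rightarrow> bool" where
  "function_on f a \<longleftrightarrow>
     (\<forall>p\<in>D. p \<epsilon> f \<longrightarrow> (\<exists>x\<in>D. \<exists>y\<in>D. x \<epsilon> a \<and> opair p x y)) \<and>
     (\<forall>x\<in>D. x \<epsilon> a \<longrightarrow> (\<exists>!y. y \<in> D \<and> app f x y))"

definition function_into :: "'m \<Rightarrow> 'm \<Rightarrow> 'm \<Rightarrow> bool" where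
  "function_into f a b \<longleftrightarrow>
     function_on f a \<and> (\<forall>x\<in>D. \<forall>y\<in>D. app f x y \<longrightarrow> y \<epsilon> b)"

definition injective :: "'m \<Rightarrow> bool" where
  "injective f \<longleftrightarrow> (\<forall>x\<in>D. \<forall>x'\<in>D. \<forall>y\<in>D. app f x y \<longrightarrow> app f x' y \<longrightarrow> x = x')"

definition bijection :: "'m \<Rightarrow> 'm \<Rightarrow> 'm \<Rightarrow> bool" where
  "bijection f a b \<longleftrightarrow> function_into f a b \<and> injective f \<and>
     (\<forall>y\<in>D. y \<epsilon> b \<longrightarrow> (\<exists>x\<in>D. x \<epsilon> a \<and> app f x y))"

subsection \<open>The axioms of ZFC\<close>

definition extensionality :: bool where
  "extensionality \<longleftrightarrow> (\<forall>a\<in>D. \<forall>b\<in>D. (\<forall>x\<in>D. x \<epsilon> a \<longleftrightarrow> x \<epsilon> b) \<longrightarrow> a = b)"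

definition foundation :: bool where
  "foundation \<longleftrightarrow>
     (\<forall>a\<in>D. \<not> is_empty a \<longrightarrow> (\<exists>x\<in>D. x \<epsilon> a \<and> \<not> (\<exists>y\<in>D. y \<epsilon> x \<and> y \<epsilon> a)))"

definition pairing :: bool where
  "pairing \<longleftrightarrow> (\<forall>a\<in>D. \<forall>b\<in>D. \<exists>c\<in>D. upair c a b)"

definition union_axiom :: bool where
  "union_axiom \<longleftrightarrow> (\<forall>a\<in>D. \<exists>b\<in>D. big_union b a)"

definition powerset_axiom :: bool where
  "powerset_axiom \<longleftrightarrow> (\<forall>a\<in>D. \<exists>b\<in>D. powerset_of b a)"

definition infinity_axiom :: bool where
  "infinity_axiom \<longleftrightarrow> (\<exists>w\<in>D. is_inductive w)"

definition separation :: bool where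
  "separation \<longleftrightarrow>
     (\<forall>p e. (\<forall>i. e i \<in> D) \<longrightarrow>
        (\<forall>a\<in>D. \<exists>b\<in>D. \<forall>x\<in>D. x \<epsilon> b \<longleftrightarrow> x \<epsilon> a \<and> sat D (\<epsilon>) p (case_nat x e)))"

definition replacement :: bool where
  "replacement \<longleftrightarrow>
     (\<forall>p e. (\<forall>i. e i \<in> D) \<longrightarrow>
        (\<forall>a\<in>D.
           (\<forall>x\<in>D. x \<epsilon> a \<longrightarrow> (\<exists>!y. y \<in> D \<and> sat D (\<epsilon>) p (case_nat x (case_nat y e)))) \<longrightarrow>
           (\<exists>b\<in>D. \<forall>y\<in>D. y \<epsilon> b \<longleftrightarrow>
              (\<exists>x\<in>D. x \<epsilon> a \<and> sat D (\<epsilon>) p (case_nat x (case_nat y e))))))"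

definition choice :: bool where
  "choice \<longleftrightarrow>
     (\<forall>a\<in>D.
        (\<forall>x\<in>D. x \<epsilon> a \<longrightarrow> \<not> is_empty x) \<and>
        (\<forall>x\<in>D. \<forall>y\<in>D. x \<epsilon> a \<and> y \<epsilon> a \<and> x \<noteq> y \<longrightarrow> \<not> (\<exists>z\<in>D. z \<epsilon> x \<and> z \<epsilon> y)) \<longrightarrow>
        (\<exists>c\<in>D. \<forall>x\<in>D. x \<epsilon> a \<longrightarrow> (\<exists>!z. z \<in> D \<and> z \<epsilon> x \<and> z \<epsilon> c)))"

definition ZFC :: bool where
  "ZFC \<longleftrightarrow> D \<noteq> {} \<and> extensionality \<and> foundation \<and> pairing \<and> union_axiom \<and>
     powerset_axiom \<and> infinity_axiom \<and> separation \<and> replacement \<and> choice"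

subsection \<open>Standard models and the codes they contain\<close>

text \<open>Well-founded, and every countable ordinal (given as a well-order of a set of natural
  numbers) is an ordinal of the structure. Up to isomorphism these are the transitive
  \<open>D\<close> with \<open>\<omega>\<^sub>1 \<subseteq> D\<close>, that is, the structures to which Shoenfield absoluteness applies.\<close>

definition standard :: bool where
  "standard \<longleftrightarrow>
     wfP (\<lambda>x y. x \<in> D \<and> y \<in> D \<and> x \<epsilon> y) \<and>
     (\<forall>r :: (nat \<times> nat) set. Well_order r \<longrightarrow>
        (\<exists>a\<in>D. ordinal a \<and>
           (\<exists>h. bij_betw h (Field r) {x \<in> D. x \<epsilon> a} \<and>
              (\<forall>i\<in>Field r. \<forall>j\<in>Field r. (i, j) \<in> r \<and> i \<noteq> j \<longleftrightarrow> h i \<epsilon> h j))))"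

primrec num :: "nat \<Rightarrow> 'm \<Rightarrow> bool" where
  "num 0 x \<longleftrightarrow> is_empty x"
| "num (Suc n) x \<longleftrightarrow> (\<exists>y\<in>D. num n y \<and> succ_of x y)"

text \<open>Inside a structure, \<open>Basic k\<close> is the pair \<open>\<langle>0, k\<rangle>\<close> and \<open>Nor f\<close> is the pair \<open>\<langle>1, F\<rangle>\<close>,
  where \<open>F\<close> is a function on \<open>\<omega>\<close> whose \<open>i\<close>-th value is the code \<open>f i\<close>.\<close>

primrec represents :: "borel_code \<Rightarrow> 'm \<Rightarrow> bool" where
  "represents (Basic k) m \<longleftrightarrow> (\<exists>z\<in>D. \<exists>n\<in>D. num 0 z \<and> num k n \<and> opair m z n)"
| "represents (Nor f) m \<longleftrightarrow>
     (\<exists>z\<in>D. \<exists>F\<in>D. \<exists>w\<in>D. num 1 z \<and> opair m z F \<and> omega w \<and> function_on F w \<and>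
        (\<forall>i. \<exists>n\<in>D. \<exists>y\<in>D. num i n \<and> app F n y \<and> represents (f i) y))"

subsection \<open>The sentences in question, evaluated in the structure\<close>

text \<open>From here on the parameter \<open>w\<close> is the \<open>\<omega>\<close> of the structure.\<close>

definition finite_in :: "'m \<Rightarrow> 'm \<Rightarrow> bool" where
  "finite_in w a \<longleftrightarrow> (\<exists>n\<in>D. n \<epsilon> w \<and> (\<exists>f\<in>D. bijection f n a))"

definition countable_in :: "'m \<Rightarrow> 'm \<Rightarrow> bool" where
  "countable_in w a \<longleftrightarrow> (\<exists>f\<in>D. function_into f a w \<and> injective f)"

definition CH_in :: bool where
  "CH_in \<longleftrightarrow>
     (\<exists>w\<in>D. \<exists>P\<in>D. omega w \<and> powerset_of P w \<and>
        (\<forall>A\<in>D. sub A P \<longrightarrow> countable_in w A \<or> (\<exists>f\<in>D. bijection f A P)))"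

text \<open>\<open>in_coded w m x\<close>: \<open>x\<close> belongs to the Borel set coded by \<open>m\<close>. The set \<open>T\<close> contains \<open>m\<close>
  and all its subcodes, and \<open>v\<close> collects those elements of \<open>T\<close> whose Borel set contains \<open>x\<close>.\<close>

definition basic_in :: "'m \<Rightarrow> 'm \<Rightarrow> 'm \<Rightarrow> bool" where
  "basic_in w t k \<longleftrightarrow> k \<epsilon> w \<and> (\<exists>z\<in>D. num 0 z \<and> opair t z k)"

definition nor_in :: "'m \<Rightarrow> 'm \<Rightarrow> 'm \<Rightarrow> bool" where
  "nor_in w t F \<longleftrightarrow> function_on F w \<and> (\<exists>z\<in>D. num 1 z \<and> opair t z F)"

definition evaluates :: "'m \<Rightarrow> 'm \<Rightarrow> 'm \<Rightarrow> 'm \<Rightarrow> bool" where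
  "evaluates w T v x \<longleftrightarrow>
     (\<forall>t\<in>D. \<forall>k\<in>D. t \<epsilon> T \<and> basic_in w t k \<longrightarrow> (t \<epsilon> v \<longleftrightarrow> k \<epsilon> x)) \<and>
     (\<forall>t\<in>D. \<forall>F\<in>D. t \<epsilon> T \<and> nor_in w t F \<longrightarrow>
        (\<forall>n\<in>D. \<forall>s\<in>D. app F n s \<longrightarrow> s \<epsilon> T) \<and>
        (t \<epsilon> v \<longleftrightarrow> (\<forall>n\<in>D. \<forall>s\<in>D. app F n s \<longrightarrow> \<not> s \<epsilon> v)))"

definition in_coded :: "'m \<Rightarrow> 'm \<Rightarrow> 'm \<Rightarrow> bool" where
  "in_coded w m x \<longleftrightarrow> sub x w \<and>
     (\<exists>T\<in>D. \<exists>v\<in>D. m \<epsilon> T \<and> evaluates w T v x \<and> m \<epsilon> v)"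

definition ultrafilter_in :: "'m \<Rightarrow> 'm \<Rightarrow> bool" where
  "ultrafilter_in w U \<longleftrightarrow>
     (\<forall>A\<in>D. A \<epsilon> U \<longrightarrow> sub A w \<and> \<not> is_empty A) \<and>
     (\<forall>A\<in>D. \<forall>B\<in>D. A \<epsilon> U \<and> sub A B \<and> sub B w \<longrightarrow> B \<epsilon> U) \<and>
     (\<forall>A\<in>D. \<forall>B\<in>D. \<forall>C\<in>D. A \<epsilon> U \<and> B \<epsilon> U \<and> inter_of C A B \<longrightarrow> C \<epsilon> U) \<and>
     (\<forall>A\<in>D. \<forall>C\<in>D. sub A w \<and> diff_of C w A \<longrightarrow> A \<epsilon> U \<or> C \<epsilon> U) \<and>
     (\<forall>A\<in>D. \<forall>C\<in>D. sub A w \<and> diff_of C w A \<and> finite_in w C \<longrightarrow> A \<epsilon> U)"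

definition in_dual :: "'m \<Rightarrow> 'm \<Rightarrow> 'm \<Rightarrow> bool" where
  "in_dual w U A \<longleftrightarrow> sub A w \<and> (\<exists>C\<in>D. diff_of C w A \<and> C \<epsilon> U)"

definition preimage_of :: "'m \<Rightarrow> 'm \<Rightarrow> 'm \<Rightarrow> 'm \<Rightarrow> bool" where
  "preimage_of C w f B \<longleftrightarrow> (\<forall>x\<in>D. x \<epsilon> C \<longleftrightarrow> x \<epsilon> w \<and> (\<exists>y\<in>D. y \<epsilon> B \<and> app f x y))"

primrec admissible_in :: "reduction \<Rightarrow> 'm \<Rightarrow> 'm \<Rightarrow> bool" where
  "admissible_in Katetov w f \<longleftrightarrow> True"
| "admissible_in Katetov_Blass w f \<longleftrightarrow>
     (\<forall>y\<in>D. \<forall>s\<in>D. \<forall>C\<in>D. y \<epsilon> w \<and> upair s y y \<and> preimage_of C w f s \<longrightarrow> finite_in w C)"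
| "admissible_in One_to_One w f \<longleftrightarrow> injective f"

text \<open>The ideal with code \<open>m\<close> reduces to the dual ideal of \<open>U\<close>.\<close>

definition reduces_in :: "reduction \<Rightarrow> 'm \<Rightarrow> 'm \<Rightarrow> 'm \<Rightarrow> bool" where
  "reduces_in r w m U \<longleftrightarrow>
     (\<exists>f\<in>D. function_into f w w \<and> admissible_in r w f \<and>
        (\<forall>B\<in>D. in_coded w m B \<longrightarrow> (\<exists>C\<in>D. preimage_of C w f B \<and> in_dual w U C)))"

definition P_point_in :: "'m \<Rightarrow> 'm \<Rightarrow> bool" where
  "P_point_in w U \<longleftrightarrow> ultrafilter_in w U \<and>
     (\<forall>\<A>\<in>D. (\<forall>A\<in>D. A \<epsilon> \<A> \<longrightarrow> in_dual w U A) \<and> countable_in w \<A> \<longrightarrow>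
        (\<exists>B\<in>D. B \<epsilon> U \<and>
           (\<forall>A\<in>D. A \<epsilon> \<A> \<longrightarrow> (\<exists>C\<in>D. inter_of C A B \<and> finite_in w C))))"

definition ex_ultra_not_P_in :: "reduction \<Rightarrow> 'm \<Rightarrow> bool" where
  "ex_ultra_not_P_in r m \<longleftrightarrow>
     (\<exists>w\<in>D. omega w \<and>
        (\<exists>U\<in>D. ultrafilter_in w U \<and> \<not> reduces_in r w m U \<and> \<not> P_point_in w U))"

text \<open>A standard model of ZFC in which the element \<open>m\<close> is the Borel code \<open>c\<close>.\<close>

definition model_with_code :: "borel_code \<Rightarrow> 'm \<Rightarrow> bool" where
  "model_with_code c m \<longleftrightarrow> ZFC \<and> standard \<and> m \<in> D \<and> represents c m"

end

section \<open>Consistency for statements about a Borel code\<close>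

text \<open>A statement about the Borel ideal with code \<open>c\<close> is consistent with ZFC if it is true in
  some model of ZFC in which \<open>c\<close> is correctly interpreted: a standard model containing \<open>c\<close>.
  Ill-founded models, or countable transitive ones, would not do: they can disagree about
  whether \<open>I \<le>\<^sub>K Fin\<^sup>2\<close> (a \<open>\<Sigma>\<^sup>1\<^sub>2\<close> property of the code), and the equivalence between
  consistency and truth under CH would fail.

  It is no restriction to let the domains be sets of elements of \<^typ>\<open>nat set\<close>, that is, of
  cardinality at most the continuum: in any standard model the Skolem hull of its countable
  ordinals and of the code is an elementary submodel of cardinality \<open>\<aleph>\<^sub>1\<close>, again standard.\<close>

definition ZFC_consistent :: "borel_code \<Rightarrow> bool" where
  "ZFC_consistent c \<longleftrightarrow>
     (\<exists>(D :: nat set set) E m. set_structure.model_with_code D E c m)"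

definition consistent_ex_ultra_not_P :: "reduction \<Rightarrow> borel_code \<Rightarrow> bool" where
  "consistent_ex_ultra_not_P r c \<longleftrightarrow>
     (\<exists>(D :: nat set set) E m. set_structure.model_with_code D E c m \<and>
        set_structure.ex_ultra_not_P_in D E r m)"

text \<open>\<open>CH \<longrightarrow> \<phi>\<close> as a theorem about the code \<open>c\<close>: it holds in the ambient universe and in all
  the models. The ambient implication alone would not do, being vacuous if CH fails.\<close>

definition under_CH_ex_ultra_not_P :: "reduction \<Rightarrow> borel_code \<Rightarrow> bool" where
  "under_CH_ex_ultra_not_P r c \<longleftrightarrow>
     (CH \<longrightarrow> ex_ultra_not_P r (borel_set c)) \<and>
     (\<forall>(D :: nat set set) E m. set_structure.model_with_code D E c m \<longrightarrow>
        set_structure.CH_in D E \<longrightarrow> set_structure.ex_ultra_not_P_in D E r m)"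

end

theory Submission
  imports Defs
begin

text \<open>For a family \<open>R\<close> of reals closed under arithmetic, write \<open>redF R r I\<close> for the existence of \<open>f\<close> in \<open>R\<close>
 witnessing the reduction of \<open>I\<close> to \<open>Fin\<^sup>2\<close> on \<open>R\<close>. If \<open>U\<close> is not a P-point, a bad sequence in its dual
 reduces \<open>Fin\<^sup>2\<close> to the dual, so that \<open>redF R r I\<close> prevents \<open>U\<close> from being as required. Conversely, if
 \<open>redF R r I\<close> fails, then along a well-order of \<open>R\<close> with countable initial segments one builds a tower of sets
 not in \<open>Fin\<^sup>2\<close>, decreasing modulo \<open>Fin\<^sup>2\<close>, that decides every set and kills every admissible function; it
 generates an ultrafilter as required. This gives (1) with \<open>R\<close> the set of all reals, and its version inside
 a model with \<open>R\<close> the reals of the model.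

 For (2), \<open>redF\<close> is a \<open>\<Sigma>\<^sup>1\<^sub>2\<close> property of the Borel code, hence absolute to standard models (Shoenfield):
 a tree of attempts in the model has a branch in the model if it has one at all, the countable ordinals
 needed to rank the well-founded tree of a witness being in the model. So one model decides (a) and (b),
 provided that some model with the code satisfies CH: this is the constructible universe of the model
 relative to a real coding \<open>c\<close>, where every real lies in a countable level by condensation.\<close>

text \<open>The models are arbitrary relations, so nothing can be built in them except through
  formulas. To avoid writing formulas, definability is treated semantically: \<open>dfn\<close> and
  \<open>dtm\<close> are closed under the logical operations, and the axiom schemas then apply to
  every expression that these rules cover. The tower argument is stated for a family of reals
  because it runs once in the universe and once in a model; \<open>ar\<close> collects the
  operations on numbers that it needs. A well-order of the constructible universe comes from naming:
  every set is the unique solution, in some level, of a formula whose only parameter is the real,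
  and a name is an ordinal with a formula number. This order also supplies the definable witnesses
  for condensation. The two directions of absoluteness differ in strength. A reduction found in the
  model stays one in the universe because the model is well-founded. A reduction of the universe is
  brought into the model together with external ranks, and this is what the countable ordinals are
  for; the function found in the model may be a different one.\<close>

notation (input) iff (infixr "<->" 25)

section \<open>Definability over a structure\<close>

primrec ren :: "(nat => nat) => fm => fm" where
 "ren f (Mem i j) = Mem (f i) (f j)"
| "ren f (Eq i j) = Eq (f i) (f j)"
| "ren f (Nand p q) = Nand (ren f p) (ren f q)"
| "ren f (All p) = All (ren (case_nat 0 (%i. Suc (f i))) p)"

lemma sat_ren: "sat D E (ren f p) e <-> sat D E p (%i. e (f i))"
proof (induction p arbitrary: f e)
 case (All p)
 have "(%i. case_nat x e (case_nat 0 (%i. Suc (f i)) i)) = case_nat x (%i. e (f i))" for x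
  by (auto split: nat.splits)
 then show ?case using All by simp
qed auto

named_theorems dfn_intros

context set_structure
begin

definition env :: "(nat => 'm) => bool" where
 "env e <-> (ALL i. e i \<in> D)"

lemma envD [simp, intro]: "env e ==> e i \<in> D"
 by (simp add: env_def)

lemma env_Suc [simp, intro]: "env e ==> env (%i. e (Suc i))"
 by (simp add: env_def)

lemma env_case_nat [simp, intro]: "env e ==> x \<in> D ==> env (case_nat x e)"
 by (auto simp: env_def split: nat.splits)

text \<open>\<open>dfn A P\<close>: the relation \<open>P\<close> on assignments is first-order definable with parameters from
 \<open>A\<close>. \<open>dtm A t\<close>: \<open>t\<close> maps assignments to elements and its graph is so definable. Bound
 variables are handled by the shift of assignments, as in \<^term>\<open>sat\<close>.\<close>

definition dfn :: "'m set => ((nat => 'm) => bool) => bool" where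
 "dfn A P <-> (EX p s. (ALL i c. s i = Inr c --> c \<in> A \<inter> D) &
   (ALL e. env e --> P e = sat D (\<epsilon>) p (%i. case_sum e id (s i))))"

definition dtm :: "'m set => ((nat => 'm) => 'm) => bool" where
 "dtm A t <-> (ALL e. env e --> t e \<in> D) & dfn A (%e. e 0 = t (%i. e (Suc i)))"

lemma dfnI:
 assumes "!!i c. s i = Inr c ==> c \<in> A" "!!i c. s i = Inr c ==> c \<in> D"
  and "!!e. env e ==> P e = sat D (\<epsilon>) p (%i. case_sum e id (s i))"
 shows "dfn A P"
 unfolding dfn_def by (intro exI[of _ p] exI[of _ s]) (use assms in auto)

lemma dfn_cong: "dfn A P ==> (!!e. env e ==> P e = Q e) ==> dfn A Q"
 unfolding dfn_def by simp

lemma dfnE: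
 assumes "dfn A P"
 obtains p s where "!!i c. s i = Inr c ==> c \<in> A \<inter> D"
  "!!e. env e ==> P e = sat D (\<epsilon>) p (%i. case_sum e id (s i))"
proof -
 obtain p s where *: "ALL i c. s i = Inr c --> c \<in> A \<inter> D"
  "ALL e. env e --> P e = sat D (\<epsilon>) p (%i. case_sum e id (s i))"
  using assms unfolding dfn_def by (elim exE conjE) (rule that)
 show thesis by (rule that[of s p]) (use * in auto)
qed

lemma dfn_mono:
 assumes "dfn A P" "A \<inter> D \<subseteq> B" shows "dfn B P"
proof -
 obtain p s where s: "!!i c. s i = Inr c ==> c \<in> A \<inter> D"
  and p: "!!e. env e ==> P e = sat D (\<epsilon>) p (%i. case_sum e id (s i))"
  by (rule dfnE[OF assms(1)]) (rule that)
 show ?thesis by (rule dfnI[of s _ _ p]) (use s p assms(2) in auto)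
qed

lemma dtmD [simp, intro]: "dtm A t ==> env e ==> t e \<in> D"
 by (simp add: dtm_def)

lemma dtm_mono: "dtm A t ==> A \<inter> D \<subseteq> B ==> dtm B t"
 unfolding dtm_def using dfn_mono by blast

lemma dtm_cong: "dtm A t ==> (!!e. env e ==> t e = u e) ==> dtm A u"
 unfolding dtm_def by (auto elim: dfn_cong)

lemma dfn_mem_var: "dfn A (%e. e i \<epsilon> e j)"
 by (rule dfnI[of Inl _ _ "Mem i j"]) auto

lemma dfn_eq_var: "dfn A (%e. e i = e j)"
 by (rule dfnI[of Inl _ _ "Eq i j"]) auto

lemma dfn_eq_const: "c \<in> A ==> c \<in> D ==> dfn A (%e. e i = c)"
 by (rule dfnI[of "%k. if k = 0 then Inl i else Inr c" _ _ "Eq 0 1"]) (auto split: if_splits)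

lemma dfn_nand:
 assumes "dfn A P" "dfn A Q"
 shows "dfn A (%e. ~ (P e & Q e))"
proof -
 obtain p s where s: "!!i c. s i = Inr c ==> c \<in> A \<inter> D"
  and p: "!!e. env e ==> P e = sat D (\<epsilon>) p (%i. case_sum e id (s i))"
  by (rule dfnE[OF assms(1)]) (rule that)
 obtain q s' where s': "!!i c. s' i = Inr c ==> c \<in> A \<inter> D"
  and q: "!!e. env e ==> Q e = sat D (\<epsilon>) q (%i. case_sum e id (s' i))"
  by (rule dfnE[OF assms(2)]) (rule that)
 \<comment> \<open>The slots of the two formulas are interleaved on even and odd variables, so that
   one slot map serves both.\<close>
 let ?s = "%i. if even i then s (i div 2) else s' (i div 2)"
 let ?p = "Nand (ren (%i. 2 * i) p) (ren (%i. 2 * i + 1) q)"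
 show ?thesis
 proof (rule dfnI[of ?s _ _ ?p])
  show "~ (P e & Q e) <-> sat D (\<epsilon>) ?p (%i. case_sum e id (?s i))" if "env e" for e
   using p[OF that] q[OF that] by (simp add: sat_ren)
 qed (use s s' in \<open>auto split: if_splits\<close>)
qed

lemma dfn_not [dfn_intros]: "dfn A P ==> dfn A (%e. ~ P e)"
 using dfn_nand[of A P P] by simp

lemma dfn_conj [dfn_intros]: "dfn A P ==> dfn A Q ==> dfn A (%e. P e & Q e)"
 using dfn_not[OF dfn_nand[of A P Q]] by simp

lemma dfn_disj [dfn_intros]: "dfn A P ==> dfn A Q ==> dfn A (%e. P e \<or> Q e)"
 using dfn_nand[OF dfn_not dfn_not, of A P Q] by simp

lemma dfn_imp [dfn_intros]: "dfn A P ==> dfn A Q ==> dfn A (%e. P e --> Q e)"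
proof -
 assume "dfn A P" "dfn A Q"
 then have "dfn A (%e. ~ P e \<or> Q e)" by (intro dfn_disj dfn_not)
 then show ?thesis by (rule dfn_cong) auto
qed

lemma dfn_iff [dfn_intros]: "dfn A P ==> dfn A Q ==> dfn A (%e. P e <-> Q e)"
proof -
 assume "dfn A P" "dfn A Q"
 then have "dfn A (%e. (P e --> Q e) & (Q e --> P e))" by (intro dfn_conj dfn_imp)
 then show ?thesis by (rule dfn_cong) auto
qed

lemma dfn_const [dfn_intros]: "dfn A (%e. P)"
proof -
 have "dfn A (%e. e 0 = e 0)" by (rule dfn_eq_var)
 then have t: "dfn A (%e. True)" by simp
 show ?thesis using t dfn_not[OF t] by (cases P) auto
qed

lemma dfn_if [dfn_intros]: "dfn A B ==> dfn A P ==> dfn A Q ==> dfn A (%e. if B e then P e else Q e)"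
proof -
 assume "dfn A B" "dfn A P" "dfn A Q"
 then have "dfn A (%e. (B e --> P e) & (~ B e --> Q e))" by (intro dfn_conj dfn_imp dfn_not)
 then show ?thesis by (rule dfn_cong) auto
qed

lemma dfn_all [dfn_intros]:
 assumes "dfn A (%e. Q (e 0) (%i. e (Suc i)))"
 shows "dfn A (%e. ALL x:D. Q x e)"
proof -
 obtain p s where s: "!!i c. s i = Inr c ==> c \<in> A \<inter> D"
  and p: "!!e. env e ==> Q (e 0) (%i. e (Suc i)) = sat D (\<epsilon>) p (%i. case_sum e id (s i))"
  by (rule dfnE[OF assms(1)]) (rule that)
 let ?s = "%i. case s i of Inl 0 => Inl 0 | Inl (Suc j) => Inl j | Inr c => Inr c"
 \<comment> \<open>Variables whose slot is the quantified index 0 are renamed to the bound variable,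
   all others are shifted past it; the value of \<open>?s\<close> at the former is a filler.\<close>
 let ?f = "%i. if s i = Inl 0 then 0 else Suc i"
 let ?p = "All (ren ?f p)"
 show ?thesis
 proof (rule dfnI[of ?s _ _ ?p])
  fix e assume e: "env e"
  have "(%i. case_nat x (%i. case_sum e id (?s i)) (?f i)) = (%i. case_sum (case_nat x e) id (s i))" for x
   by (auto split: sum.splits nat.splits)
  then show "(ALL x:D. Q x e) <-> sat D (\<epsilon>) ?p (%i. case_sum e id (?s i))"
   using p[of "case_nat x e" for x] e by (simp add: sat_ren)
 qed (use s in \<open>auto split: if_splits sum.splits nat.splits\<close>)
qed

lemma dfn_ex [dfn_intros]:
 assumes "dfn A (%e. Q (e 0) (%i. e (Suc i)))"
 shows "dfn A (%e. EX x:D. Q x e)"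
proof -
 have "dfn A (%e. ALL x:D. ~ Q x e)" by (intro dfn_all dfn_not assms)
 from dfn_not[OF this] show ?thesis by simp
qed

lemma dfn_ren: "dfn A P ==> dfn A (%e. P (%i. e (f i)))"
proof -
 assume P: "dfn A P"
 obtain p s where s: "!!i c. s i = Inr c ==> c \<in> A \<inter> D"
  and p: "!!e. env e ==> P e = sat D (\<epsilon>) p (%i. case_sum e id (s i))"
  by (rule dfnE[OF P]) (rule that)
 let ?s = "%i. case s i of Inl j => Inl (f j) | Inr c => Inr c"
 have "(%i. case_sum e id (?s i)) = (%i. case_sum (%i. e (f i)) id (s i))" for e
  by (auto split: sum.splits)
 moreover have "env (%i. e (f i))" if "env e" for e using that by (simp add: env_def)
 ultimately show ?thesis using p
  by (intro dfnI[of ?s _ _ p]) (use s in \<open>auto split: sum.splits\<close>)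
qed

text \<open>Only the graph of \<open>t\<close> is definable, so the term is eliminated by
  quantifying over its value.\<close>

lemma dfn_term:
 assumes "dfn A (%e. Q (e 0) (%i. e (Suc i)))" "dtm A t"
 shows "dfn A (%e. Q (t e) e)"
proof -
 have "dfn A (%e. EX x:D. x = t e & Q x e)"
  using assms unfolding dtm_def by (intro dfn_intros) auto
 then show ?thesis by (rule dfn_cong) (use assms in auto)
qed

lemma dtm_var [dfn_intros]: "dtm A (%e. e i)"
 unfolding dtm_def using dfn_eq_var by auto

lemma dtm_const [dfn_intros]: "c \<in> A ==> c \<in> D ==> dtm A (%e. c)"
 unfolding dtm_def using dfn_eq_const by auto

lemma dtm_ren: "dtm A t ==> dtm A (%e. t (%i. e (f i)))"
proof -
 assume t: "dtm A t"
 then have "dfn A (%e. e 0 = t (%i. e (Suc i)))" by (simp add: dtm_def)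
 from dfn_ren[OF this, of "case_nat 0 (%i. Suc (f i))"]
 have "dfn A (%e. e 0 = t (%i. e (Suc (f i))))" by simp
 then show ?thesis using t unfolding dtm_def by (auto simp: env_def)
qed

lemma dtm_shift: "dtm A t ==> dtm A (%e. t (%i. e (Suc i)))"
 by (rule dtm_ren)

lemma dfn_mem [dfn_intros]:
 assumes "dtm A t" "dtm A u" shows "dfn A (%e. t e \<epsilon> u e)"
proof -
 have "dfn A (%e. e 0 \<epsilon> u (%i. e (Suc i)))"
  by (rule dfn_term[of A "%y e. e 0 \<epsilon> y", OF _ dtm_shift[OF assms(2)]]) (rule dfn_mem_var)
 from dfn_term[of A "%x e. x \<epsilon> u e", OF this assms(1)] show ?thesis .
qed

lemma dfn_eq [dfn_intros]:
 assumes "dtm A t" "dtm A u" shows "dfn A (%e. t e = u e)"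
proof -
 have "dfn A (%e. e 0 = u (%i. e (Suc i)))"
  by (rule dfn_term[of A "%y e. e 0 = y", OF _ dtm_shift[OF assms(2)]]) (rule dfn_eq_var)
 from dfn_term[of A "%x e. x = u e", OF this assms(1)] show ?thesis .
qed

text \<open>Terms are substituted for all variables of a fixed formula at once, by induction on the
  formula. Constants are terms too, so \<open>dfn_subst\<close> can treat parameters and variables
  alike.\<close>

lemma dfn_sat_terms:
 assumes "!!i. dtm A (t i)"
 shows "dfn A (%e. sat D (\<epsilon>) p (%i. t i e))"
 using assms
proof (induction p arbitrary: t)
 case (Nand p q)
 then show ?case unfolding sat.simps by (intro dfn_nand) auto
next
 case (All p)
 let ?t = "%i. case i of 0 => (%e. e 0) | Suc i => (%e. t i (%i. e (Suc i)))"
 have "dtm A (?t i)" for i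
  by (cases i) (auto intro: dtm_var dtm_shift All.prems)
 from All.IH[OF this] have "dfn A (%e. sat D (\<epsilon>) p (%i. ?t i e))" .
 moreover have "(%i. ?t i e) = case_nat (e 0) (%i. t i (%i. e (Suc i)))" for e
  by (auto split: nat.splits)
 ultimately show ?case by (auto intro!: dfn_all)
qed (auto intro: dfn_mem dfn_eq)

lemma dfn_subst:
 assumes "dfn B P" "!!i. dtm A (t i)" "!!c. c \<in> B ==> c \<in> D ==> dtm A (%_. c)"
 shows "dfn A (%e. P (%i. t i e))"
proof -
 obtain p s where s: "!!i c. s i = Inr c ==> c \<in> B \<inter> D"
  and p: "!!e. env e ==> P e = sat D (\<epsilon>) p (%i. case_sum e id (s i))"
  by (rule dfnE[OF assms(1)]) (rule that)
 let ?u = "%i. case s i of Inl j => t j | Inr c => (%_. c)"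
 have "dfn A (%e. sat D (\<epsilon>) p (%i. ?u i e))"
 proof (rule dfn_sat_terms)
  fix i show "dtm A (?u i)" using assms(2,3) s[of i] by (auto split: sum.splits)
 qed
 moreover have "(%i. ?u i e) = (%i. case_sum (%i. t i e) id (s i))" for e
  by (auto split: sum.splits)
 moreover have "env (%i. t i e)" if "env e" for e
  using assms(2) that by (auto simp: env_def[of "%i. t i e"])
 ultimately show ?thesis using p by (auto elim!: dfn_cong)
qed

lemma dfn_subst': "dfn A P ==> (!!i. dtm A (t i)) ==> dfn A (%e. P (%i. t i e))"
 by (rule dfn_subst) (auto intro: dtm_const)

lemma dtm_subst:
 assumes "dtm A u" "!!i. dtm A (t i)" shows "dtm A (%e. u (%i. t i e))"
proof -
 let ?t = "%i. case i of 0 => (%e. e 0) | Suc i => (%e. t i (%i. e (Suc i)))"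
 have "dtm A (?t i)" for i
  using assms(2) by (cases i) (auto intro: dtm_var dtm_shift)
 moreover have "dfn A (%e. e 0 = u (%i. e (Suc i)))" using assms(1) by (simp add: dtm_def)
 ultimately have "dfn A (%e. e 0 = u (%i. t i (%i. e (Suc i))))"
  using dfn_subst'[of A "%e. e 0 = u (%i. e (Suc i))" ?t] by simp
 moreover have "env (%i. t i e)" if "env e" for e
  using assms(2) that by (auto simp: env_def[of "%i. t i e"])
 ultimately show ?thesis using assms(1) by (simp add: dtm_def)
qed

text \<open>This group reduces a relation or operation applied to terms to the same relation or
  operation applied to the first few variables.\<close>

lemma dfn1: "dfn A (%e. R (e 0)) ==> dtm A t ==> dfn A (%e. R (t e))"
 using dfn_subst'[of A "%e. R (e 0)" "%i. t"] by simp

lemma dfn2: "dfn A (%e. R (e 0) (e (Suc 0))) ==> dtm A t ==> dtm A u ==> dfn A (%e. R (t e) (u e))"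
 using dfn_subst'[of A "%e. R (e 0) (e (Suc 0))" "case_nat t (%_. u)"] by (simp split: nat.splits)

lemma dfn3: "dfn A (%e. R (e 0) (e (Suc 0)) (e (Suc (Suc 0)))) ==> dtm A t ==> dtm A u ==> dtm A v ==>
  dfn A (%e. R (t e) (u e) (v e))"
 using dfn_subst'[of A "%e. R (e 0) (e (Suc 0)) (e (Suc (Suc 0)))" "case_nat t (case_nat u (%_. v))"]
 by (simp split: nat.splits)

lemma dfn4: "dfn A (%e. R (e 0) (e (Suc 0)) (e (Suc (Suc 0))) (e (Suc (Suc (Suc 0))))) ==>
  dtm A t ==> dtm A u ==> dtm A v ==> dtm A w ==> dfn A (%e. R (t e) (u e) (v e) (w e))"
 using dfn_subst'[of A "%e. R (e 0) (e (Suc 0)) (e (Suc (Suc 0))) (e (Suc (Suc (Suc 0))))"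
   "case_nat t (case_nat u (case_nat v (%_. w)))"] by (simp split: nat.splits)

lemma dtm1: "dtm A (%e. f (e 0)) ==> dtm A t ==> dtm A (%e. f (t e))"
 using dtm_subst[of A "%e. f (e 0)" "%i. t"] by simp

lemma dtm2: "dtm A (%e. f (e 0) (e (Suc 0))) ==> dtm A t ==> dtm A u ==> dtm A (%e. f (t e) (u e))"
 using dtm_subst[of A "%e. f (e 0) (e (Suc 0))" "case_nat t (%_. u)"] by (simp split: nat.splits)

lemma dtm3: "dtm A (%e. f (e 0) (e (Suc 0)) (e (Suc (Suc 0)))) ==> dtm A t ==> dtm A u ==> dtm A v ==>
  dtm A (%e. f (t e) (u e) (v e))"
 using dtm_subst[of A "%e. f (e 0) (e (Suc 0)) (e (Suc (Suc 0)))" "case_nat t (case_nat u (%_. v))"]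
 by (simp split: nat.splits)

text \<open>For a condition that reappears under further quantifiers, where its remaining variables
  sit at shifted positions.\<close>

lemma dfn_term_ren:
 assumes "dfn A (%e. Q (e 0) (%i. e (Suc i)))" "dtm A t"
 shows "dfn A (%e. Q (t e) (%i. e (f i)))"
proof -
 have "dtm A (%e. case_nat (t e) (%i. e (f i)) i)" for i
  by (cases i) (auto intro: dtm_var assms(2))
 then show ?thesis using dfn_subst'[OF assms(1), of "%i e. case_nat (t e) (%i. e (f i)) i"] by simp
qed

lemma dtm_term_ren:
 assumes "dtm A (%e. u (e 0) (%i. e (Suc i)))" "dtm A t"
 shows "dtm A (%e. u (t e) (%i. e (f i)))"
proof -
 have "dtm A (%e. case_nat (t e) (%i. e (f i)) i)" for i
  by (cases i) (auto intro: dtm_var assms(2))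
 then show ?thesis using dtm_subst[OF assms(1), of "%i e. case_nat (t e) (%i. e (f i)) i"] by simp
qed

lemma dtm_if [dfn_intros]:
 assumes "dfn A B" "dtm A t" "dtm A u" shows "dtm A (%e. if B e then t e else u e)"
proof -
 have B: "dfn A (%e. B (%i. e (Suc i)))" by (rule dfn_ren[OF assms(1)])
 have "dfn A (%e. if B (%i. e (Suc i)) then e 0 = t (%i. e (Suc i)) else e 0 = u (%i. e (Suc i)))"
  by (intro dfn_intros B dtm_shift assms)
 then show ?thesis using assms unfolding dtm_def by (auto elim!: dfn_cong)
qed

section \<open>Extensions of elements and bounded quantifiers\<close>

definition ext :: "'m => 'm set" where
 "ext a = {x \<in> D. x \<epsilon> a}"

lemma in_ext [simp]: "x \<in> ext a <-> x \<in> D & x \<epsilon> a"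
 by (simp add: ext_def)

lemma dfn_in_ext [dfn_intros]: "dtm A t ==> dtm A u ==> dfn A (%e. t e \<in> ext (u e))"
 by (rule dfn_cong[OF dfn_mem]) auto

lemma dfn_ball_ext [dfn_intros]:
 assumes "dtm A t" "dfn A (%e. Q (e 0) (%i. e (Suc i)))"
 shows "dfn A (%e. ALL x:ext (t e). Q x e)"
proof -
 have "dfn A (%e. ALL x:D. x \<epsilon> t e --> Q x e)" by (intro dfn_intros dtm_shift assms)
 then show ?thesis by (rule dfn_cong) auto
qed

lemma dfn_bex_ext [dfn_intros]:
 assumes "dtm A t" "dfn A (%e. Q (e 0) (%i. e (Suc i)))"
 shows "dfn A (%e. EX x:ext (t e). Q x e)"
proof -
 have "dfn A (%e. EX x:D. x \<epsilon> t e & Q x e)" by (intro dfn_intros dtm_shift assms)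
 then show ?thesis by (rule dfn_cong) auto
qed

lemma dfn_in_D [dfn_intros]: "dtm A t ==> dfn A (%e. t e \<in> D)"
 by (rule dfn_cong[OF dfn_const[of A True]]) auto

end

section \<open>Standard models of ZF\<close>

context set_structure
begin

definition isset :: "'m set => bool" where
 "isset S <-> (EX a:D. ext a = S)"

text \<open>Inverse of \<open>ext\<close> on the external sets that the model realizes. It allows
  elements of the model to be written as HOL comprehensions.\<close>

definition mk :: "'m set => 'm" where
 "mk S = (THE a. a \<in> D & ext a = S)"

definition op :: "'m => 'm => 'm" where
 "op a b = mk {mk {a}, mk {a, b}}"

end

text \<open>Foundation appears as external well-foundedness, which \<open>standard\<close> provides.
  Choice is left out, so that the locale applies to the constructible universe before choice is
  proved there.\<close>

locale zfm = set_structure D mem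
 for D :: "'m set" and mem :: "'m => 'm => bool"  (infix "\<epsilon>" 50) +
 assumes nonempty: "D ~= {}"
  and ax_ext: extensionality and ax_pair: pairing and ax_union: union_axiom
  and ax_pow: powerset_axiom and ax_inf: infinity_axiom
  and ax_sep: separation and ax_rep: replacement
  and wf_mem: "wfP (%x y. x \<in> D & y \<in> D & x \<epsilon> y)"
begin

lemma ext_inj: "a \<in> D ==> b \<in> D ==> ext a = ext b ==> a = b"
 using ax_ext unfolding extensionality_def ext_def by blast

lemma ext_eq_iff: "a \<in> D ==> b \<in> D ==> ext a = ext b <-> a = b"
 using ext_inj by blast

lemma mk_ext [simp]: "a \<in> D ==> mk (ext a) = a"
 unfolding mk_def by (rule the_equality) (auto intro: ext_inj)

lemma isset_ext [simp, intro]: "a \<in> D ==> isset (ext a)"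
 unfolding isset_def by blast

lemma ext_mk [simp]: "isset S ==> ext (mk S) = S"
 unfolding isset_def by auto

lemma mk_D [simp, intro]: "isset S ==> mk S \<in> D"
 unfolding isset_def by auto

lemma isset_sub_D: "isset S ==> x \<in> S ==> x \<in> D"
 unfolding isset_def by auto

lemma mem_mk [simp]: "isset S ==> x \<epsilon> mk S & x \<in> D <-> x \<in> S"
 using ext_mk[of S] in_ext[of x "mk S"] by blast

lemma mem_mkD [simp]: "isset S ==> x \<in> D ==> x \<epsilon> mk S <-> x \<in> S"
 using mem_mk by blast

lemma mk_inj: "isset S ==> isset T ==> mk S = mk T <-> S = T"
 using ext_mk by metis

lemma eq_mk_iff: "a \<in> D ==> isset S ==> a = mk S <-> (ALL x:D. x \<epsilon> a <-> x \<in> S)"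
 by (subst ext_eq_iff[symmetric]) (auto dest: isset_sub_D)

lemma mem_induct [consumes 1, case_names mem]:
 assumes "x \<in> D" "!!x. x \<in> D ==> (!!y. y \<in> ext x ==> P y) ==> P x"
 shows "P x"
 using wf_mem assms(1)
proof (induction x rule: wfp_induct_rule)
 case (less x)
 then show ?case using assms(2)[of x] by auto
qed

lemma mem_irrefl: "x \<in> D ==> ~ x \<epsilon> x"
 by (induction x rule: mem_induct) auto

text \<open>Brings a definable property into the form demanded by the schemas: variable 0 is the
  argument, and all other slots, constants included, are merged into one assignment.\<close>

lemma dfn_sat1:
 assumes "dfn A P" "env d"
 obtains p e' where "env e'" "!!x. x \<in> D ==> P (case_nat x d) = sat D (\<epsilon>) p (case_nat x e')"
proof -
 obtain p s where s: "!!i c. s i = Inr c ==> c \<in> A \<inter> D"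
  and p: "!!e. env e ==> P e = sat D (\<epsilon>) p (%i. case_sum e id (s i))"
  by (rule dfnE[OF assms(1)]) (rule that)
 let ?g = "%i. if s i = Inl 0 then 0 else Suc i"
 let ?e = "%i. case s i of Inl 0 => d 0 | Inl (Suc j) => d j | Inr c => c"
 have e: "env ?e" using s assms(2) by (auto simp: env_def split: sum.splits nat.splits)
 have "(%i. case_nat x ?e (?g i)) = (%i. case_sum (case_nat x d) id (s i))" for x
  by (auto split: sum.splits nat.splits)
 then have "P (case_nat x d) = sat D (\<epsilon>) (ren ?g p) (case_nat x ?e)" if "x \<in> D" for x
  using p[of "case_nat x d"] that assms(2) by (simp add: sat_ren)
 with e show thesis by (rule that)
qed

lemma dfn_sat2:
 assumes "dfn A P" "env d"
 obtains p e' where "env e'"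
  "!!x y. x \<in> D ==> y \<in> D ==>
   P (case_nat x (case_nat y d)) = sat D (\<epsilon>) p (case_nat x (case_nat y e'))"
proof -
 obtain p s where s: "!!i c. s i = Inr c ==> c \<in> A \<inter> D"
  and p: "!!e. env e ==> P e = sat D (\<epsilon>) p (%i. case_sum e id (s i))"
  by (rule dfnE[OF assms(1)]) (rule that)
 let ?g = "%i. if s i = Inl 0 then 0 else if s i = Inl 1 then 1 else Suc (Suc i)"
 let ?e = "%i. case s i of Inl 0 => d 0 | Inl (Suc 0) => d 0 | Inl (Suc (Suc j)) => d j | Inr c => c"
 have e: "env ?e" using s assms(2) by (auto simp: env_def split: sum.splits nat.splits)
 have "(%i. case_nat x (case_nat y ?e) (?g i)) = (%i. case_sum (case_nat x (case_nat y d)) id (s i))" for x y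
  by (auto split: sum.splits nat.splits)
 then have "P (case_nat x (case_nat y d)) = sat D (\<epsilon>) (ren ?g p) (case_nat x (case_nat y ?e))"
  if "x \<in> D" "y \<in> D" for x y
  using p[of "case_nat x (case_nat y d)"] that assms(2) by (simp add: sat_ren)
 with e show thesis by (rule that)
qed

section \<open>Realized sets and definable set terms\<close>

lemma ex_env: "EX d. env d"
 using nonempty by (auto simp: env_def intro!: exI[of _ "%_. SOME x. x \<in> D"] some_in_eq[THEN iffD2])

lemma isset_sep:
 assumes "dfn D (%e. P (e 0))" "a \<in> D"
 shows "isset {x \<in> ext a. P x}"
proof -
 obtain d where d: "env d" using ex_env by blast
 obtain p e' where e': "env e'" and p: "!!x. x \<in> D ==> P x = sat D (\<epsilon>) p (case_nat x e')"
  using dfn_sat1[OF assms(1) d] by (metis nat.case(1))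
 have "EX b:D. ALL x:D. x \<epsilon> b <-> x \<epsilon> a & sat D (\<epsilon>) p (case_nat x e')"
  using ax_sep e' assms(2) unfolding separation_def env_def by blast
 then show ?thesis unfolding isset_def ext_def using p by blast
qed

lemma isset_subset:
 assumes "isset T" "S \<subseteq> T" "dfn D (%e. e 0 \<in> S)" shows "isset S"
proof -
 have "isset {x \<in> ext (mk T). x \<in> S}" using assms(1,3) by (intro isset_sep) auto
 moreover have "{x \<in> ext (mk T). x \<in> S} = S" using assms(1,2) by auto
 ultimately show ?thesis by simp
qed

text \<open>The remaining variables are frozen at the values of \<open>e\<close> and become
  parameters, which is why the result is definability from all of \<open>D\<close>.\<close>

lemma dfn_fix:
 assumes "dfn A (%e. Q (e 0) (%i. e (Suc i)))" "env e" shows "dfn D (%e'. Q (e' 0) e)"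
proof -
 have "dtm D (%e'. case_nat (e' 0) e i)" for i
  using assms(2) by (cases i) (auto intro!: dtm_var dtm_const)
 from dfn_subst[OF assms(1), of D "%i e'. case_nat (e' 0) e i", OF this] show ?thesis
  by (auto intro: dtm_const)
qed

lemma dtm_fix:
 assumes "dtm A (%e. f (e 0) (%i. e (Suc i)))" "env e" shows "dtm D (%e'. f (e' 0) e)"
proof -
 have "dtm D (%e. f (e 0) (%i. e (Suc i)))" using assms(1) by (rule dtm_mono) auto
 moreover have "dtm D (%e'. case_nat (e' 0) e i)" for i
  using assms(2) by (cases i) (auto intro!: dtm_var dtm_const)
 ultimately show ?thesis using dtm_subst[of D _ "%i e'. case_nat (e' 0) e i"] by fastforce
qed

lemma isset_rep:
 assumes "dtm D (%e. f (e 0))" "a \<in> D"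
 shows "isset (f ` ext a)"
proof -
 obtain d where d: "env d" using ex_env by blast
 have "dfn D (%e. e (Suc 0) = f (e 0))"
  using assms(1) by (intro dfn_eq dtm_var)
 then obtain p e' where e': "env e'"
  and p: "!!x y. x \<in> D ==> y \<in> D ==> (y = f x) = sat D (\<epsilon>) p (case_nat x (case_nat y e'))"
  by (rule dfn_sat2[OF _ d]) (rule that, assumption, simp)
 have fD: "f x \<in> D" if "x \<in> D" for x
  using dtmD[OF assms(1), of "case_nat x d"] d that by simp
 have "(ALL x:D. x \<epsilon> a --> (EX! y. y \<in> D & sat D (\<epsilon>) p (case_nat x (case_nat y e')))) -->
      (EX b:D. ALL y:D. y \<epsilon> b <->
       (EX x:D. x \<epsilon> a & sat D (\<epsilon>) p (case_nat x (case_nat y e'))))"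
  using ax_rep e' assms(2) unfolding replacement_def env_def by blast
 moreover have "EX! y. y \<in> D & sat D (\<epsilon>) p (case_nat x (case_nat y e'))" if "x \<in> D" for x
  using p fD that by blast
 ultimately obtain b where "b \<in> D" "!!y. y \<in> D ==> y \<epsilon> b <-> (EX x:D. x \<epsilon> a & y = f x)"
  using p by auto
 then show ?thesis unfolding isset_def ext_def using fD by (intro bexI[of _ b]) auto
qed

text \<open>Extensionality turns the graph of \<open>mk\<close> into a statement about members, so
  the term is definable as soon as membership in \<open>S\<close> is.\<close>

lemma dtm_mk:
 assumes "!!e. env e ==> isset (S e)" "dfn A (%e. e 0 \<in> S (%i. e (Suc i)))"
 shows "dtm A (%e. mk (S e))"
proof -
 have "dfn A (%e. ALL x:D. x \<epsilon> e 0 <-> x \<in> S (%i. e (Suc i)))"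
  using dfn_ren[OF assms(2), of "case_nat 0 (%i. Suc (Suc i))"] by (intro dfn_intros) simp
 then have "dfn A (%e. e 0 = mk (S (%i. e (Suc i))))"
  by (rule dfn_cong) (use assms(1) eq_mk_iff in auto)
 then show ?thesis unfolding dtm_def using assms(1) by auto
qed

lemma isset_sep_env:
 assumes "dfn A (%e. Q (e 0) (%i. e (Suc i)))" "env e" "a \<in> D"
 shows "isset {x \<in> ext a. Q x e}"
 by (rule isset_sep[OF dfn_fix[OF assms(1,2)] assms(3)])

lemma dtm_sep [dfn_intros]:
 assumes "dtm A t" "dfn A (%e. Q (e 0) (%i. e (Suc i)))"
 shows "dtm A (%e. mk {x \<in> ext (t e). Q x e})"
proof (rule dtm_mk)
 show "isset {x \<in> ext (t e). Q x e}" if "env e" for e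
  using isset_sep_env[OF assms(2) that] assms(1) that by auto
 have "dfn A (%e. e 0 \<in> ext (t (%i. e (Suc i))) & Q (e 0) (%i. e (Suc i)))"
  by (intro dfn_intros dtm_shift assms)
 then show "dfn A (%e. e 0 \<in> {x \<in> ext (t (%i. e (Suc i))). Q x (%i. e (Suc i))})" by simp
qed

lemma isset_rep_env:
 assumes "dtm A (%e. f (e 0) (%i. e (Suc i)))" "env e" "a \<in> D"
 shows "isset ((%x. f x e) ` ext a)"
 by (rule isset_rep[OF dtm_fix[OF assms(1,2)] assms(3)])

lemma dtm_rep [dfn_intros]:
 assumes "dtm A t" "dtm A (%e. f (e 0) (%i. e (Suc i)))"
 shows "dtm A (%e. mk ((%x. f x e) ` ext (t e)))"
proof (rule dtm_mk)
 show "isset ((%x. f x e) ` ext (t e))" if "env e" for e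
  using isset_rep_env[OF assms(2) that] assms(1) that by auto
 have "dtm A (%e. f (e 0) (%i. e (Suc (Suc i))))"
  using dtm_ren[OF assms(2), of "case_nat 0 (%i. Suc (Suc i))"] by simp
 then have "dfn A (%e. EX x:ext (t (%i. e (Suc i))). e 0 = f x (%i. e (Suc i)))"
  by (intro dfn_intros dtm_shift assms)
 then show "dfn A (%e. e 0 \<in> (%x. f x (%i. e (Suc i))) ` ext (t (%i. e (Suc i))))"
  by (rule dfn_cong) auto
qed

lemma isset_union:
 assumes "a \<in> D" shows "isset (\<Union>x\<in>ext a. ext x)"
proof -
 obtain b where "b \<in> D" "big_union b a" using ax_union assms unfolding union_axiom_def by blast
 then show ?thesis unfolding isset_def big_union_def ext_def by (intro bexI[of _ b]) auto
qed

lemma isset_pair: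
 assumes "a \<in> D" "b \<in> D" shows "isset {a, b}"
proof -
 obtain c where "c \<in> D" "upair c a b" using ax_pair assms unfolding pairing_def by blast
 then show ?thesis unfolding isset_def upair_def ext_def using assms by (intro bexI[of _ c]) auto
qed

lemma isset_pow:
 assumes "a \<in> D" shows "isset {x \<in> D. ext x \<subseteq> ext a}"
proof -
 obtain b where "b \<in> D" "powerset_of b a" using ax_pow assms unfolding powerset_axiom_def by blast
 then show ?thesis unfolding isset_def powerset_of_def sub_def ext_def by (intro bexI[of _ b]) auto
qed

lemma isset_empty [simp, intro]: "isset {}"
proof -
 obtain a where "a \<in> D" using nonempty by blast
 then have "isset {x \<in> ext a. False}" by (intro isset_sep dfn_const)
 then show ?thesis by simp
qed

lemma isset_UN:
 assumes "isset S" "dtm D (%e. f (e 0))" shows "isset (\<Union>x\<in>S. ext (f x))"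
proof -
 have *: "isset (f ` S)" using isset_rep[OF assms(2), of "mk S"] assms(1) by simp
 have "isset (\<Union>x\<in>ext (mk (f ` S)). ext x)" using * by (intro isset_union) auto
 then show ?thesis using * by simp
qed

lemma isset_image: "isset S ==> dtm D (%e. f (e 0)) ==> isset (f ` S)"
 using isset_rep[of f "mk S"] by simp

lemma isset_Un [simp, intro]:
 assumes "isset S" "isset T" shows "isset (S \<union> T)"
proof -
 have "isset {mk S, mk T}" using assms by (intro isset_pair) auto
 then have "isset (\<Union>x\<in>{mk S, mk T}. ext x)" using isset_union[of "mk {mk S, mk T}"] by simp
 then show ?thesis using assms by simp
qed

lemma isset_sing [simp, intro]: "a \<in> D ==> isset {a}"
 using isset_pair[of a a] by simp

lemma isset_insert [simp, intro]: "a \<in> D ==> isset S ==> isset (insert a S)"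
 using isset_Un[of "{a}" S] by simp

lemma isset_finite: "finite S ==> S \<subseteq> D ==> isset S"
 by (induction S rule: finite_induct) auto

lemma dfn_subset [dfn_intros]:
 assumes "dtm A t" "dtm A u" shows "dfn A (%e. ext (t e) \<subseteq> ext (u e))"
proof -
 have "dfn A (%e. ALL x:ext (t e). x \<in> ext (u e))" by (intro dfn_intros dtm_shift assms)
 then show ?thesis by (rule dfn_cong) auto
qed

lemma dtm_pow [dfn_intros]:
 assumes "dtm A t" shows "dtm A (%e. mk {x \<in> D. ext x \<subseteq> ext (t e)})"
proof (rule dtm_mk)
 have "dfn A (%e. ext (e 0) \<subseteq> ext (t (%i. e (Suc i))))" by (intro dfn_intros dtm_shift assms)
 then show "dfn A (%e. e 0 \<in> {x \<in> D. ext x \<subseteq> ext (t (%i. e (Suc i)))})" by (rule dfn_cong) auto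
qed (use assms in \<open>auto intro!: isset_pow\<close>)

lemma dtm_empty [dfn_intros]: "dtm A (%e. mk {})"
 by (rule dtm_mk) (auto intro: dfn_const)

lemma dtm_sing [dfn_intros]: "dtm A t ==> dtm A (%e. mk {t e})"
 by (rule dtm_mk) (auto intro!: dfn_intros dtm_shift)

lemma dtm_pair [dfn_intros]: "dtm A t ==> dtm A u ==> dtm A (%e. mk {t e, u e})"
 by (rule dtm_mk) (auto intro!: dfn_intros dtm_shift)

lemma dtm_Un [dfn_intros]:
 assumes "dtm A t" "dtm A u" shows "dtm A (%e. mk (ext (t e) \<union> ext (u e)))"
proof (rule dtm_mk)
 have "dfn A (%e. e 0 \<in> ext (t (%i. e (Suc i))) \<or> e 0 \<in> ext (u (%i. e (Suc i))))"
  by (intro dfn_intros dtm_shift assms)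
 then show "dfn A (%e. e 0 \<in> ext (t (%i. e (Suc i))) \<union> ext (u (%i. e (Suc i))))" by (rule dfn_cong) auto
qed (use assms in auto)

lemma dtm_insert [dfn_intros]:
 assumes "dtm A t" "dtm A u" shows "dtm A (%e. mk (insert (t e) (ext (u e))))"
proof (rule dtm_mk)
 have "dfn A (%e. e 0 = t (%i. e (Suc i)) \<or> e 0 \<in> ext (u (%i. e (Suc i))))"
  by (intro dfn_intros dtm_shift assms)
 then show "dfn A (%e. e 0 \<in> insert (t (%i. e (Suc i))) (ext (u (%i. e (Suc i)))))" by (rule dfn_cong) auto
qed (use assms in auto)

lemma dtm_UN [dfn_intros]:
 assumes "dtm A t" "dtm A (%e. f (e 0) (%i. e (Suc i)))"
 shows "dtm A (%e. mk (\<Union>x\<in>ext (t e). ext (f x e)))"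
proof (rule dtm_mk)
 show "isset (\<Union>x\<in>ext (t e). ext (f x e))" if "env e" for e
  by (rule isset_UN[OF _ dtm_fix[OF assms(2) that]]) (use assms(1) that in auto)
 have "dtm A (%e. f (e 0) (%i. e (Suc (Suc i))))"
  using dtm_ren[OF assms(2), of "case_nat 0 (%i. Suc (Suc i))"] by simp
 then have "dfn A (%e. EX x:ext (t (%i. e (Suc i))). e 0 \<in> ext (f x (%i. e (Suc i))))"
  by (intro dfn_intros dtm_shift assms)
 then show "dfn A (%e. e 0 \<in> (\<Union>x\<in>ext (t (%i. e (Suc i))). ext (f x (%i. e (Suc i)))))"
  by (rule dfn_cong) auto
qed

section \<open>Ordered pairs and products\<close>

lemma op_D [simp, intro]: "a \<in> D ==> b \<in> D ==> op a b \<in> D"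
 unfolding op_def by (intro mk_D isset_pair) auto

lemma dtm_op [dfn_intros]: "dtm A t ==> dtm A u ==> dtm A (%e. op (t e) (u e))"
 unfolding op_def by (intro dfn_intros)

lemma op_inject [simp]:
 assumes "a \<in> D" "b \<in> D" "c \<in> D" "d \<in> D" shows "op a b = op c d <-> a = c & b = d"
proof
 assume "op a b = op c d"
 then have "{mk {a}, mk {a, b}} = {mk {c}, mk {c, d}}"
  unfolding op_def using assms by (subst (asm) mk_inj) auto
 moreover have "mk {a} = mk {x, y} <-> {a} = {x, y}" if "a \<in> D" "x \<in> D" "y \<in> D" for a x y
  using that by (subst mk_inj) auto
 moreover have "mk {a} = mk {x} <-> a = x" if "a \<in> D" "x \<in> D" for a x
  using that by (subst mk_inj) auto
 moreover have "mk {a, b} = mk {c, d} <-> {a, b} = {c, d}"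
  using assms by (subst mk_inj) auto
 ultimately show "a = c & b = d"
  using assms by (auto simp: doubleton_eq_iff)
qed auto

lemma upair_iff: "c \<in> D ==> a \<in> D ==> b \<in> D ==> upair c a b <-> c = mk {a, b}"
 unfolding upair_def by (subst eq_mk_iff) auto

lemma opair_iff: "p \<in> D ==> a \<in> D ==> b \<in> D ==> opair p a b <-> p = op a b"
 unfolding opair_def op_def by (auto simp: upair_iff)

lemma is_empty_iff: "a \<in> D ==> is_empty a <-> a = mk {}"
 unfolding is_empty_def by (subst eq_mk_iff) auto

lemma succ_of_iff: "a \<in> D ==> b \<in> D ==> succ_of b a <-> b = mk (insert a (ext a))"
 unfolding succ_of_def by (subst eq_mk_iff) auto

lemma sub_iff: "sub a b <-> ext a \<subseteq> ext b"
 unfolding sub_def by auto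

lemma diff_of_iff: "diff_of c a b <-> ext c = ext a - ext b"
 unfolding diff_of_def by (auto simp: ext_def)

lemma inter_of_iff: "inter_of c a b <-> ext c = ext a \<inter> ext b"
 unfolding inter_of_def by (auto simp: ext_def)

lemma powerset_of_iff: "powerset_of b a <-> ext b = {x \<in> D. ext x \<subseteq> ext a}"
 unfolding powerset_of_def sub_iff by (auto simp: ext_def)

text \<open>The default \<open>mk {}\<close> outside of pairs makes the projection total, as
  \<open>dtm\<close> demands; \<open>psnd\<close> and \<open>ap\<close> are treated in the same
  way.\<close>

definition pfst :: "'m => 'm" where
 "pfst p = (if EX x:D. EX y:D. p = op x y then THE x. x \<in> D & (EX y:D. p = op x y) else mk {})"

definition psnd :: "'m => 'm" where
 "psnd p = (if EX x:D. EX y:D. p = op x y then THE y. y \<in> D & (EX x:D. p = op x y) else mk {})"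

lemma pfst_op [simp]: "a \<in> D ==> b \<in> D ==> pfst (op a b) = a"
 unfolding pfst_def by (subst if_P) auto

lemma psnd_op [simp]: "a \<in> D ==> b \<in> D ==> psnd (op a b) = b"
 unfolding psnd_def by (subst if_P) auto

lemma dtm_pfst [dfn_intros]:
 assumes "dtm A t" shows "dtm A (%e. pfst (t e))"
proof (rule dtm1[OF _ assms])
 have D: "pfst p \<in> D" for p
 proof (cases "EX x:D. EX y:D. p = op x y")
  case False
  then show ?thesis unfolding pfst_def by (subst if_not_P) auto
 qed auto
 have "dfn A (%e. if EX x:D. EX y:D. e (Suc 0) = op x y then EX y:D. e (Suc 0) = op (e 0) y else e 0 = mk {})"
  by (intro dfn_intros)
 then have "dfn A (%e. e 0 = pfst (e (Suc 0)))"
 proof (rule dfn_cong)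
  fix e assume e: "env e"
  show "(if EX x:D. EX y:D. e (Suc 0) = op x y then EX y:D. e (Suc 0) = op (e 0) y else e 0 = mk {}) =
   (e 0 = pfst (e (Suc 0)))"
  proof (cases "EX x:D. EX y:D. e (Suc 0) = op x y")
   case False
   then show ?thesis unfolding pfst_def by (simp only: if_not_P if_False)
  qed (use e in auto)
 qed
 then show "dtm A (%e. pfst (e 0))" unfolding dtm_def using D by simp
qed

lemma dtm_psnd [dfn_intros]:
 assumes "dtm A t" shows "dtm A (%e. psnd (t e))"
proof (rule dtm1[OF _ assms])
 have D: "psnd p \<in> D" for p
 proof (cases "EX x:D. EX y:D. p = op x y")
  case False
  then show ?thesis unfolding psnd_def by (subst if_not_P) auto
 qed auto
 have "dfn A (%e. if EX x:D. EX y:D. e (Suc 0) = op x y then EX x:D. e (Suc 0) = op x (e 0) else e 0 = mk {})"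
  by (intro dfn_intros)
 then have "dfn A (%e. e 0 = psnd (e (Suc 0)))"
 proof (rule dfn_cong)
  fix e assume e: "env e"
  show "(if EX x:D. EX y:D. e (Suc 0) = op x y then EX x:D. e (Suc 0) = op x (e 0) else e 0 = mk {}) =
   (e 0 = psnd (e (Suc 0)))"
  proof (cases "EX x:D. EX y:D. e (Suc 0) = op x y")
   case False
   then show ?thesis unfolding psnd_def by (simp only: if_not_P if_False)
  qed (use e in auto)
 qed
 then show "dtm A (%e. psnd (e 0))" unfolding dtm_def using D by simp
qed

lemma isset_times:
 assumes "isset S" "isset T" shows "isset {op x y |x y. x \<in> S & y \<in> T}"
proof -
 have T: "mk T \<in> D" using assms by simp
 have "isset (\<Union>x\<in>S. ext (mk ((%y. op x y) ` ext (mk T))))"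
  by (rule isset_UN[OF assms(1)]) (intro dfn_intros T)
 moreover have "isset ((%y. op x y) ` ext (mk T))" if "x \<in> D" for x
  using T that by (intro isset_rep dtm_op dtm_var dtm_const)
 moreover have "x \<in> D" if "x \<in> S" for x using assms(1) that by (rule isset_sub_D)
 ultimately have "isset (\<Union>x\<in>S. (%y. op x y) ` T)" using assms by simp
 moreover have "(\<Union>x\<in>S. (%y. op x y) ` T) = {op x y |x y. x \<in> S & y \<in> T}" by auto
 ultimately show ?thesis by simp
qed

definition prd :: "'m => 'm => 'm" where
 "prd a b = mk {op x y |x y. x \<in> ext a & y \<in> ext b}"

lemma prd_D [simp, intro]: "a \<in> D ==> b \<in> D ==> prd a b \<in> D"
 unfolding prd_def by (intro mk_D isset_times) auto

lemma ext_prd [simp]: "a \<in> D ==> b \<in> D ==> ext (prd a b) = {op x y |x y. x \<in> ext a & y \<in> ext b}"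
 unfolding prd_def by (intro ext_mk isset_times) auto

lemma dtm_prd [dfn_intros]:
 assumes "dtm A t" "dtm A u" shows "dtm A (%e. prd (t e) (u e))"
 unfolding prd_def
proof (rule dtm_mk)
 show "isset {op x y |x y. x \<in> ext (t e) & y \<in> ext (u e)}" if "env e" for e
  by (intro isset_times isset_ext) (use assms that in auto)
 have "dfn A (%e. EX x:ext (t (%i. e (Suc i))). EX y:ext (u (%i. e (Suc i))). e 0 = op x y)"
  by (intro dfn_intros dtm_shift assms)
 then show "dfn A (%e. e 0 \<in> {op x y |x y. x \<in> ext (t (%i. e (Suc i))) & y \<in> ext (u (%i. e (Suc i)))})"
  by (rule dfn_cong) blast
qed

section \<open>Functions as elements of the model\<close>

definition ap :: "'m => 'm => 'm" where
 "ap f x = (if EX! y. y \<in> D & op x y \<epsilon> f then THE y. y \<in> D & op x y \<epsilon> f else mk {})"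

definition lam :: "'m set => ('m => 'm) => 'm" where
 "lam S F = mk ((%x. op x (F x)) ` S)"

lemma ap_eq: "op x y \<epsilon> f ==> y \<in> D ==> (!!z. z \<in> D ==> op x z \<epsilon> f ==> z = y) ==> ap f x = y"
 unfolding ap_def by (subst if_P) blast+

lemma ap_D [simp, intro]: "ap f x \<in> D"
proof (cases "EX! y. y \<in> D & op x y \<epsilon> f")
 case True
 from theI'[OF this] show ?thesis unfolding ap_def using True by simp
next
 case False
 then show ?thesis unfolding ap_def by (subst if_not_P) auto
qed

lemma dtm_ap [dfn_intros]:
 assumes "dtm A t" "dtm A u" shows "dtm A (%e. ap (t e) (u e))"
proof (rule dtm2[OF _ assms])
 let ?P = "%f x. EX y:D. op x y \<epsilon> f & (ALL z:D. op x z \<epsilon> f --> z = y)"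
 have "dfn A (%e. if ?P (e (Suc 0)) (e (Suc (Suc 0))) then op (e (Suc (Suc 0))) (e 0) \<epsilon> e (Suc 0) else e 0 = mk {})"
  by (intro dfn_intros)
 then have "dfn A (%e. e 0 = ap (e (Suc 0)) (e (Suc (Suc 0))))"
 proof (rule dfn_cong)
  fix e assume e: "env e"
  show "(if ?P (e (Suc 0)) (e (Suc (Suc 0))) then op (e (Suc (Suc 0))) (e 0) \<epsilon> e (Suc 0) else e 0 = mk {}) =
   (e 0 = ap (e (Suc 0)) (e (Suc (Suc 0))))"
  proof (cases "?P (e (Suc 0)) (e (Suc (Suc 0)))")
   case True
   then obtain y where y: "y \<in> D" "op (e (Suc (Suc 0))) y \<epsilon> e (Suc 0)"
    "!!z. z \<in> D ==> op (e (Suc (Suc 0))) z \<epsilon> e (Suc 0) ==> z = y" by blast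
   have "ap (e (Suc 0)) (e (Suc (Suc 0))) = y" by (rule ap_eq[OF y(2,1)]) (rule y(3))
   moreover have "op (e (Suc (Suc 0))) (e 0) \<epsilon> e (Suc 0) <-> e 0 = y" using y e by blast
   ultimately show ?thesis by (simp only: if_P[OF True])
  next
   case False
   then have "~ (EX! y. y \<in> D & op (e (Suc (Suc 0))) y \<epsilon> e (Suc 0))" by blast
   then have "ap (e (Suc 0)) (e (Suc (Suc 0))) = mk {}" unfolding ap_def by simp
   then show ?thesis using False by (simp only: if_not_P if_False)
  qed
 qed
 then show "dtm A (%e. ap (e 0) (e (Suc 0)))" unfolding dtm_def by simp
qed

lemma isset_lam: "isset S ==> dtm D (%e. F (e 0)) ==> isset ((%x. op x (F x)) ` S)"
 by (rule isset_image) (auto intro!: dfn_intros)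

lemma dtm_lam [dfn_intros]:
 assumes "dtm A t" "dtm A (%e. f (e 0) (%i. e (Suc i)))"
 shows "dtm A (%e. lam (ext (t e)) (%x. f x e))"
 unfolding lam_def by (intro dtm_rep dtm_op dtm_var assms)

lemma lam_cong: "S = T ==> (!!x. x \<in> T ==> F x = G x) ==> lam S F = lam T G"
 unfolding lam_def by (simp cong: image_cong)

lemma ap_lam:
 assumes "isset ((%x. op x (F x)) ` S)" "S \<subseteq> D" "x \<in> S" "!!x. x \<in> S ==> F x \<in> D"
 shows "ap (lam S F) x = F x"
proof (rule ap_eq)
 have *: "ext (lam S F) = (%x. op x (F x)) ` S" unfolding lam_def using assms(1) by simp
 have "op x (F x) \<in> ext (lam S F)" unfolding * using assms(3) by (rule imageI)
 then show "op x (F x) \<epsilon> lam S F" by simp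
 show "F x \<in> D" using assms by auto
 fix z assume z: "z \<in> D" "op x z \<epsilon> lam S F"
 then have "op x z \<in> ext (lam S F)" using assms(2,3) by auto
 then obtain x' where x': "x' \<in> S" "op x z = op x' (F x')" unfolding * by auto
 moreover from x'(1) have "x' \<in> D" "F x' \<in> D" using assms(2,4) by auto
 moreover have "x \<in> D" using assms(2,3) by auto
 ultimately show "z = F x" using z(1) by simp
qed

lemma app_iff: "f \<in> D ==> x \<in> D ==> y \<in> D ==> app f x y <-> op x y \<epsilon> f"
 unfolding app_def by (auto simp: opair_iff)

lemma function_on_ap:
 assumes "function_on f a" "f \<in> D" "a \<in> D" "x \<in> ext a" "y \<in> D"
 shows "app f x y <-> y = ap f x"
proof -
 have "EX! y. y \<in> D & app f x y" using assms unfolding function_on_def by auto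
 then obtain z where z: "z \<in> D" "app f x z" "!!y. y \<in> D ==> app f x y ==> y = z" by blast
 have x: "x \<in> D" using assms(4) by simp
 have "ap f x = z"
 proof (rule ap_eq)
  show "op x z \<epsilon> f" using z(1,2) app_iff[OF assms(2) x] by simp
  show "z' = z" if "z' \<in> D" "op x z' \<epsilon> f" for z'
   using z(3)[OF that(1)] that app_iff[OF assms(2) x] by simp
 qed (rule z(1))
 then show ?thesis using z(2) z(3)[OF assms(5)] by auto
qed

lemma lam_function_on:
 assumes "dtm D (%e. F (e 0))" "a \<in> D"
 shows "lam (ext a) F \<in> D" "function_on (lam (ext a) F) a"
  "!!x. x \<in> ext a ==> ap (lam (ext a) F) x = F x"
  "ext (lam (ext a) F) = (%x. op x (F x)) ` ext a"
proof -
 have F: "F x \<in> D" if "x \<in> D" for x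
 proof -
  obtain d where "env d" using ex_env by blast
  then show ?thesis using dtmD[OF assms(1), of "case_nat x d"] that by simp
 qed
 have i: "isset ((%x. op x (F x)) ` ext a)" by (rule isset_lam) (use assms in auto)
 show e: "ext (lam (ext a) F) = (%x. op x (F x)) ` ext a" unfolding lam_def using i by simp
 show d: "lam (ext a) F \<in> D" unfolding lam_def using i by simp
 show "ap (lam (ext a) F) x = F x" if "x \<in> ext a" for x
  by (rule ap_lam[OF i]) (use that F in auto)
 have *: "p \<epsilon> lam (ext a) F <-> (EX x:ext a. p = op x (F x))" if "p \<in> D" for p
  using e in_ext[of p "lam (ext a) F"] that by auto
 show "function_on (lam (ext a) F) a"
  unfolding function_on_def
 proof (intro conjI ballI impI)
  fix p assume "p \<in> D" "p \<epsilon> lam (ext a) F"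
  then show "EX x:D. EX y:D. x \<epsilon> a & opair p x y" using * F by (auto simp: opair_iff)
 next
  fix x assume x: "x \<in> D" "x \<epsilon> a"
  have "app (lam (ext a) F) x y <-> y = F x" if y: "y \<in> D" for y
  proof -
   have "app (lam (ext a) F) x y <-> (EX x':ext a. op x y = op x' (F x'))"
    using app_iff[OF d x(1) y] *[of "op x y"] x y by simp
   also have "\<dots> <-> (EX x':ext a. x = x' & y = F x')"
    using x y F by (intro bex_cong refl op_inject) auto
   finally show ?thesis using x by auto
  qed
  then show "EX! y. y \<in> D & app (lam (ext a) F) x y" using F[OF x(1)] by (intro ex1I[of _ "F x"]) auto
 qed
qed

end

section \<open>Natural numbers and reals of a standard model\<close>

abbreviation enc :: "nat => nat => nat" where "enc m n \<equiv> prod_encode (m, n)"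
abbreviation dfst :: "nat => nat" where "dfst n \<equiv> fst (prod_decode n)"
abbreviation dsnd :: "nat => nat" where "dsnd n \<equiv> snd (prod_decode n)"

text \<open>The pairing walks along the antidiagonals. With this successor rule the model can decode
  by iterating a step on pairs, without arithmetic of its own.\<close>

lemma prod_decode_Suc:
 "prod_decode (Suc n) = (if dsnd n = 0 then (0, Suc (dfst n)) else (Suc (dfst n), dsnd n - 1))"
proof -
 obtain a b where n: "prod_decode n = (a, b)" by (cases "prod_decode n")
 then have n': "n = prod_encode (a, b)" by (metis prod_decode_inverse)
 let ?p = "if b = 0 then (0, Suc a) else (Suc a, b - 1)"
 have "prod_encode ?p = Suc n" unfolding n' by (cases b) (auto simp: prod_encode_def)
 then have "prod_decode (Suc n) = ?p" by (metis prod_encode_inverse)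
 then show ?thesis by (simp add: n)
qed

lemma prod_decode_0: "prod_decode 0 = (0, 0)"
 by (simp add: prod_decode_def prod_decode_aux.simps)

context zfm
begin

primrec nm :: "nat => 'm" where
 "nm 0 = mk {}"
| "nm (Suc n) = mk (insert (nm n) (ext (nm n)))"

lemma nm_D [simp, intro]: "nm n \<in> D"
 by (induction n) auto

lemma ext_nm: "ext (nm n) = nm ` {..<n}"
proof (induction n)
 case (Suc n)
 have "ext (nm (Suc n)) = insert (nm n) (ext (nm n))" by simp
 then show ?case using Suc by (simp add: lessThan_Suc)
qed simp

lemma nm_inj_less: "m < n ==> nm m ~= nm n"
proof
 assume "m < n" "nm m = nm n"
 then have "nm n \<in> ext (nm n)" by (metis ext_nm imageI lessThan_iff)
 then show False using mem_irrefl[of "nm n"] by simp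
qed

lemma nm_eq [simp]: "nm m = nm n <-> m = n"
 by (metis nm_inj_less nat_neq_iff)

lemma nm_mem [simp]: "nm m \<epsilon> nm n <-> m < n"
proof -
 have "nm m \<epsilon> nm n <-> nm m \<in> ext (nm n)" by simp
 then show ?thesis unfolding ext_nm by auto
qed

lemma num_iff: "x \<in> D ==> num n x <-> x = nm n"
 by (induction n arbitrary: x) (auto simp: is_empty_iff succ_of_iff)

lemma is_inductive_iff:
 assumes "v \<in> D"
 shows "is_inductive v <-> mk {} \<epsilon> v & (ALL n:ext v. mk (insert n (ext n)) \<epsilon> v)"
proof -
 have "(EX z:D. is_empty z & z \<epsilon> v) <-> mk {} \<epsilon> v"
  using is_empty_iff by (metis isset_empty mk_D)
 moreover have "(EX s:D. succ_of s n & s \<epsilon> v) <-> mk (insert n (ext n)) \<epsilon> v" if "n \<in> D" for n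
  using succ_of_iff[OF that] that by (metis isset_ext isset_insert mk_D)
 ultimately show ?thesis unfolding is_inductive_def by auto
qed

lemma nm_in_inductive: "v \<in> D ==> is_inductive v ==> nm n \<in> ext v"
 by (induction n) (auto simp: is_inductive_iff)

lemma dfn_is_inductive: "dtm A t ==> dfn A (%e. is_inductive (t e))"
proof -
 assume t: "dtm A t"
 have "dfn A (%e. mk {} \<epsilon> t e & (ALL n:ext (t e). mk (insert n (ext n)) \<epsilon> t e))"
  by (intro dfn_intros t dtm_shift)
 then show ?thesis by (rule dfn_cong) (use is_inductive_iff t in auto)
qed

text \<open>Well-foundedness makes omega standard. An element of the least inductive set that is
  neither zero nor a successor could be removed from it; hence, by induction along membership, all
  elements are numerals.\<close>

lemma isset_range_nm: "isset (range nm)"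
proof -
 obtain v where v: "v \<in> D" "is_inductive v" using ax_inf unfolding infinity_axiom_def by blast
 let ?W = "{x \<in> ext v. ALL u:D. is_inductive u --> x \<epsilon> u}"
 have W: "isset ?W" by (rule isset_sep) (intro dfn_intros dfn_is_inductive v)+
 have ind: "u \<in> D ==> is_inductive u ==> ?W \<subseteq> ext u" for u by auto
 have "x \<in> range nm" if "x \<in> ?W" for x
 proof -
  have "x \<in> D" using that by simp
  then show ?thesis using that
  proof (induction x rule: mem_induct)
   case (mem x)
   show ?case
   proof (cases "x = mk {} \<or> (EX y:?W. x = mk (insert y (ext y)))")
    case True
    then consider "x = mk {}" | y where "y \<in> ?W" "x = mk (insert y (ext y))" by blast
    then show ?thesis
    proof cases
     case 1
     then have "x = nm 0" by simp
     then show ?thesis by blast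
    next
     case 2
     then have "y \<in> ext x" by simp
     then have "y \<in> range nm" using mem.IH 2 by blast
     then obtain n where "y = nm n" by blast
     then have "x = nm (Suc n)" using 2 by simp
     then show ?thesis by blast
    qed
   next
    case False
    let ?V = "?W - {x}"
    have V: "isset ?V"
    proof (rule isset_subset[OF W])
     have "dfn D (%e. (e 0 \<in> ext v & (ALL u:D. is_inductive u --> e 0 \<epsilon> u)) & e 0 ~= x)"
      by (intro dfn_intros dfn_is_inductive v mem.hyps)
     then show "dfn D (%e. e 0 \<in> ?V)" by simp
    qed auto
    have Wi: "mk {} \<in> ?W" "!!y. y \<in> ?W ==> mk (insert y (ext y)) \<in> ?W"
     using v by (auto simp: is_inductive_iff)
    have "is_inductive (mk ?V)"
     using V Wi False by (subst is_inductive_iff) auto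
    then have "?W \<subseteq> ?V" using ind[of "mk ?V"] V by simp
    then show ?thesis using mem.prems by blast
   qed
  qed
 qed
 moreover have "range nm \<subseteq> ?W" using nm_in_inductive v by auto
 ultimately have "range nm = ?W" by blast
 then show ?thesis using W by simp
qed

definition om :: 'm where "om = mk (range nm)"

lemma om_D [simp, intro]: "om \<in> D" and ext_om: "ext om = range nm"
 unfolding om_def using isset_range_nm by auto

lemma nm_om [simp]: "nm n \<epsilon> om"
proof -
 have "nm n \<in> ext om" unfolding ext_om by blast
 then show ?thesis by simp
qed

lemma omE:
 assumes "x \<in> D" "x \<epsilon> om" obtains n where "x = nm n"
proof -
 have "x \<in> ext om" using assms by simp
 then show thesis using that unfolding ext_om by blast
qed

lemma is_inductive_om: "is_inductive om"
proof -
 have "nm 0 \<epsilon> om" by (rule nm_om)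
 moreover have "mk (insert x (ext x)) \<epsilon> om" if "x \<in> ext om" for x
 proof -
  from that have "x \<in> D" "x \<epsilon> om" by auto
  then obtain n where "x = nm n" by (rule omE)
  then show ?thesis using nm_om[of "Suc n"] by simp
 qed
 ultimately show ?thesis by (subst is_inductive_iff) auto
qed

lemma omega_iff: "w \<in> D ==> omega w <-> w = om"
proof
 assume w: "w \<in> D" "omega w"
 then have "is_inductive w" "ext w \<subseteq> ext om"
  using is_inductive_om unfolding omega_def sub_iff by auto
 moreover have "ext om \<subseteq> ext w"
  using nm_in_inductive[OF w(1) \<open>is_inductive w\<close>] unfolding ext_om by blast
 ultimately show "w = om" using w by (intro ext_inj) auto
next
 assume "w = om"
 moreover have "ext om \<subseteq> ext v" if "v \<in> D" "is_inductive v" for v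
  using nm_in_inductive[OF that] unfolding ext_om by blast
 ultimately show "omega w" using is_inductive_om unfolding omega_def sub_iff by blast
qed

lemma dtm_om [dfn_intros]: "dtm A (%e. om)"
proof -
 have "dfn A (%e. is_inductive (e 0) & (ALL v:D. is_inductive v --> ext (e 0) \<subseteq> ext v))"
  by (intro dfn_intros dfn_is_inductive)
 then have "dfn A (%e. e 0 = om)"
  by (rule dfn_cong) (subst omega_iff[symmetric], auto simp: omega_def sub_iff)
 then show ?thesis by (simp add: dtm_def)
qed

section \<open>Number-valued terms\<close>

definition nof :: "'m => nat" where
 "nof x = (if x \<in> range nm then inv nm x else 0)"

lemma nof_nm [simp]: "nof (nm n) = n"
 unfolding nof_def by (simp add: inv_f_f inj_on_def)

lemma nm_nof: "x \<in> D ==> nm (nof x) = (if x \<epsilon> om then x else nm 0)"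
proof (cases "x \<epsilon> om")
 case True
 moreover assume "x \<in> D"
 ultimately obtain n where "x = nm n" using omE by blast
 then show ?thesis by simp
next
 case False
 then have "x \<notin> range nm" by auto
 then show ?thesis using False by (simp add: nof_def)
qed

text \<open>Terms with external numbers as values, definable through their numerals. A quantifier
  over HOL numbers becomes a quantifier over all of \<open>D\<close> read through
  \<open>nof\<close>, which sends elements that are not numerals to 0.\<close>

definition ntm :: "'m set => ((nat => 'm) => nat) => bool" where
 "ntm A t <-> dtm A (%e. nm (t e))"

lemma ntmD: "ntm A t ==> dtm A (%e. nm (t e))"
 by (simp add: ntm_def)

lemma dtm_nm [dfn_intros]: "ntm A t ==> dtm A (%e. nm (t e))"
 by (simp add: ntm_def)

lemma ntm_ren: "ntm A t ==> ntm A (%e. t (%i. e (f i)))"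
 unfolding ntm_def by (rule dtm_ren)

lemma ntm_shift: "ntm A t ==> ntm A (%e. t (%i. e (Suc i)))"
 by (rule ntm_ren)

lemma ntm_const [dfn_intros]: "ntm A (%e. n)"
 unfolding ntm_def by (induction n) (auto intro: dfn_intros)

lemma ntm_nof [dfn_intros]: "dtm A t ==> ntm A (%e. nof (t e))"
proof -
 assume t: "dtm A t"
 have "dtm A (%e. if t e \<epsilon> om then t e else mk {})" by (intro dfn_intros t)
 then show ?thesis unfolding ntm_def by (rule dtm_cong) (use t in \<open>auto simp: nm_nof\<close>)
qed

lemma dfn_nat_eq [dfn_intros]:
 assumes "ntm A m" "ntm A n" shows "dfn A (%e. m e = n e)"
 using dfn_eq[OF ntmD ntmD, OF assms] by simp

lemma dfn_nat_less [dfn_intros]: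
 assumes "ntm A m" "ntm A n" shows "dfn A (%e. m e < n e)"
 using dfn_mem[OF ntmD ntmD, OF assms] by simp

lemma dfn_nat_le [dfn_intros]:
 assumes "ntm A m" "ntm A n" shows "dfn A (%e. m e \<le> n e)"
proof -
 have "dfn A (%e. ~ n e < m e)" by (intro dfn_intros assms)
 then show ?thesis by (simp add: not_less)
qed

lemma dfn_all_nat [dfn_intros]:
 assumes "dfn A (%e. Q (nof (e 0)) (%i. e (Suc i)))" shows "dfn A (%e. ALL n. Q n e)"
proof -
 have "dfn A (%e. ALL x:D. Q (nof x) e)" by (intro dfn_all assms)
 then show ?thesis by (rule dfn_cong) (metis nm_D nof_nm)
qed

lemma dfn_ex_nat [dfn_intros]:
 assumes "dfn A (%e. Q (nof (e 0)) (%i. e (Suc i)))" shows "dfn A (%e. EX n. Q n e)"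
proof -
 have "dfn A (%e. EX x:D. Q (nof x) e)" by (intro dfn_ex assms)
 then show ?thesis by (rule dfn_cong) (metis nm_D nof_nm)
qed

lemma dfn_all_less [dfn_intros]:
 assumes "ntm A m" "dfn A (%e. Q (nof (e 0)) (%i. e (Suc i)))" shows "dfn A (%e. ALL n<m e. Q n e)"
 by (intro dfn_intros ntm_shift assms)

lemma ntmI:
 assumes "dfn A (%e. nof (e 0) = t (%i. e (Suc i)))" shows "ntm A t"
proof -
 have "dfn A (%e. e 0 \<epsilon> om & nof (e 0) = t (%i. e (Suc i)))" by (intro dfn_intros assms)
 then have "dfn A (%e. e 0 = nm (t (%i. e (Suc i))))"
  by (rule dfn_cong) (metis envD nm_nof nm_om nof_nm)
 then show ?thesis by (simp add: ntm_def dtm_def)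
qed

lemma ntm_Suc [dfn_intros]: "ntm A t ==> ntm A (%e. Suc (t e))"
 unfolding ntm_def by (auto intro: dfn_intros)

lemma ntm_if [dfn_intros]:
 assumes "dfn A B" "ntm A t" "ntm A u" shows "ntm A (%e. if B e then t e else u e)"
 using dtm_if[OF assms(1) ntmD ntmD, OF assms(2,3)] unfolding ntm_def by (simp add: if_distrib)

text \<open>Finite external sets of elements are realized, so every finite external sequence of
  elements is coded by an element. Absoluteness of recursion on numbers rests on this.\<close>

lemma ap_finite:
 assumes "k \<le> n" "!!k. k \<le> n ==> F k \<in> D"
 shows "ap (mk ((%k. op (nm k) (F k)) ` {..n})) (nm k) = F k"
  "isset ((%k. op (nm k) (F k)) ` {..n})"
proof -
 show i: "isset ((%k. op (nm k) (F k)) ` {..n})" by (rule isset_finite) (use assms in auto)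
 show "ap (mk ((%k. op (nm k) (F k)) ` {..n})) (nm k) = F k"
 proof (rule ap_eq)
  show "op (nm k) (F k) \<epsilon> mk ((%k. op (nm k) (F k)) ` {..n})" using i assms by simp
  show "F k \<in> D" using assms by simp
  fix z assume z: "z \<in> D" "op (nm k) z \<epsilon> mk ((%k. op (nm k) (F k)) ` {..n})"
  then have "op (nm k) z \<in> (%k. op (nm k) (F k)) ` {..n}" using i by simp
  then show "z = F k" using z assms by auto
 qed
qed

text \<open>The iteration is expressed by the existence of a computation sequence \<open>g\<close>,
  which is finite and therefore in the model.\<close>

lemma dtm_funpow [dfn_intros]:
 assumes "dtm A (%e. F (e 0) (%i. e (Suc i)))" "ntm A n" "dtm A c"
 shows "dtm A (%e. ((%x. F x e) ^^ n e) (c e))"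
proof -
 have F: "F x e \<in> D" if "env e" "x \<in> D" for x e
  using dtmD[OF assms(1), of "case_nat x e"] that by simp
 have FF: "((%x. F x e) ^^ k) (c e) \<in> D" if "env e" for k e
  using that assms(3) by (induction k) (auto intro: F)
 let ?P = "%g y e. ap g (nm 0) = c e & (ALL k<n e. ap g (nm (Suc k)) = F (ap g (nm k)) e) & ap g (nm (n e)) = y"
 have F2: "dtm A (%e. F (ap (e (Suc 0)) (nm (nof (e 0)))) (%i. e (Suc (Suc (Suc i)))))"
  by (rule dtm_term_ren[OF assms(1)]) (intro dfn_intros)
 have "dfn A (%e. EX g:D. ?P g (e 0) (%i. e (Suc i)))"
  by (intro dfn_intros dtm_ren[OF assms(3), of "%i. Suc (Suc i)"] ntm_ren[OF assms(2), of "%i. Suc (Suc i)"] F2)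
 then have "dfn A (%e. e 0 = ((%x. F x (%i. e (Suc i))) ^^ n (%i. e (Suc i))) (c (%i. e (Suc i))))"
 proof (rule dfn_cong)
  fix e' assume "env e'"
  define e where "e = (%i. e' (Suc i))"
  have e: "env e" using \<open>env e'\<close> by (simp add: e_def)
  have "(EX g:D. ?P g y e) <-> y = ((%x. F x e) ^^ n e) (c e)" for y
  proof
   assume "EX g:D. ?P g y e"
   then obtain g where g: "?P g y e" by blast
   have "k \<le> n e ==> ap g (nm k) = ((%x. F x e) ^^ k) (c e)" for k
    using g by (induction k) auto
   then show "y = ((%x. F x e) ^^ n e) (c e)" using g by auto
  next
   assume y: "y = ((%x. F x e) ^^ n e) (c e)"
   let ?G = "%k. ((%x. F x e) ^^ k) (c e)"
   let ?g = "mk ((%k. op (nm k) (?G k)) ` {..n e})"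
   have g: "ap ?g (nm k) = ?G k" if "k \<le> n e" for k
    by (rule ap_finite(1)[OF that]) (rule FF[OF e])
   have "isset ((%k. op (nm k) (?G k)) ` {..n e})"
    by (rule ap_finite(2)[OF order_refl]) (rule FF[OF e])
   then have D: "?g \<in> D" by (rule mk_D)
   have "?P ?g y e"
   proof (intro conjI allI impI)
    show "ap ?g (nm 0) = c e" using g[of 0] by (simp del: nm.simps)
    show "ap ?g (nm (n e)) = y" using g[of "n e"] y by simp
    show "ap ?g (nm (Suc k)) = F (ap ?g (nm k)) e" if "k < n e" for k
     using g[of "Suc k"] g[of k] that by (simp del: nm.simps)
   qed
   with D show "EX g:D. ?P g y e" by blast
  qed
  then show "(EX g:D. ?P g (e' 0) (%i. e' (Suc i))) =
    (e' 0 = ((%x. F x (%i. e' (Suc i))) ^^ n (%i. e' (Suc i))) (c (%i. e' (Suc i))))"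
   unfolding e_def by blast
 qed
 then show ?thesis unfolding dtm_def using FF by auto
qed

lemma ntm_funpow [dfn_intros]:
 assumes "ntm A (%e. f (nof (e 0)) (%i. e (Suc i)))" "ntm A n" "ntm A c"
 shows "ntm A (%e. ((%x. f x e) ^^ n e) (c e))"
proof -
 have "((%x. nm (f (nof x) e)) ^^ k) (nm (c e)) = nm (((%x. f x e) ^^ k) (c e))" for k e
  by (induction k) (auto simp del: nm.simps)
 moreover have "dtm A (%e. ((%x. nm (f (nof x) e)) ^^ n e) (nm (c e)))"
  by (intro dtm_funpow ntmD assms)
 ultimately show ?thesis by (simp add: ntm_def)
qed

lemma ntm_pred [dfn_intros]:
 assumes "ntm A t" shows "ntm A (%e. t e - Suc 0)"
proof (rule ntmI)
 have "dfn A (%e. if t (%i. e (Suc i)) = 0 then nof (e 0) = 0 else Suc (nof (e 0)) = t (%i. e (Suc i)))"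
  by (intro dfn_intros ntm_shift assms)
 then show "dfn A (%e. nof (e 0) = t (%i. e (Suc i)) - Suc 0)" by (rule dfn_cong) auto
qed

lemma ntm_decode:
 assumes "ntm A t" shows "dtm A (%e. op (nm (dfst (t e))) (nm (dsnd (t e))))"
proof -
 let ?G = "%p. if nof (psnd p) = 0 then op (nm 0) (nm (Suc (nof (pfst p))))
   else op (nm (Suc (nof (pfst p)))) (nm (nof (psnd p) - Suc 0))"
 have "dtm A (%e. ((%p. ?G p) ^^ t e) (op (nm 0) (nm 0)))" by (intro dfn_intros assms)
 moreover have "((%p. ?G p) ^^ k) (op (nm 0) (nm 0)) = op (nm (dfst k)) (nm (dsnd k))" for k
  by (induction k) (auto simp: prod_decode_Suc prod_decode_0 simp del: nm.simps)
 ultimately show ?thesis by simp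
qed

lemma ntm_dfst [dfn_intros]:
 assumes "ntm A t" shows "ntm A (%e. dfst (t e))"
 using dtm_pfst[OF ntm_decode[OF assms]] by (simp add: ntm_def)

lemma ntm_dsnd [dfn_intros]:
 assumes "ntm A t" shows "ntm A (%e. dsnd (t e))"
 using dtm_psnd[OF ntm_decode[OF assms]] by (simp add: ntm_def)

lemma eq_enc_iff: "k = enc m n <-> dfst k = m & dsnd k = n"
proof -
 have "k = enc m n <-> prod_decode k = (m, n)" by (metis prod_decode_inverse prod_encode_inverse)
 then show ?thesis by (auto simp: prod_eq_iff)
qed

lemma ntm_enc [dfn_intros]:
 assumes "ntm A t" "ntm A u" shows "ntm A (%e. enc (t e) (u e))"
proof (rule ntmI)
 have "dfn A (%e. dfst (nof (e 0)) = t (%i. e (Suc i)) & dsnd (nof (e 0)) = u (%i. e (Suc i)))"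
  by (intro dfn_intros ntm_shift assms)
 then show "dfn A (%e. nof (e 0) = enc (t (%i. e (Suc i))) (u (%i. e (Suc i))))"
  by (simp add: eq_enc_iff)
qed

text \<open>The cardinality is computed by iterating a counter whose state pairs the position with
  the number of hits so far.\<close>

lemma ntm_card [dfn_intros]:
 assumes "ntm A n" "dfn A (%e. Q (nof (e 0)) (%i. e (Suc i)))"
 shows "ntm A (%e. card {y. y < n e & Q y e})"
proof -
 let ?F = "%s e. enc (Suc (dfst s)) (if Q (dfst s) e then Suc (dsnd s) else dsnd s)"
 have "((%s. ?F s e) ^^ k) (enc 0 0) = enc k (card {y. y < k & Q y e})" for k e
 proof (induction k)
  case (Suc k)
  have "{y. y < Suc k & Q y e} = (if Q k e then insert k {y. y < k & Q y e} else {y. y < k & Q y e})"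
   by (auto simp: less_Suc_eq)
  then show ?case using Suc by simp
 qed simp
 then have *: "dsnd (((%s. ?F s e) ^^ k) (enc 0 0)) = card {y. y < k & Q y e}" for k e by simp
 have "dfn A (%e. Q (dfst (nof (e 0))) (%i. e (Suc i)))"
  using dfn_term_ren[OF assms(2) dtm_nm[OF ntm_dfst[OF ntm_nof[OF dtm_var[of _ 0]]]], of Suc] by simp
 then have "ntm A (%e. dsnd (((%s. ?F s e) ^^ n e) (enc 0 0)))"
  by (intro dfn_intros assms(1))
 then show ?thesis by (simp only: *)
qed

section \<open>Reals of the model as external sets of numbers\<close>

definition reals :: "nat set set" where
 "reals = {B. isset (nm ` B)}"

definition rl :: "nat set => 'm" where
 "rl B = mk (nm ` B)"

definition rof :: "'m => nat set" where
 "rof x = {n. nm n \<epsilon> x}"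

lemma rl_D [simp, intro]: "B \<in> reals ==> rl B \<in> D"
 and ext_rl: "B \<in> reals ==> ext (rl B) = nm ` B"
 unfolding rl_def reals_def by auto

lemma rof_rl [simp]:
 assumes "B \<in> reals" shows "rof (rl B) = B"
proof -
 have "nm n \<epsilon> rl B <-> nm n \<in> ext (rl B)" for n by simp
 then show ?thesis using ext_rl[OF assms] unfolding rof_def by auto
qed

lemma nm_rof: "x \<in> D ==> nm ` rof x = ext x \<inter> ext om"
 unfolding rof_def ext_om by auto

lemma rof_reals [simp, intro]:
 assumes "x \<in> D" shows "rof x \<in> reals"
proof -
 have "isset {y \<in> ext x. y \<in> ext om}" by (rule isset_sep) (intro dfn_intros om_D assms)+
 moreover have "{y \<in> ext x. y \<in> ext om} = nm ` rof x" using nm_rof[OF assms] by auto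
 ultimately show ?thesis unfolding reals_def by simp
qed

lemma rl_rof: "x \<in> D ==> ext x \<subseteq> ext om ==> rl (rof x) = x"
 unfolding rl_def using nm_rof[of x] mk_ext[of x] by (metis inf.absorb1)

lemma ext_rl_om: "B \<in> reals ==> ext (rl B) \<subseteq> ext om"
 unfolding ext_om by (auto simp: ext_rl)

lemma rl_inj: "B \<in> reals ==> C \<in> reals ==> rl B = rl C <-> B = C"
 by (metis rof_rl)

lemma realsI:
 assumes "dfn D (%e. P (nof (e 0)))" shows "{n. P n} \<in> reals"
proof -
 have "isset {x \<in> ext om. P (nof x)}" by (rule isset_sep) (intro assms om_D)+
 moreover have "{x \<in> ext om. P (nof x)} = nm ` {n. P n}" unfolding ext_om by auto
 ultimately show ?thesis unfolding reals_def by simp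
qed

lemma dfn_in_rof [dfn_intros]:
 assumes "ntm A n" "dtm A t" shows "dfn A (%e. n e \<in> rof (t e))"
proof -
 have "dfn A (%e. nm (n e) \<epsilon> t e)" by (intro dfn_intros assms)
 then show ?thesis by (simp add: rof_def)
qed

lemma dfn_in_real [dfn_intros]:
 assumes "B \<in> reals" "ntm D n" shows "dfn D (%e. n e \<in> B)"
proof -
 have "dfn D (%e. n e \<in> rof (rl B))" by (intro dfn_intros assms rl_D)
 then show ?thesis using assms by simp
qed

lemma in_nm_image:
 assumes "x \<in> D" shows "x \<in> nm ` B <-> x \<epsilon> om & nof x \<in> B"
proof
 assume "x \<epsilon> om & nof x \<in> B"
 moreover then have "x = nm (nof x)" using nm_nof[OF assms] by simp
 ultimately show "x \<in> nm ` B" by blast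
qed auto

lemma dtm_rl:
 assumes "!!e. env e ==> B e \<in> reals" "dfn A (%e. nof (e 0) \<in> B (%i. e (Suc i)))"
 shows "dtm A (%e. rl (B e))"
 unfolding rl_def
proof (rule dtm_mk)
 have "dfn A (%e. e 0 \<epsilon> om & nof (e 0) \<in> B (%i. e (Suc i)))" by (intro dfn_intros assms(2))
 then show "dfn A (%e. e 0 \<in> nm ` B (%i. e (Suc i)))"
  by (rule dfn_cong) (simp add: in_nm_image)
qed (use assms(1) in \<open>simp add: reals_def\<close>)

end

section \<open>Recursion on definable set-like relations\<close>

context zfm
begin

text \<open>Transitive closure of \<open>x\<close> under the predecessor operation
  \<open>pr\<close>, as the union of its finite stages.\<close>

definition tcl :: "('m => 'm) => 'm => 'm" where
 "tcl pr x = mk (\<Union>n\<in>ext om. ext (((%c. mk (ext c \<union> ext (mk (\<Union>z\<in>ext c. ext (pr z))))) ^^ nof n) (mk {x})))"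

lemma dtm1_D: "dtm A (%e. f (e 0)) ==> x \<in> D ==> f x \<in> D"
proof -
 assume f: "dtm A (%e. f (e 0))" and x: "x \<in> D"
 then have "env (%_. x)" by (simp add: env_def)
 from dtmD[OF f this] show ?thesis by simp
qed

lemma tcl:
 assumes pr: "dtm A (%e. pr (e 0))" and x: "x \<in> D"
 shows tcl_D: "tcl pr x \<in> D"
  and tcl_self: "x \<in> ext (tcl pr x)"
  and tcl_closed: "!!z y. z \<in> ext (tcl pr x) ==> y \<in> ext (pr z) ==> y \<in> ext (tcl pr x)"
  and tcl_least: "!!S. x \<in> S ==> (!!z. z \<in> S ==> z \<in> D ==> ext (pr z) \<subseteq> S) ==> ext (tcl pr x) \<subseteq> S"
proof -
 let ?S = "%c. mk (ext c \<union> ext (mk (\<Union>z\<in>ext c. ext (pr z))))"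
 let ?c = "%n. (?S ^^ n) (mk {x})"
 have pr': "dtm D (%e. pr (e 0))" by (rule dtm_mono[OF pr]) auto
 have U: "isset (\<Union>z\<in>ext c. ext (pr z))" if "c \<in> D" for c
  using that by (intro isset_UN pr') auto
 have cD: "?c n \<in> D" for n by (induction n) (use x U in auto)
 have eS: "ext (?S c) = ext c \<union> (\<Union>z\<in>ext c. ext (pr z))" if "c \<in> D" for c
  using U[OF that] that by simp
 have "isset (\<Union>n\<in>ext om. ext (?c (nof n)))"
  by (rule isset_UN) (intro dfn_intros pr' isset_ext om_D | rule x)+
 then have e: "ext (tcl pr x) = (\<Union>n. ext (?c n))" and D: "tcl pr x \<in> D"
  unfolding tcl_def by (auto simp: ext_om)
 show "tcl pr x \<in> D" by (rule D)
 have "x \<in> ext (?c 0)" using x by simp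
 then show "x \<in> ext (tcl pr x)" unfolding e by blast
 show "y \<in> ext (tcl pr x)" if z: "z \<in> ext (tcl pr x)" and y: "y \<in> ext (pr z)" for z y
 proof -
  obtain n where "z \<in> ext (?c n)" using z unfolding e by blast
  then have "y \<in> ext (?c (Suc n))" using y eS[OF cD[of n]] by auto
  then show ?thesis unfolding e by blast
 qed
 show "ext (tcl pr x) \<subseteq> S"
  if S: "x \<in> S" and SS: "!!z. z \<in> S ==> z \<in> D ==> ext (pr z) \<subseteq> S" for S
 proof -
  have "ext (?c n) \<subseteq> S" for n
  proof (induction n)
   case 0
   then show ?case using S x by simp
  next
   case (Suc n)
   have "ext (pr z) \<subseteq> S" if "z \<in> ext (?c n)" for z
    by (rule SS) (use that Suc in auto)
   then have "(\<Union>z\<in>ext (?c n). ext (pr z)) \<subseteq> S" by blast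
   then show ?case using Suc eS[OF cD[of n]] by simp
  qed
  then show ?thesis unfolding e by blast
 qed
qed

lemma tcl_cases:
 assumes pr: "dtm A (%e. pr (e 0))" and x: "x \<in> D" and z: "z \<in> ext (tcl pr x)"
 shows "z = x \<or> (EX y:ext (pr x). z \<in> ext (tcl pr y))"
proof -
 let ?S = "insert x (\<Union>y\<in>ext (pr x). ext (tcl pr y))"
 have "ext (tcl pr x) \<subseteq> ?S"
 proof (rule tcl_least[OF pr x])
  fix z assume z: "z \<in> ?S" "z \<in> D"
  show "ext (pr z) \<subseteq> ?S"
  proof
   fix w assume w: "w \<in> ext (pr z)"
   show "w \<in> ?S"
   proof (cases "z = x")
    case True
    then show ?thesis using w tcl_self[OF pr, of w] by auto
   next
    case False
    then obtain y where y: "y \<in> ext (pr x)" "z \<in> ext (tcl pr y)" using z by blast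
    then have "w \<in> ext (tcl pr y)" using tcl_closed[OF pr _ y(2) w] by auto
    then show ?thesis using y by blast
   qed
  qed
 qed auto
 then show ?thesis using z by blast
qed

text \<open>Well-foundedness of \<open>R\<close> enters as induction for definable predicates only.
  This generality matters in \<open>branch\<close>, where the relation is known to be well-founded
  inside the model while an external infinite descent has yet to be excluded.\<close>

theorem recursion:
 assumes R: "dfn A (%e. R (e 0) (e (Suc 0)))"
  and sl: "!!x. x \<in> D ==> isset {y \<in> D. R y x}"
  and ind: "!!P x. dfn D (%e. P (e 0)) ==>
   (!!x. x \<in> D ==> (!!y. y \<in> D ==> R y x ==> P y) ==> P x) ==> x \<in> D ==> P x"
  and G: "dtm A (%e. G (e 0) (e (Suc 0)))"
 obtains F where "dtm A (%e. F (e 0))" "!!x. x \<in> D ==> F x = G x (lam {y \<in> D. R y x} F)"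
  "!!x. x \<in> D ==> lam {y \<in> D. R y x} F \<in> D"
proof -
 define pr where "pr x = mk {y \<in> D. R y x}" for x
 have pr: "dtm B (%e. pr (e 0))" if "A \<inter> D \<subseteq> B" for B
  unfolding pr_def
 proof (rule dtm_mk)
  show "isset {y \<in> D. R y (e 0)}" if "env e" for e using that sl by auto
  have "dfn B (%e. R (e 0) (e (Suc 0)))" by (rule dfn_mono[OF R that])
  then show "dfn B (%e. e 0 \<in> {y \<in> D. R y (e (Suc 0))})" by (rule dfn_cong) auto
 qed
 have epr: "ext (pr x) = {y \<in> D. R y x}" if "x \<in> D" for x
  unfolding pr_def using sl[OF that] by simp
 have prD: "pr x \<in> D" if "x \<in> D" for x unfolding pr_def using sl[OF that] by simp
 note prA = pr[OF Int_lower1] and prDD = pr[OF Int_lower2]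
 have GB: "dtm B (%e. G (e 0) (e (Suc 0)))" if "A \<inter> D \<subseteq> B" for B
  by (rule dtm_mono[OF G that])
 define st where "st g z = G z (lam (ext (pr z)) (ap g))" for g z
 have st: "dtm B (%e. st (t e) (u e))" if "A \<inter> D \<subseteq> B" "dtm B t" "dtm B u" for B t u
  unfolding st_def
  by (intro dtm2[OF GB[OF that(1)]] that(3) dtm_lam dtm1[OF pr[OF that(1)] that(3)])
    (intro dtm_ap dtm_var dtm_shift that(2))
 \<comment> \<open>\<open>g\<close> is an approximation to the recursive function on the
   \<open>pr\<close>-closed set \<open>d\<close>.\<close>
 define apx where "apx g d <-> (ALL x:ext d. ext (pr x) \<subseteq> ext d & ap g x = st g x)" for g d
 have apx: "dfn B (%e. apx (t e) (u e))" if "A \<inter> D \<subseteq> B" "dtm B t" "dtm B u" for B t u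
 proof (rule dfn2[OF _ that(2,3)])
  show "dfn B (%e. apx (e 0) (e (Suc 0)))"
   unfolding apx_def by (intro dfn_intros st that(1) dtm1[OF pr[OF that(1)]])
 qed
 have uniq: "ap g z = ap g' z"
  if g: "g \<in> D" "d \<in> D" "apx g d" "z \<in> ext d" and g': "g' \<in> D" "d' \<in> D" "apx g' d'" "z \<in> ext d'"
  for g d g' d' z
 proof -
  have "z \<in> D" using g by simp
  have "z \<in> ext d --> z \<in> ext d' --> ap g z = ap g' z"
  proof (rule ind[OF _ _ \<open>z \<in> D\<close>])
   show "dfn D (%e. e 0 \<in> ext d --> e 0 \<in> ext d' --> ap g (e 0) = ap g' (e 0))"
    by (intro dfn_intros g g')
  next
   fix x assume x: "x \<in> D" and IH: "!!y. y \<in> D ==> R y x ==> y \<in> ext d --> y \<in> ext d' --> ap g y = ap g' y"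
   show "x \<in> ext d --> x \<in> ext d' --> ap g x = ap g' x"
   proof (intro impI)
    assume xd: "x \<in> ext d" "x \<in> ext d'"
    have "lam (ext (pr x)) (ap g) = lam (ext (pr x)) (ap g')"
    proof (rule lam_cong[OF refl])
     fix y assume y: "y \<in> ext (pr x)"
     then have "y \<in> ext d" "y \<in> ext d'" using g(3) g'(3) xd unfolding apx_def by blast+
     then show "ap g y = ap g' y" using IH y epr[OF x] by auto
    qed
    then show "ap g x = ap g' x" using xd g(3) g'(3) unfolding apx_def st_def by metis
   qed
  qed
  then show ?thesis using g g' by blast
 qed
 define V where "V x y <-> (EX g:D. EX d:D. apx g d & x \<in> ext d & y = ap g x)" for x y
 have V: "dfn A (%e. V (e i) (e j))" for i j
  unfolding V_def by (intro dfn_intros apx) auto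
 have Vu: "V x y ==> V x y' ==> y = y'" for x y y'
  unfolding V_def using uniq by blast
 define F where "F x = (if EX y:D. V x y then THE y. V x y else mk {})" for x
 have FV: "F x = y" if "V x y" for x y
 proof -
  have "EX y:D. V x y" using that unfolding V_def by blast
  then show ?thesis unfolding F_def using that Vu by (simp add: the_equality)
 qed
 have VD: "V x y ==> y \<in> D" for x y unfolding V_def by auto
 have FD: "F x \<in> D" for x
 proof (cases "EX y:D. V x y")
  case True
  then show ?thesis using FV by auto
 next
  case False
  then show ?thesis unfolding F_def by (simp only: if_False) auto
 qed
 have F: "dtm A (%e. F (e 0))"
 proof -
  have "dfn A (%e. V (e (Suc 0)) (e 0) \<or> (~ (EX y:D. V (e (Suc 0)) y) & e 0 = mk {}))"
   by (intro dfn_intros V)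
  then have "dfn A (%e. e 0 = F (e (Suc 0)))"
  proof (rule dfn_cong)
   fix e assume e: "env e"
   show "(V (e (Suc 0)) (e 0) \<or> (~ (EX y:D. V (e (Suc 0)) y) & e 0 = mk {})) = (e 0 = F (e (Suc 0)))"
   proof (cases "EX y:D. V (e (Suc 0)) y")
    case True
    then obtain y where y: "V (e (Suc 0)) y" by blast
    then have "V (e (Suc 0)) (e 0) <-> e 0 = y" using Vu by blast
    then show ?thesis using FV[OF y] True by simp
   next
    case False
    then have "F (e (Suc 0)) = mk {}" unfolding F_def by (simp only: if_False)
    then show ?thesis using False e by auto
   qed
  qed
  then show ?thesis unfolding dtm_def using FD by simp
 qed
 have FDD: "dtm D (%e. F (e 0))"
  by (rule dtm_mono[OF F]) auto
 have step: "F z = G z (lam (ext (pr z)) F) & (ALL w:ext (pr z). EX y. V w y)" if "V z y" for z y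
 proof -
  obtain g d where g: "g \<in> D" "d \<in> D" "apx g d" "z \<in> ext d" "y = ap g z"
   using \<open>V z y\<close> unfolding V_def by blast
  then have *: "ap g z = G z (lam (ext (pr z)) (ap g))" unfolding apx_def st_def by blast
  have **: "V w (ap g w)" if "w \<in> ext (pr z)" for w
   using g that unfolding V_def apx_def by blast
  have "lam (ext (pr z)) (ap g) = lam (ext (pr z)) F"
   by (rule lam_cong[OF refl]) (use ** FV in metis)
  moreover have "ALL w:ext (pr z). EX y. V w y" using ** by blast
  ultimately show ?thesis using * FV[OF that] g(5) by simp
 qed
 have ex: "EX y. V x y" if "x \<in> D" for x
 proof (rule ind[OF _ _ that])
  have "dfn D (%e. EX y:D. V (e 0) y)"
   unfolding V_def by (intro dfn_intros apx) auto
  then show "dfn D (%e. EX y. V (e 0) y)" by (rule dfn_cong) (use VD in blast)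
 next
  fix x assume x: "x \<in> D" and "!!y. y \<in> D ==> R y x ==> EX z. V y z"
  then have IH: "EX z. V y z" if "y \<in> ext (pr x)" for y using that epr[OF x] by auto
  have *: "EX y. V z y" if y: "y \<in> ext (pr x)" and z: "z \<in> ext (tcl pr y)" for y z
  proof -
   obtain g d where g: "g \<in> D" "d \<in> D" "apx g d" "y \<in> ext d" using IH[OF y] unfolding V_def by blast
   have "ext (tcl pr y) \<subseteq> ext d"
    by (rule tcl_least[OF prA]) (use y g in \<open>auto simp: apx_def\<close>)
   then show ?thesis using g z unfolding V_def by blast
  qed
  let ?d = "tcl pr x" and ?H = "%z. G z (lam (ext (pr z)) F)"
  let ?g = "lam (ext ?d) ?H"
  have d: "?d \<in> D" by (rule tcl_D[OF prA x])
  have H: "dtm D (%e. ?H (e 0))"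
   by (intro dtm2[OF GB] dfn_intros prDD FDD) auto
  note g = lam_function_on[OF H d]
  have Fw: "?H w = F w" if "z \<in> ext ?d" "w \<in> ext (pr z)" for z w
  proof -
   have "EX y. V w y"
    using tcl_cases[OF prA x that(1)]
   proof
    assume "z = x"
    then show ?thesis using IH that(2) by blast
   next
    assume "EX y:ext (pr x). z \<in> ext (tcl pr y)"
    then obtain y where y: "y \<in> ext (pr x)" "z \<in> ext (tcl pr y)" by blast
    then have "w \<in> ext (tcl pr y)" using tcl_closed[OF prA _ y(2) that(2)] by simp
    then show ?thesis using * y by blast
   qed
   then show ?thesis using step by metis
  qed
  have "apx ?g ?d"
   unfolding apx_def
  proof (intro ballI conjI)
   fix z assume z: "z \<in> ext ?d"
   show sub: "ext (pr z) \<subseteq> ext ?d" using tcl_closed[OF prA x z] by blast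
   have "lam (ext (pr z)) (ap ?g) = lam (ext (pr z)) F"
   proof (rule lam_cong[OF refl])
    fix w assume w: "w \<in> ext (pr z)"
    then have "w \<in> ext ?d" using sub by blast
    from g(3)[OF this] show "ap ?g w = F w" using Fw[OF z w] by simp
   qed
   then show "ap ?g z = st ?g z" unfolding st_def using g(3)[OF z] by simp
  qed
  then show "EX y. V x y" using g(1) d tcl_self[OF prA x] unfolding V_def by blast
 qed
 show thesis
 proof (rule that[OF F])
  show "F x = G x (lam {y \<in> D. R y x} F)" if "x \<in> D" for x
   using ex[OF that] step epr[OF that] by metis
  show "lam {y \<in> D. R y x} F \<in> D" if "x \<in> D" for x
   using lam_function_on(1)[OF FDD prD[OF that]] epr[OF that] by simp
 qed
qed

lemma mem_recursion:
 assumes G: "dtm A (%e. G (e 0) (e (Suc 0)))"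
 obtains F where "dtm A (%e. F (e 0))" "!!x. x \<in> D ==> F x = G x (lam (ext x) F)"
  "!!x. x \<in> D ==> lam (ext x) F \<in> D"
proof (rule recursion[of A "%y x. y \<epsilon> x" G])
 show "dfn A (%e. e 0 \<epsilon> e (Suc 0))" by (rule dfn_mem_var)
 show "isset {y \<in> D. y \<epsilon> x}" if "x \<in> D" for x using that isset_ext unfolding ext_def by blast
 show "P x" if P: "!!x. x \<in> D ==> (!!y. y \<in> D ==> y \<epsilon> x ==> P y) ==> P x" and x: "x \<in> D" for P x
  using x
 proof (induction x rule: mem_induct)
  case (mem x)
  show ?case by (rule P[OF mem.hyps]) (use mem.IH in simp)
 qed
next
 fix F assume F: "dtm A (%e. F (e 0))" "!!x. x \<in> D ==> F x = G x (lam {y \<in> D. y \<epsilon> x} F)"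
  "!!x. x \<in> D ==> lam {y \<in> D. y \<epsilon> x} F \<in> D"
 show thesis by (rule that[OF F(1)]) (use F(2,3) in \<open>simp_all add: ext_def\<close>)
qed (rule G)

lemma ap_lam':
 assumes "lam S F \<in> D" "isset S" "dtm D (%e. F (e 0))" "x \<in> S"
 shows "ap (lam S F) x = F x"
 using lam_function_on(3)[OF assms(3), of "mk S" x] assms(2,4) by simp

end

section \<open>Ultrafilters on a family of reals closed under arithmetic\<close>

text \<open>Arithmetic relations with parameters from \<open>R\<close>. Counting is a primitive
  because the increasing enumeration of an infinite set is described by it, and a model computes it
  by a simple iteration.\<close>

inductive ar :: "nat set set => ((nat => nat) => bool) => bool" for R where
 ar_mem_var: "B \<in> R ==> ar R (%e. e i \<in> B)"
| ar_less_var: "ar R (%e. e i < e j)"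
| ar_const_var: "ar R (%e. e i = c)"
| ar_enc_var: "ar R (%e. e i = enc (e j) (e k))"
| ar_nand: "ar R P ==> ar R Q ==> ar R (%e. ~ (P e & Q e))"
| ar_all': "ar R P ==> ar R (%e. ALL n. P (case_nat n e))"
| ar_card': "ar R P ==> ar R (%e. e i = card {y. y < e j & P (case_nat y e)})"

named_theorems ar_intros

definition nt :: "nat set set => ((nat => nat) => nat) => bool" where
 "nt R t <-> ar R (%e. e 0 = t (%i. e (Suc i)))"

lemma ar_ren: "ar R P ==> ar R (%e. P (%i. e (f i)))"
proof (induction arbitrary: f rule: ar.induct)
 case (ar_all' P)
 have "ar R (%e. P (%i. e (case_nat 0 (%i. Suc (f i)) i)))" by (rule ar_all')
 then have "ar R (%e. ALL n. P (%i. case_nat n e (case_nat 0 (%i. Suc (f i)) i)))" by (rule ar.ar_all')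
 moreover have "(%i. case_nat n e (case_nat 0 (%i. Suc (f i)) i)) = case_nat n (%i. e (f i))" for n and e :: "nat => nat"
  by (auto split: nat.splits)
 ultimately show ?case by simp
next
 case (ar_card' P i j)
 have "ar R (%e. P (%i. e (case_nat 0 (%i. Suc (f i)) i)))" by (rule ar_card')
 then have "ar R (%e. e (f i) = card {y. y < e (f j) & P (%i. case_nat y e (case_nat 0 (%i. Suc (f i)) i))})"
  by (rule ar.ar_card')
 moreover have "(%i. case_nat n e (case_nat 0 (%i. Suc (f i)) i)) = case_nat n (%i. e (f i))" for n and e :: "nat => nat"
  by (auto split: nat.splits)
 ultimately show ?case by simp
next
 case (ar_nand P Q)
 show ?case by (rule ar.ar_nand[OF ar_nand.IH])
qed (auto intro: ar.intros)

lemma ar_not [ar_intros]: "ar R P ==> ar R (%e. ~ P e)"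
 using ar_nand[of R P P] by simp

lemma ar_conj [ar_intros]: "ar R P ==> ar R Q ==> ar R (%e. P e & Q e)"
 using ar_not[OF ar_nand[of R P Q]] by simp

lemma ar_disj [ar_intros]:
 assumes "ar R P" "ar R Q" shows "ar R (%e. P e \<or> Q e)"
proof -
 have "ar R (%e. ~ (~ P e & ~ Q e))" by (intro ar_intros assms)
 then show ?thesis by (simp only: de_Morgan_conj not_not)
qed

lemma ar_imp [ar_intros]:
 assumes "ar R P" "ar R Q" shows "ar R (%e. P e --> Q e)"
proof -
 have "ar R (%e. ~ (P e & ~ Q e))" by (intro ar_intros assms)
 then show ?thesis by simp
qed

lemma ar_all [ar_intros]:
 assumes "ar R (%e. Q (e 0) (%i. e (Suc i)))" shows "ar R (%e. ALL n. Q n e)"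
 using ar_all'[OF assms] by simp

lemma ar_ex [ar_intros]:
 assumes "ar R (%e. Q (e 0) (%i. e (Suc i)))" shows "ar R (%e. EX n. Q n e)"
proof -
 have "ar R (%e. ~ (ALL n. ~ Q n e))" by (intro ar_intros assms)
 then show ?thesis by simp
qed

lemma ar_true [ar_intros]: "ar R (%e. P)"
proof -
 have "ar R (%e. ~ e 0 = 0 \<or> e 0 = 0)" by (intro ar_intros ar_const_var)
 then have t: "ar R (%e. True)" by (simp only: excluded_middle)
 show ?thesis using t ar_not[OF t] by (cases P) auto
qed

lemma ar_eq_var: "ar R (%e. e i = e j)"
proof -
 have "ar R (%e. ~ e i < e j & ~ e j < e i)" by (intro ar_intros ar_less_var)
 moreover have "(%e. ~ e i < e j & ~ e j < e i) = (%e :: nat => nat. e i = e j)" by (auto intro!: ext)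
 ultimately show ?thesis by simp
qed

lemma nt_var [ar_intros]: "nt R (%e. e i)"
 unfolding nt_def by (rule ar_eq_var)

lemma nt_const [ar_intros]: "nt R (%e. c)"
 unfolding nt_def by (rule ar_const_var)

lemma nt_ren: "nt R t ==> nt R (%e. t (%i. e (f i)))"
 unfolding nt_def using ar_ren[of R "%e. e 0 = t (%i. e (Suc i))" "case_nat 0 (%i. Suc (f i))"] by simp

lemma nt_shift: "nt R t ==> nt R (%e. t (%i. e (Suc i)))"
 by (rule nt_ren)

lemma ar_term:
 assumes "ar R (%e. Q (e 0) (%i. e (Suc i)))" "nt R t"
 shows "ar R (%e. Q (t e) e)"
proof -
 have "ar R (%e. EX x. x = t e & Q x e)"
  using assms unfolding nt_def by (intro ar_intros)
 then show ?thesis by simp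
qed

lemma ar_term1: "ar R (%e. P (e 0)) ==> nt R t ==> ar R (%e. P (t e))"
 using ar_term[of R "%x e. P x" t] by simp

lemma ar_term2:
 assumes "ar R (%e. P (e 0) (e (Suc 0)))" "nt R t" "nt R u"
 shows "ar R (%e. P (t e) (u e))"
proof -
 have "ar R (%e. P (e (Suc 0)) (e 0))" using ar_ren[OF assms(1), of "%i. if i = 0 then 1 else 0"] by simp
 then have "ar R (%e. P (e 0) (u (%i. e (Suc i))))"
  by (rule ar_term[of R "%y e. P (e 0) y", OF _ nt_shift[OF assms(3)]])
 from ar_term[of R "%x e. P x (u e)", OF this assms(2)] show ?thesis .
qed

lemma ar_mem [ar_intros]: "B \<in> R ==> nt R t ==> ar R (%e. t e \<in> B)"
 by (rule ar_term1[OF ar_mem_var])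

lemma ar_less [ar_intros]: "nt R t ==> nt R u ==> ar R (%e. t e < u e)"
 using ar_term2[of R "(<)" t u] ar_less_var by simp

lemma ar_eq [ar_intros]: "nt R t ==> nt R u ==> ar R (%e. t e = u e)"
 using ar_term2[of R "(=)" t u] ar_eq_var by simp

lemma ar_le [ar_intros]: "nt R t ==> nt R u ==> ar R (%e. t e \<le> u e)"
 using ar_not[OF ar_less[of R u t]] by (simp only: not_less)

lemma nt_enc [ar_intros]:
 assumes "nt R t" "nt R u" shows "nt R (%e. enc (t e) (u e))"
proof -
 have "ar R (%e. e (Suc (Suc 0)) = enc (e (Suc 0)) (e 0))" by (rule ar_enc_var)
 from ar_term[of R "%y e. e (Suc 0) = enc (e 0) y", OF this nt_ren[OF assms(2), of "%i. Suc (Suc i)"]]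
 have "ar R (%e. e (Suc 0) = enc (e 0) (u (%i. e (Suc (Suc i)))))" .
 from ar_term[of R "%x e. e 0 = enc x (u (%i. e (Suc i)))", OF this nt_shift[OF assms(1)]]
 show ?thesis unfolding nt_def .
qed

lemma eq_enc: "k = enc m n <-> dfst k = m & dsnd k = n"
proof -
 have "k = enc m n <-> prod_decode k = (m, n)" by (metis prod_decode_inverse prod_encode_inverse)
 then show ?thesis by (auto simp: prod_eq_iff)
qed

lemma nt_dfst [ar_intros]:
 assumes "nt R t" shows "nt R (%e. dfst (t e))"
proof -
 have "ar R (%e. EX n. t (%i. e (Suc i)) = enc (e 0) n)" by (intro ar_intros nt_ren[OF assms])
 moreover have "(EX n. k = enc a n) <-> a = dfst k" for k a by (auto simp: eq_enc)
 ultimately show ?thesis unfolding nt_def by (simp only:)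
qed

lemma nt_dsnd [ar_intros]:
 assumes "nt R t" shows "nt R (%e. dsnd (t e))"
proof -
 have "ar R (%e. EX n. t (%i. e (Suc i)) = enc n (e 0))" by (intro ar_intros nt_ren[OF assms])
 moreover have "(EX n. k = enc n a) <-> a = dsnd k" for k a by (auto simp: eq_enc)
 ultimately show ?thesis unfolding nt_def by (simp only:)
qed

lemma ar_card [ar_intros]:
 assumes "nt R t" "nt R u" "ar R (%e. Q (e 0) (%i. e (Suc i)))"
 shows "ar R (%e. t e = card {y. y < u e & Q y e})"
proof -
 have "ar R (%e. Q (e 0) (%i. e (Suc (Suc (Suc i)))))"
  using ar_ren[OF assms(3), of "case_nat 0 (%i. Suc (Suc (Suc i)))"] by simp
 from ar_card'[OF this, of "Suc 0" 0]
 have "ar R (%e. e (Suc 0) = card {y. y < e 0 & Q y (%i. e (Suc (Suc i)))})" by simp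
 from ar_term[of R "%x e. e 0 = card {y. y < x & Q y (%i. e (Suc i))}", OF this nt_shift[OF assms(2)]]
 have "ar R (%e. e 0 = card {y. y < u (%i. e (Suc i)) & Q y (%i. e (Suc i))})" .
 from ar_term[of R "%x e. x = card {y. y < u e & Q y e}", OF this assms(1)] show ?thesis .
qed

text \<open>Closure under arithmetic comprehension. It is used for two families: all sets of
  numbers, and the reals of a model.\<close>

definition closed_ar :: "nat set set => bool" where
 "closed_ar R <-> (ALL P e. ar R P --> {n. P (case_nat n e)} \<in> R)"

lemma closed_arD: "closed_ar R ==> ar R (%e. P (e 0)) ==> {n. P n} \<in> R"
 unfolding closed_ar_def by (drule spec, drule spec[of _ "%_. 0"]) fastforce

lemma closed_ar_UNIV: "closed_ar UNIV"
 by (simp add: closed_ar_def)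

definition graph :: "(nat => nat) => nat set" where
 "graph f = {x. f (dfst x) = dsnd x}"

lemma enc_graph [simp]: "enc m n \<in> graph f <-> f m = n"
 by (simp add: graph_def)

lemma graph_inj: "graph f = graph g ==> f = g"
 by (metis enc_graph ext)

lemma nt_fun:
 assumes "graph f \<in> R" "nt R t" shows "nt R (%e. f (t e))"
proof -
 have "ar R (%e. enc (t (%i. e (Suc i))) (e 0) \<in> graph f)" by (intro ar_intros nt_ren[OF assms(2)] assms(1))
 then show ?thesis unfolding nt_def by (simp add: eq_commute)
qed

lemma graphI: "closed_ar R ==> nt R (%e. f (e 0)) ==> graph f \<in> R"
proof -
 assume R: "closed_ar R" and f: "nt R (%e. f (e 0))"
 have "ar R (%e. e 0 = f (e (Suc 0)))" using f by (simp add: nt_def)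
 from ar_term2[OF this, of "%e. dsnd (e 0)" "%e. dfst (e 0)"]
 have "ar R (%e. dsnd (e 0) = f (dfst (e 0)))" by (simp add: ar_intros)
 then show ?thesis unfolding graph_def using closed_arD[OF R] by (simp add: eq_commute)
qed

lemma closed_ops:
 assumes "closed_ar R" "B \<in> R"
 shows closed_compl: "- B \<in> R" and closed_inter: "C \<in> R ==> B \<inter> C \<in> R"
  and closed_diff: "C \<in> R ==> B - C \<in> R" and closed_vimage: "graph f \<in> R ==> f -` B \<in> R"
proof -
 have "{n. n \<notin> B} \<in> R" by (rule closed_arD[OF assms(1)]) (intro ar_intros assms)
 then show "- B \<in> R" by (simp add: Compl_eq)
 assume C: "C \<in> R"
 have "{n. n \<in> B & n \<in> C} \<in> R" by (rule closed_arD[OF assms(1)]) (intro ar_intros assms C)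
 then show "B \<inter> C \<in> R" by (simp add: Int_def)
 have "{n. n \<in> B & n \<notin> C} \<in> R" by (rule closed_arD[OF assms(1)]) (intro ar_intros assms C)
 then show "B - C \<in> R" by (simp add: set_diff_eq)
next
 assume f: "graph f \<in> R"
 have "{n. f n \<in> B} \<in> R" by (rule closed_arD[OF assms(1)]) (intro ar_intros nt_fun[OF f] assms)
 then show "f -` B \<in> R" by (simp add: vimage_def)
qed

section \<open>The ideal on numbers and ultrafilters relative to a family\<close>

definition sec :: "nat set => nat => nat set" where
 "sec C n = {k. enc n k \<in> C}"

lemma in_sec [simp]: "k \<in> sec C n <-> enc n k \<in> C"
 by (simp add: sec_def)

text \<open>The ideal \<open>Fin2\<close> transported to the numbers by the pairing
  function.\<close>

definition Fin2n :: "nat set set" where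
 "Fin2n = {B. finite {n. infinite (sec B n)}}"

lemma sec_Int: "sec (B \<inter> C) n = sec B n \<inter> sec C n" and sec_Un: "sec (B \<union> C) n = sec B n \<union> sec C n"
 and sec_mono: "B \<subseteq> C ==> sec B n \<subseteq> sec C n"
 by auto

lemma Fin2n_mono:
 assumes "C \<in> Fin2n" "B \<subseteq> C" shows "B \<in> Fin2n"
proof -
 have "{n. infinite (sec B n)} \<subseteq> {n. infinite (sec C n)}"
  using finite_subset[OF sec_mono[OF assms(2)]] by blast
 then show ?thesis using assms(1) unfolding Fin2n_def by (auto intro: finite_subset)
qed

lemma Fin2n_Un:
 assumes "B \<in> Fin2n" "C \<in> Fin2n" shows "B \<union> C \<in> Fin2n"
proof -
 have "{n. infinite (sec (B \<union> C) n)} \<subseteq> {n. infinite (sec B n)} \<union> {n. infinite (sec C n)}"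
  by (auto simp: sec_Un)
 then show ?thesis using assms unfolding Fin2n_def by (auto intro: finite_subset)
qed

lemma sec_finite: "finite B ==> finite (sec B n)"
proof (erule finite_surj[of B _ dsnd], rule subsetI)
 fix k assume "k \<in> sec B n"
 then have "enc n k \<in> B" "k = dsnd (enc n k)" by auto
 then show "k \<in> dsnd ` B" by (rule rev_image_eqI)
qed

lemma Fin2n_finite: "finite B ==> B \<in> Fin2n"
 unfolding Fin2n_def by (simp add: sec_finite)

lemma UNIV_Fin2n: "UNIV \<notin> Fin2n"
 unfolding Fin2n_def by (simp add: sec_def)

definition UF :: "nat set set => nat set set => bool" where
 "UF R U <-> U \<subseteq> R & {} \<notin> U & (ALL A:U. ALL B:R. A \<subseteq> B --> B \<in> U) &
  (ALL A:U. ALL B:U. A \<inter> B \<in> U) & (ALL A:R. A \<in> U \<or> - A \<in> U) & (ALL A:R. finite (- A) --> A \<in> U)"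

lemma UF_D:
 assumes "UF R U"
 shows "U \<subseteq> R" "{} \<notin> U" "A \<in> U ==> B \<in> R ==> A \<subseteq> B ==> B \<in> U" "A \<in> U ==> B \<in> U ==> A \<inter> B \<in> U"
  "A \<in> R ==> A \<in> U \<or> - A \<in> U" "A \<in> R ==> finite (- A) ==> A \<in> U"
proof -
 have 1: "U \<subseteq> R" and 2: "{} \<notin> U" and 3: "ALL A:U. ALL B:R. A \<subseteq> B --> B \<in> U" and 4: "ALL A:U. ALL B:U. A \<inter> B \<in> U"
  and 5: "ALL A:R. A \<in> U \<or> - A \<in> U" and 6: "ALL A:R. finite (- A) --> A \<in> U"
  using assms unfolding UF_def by auto
 show "U \<subseteq> R" "{} \<notin> U" by (fact 1) (fact 2)
 show "A \<in> U ==> B \<in> R ==> A \<subseteq> B ==> B \<in> U" using 3 by blast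
 show "A \<in> U ==> B \<in> U ==> A \<inter> B \<in> U" using 4 by blast
 show "A \<in> R ==> A \<in> U \<or> - A \<in> U" using 5 by blast
 show "A \<in> R ==> finite (- A) ==> A \<in> U" using 6 by blast
qed

definition redU :: "nat set set => reduction => nat set set => nat set set => bool" where
 "redU R r I U <-> (EX f. graph f \<in> R & admissible r f & (ALL B:I\<inter>R. - (f -` B) \<in> U))"

text \<open>The P-point condition relative to \<open>R\<close>: a countable family is presented by
  the sections of a single real.\<close>

definition PU :: "nat set set => nat set set => bool" where
 "PU R U <-> (ALL C:R. (ALL n. - sec C n \<in> U) --> (EX B:U. ALL n. finite (sec C n \<inter> B)))"

definition redF :: "nat set set => reduction => nat set set => bool" where
 "redF R r I <-> (EX f. graph f \<in> R & admissible r f & (ALL B:I\<inter>R. f -` B \<in> Fin2n))"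

lemma closed_sec: "closed_ar R ==> C \<in> R ==> sec C n \<in> R"
 unfolding sec_def by (rule closed_arD, assumption) (intro ar_intros)

lemma admissible_comp:
 assumes "admissible r (f :: nat => nat)" "inj g" shows "admissible r (%x. f (g x))"
proof (cases r)
 case Katetov_Blass
 have "(%x. f (g x)) -` {x} = g -` (f -` {x})" for x by auto
 then show ?thesis using assms Katetov_Blass by (simp add: finite_vimageI)
next
 case One_to_One
 then show ?thesis using assms by (auto simp: inj_def)
qed simp

text \<open>If \<open>C\<close> lists sets of the dual ideal without a pseudo-complement in \<open>U\<close>, then sending \<open>k\<close> to
 \<open>(m k, k)\<close>, where \<open>m k\<close> is the index of the first set containing \<open>k\<close>, reduces \<open>Fin\<^sup>2\<close>.\<close>

lemma redF_imp_redU: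
 assumes R: "closed_ar R" and U: "UF R U" and P: "~ PU R U" and F: "redF R r I"
 shows "redU R r I U"
proof -
 obtain C where C: "C \<in> R" "ALL n. - sec C n \<in> U" "ALL B:U. EX n. infinite (sec C n \<inter> B)"
  using P unfolding PU_def by auto
 obtain f where f: "graph f \<in> R" "admissible r f" "ALL B:I\<inter>R. f -` B \<in> Fin2n"
  using F unfolding redF_def by auto
 have Uint: "A \<in> U ==> B \<in> U ==> A \<inter> B \<in> U" and Usup: "A \<in> U ==> B \<in> R ==> A \<subseteq> B ==> B \<in> U"
  and Udec: "A \<in> R ==> A \<in> U \<or> - A \<in> U" and Ucof: "A \<in> R ==> finite (- A) ==> A \<in> U"
  and UR: "U \<subseteq> R" for A B
  using UF_D[OF U] by auto
 \<comment> \<open>The value 0 is reserved for points in no section, so the index of the first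
   section is shifted by one.\<close>
 define m where "m k = (if EX n. enc n k \<in> C then Suc (LEAST n. enc n k \<in> C) else 0)" for k
 have m0: "m k = 0 <-> (ALL n. enc n k \<notin> C)" for k unfolding m_def by auto
 have mS: "m k = Suc n <-> enc n k \<in> C & (ALL i<n. enc i k \<notin> C)" for k n
 proof
  assume *: "m k = Suc n"
  then have ex: "EX n. enc n k \<in> C" unfolding m_def by (auto split: if_splits)
  have "n = (LEAST n. enc n k \<in> C)" using * ex unfolding m_def by simp
  then show "enc n k \<in> C & (ALL i<n. enc i k \<notin> C)"
   using LeastI_ex[OF ex] not_less_Least[of _ "%n. enc n k \<in> C"] by blast
 next
  assume n: "enc n k \<in> C & (ALL i<n. enc i k \<notin> C)"
  have "(LEAST n. enc n k \<in> C) = n" by (rule Least_equality) (use n not_less in blast)+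
  then show "m k = Suc n" unfolding m_def using n by auto
 qed
 have mnt: "nt R (%e. m (e 0))"
 proof -
  \<comment> \<open>The successor is not among the primitives of \<open>ar\<close> and is defined
    from the order.\<close>
  have "nt R Suc'" if "Suc' = (%e. Suc (e 0))" for Suc'
  proof -
   have "ar R (%e. e (Suc 0) < e 0 & (ALL k. e (Suc 0) < k --> e 0 \<le> k))" by (intro ar_intros)
   moreover have "(e (Suc 0) < e 0 & (ALL k. e (Suc 0) < k --> e 0 \<le> k)) = (e 0 = Suc (e (Suc 0)))" for e :: "nat => nat"
    by (auto simp: Suc_le_eq dest: spec[of _ "Suc (e (Suc 0))"])
   ultimately show ?thesis unfolding nt_def that by simp
  qed
  then have S: "nt R (%e. Suc (e 0))" by blast
  have "ar R (%e. e 0 = Suc (e (Suc 0)))" using S by (simp add: nt_def)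
  from ar_term2[OF this] have S': "ar R (%e. t e = Suc (u e))" if "nt R t" "nt R u" for t u using that by blast
  have "ar R (%e. e 0 = 0 & (ALL n. enc n (e (Suc 0)) \<notin> C) \<or>
    (EX n. e 0 = Suc n & enc n (e (Suc 0)) \<in> C & (ALL i. i < n --> enc i (e (Suc 0)) \<notin> C)))"
   by (intro ar_intros S' C(1))
  moreover have "(e 0 = 0 & (ALL n. enc n (e (Suc 0)) \<notin> C) \<or>
    (EX n. e 0 = Suc n & enc n (e (Suc 0)) \<in> C & (ALL i. i < n --> enc i (e (Suc 0)) \<notin> C))) = (e 0 = m (e (Suc 0)))"
   for e :: "nat => nat"
   using m0[of "e (Suc 0)"] mS[of "e (Suc 0)"] by (cases "m (e (Suc 0))") metis+
  ultimately show ?thesis unfolding nt_def by simp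
 qed
 then have mg: "graph m \<in> R" by (rule graphI[OF R])
 define g where "g k = f (enc (m k) k)" for k
 have g: "graph g \<in> R" unfolding g_def by (rule graphI[OF R]) (intro ar_intros nt_fun[OF f(1)] nt_fun[OF mg])
 have "inj (%k. enc (m k) k)" by (auto simp: inj_def)
 then have ga: "admissible r g" unfolding g_def using admissible_comp[OF f(2)] by blast
 have "- (g -` B) \<in> U" if B: "B \<in> I \<inter> R" for B
 proof -
  let ?X = "f -` B" and ?Y = "g -` B"
  have X: "?X \<in> R" "?Y \<in> R" using closed_vimage[OF R _] B f g by auto
  have "?X \<in> Fin2n" using f B by blast
  then have "finite {n. infinite (sec ?X n)}" unfolding Fin2n_def by blast
  then obtain n0 where "ALL n:{n. infinite (sec ?X n)}. n < n0" using finite_nat_set_iff_bounded by blast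
  then have n0: "finite (sec ?X n)" if "n0 \<le> n" for n using that leD by blast
  \<comment> \<open>\<open>?Z\<close> meets each section of \<open>C\<close> in a finite set,
    because only finitely many columns of \<open>?X\<close> from \<open>n0\<close> on are involved
    there. A member of \<open>U\<close> has an infinite intersection with some section, so
    \<open>?Z\<close> is not in \<open>U\<close>.\<close>
  let ?Z = "{k. k \<in> ?Y & n0 \<le> m k}"
  have Z: "?Z \<in> R" by (rule closed_arD[OF R]) (intro ar_intros nt_fun[OF mg] X)
  have "?Z \<notin> U"
  proof
   assume "?Z \<in> U"
   then obtain n where n: "infinite (sec C n \<inter> ?Z)" using C by blast
   have "sec C n \<inter> ?Z \<subseteq> (\<Union>j\<in>{n0..Suc n}. sec ?X j)"
   proof
    fix k assume k: "k \<in> sec C n \<inter> ?Z"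
    then have "EX n. enc n k \<in> C" "(LEAST n. enc n k \<in> C) \<le> n" by (auto intro: Least_le)
    then have "m k \<le> Suc n" unfolding m_def by simp
    then show "k \<in> (\<Union>j\<in>{n0..Suc n}. sec ?X j)" using k by (auto simp: g_def)
   qed
   moreover have "finite (\<Union>j\<in>{n0..Suc n}. sec ?X j)" using n0 by auto
   ultimately show False using n finite_subset by blast
  qed
  then have Z': "- ?Z \<in> U" using Udec Z by blast
  \<comment> \<open>No fibre of \<open>m\<close> is in \<open>U\<close>: fibre \<open>Suc n\<close>
    lies inside section \<open>n\<close>, and fibre 0 misses every section.\<close>
  have "{k. m k ~= j} \<in> U" for j
  proof (cases j)
   case 0
   have W: "{k. m k = 0} \<in> R" by (rule closed_arD[OF R]) (intro ar_intros nt_fun[OF mg])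
   moreover have "{k. m k = 0} \<notin> U"
   proof
    assume "{k. m k = 0} \<in> U"
    then obtain n where "infinite (sec C n \<inter> {k. m k = 0})" using C by blast
    moreover have "sec C n \<inter> {k. m k = 0} = {}" using m0 by auto
    ultimately show False by simp
   qed
   ultimately have "- {k. m k = 0} \<in> U" using Udec by blast
   then show ?thesis using 0 by (simp add: Compl_eq)
  next
   case (Suc n)
   have "{k. m k ~= j} \<in> R" by (rule closed_arD[OF R]) (intro ar_intros nt_fun[OF mg])
   moreover have "- sec C n \<subseteq> {k. m k ~= j}" using mS Suc by auto
   ultimately show ?thesis using Usup C(2) by blast
  qed
  note mj = this
  have "{k. n \<le> m k} \<in> U" for n
  proof (induction n)
   case 0
   have "{k. 0 \<le> m k} \<in> R" by (rule closed_arD[OF R]) (intro ar_intros nt_fun[OF mg])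
   then show ?case using Ucof by simp
  next
   case (Suc n)
   have "{k. n \<le> m k} \<inter> {k. m k ~= n} = {k. Suc n \<le> m k}" by auto
   then show ?case using Uint[OF Suc mj[of n]] by simp
  qed
  then have "- ?Z \<inter> {k. n0 \<le> m k} \<in> U" using Uint Z' by blast
  moreover have "- ?Z \<inter> {k. n0 \<le> m k} \<subseteq> - ?Y" by auto
  ultimately show ?thesis using Usup closed_compl[OF R X(2)] by blast
 qed
 then show ?thesis unfolding redU_def using g ga by blast
qed

subsection \<open>The step of the construction\<close>

text \<open>One stage of the tower. The real \<open>y\<close> does double duty, as a set to be
  decided and, when it is a graph, as a function to be killed; \<open>Pr\<close> is the family of
  earlier tower elements.\<close>

definition Phi :: "nat set set => reduction => nat set set => nat set => nat set => nat set set => bool" where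
 "Phi R r I A y Pr <-> A \<in> R & A \<notin> Fin2n & (ALL Z:Pr. A - Z \<in> Fin2n) & (A \<subseteq> y \<or> A \<inter> y = {}) &
   (ALL f. graph f = y --> admissible r f --> (EX B:I\<inter>R. A \<subseteq> f -` B))"

lemma ar_infinite [ar_intros]:
 assumes "ar R (%e. Q (e 0) (%i. e (Suc i)))" shows "ar R (%e. infinite {n. Q n e})"
proof -
 have "ar R (%e. Q (e 0) (%i. e (Suc (Suc i))))"
  using ar_ren[OF assms, of "case_nat 0 (%i. Suc (Suc i))"] by simp
 then have "ar R (%e. ALL m. EX n. m < n & Q n e)" by (intro ar_intros)
 then show ?thesis unfolding infinite_nat_iff_unbounded by simp
qed

text \<open>Describes the increasing enumeration by counting and hence arithmetically.\<close>

lemma eq_enumerate_iff: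
 fixes S :: "nat set"
 assumes "infinite S" shows "z = enumerate S n <-> z \<in> S & n = card {y. y < z & y \<in> S}"
proof -
 have c: "card {y. y < enumerate S n & y \<in> S} = n" for n
 proof -
  have "{y. y < enumerate S n & y \<in> S} = enumerate S ` {..<n}"
  proof (intro set_eqI iffI)
   fix y assume "y \<in> {y. y < enumerate S n & y \<in> S}"
   moreover then obtain k where "y = enumerate S k" using range_enumerate[OF assms] by blast
   ultimately show "y \<in> enumerate S ` {..<n}" using enumerate_mono_iff[OF assms] by simp
  qed (use assms in \<open>auto simp: enumerate_in_set\<close>)
  then show ?thesis using inj_enumerate[OF assms] by (simp add: card_image inj_on_subset)
 qed
 show ?thesis
 proof
  assume "z = enumerate S n"
  then show "z \<in> S & n = card {y. y < z & y \<in> S}" using c assms by (simp add: enumerate_in_set)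
 next
  assume z: "z \<in> S & n = card {y. y < z & y \<in> S}"
  then obtain k where "z = enumerate S k" using range_enumerate[OF assms] by blast
  then show "z = enumerate S n" using z c[of k] by simp
 qed
qed

text \<open>A positive set contains a copy of the whole square: enumerate its infinite columns, and
  then each of them. Composition with this injection turns a reduction on \<open>A\<close> into a
  reduction on everything and keeps admissibility.\<close>

lemma redF_restrict:
 assumes R: "closed_ar R" and A: "A \<in> R" "A \<notin> Fin2n" and f: "graph f \<in> R" "admissible r f"
  and B: "!!B. B \<in> I ==> B \<in> R ==> f -` B \<inter> A \<in> Fin2n"
 shows "redF R r I"
proof -
 let ?K = "{k. infinite {j. enc k j \<in> A}}"
 have secA: "sec A k = {j. enc k j \<in> A}" for k by auto
 have K: "infinite ?K" using A(2) unfolding Fin2n_def by (simp add: secA)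
 have KR: "?K \<in> R" by (rule closed_arD[OF R]) (intro ar_intros A)
 define c where "c = enumerate ?K"
 have c: "infinite (sec A (c n))" for n
  using enumerate_in_set[OF K, of n] unfolding c_def secA by simp
 have cinj: "inj c" unfolding c_def by (rule inj_enumerate[OF K])
 define h where "h x = enc (c (dfst x)) (enumerate (sec A (c (dfst x))) (dsnd x))" for x
 have hA: "h x \<in> A" for x
  using enumerate_in_set[OF c, of "dfst x" "dsnd x"] unfolding h_def by simp
 have hinj: "inj h"
 proof (rule injI)
  fix x y assume "h x = h y"
  then have 1: "dfst x = dfst y" using cinj unfolding h_def by (simp add: inj_eq)
  then have "dsnd x = dsnd y" using \<open>h x = h y\<close> inj_enumerate[OF c] unfolding h_def by (simp add: inj_eq)
  with 1 show "x = y" by (metis prod.collapse prod_decode_inverse)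
 qed
 have hg: "graph h \<in> R"
 proof (rule graphI[OF R])
  have "ar R (%e. dfst (e 0) \<in> ?K & dfst (e (Suc 0)) = card {y. y < dfst (e 0) & y \<in> ?K} &
    enc (dfst (e 0)) (dsnd (e 0)) \<in> A & dsnd (e (Suc 0)) = card {y. y < dsnd (e 0) & enc (dfst (e 0)) y \<in> A})"
   by (intro ar_intros A KR)
  moreover have "(dfst z \<in> ?K & dfst x = card {y. y < dfst z & y \<in> ?K} &
    enc (dfst z) (dsnd z) \<in> A & dsnd x = card {y. y < dsnd z & enc (dfst z) y \<in> A}) = (z = h x)" for z x
  proof -
   have "z = h x <-> dfst z = c (dfst x) & dsnd z = enumerate (sec A (dfst z)) (dsnd x)"
    unfolding h_def eq_enc by auto
   also have "\<dots> <-> (dfst z \<in> ?K & dfst x = card {y. y < dfst z & y \<in> ?K}) & dsnd z = enumerate (sec A (dfst z)) (dsnd x)"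
    unfolding c_def eq_enumerate_iff[OF K] by blast
   also have "\<dots> <-> (dfst z \<in> ?K & dfst x = card {y. y < dfst z & y \<in> ?K}) &
     dsnd z \<in> sec A (dfst z) & dsnd x = card {y. y < dsnd z & y \<in> sec A (dfst z)}"
    using eq_enumerate_iff[of "sec A (dfst z)" "dsnd z" "dsnd x"] unfolding secA by blast
   finally show ?thesis by auto
  qed
  ultimately show "nt R (%e. h (e 0))" unfolding nt_def by simp
 qed
 have "(%x. f (h x)) -` B \<in> Fin2n" if "B \<in> I \<inter> R" for B
 proof -
  let ?X = "f -` B \<inter> A"
  have X: "finite {k. infinite (sec ?X k)}" using assms(6)[of B] that unfolding Fin2n_def by blast
  have "{n. infinite (sec ((%x. f (h x)) -` B) n)} \<subseteq> c -` {k. infinite (sec ?X k)}"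
  proof
   fix n assume n: "n \<in> {n. infinite (sec ((%x. f (h x)) -` B) n)}"
   have "enumerate (sec A (c n)) ` sec ((%x. f (h x)) -` B) n \<subseteq> sec ?X (c n)"
   proof
    fix j assume "j \<in> enumerate (sec A (c n)) ` sec ((%x. f (h x)) -` B) n"
    then obtain i where i: "j = enumerate (sec A (c n)) i" "f (h (enc n i)) \<in> B" by auto
    moreover have "h (enc n i) = enc (c n) j" unfolding h_def using i by simp
    ultimately show "j \<in> sec ?X (c n)" using hA[of "enc n i"] by simp
   qed
   moreover have "infinite (enumerate (sec A (c n)) ` sec ((%x. f (h x)) -` B) n)"
    using n inj_enumerate[OF c, of n] by (simp add: finite_image_iff inj_on_subset)
   ultimately show "n \<in> c -` {k. infinite (sec ?X k)}" using finite_subset by blast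
  qed
  moreover have "finite (c -` {k. infinite (sec ?X k)})" using X cinj by (rule finite_vimageI)
  ultimately show ?thesis unfolding Fin2n_def using finite_subset by blast
 qed
 moreover have "graph (%x. f (h x)) \<in> R" by (rule graphI[OF R]) (intro ar_intros nt_fun[OF f(1)] nt_fun[OF hg])
 ultimately show ?thesis unfolding redF_def using admissible_comp[OF f(2) hinj] by blast
qed

text \<open>Column \<open>k\<close> of the pseudo-intersection is column \<open>k\<close> of \<open>D\<^sub>n\<close>, the intersection of the first
 sets, for the largest \<open>n \<le> k\<close> that makes it infinite; every \<open>n\<close> is used for one column only.\<close>

lemma pseudo_intersection:
 assumes R: "closed_ar R" and C: "C \<in> R"
  and pos: "!!n. {x. ALL i<=n. enc i x \<in> C} \<notin> Fin2n"
 obtains A where "A \<in> R" "A \<notin> Fin2n" "!!i. A - sec C i \<in> Fin2n"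
proof -
 define Dn where "Dn n = {x. ALL i. i \<le> n --> enc i x \<in> C}" for n
 define inf' where "inf' n k <-> infinite {j. ALL i. i \<le> n --> enc i (enc k j) \<in> C}" for n k
 have inf': "inf' n k <-> infinite (sec (Dn n) k)" for n k unfolding inf'_def Dn_def sec_def by simp
 define gd where "gd n k <-> n \<le> k & inf' n k & (ALL n'. n' \<le> k & inf' n' k --> n' \<le> n)" for n k
 \<comment> \<open>A single column for each \<open>n\<close> leaves only finitely many columns of
   \<open>A\<close> with points outside section \<open>i\<close>, namely those belonging to some
   \<open>n < i\<close>.\<close>
 define us where "us n k <-> gd n k & (ALL k'. k' < k --> ~ gd n k')" for n k
 define A where "A = {x. EX n. us n (dfst x) & (ALL i. i \<le> n --> enc i x \<in> C)}"
 have arinf: "ar R (%e. inf' (t e) (u e))" if "nt R t" "nt R u" for t u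
  by (rule ar_term2[OF _ that]) (unfold inf'_def, intro ar_intros C)
 have argd: "ar R (%e. gd (t e) (u e))" if "nt R t" "nt R u" for t u
  by (rule ar_term2[OF _ that]) (unfold gd_def, intro ar_intros arinf C)
 have arus: "ar R (%e. us (t e) (u e))" if "nt R t" "nt R u" for t u
  by (rule ar_term2[OF _ that]) (unfold us_def, intro ar_intros argd C)
 have AR: "A \<in> R" unfolding A_def by (rule closed_arD[OF R]) (intro ar_intros arus C)
 have gdu: "gd n k ==> gd n' k ==> n = n'" for n n' k unfolding gd_def by (meson le_antisym)
 have usu: "us n k ==> us n k' ==> k = k'" for n k k' unfolding us_def by (meson linorder_neqE_nat)
 have Anti: "n \<le> n' ==> inf' n' k ==> inf' n k" for n n' k
  unfolding inf'_def by (erule contrapos_nn, rule finite_subset[rotated]) auto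
 have ex: "EX n k. N \<le> n & us n k" for N
 proof -
  have "infinite {k. inf' N k}"
  proof -
   have "Dn N \<notin> Fin2n" using pos[of N] unfolding Dn_def by simp
   then show ?thesis unfolding Fin2n_def inf' by simp
  qed
  then obtain k where k: "N \<le> k" "inf' N k" unfolding infinite_nat_iff_unbounded_le by blast
  \<comment> \<open>The bound by \<open>k\<close> in \<open>gd\<close> makes this maximum exist even
    if column \<open>k\<close> is infinite at every stage.\<close>
  let ?n = "Max {n. n \<le> k & inf' n k}"
  have fin: "finite {n. n \<le> k & inf' n k}" by simp
  have "?n \<in> {n. n \<le> k & inf' n k}" by (rule Max_in[OF fin]) (use k in blast)
  moreover have "n' \<le> ?n" if "n' \<le> k" "inf' n' k" for n' by (rule Max_ge[OF fin]) (use that in blast)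
  ultimately have g: "gd ?n k" "N \<le> ?n" unfolding gd_def using k by auto
  have "us ?n (LEAST k. gd ?n k)"
   unfolding us_def using LeastI[of "gd ?n", OF g(1)] not_less_Least[of _ "gd ?n"] by blast
  then show ?thesis using g by blast
 qed
 have secA: "sec A k = sec (Dn n) k" if "us n k" for n k
 proof -
  have "us n' k ==> n' = n" for n' using gdu that unfolding us_def by blast
  then have "(EX n'. us n' k & P n') <-> P n" for P using that by blast
  then show ?thesis unfolding A_def Dn_def sec_def by simp
 qed
 have "infinite {k. infinite (sec A k)}"
 proof
  assume fin: "finite {k. infinite (sec A k)}"
  have sub: "{n. EX k. us n k} \<subseteq> (%k. THE n. gd n k) ` {k. infinite (sec A k)}"
  proof
   fix n assume "n \<in> {n. EX k. us n k}"
   then obtain k where k: "us n k" by blast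
   then have "gd n k" "infinite (sec (Dn n) k)" unfolding us_def gd_def inf' by auto
   moreover then have "(THE n. gd n k) = n" using gdu by blast
   ultimately show "n \<in> (%k. THE n. gd n k) ` {k. infinite (sec A k)}" using secA[OF k] by force
  qed
  have "infinite {n. EX k. us n k}" unfolding infinite_nat_iff_unbounded_le using ex by blast
  then show False using sub fin by (meson finite_imageI finite_subset)
 qed
 then have pA: "A \<notin> Fin2n" unfolding Fin2n_def by simp
 have "A - sec C i \<in> Fin2n" for i
 proof -
  have "{k. infinite (sec (A - sec C i) k)} \<subseteq> (%n. THE k. us n k) ` {..<i}"
  proof
   fix k assume "k \<in> {k. infinite (sec (A - sec C i) k)}"
   then have "sec (A - sec C i) k ~= {}" using infinite_imp_nonempty by blast
   then obtain j where j: "enc k j \<in> A" "enc i (enc k j) \<notin> C" by auto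
   then obtain n where n: "us n k" "!!i. i \<le> n ==> enc i (enc k j) \<in> C" unfolding A_def by auto
   then have "n < i" using j(2) not_less by blast
   moreover have "(THE k. us n k) = k" using n usu by blast
   ultimately show "k \<in> (%n. THE k. us n k) ` {..<i}" by force
  qed
  then show ?thesis unfolding Fin2n_def using finite_subset by blast
 qed
 with AR pA show thesis by (rule that)
qed

text \<open>Take a pseudo-intersection, cut it by \<open>y\<close> or its complement, and, if
  \<open>y\<close> is an admissible graph, by the preimage of a member of \<open>I\<close> that
  leaves a positive set. If no such member existed, \<open>redF_restrict\<close> would yield a
  reduction.\<close>

lemma Phi_step:
 assumes R: "closed_ar R" and F: "~ redF R r I" and C: "C \<in> R" and y: "y \<in> R"
  and pos: "!!n. sec C n \<notin> Fin2n"
  and chain: "!!m n. sec C n - sec C m \<in> Fin2n \<or> sec C m - sec C n \<in> Fin2n"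
 shows "EX A. Phi R r I A y (range (sec C))"
proof -
 have pos': "{x. ALL i<=n. enc i x \<in> C} \<notin> Fin2n" for n
 proof -
  \<comment> \<open>Among finitely many members of a chain modulo the ideal there is an almost least
    one; it differs from the intersection by a set in the ideal.\<close>
  have "EX i<=n. ALL j<=n. sec C i - sec C j \<in> Fin2n"
  proof (induction n)
   case 0
   then show ?case by (simp add: Fin2n_finite)
  next
   case (Suc n)
   then obtain i where i: "i \<le> n" "!!j. j \<le> n ==> sec C i - sec C j \<in> Fin2n" by blast
   show ?case
   proof (cases "sec C i - sec C (Suc n) \<in> Fin2n")
    case True
    then show ?thesis using i by (intro exI[of _ i]) (auto simp: le_Suc_eq)
   next
    case False
    then have *: "sec C (Suc n) - sec C i \<in> Fin2n" using chain by blast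
    have "sec C (Suc n) - sec C j \<in> Fin2n" if "j \<le> n" for j
     by (rule Fin2n_mono[OF Fin2n_Un[OF * i(2)[OF that]]]) auto
    then show ?thesis by (intro exI[of _ "Suc n"]) (auto simp: le_Suc_eq Fin2n_finite)
   qed
  qed
  then obtain i where i: "i \<le> n" "!!j. j \<le> n ==> sec C i - sec C j \<in> Fin2n" by blast
  have "(\<Union>j\<in>J. sec C i - sec C j) \<in> Fin2n" if "finite J" "J \<subseteq> {..n}" for J
   using that
  proof (induction J rule: finite_induct)
   case (insert j J)
   then show ?case using Fin2n_Un[OF i(2)[of j]] by simp
  qed (simp add: Fin2n_finite)
  from this[of "{..n}"] have "(\<Union>j\<in>{..n}. sec C i - sec C j) \<in> Fin2n" by simp
  moreover have "sec C i \<subseteq> (\<Union>j\<in>{..n}. sec C i - sec C j) \<union> {x. ALL i<=n. enc i x \<in> C}" by auto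
  ultimately show ?thesis using pos[of i] Fin2n_mono Fin2n_Un by blast
 qed
 obtain A where A: "A \<in> R" "A \<notin> Fin2n" "!!i. A - sec C i \<in> Fin2n"
  using pseudo_intersection[OF R C pos'] by blast
 have "A = (A \<inter> y) \<union> (A - y)" by auto
 then have "A \<inter> y \<notin> Fin2n \<or> A - y \<notin> Fin2n" using A(2) Fin2n_Un by metis
 then obtain A1 where A1: "A1 \<in> R" "A1 \<notin> Fin2n" "A1 \<subseteq> A" "A1 \<subseteq> y \<or> A1 \<inter> y = {}"
  using closed_inter[OF R A(1) y] closed_diff[OF R A(1) y] by (metis Diff_disjoint Diff_subset inf_commute inf_le1 inf_le2 Int_Diff Diff_Int_distrib)
 obtain A2 where A2: "A2 \<in> R" "A2 \<notin> Fin2n" "A2 \<subseteq> A1"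
  "!!f. graph f = y ==> admissible r f ==> EX B:I\<inter>R. A2 \<subseteq> f -` B"
 proof (cases "EX f. graph f = y & admissible r f")
  case True
  then obtain f where f: "graph f = y" "admissible r f" by blast
  then obtain B where B: "B \<in> I" "B \<in> R" "f -` B \<inter> A1 \<notin> Fin2n"
   using redF_restrict[OF R A1(1,2), of f r I] F y by blast
  have "f -` B \<inter> A1 \<in> R" using closed_inter[OF R closed_vimage[OF R B(2)] A1(1)] f y by simp
  moreover have "f' = f" if "graph f' = y" for f' using that f graph_inj by metis
  ultimately show thesis using that[of "f -` B \<inter> A1"] B by blast
 next
  case False
  then show thesis using that[of A1] A1 by blast
 qed
 have "A2 - Z \<in> Fin2n" if "Z \<in> range (sec C)" for Z
  using A(3) that A2(3) A1(3) by (auto intro: Fin2n_mono)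
 then have "Phi R r I A2 y (range (sec C))"
  unfolding Phi_def using A1 A2 by blast
 then show ?thesis ..
qed

lemma Phi_antimono: "Phi R r I A y P ==> Q \<subseteq> P ==> Phi R r I A y Q"
 unfolding Phi_def by blast

text \<open>The tower generates a filter because it is a chain, and an ultrafilter because every
  real was decided. All its members are positive, so the columns lie in the dual ideal; a set
  meeting every column in a finite set is not positive, hence the columns witness that this is not a
  P-point.\<close>

lemma tower_ultrafilter:
 assumes R: "closed_ar R"
  and lin: "!!x y. x \<in> R ==> y \<in> R ==> lt x y \<or> x = y \<or> lt y x"
  and A: "!!y. y \<in> R ==> Phi R r I (A y) y (A ` {z \<in> R. lt z y})"
 defines "U \<equiv> {X \<in> R. EX y:R. A y - X \<in> Fin2n}"
 shows "UF R U" "~ redU R r I U" "~ PU R U"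
proof -
 have AR: "A y \<in> R" and pos: "A y \<notin> Fin2n" and dec: "A y \<subseteq> y \<or> A y \<inter> y = {}" if "y \<in> R" for y
  using A[OF that] unfolding Phi_def by blast+
 have chain: "A y - A z \<in> Fin2n \<or> A z - A y \<in> Fin2n" if "y \<in> R" "z \<in> R" for y z
  using lin[OF that] A[OF that(1)] A[OF that(2)] that unfolding Phi_def by (auto simp: Fin2n_finite)
 have UNIVR: "UNIV \<in> R" using closed_arD[OF R ar_true[of R True]] by simp
 have ne: "R ~= {}" using UNIVR by blast
 have neg: "X \<notin> Fin2n" if XU: "X \<in> U" for X
 proof
  assume X: "X \<in> Fin2n"
  obtain y where "y \<in> R" "A y - X \<in> Fin2n" using XU unfolding U_def by blast
  then have "(A y - X) \<union> X \<in> Fin2n" using X Fin2n_Un by blast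
  then have "A y \<in> Fin2n" by (rule Fin2n_mono) auto
  then show False using pos[OF \<open>y \<in> R\<close>] by blast
 qed
 have inter: "X \<inter> Y \<in> U" if XY: "X \<in> U" "Y \<in> U" for X Y
 proof -
  obtain y z where y: "y \<in> R" "A y - X \<in> Fin2n" and z: "z \<in> R" "A z - Y \<in> Fin2n"
   using XY unfolding U_def by blast
  have XYR: "X \<inter> Y \<in> R" using closed_inter[OF R] XY unfolding U_def by blast
  show ?thesis
   using chain[OF y(1) z(1)]
  proof
   assume *: "A y - A z \<in> Fin2n"
   have "A y - X \<inter> Y \<in> Fin2n"
    by (rule Fin2n_mono[OF Fin2n_Un[OF y(2) Fin2n_Un[OF * z(2)]]]) auto
   then show ?thesis unfolding U_def using XYR y by blast
  next
   assume *: "A z - A y \<in> Fin2n"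
   have "A z - X \<inter> Y \<in> Fin2n"
    by (rule Fin2n_mono[OF Fin2n_Un[OF z(2) Fin2n_Un[OF * y(2)]]]) auto
   then show ?thesis unfolding U_def using XYR z by blast
  qed
 qed
 have co: "- X \<in> U" if "X \<in> R" "X \<in> Fin2n" for X
 proof -
  have "A UNIV - (- X) \<in> Fin2n" using that(2) by (rule Fin2n_mono) auto
  then show ?thesis unfolding U_def using closed_compl[OF R that(1)] UNIVR by blast
 qed
 show UF: "UF R U"
  unfolding UF_def
 proof (intro conjI ballI impI)
  show "{} \<notin> U" using neg Fin2n_finite by blast
  show "B \<in> U" if AU: "A' \<in> U" and B: "B \<in> R" "A' \<subseteq> B" for A' B
  proof -
   obtain y where y: "y \<in> R" "A y - A' \<in> Fin2n" using AU unfolding U_def by blast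
   have "A y - B \<in> Fin2n" by (rule Fin2n_mono[OF y(2)]) (use B in auto)
   then show ?thesis unfolding U_def using B y by blast
  qed
  show "X \<in> U \<or> - X \<in> U" if "X \<in> R" for X
  proof -
   have "A X - X \<in> Fin2n \<or> A X - - X \<in> Fin2n" using dec[OF that]
   proof
    assume "A X \<subseteq> X" then have "A X - X = {}" by auto
    then have "A X - X \<in> Fin2n" by (simp only: Fin2n_finite finite.emptyI)
    then show ?thesis ..
   next
    assume "A X \<inter> X = {}" then have "A X - - X = {}" by auto
    then have "A X - - X \<in> Fin2n" by (simp only: Fin2n_finite finite.emptyI)
    then show ?thesis ..
   qed
   then show ?thesis unfolding U_def using that closed_compl[OF R that] by blast
  qed
  show "X \<in> U" if "X \<in> R" "finite (- X)" for X
   using co[of "- X"] closed_compl[OF R that(1)] that Fin2n_finite by simp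
 qed (use inter U_def in auto)
 show "~ redU R r I U"
 proof
  assume "redU R r I U"
  then obtain f where f: "graph f \<in> R" "admissible r f" "!!B. B \<in> I \<inter> R ==> - (f -` B) \<in> U"
   unfolding redU_def by blast
  obtain B where B: "B \<in> I \<inter> R" "A (graph f) \<subseteq> f -` B"
   using A[OF f(1)] f(2) unfolding Phi_def by blast
  then have "A (graph f) - f -` B = {}" by auto
  then have "A (graph f) - f -` B \<in> Fin2n" by (simp only: Fin2n_finite finite.emptyI)
  then have "f -` B \<in> U"
   unfolding U_def using f(1) closed_vimage[OF R _ f(1), of B] B by blast
  then have "{} \<in> U" using inter[of "f -` B" "- (f -` B)"] f(3)[OF B(1)] by simp
  then show False using neg Fin2n_finite by blast
 qed
 show "~ PU R U"
 proof
  assume PU: "PU R U"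
  let ?C = "{x. dfst (dsnd x) = dfst x}"
  have CR: "?C \<in> R" by (rule closed_arD[OF R]) (intro ar_intros)
  have sC: "sec ?C n = {x. dfst x = n}" for n by auto
  have "sec ?C n \<in> Fin2n" for n
  proof -
   have "{k. infinite (sec (sec ?C n) k)} \<subseteq> {n}"
    unfolding sC sec_def by (auto intro: ccontr)
   then show ?thesis unfolding Fin2n_def using finite_subset by blast
  qed
  then have "- sec ?C n \<in> U" for n using co closed_sec[OF R CR] by blast
  then obtain B where B: "B \<in> U" "!!n. finite (sec ?C n \<inter> B)" using PU CR unfolding PU_def by blast
  have "finite (sec B n)" for n
  proof -
   have "enc n ` sec B n \<subseteq> sec ?C n \<inter> B" by auto
   then have "finite (enc n ` sec B n)" using B(2) finite_subset by blast
   then show ?thesis by (rule finite_imageD) (auto simp: inj_on_def)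
  qed
  then have "B \<in> Fin2n" unfolding Fin2n_def by simp
  then show False using neg B by blast
 qed
qed

text \<open>The earlier elements must be listed by one real of \<open>R\<close> before the step
  applies. This is where countability of initial segments enters.\<close>

lemma tower_step:
 assumes R: "closed_ar R" and F: "~ redF R r I" and y: "y \<in> R"
  and lin: "!!x y. x \<in> R ==> y \<in> R ==> lt x y \<or> x = y \<or> lt y x"
  and IH: "!!z. z \<in> R ==> lt z y ==> Phi R r I (A z) z (A ` {w \<in> R. lt w z})"
  and C: "{z \<in> R. lt z y} = {} \<or> (EX C:R. range (sec C) = A ` {z \<in> R. lt z y})"
 shows "EX a. Phi R r I a y (A ` {z \<in> R. lt z y})"
proof (cases "{z \<in> R. lt z y} = {}")
 case True
 have U: "UNIV \<in> R" using closed_arD[OF R ar_true[of R True]] by simp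
 have s: "sec UNIV n = UNIV" for n by auto
 have "EX A. Phi R r I A y (range (sec UNIV))"
  by (rule Phi_step[OF R F U y]) (simp_all add: s UNIV_Fin2n Fin2n_finite)
 then show ?thesis unfolding True image_empty using Phi_antimono[OF _ empty_subsetI] by blast
next
 case False
 then obtain C where C: "C \<in> R" "range (sec C) = A ` {z \<in> R. lt z y}" using C by blast
 have rep: "EX z:R. lt z y & sec C n = A z" for n
 proof -
  have "sec C n \<in> A ` {z \<in> R. lt z y}" using C(2) by blast
  then show ?thesis by blast
 qed
 have "EX a. Phi R r I a y (range (sec C))"
 proof (rule Phi_step[OF R F C(1) y])
  show "sec C n \<notin> Fin2n" for n
   using rep[of n] IH unfolding Phi_def by metis
  show "sec C n - sec C m \<in> Fin2n \<or> sec C m - sec C n \<in> Fin2n" for m n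
  proof -
   obtain z w where z: "z \<in> R" "lt z y" "sec C n = A z" and w: "w \<in> R" "lt w y" "sec C m = A w"
    using rep[of n] rep[of m] by blast
   from IH[OF z(1,2)] have Z: "ALL x:R. lt x z --> A z - A x \<in> Fin2n" unfolding Phi_def by blast
   from IH[OF w(1,2)] have W: "ALL x:R. lt x w --> A w - A x \<in> Fin2n" unfolding Phi_def by blast
   consider "lt z w" | "z = w" | "lt w z" using lin[OF z(1) w(1)] by blast
   then show ?thesis
   proof cases
    case 2
    then show ?thesis using z w by (simp add: Fin2n_finite)
   qed (use Z W z w in auto)
  qed
 qed
 then show ?thesis using C(2) by simp
qed

subsection \<open>The ambient universe\<close>

lemma dual_iff: "X \<in> dual U <-> - X \<in> U"
 unfolding dual_def by (metis double_complement image_iff)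

lemma ultrafilter_iff: "ultrafilter U <-> UF UNIV U"
 unfolding ultrafilter_def UF_def by auto

lemma reduces_dual_iff: "reduces r I (dual U) <-> redU UNIV r I U"
 unfolding reduces_def redU_def dual_iff by auto

lemma P_point_iff: "P_point U <-> UF UNIV U & PU UNIV U"
proof -
 have "(ALL \<A>. \<A> \<subseteq> dual U --> countable \<A> --> (EX B:U. ALL A:\<A>. finite (A \<inter> B))) <-> PU UNIV U" if U: "UF UNIV U"
 proof
  assume L: "ALL \<A>. \<A> \<subseteq> dual U --> countable \<A> --> (EX B:U. ALL A:\<A>. finite (A \<inter> B))"
  show "PU UNIV U"
   unfolding PU_def
  proof (intro ballI impI)
   fix C assume "ALL n. - sec C n \<in> U"
   then have "range (sec C) \<subseteq> dual U" by (auto simp: dual_iff)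
   moreover have "countable (range (sec C))" by simp
   ultimately have "EX B:U. ALL A:range (sec C). finite (A \<inter> B)" using L by blast
   then show "EX B:U. ALL n. finite (sec C n \<inter> B)" by simp
  qed
 next
  assume P: "PU UNIV U"
  show "ALL \<A>. \<A> \<subseteq> dual U --> countable \<A> --> (EX B:U. ALL A:\<A>. finite (A \<inter> B))"
  proof (intro allI impI)
   fix \<A> assume A: "\<A> \<subseteq> dual U" "countable \<A>"
   show "EX B:U. ALL A:\<A>. finite (A \<inter> B)"
   proof (cases "\<A> = {}")
    case True
    then show ?thesis using UF_D(6)[OF U, of UNIV] by auto
   next
    case False
    let ?C = "{x. dsnd x \<in> from_nat_into \<A> (dfst x)}"
    have s: "sec ?C n = from_nat_into \<A> n" for n by auto
    have "- sec ?C n \<in> U" for n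
     unfolding s using from_nat_into[OF False] A(1) by (auto simp: dual_iff[symmetric])
    then obtain B where B: "B \<in> U" "!!n. finite (sec ?C n \<inter> B)" using P unfolding PU_def by blast
    have "finite (A \<inter> B)" if AA: "A \<in> \<A>" for A
    proof -
     obtain n where "A = from_nat_into \<A> n" using from_nat_into_surj[OF A(2) AA] by blast
     then show ?thesis using B(2)[of n] s by simp
    qed
    then show ?thesis using B by blast
   qed
  qed
 qed
 then show ?thesis unfolding P_point_def ultrafilter_iff by blast
qed

lemma ex_ultra_not_P_iff:
 "ex_ultra_not_P r I <-> (EX U. UF UNIV U & ~ redU UNIV r I U & ~ PU UNIV U)"
 unfolding ex_ultra_not_P_def I_ultra_def ultrafilter_iff P_point_iff reduces_dual_iff by blast

lemma reduces_Fin2_iff: "reduces r I Fin2 <-> redF UNIV r I"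
proof -
 have F: "f -` B \<in> Fin2 <-> (%x. f (prod_decode x)) -` B \<in> Fin2n" for f :: "nat \<times> nat => nat" and B
 proof -
  have "sec ((%x. f (prod_decode x)) -` B) n = {k. (n, k) \<in> f -` B}" for n by auto
  then show ?thesis unfolding Fin2_def Fin2n_def by simp
 qed
 have dec: "inj prod_decode" "inj prod_encode" by (simp_all add: inj_prod_decode inj_prod_encode)
 have adm: "admissible r f <-> admissible r (%x. f (prod_decode x))" for f :: "nat \<times> nat => nat"
 proof (cases r)
  case Katetov_Blass
  have "(%x. f (prod_decode x)) -` {x} = prod_encode ` (f -` {x})" for x
   by (force simp: image_iff intro: prod_decode_inverse[symmetric])
  then show ?thesis using Katetov_Blass dec by (simp add: finite_image_iff inj_on_subset)
 next
  case One_to_One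
  have "inj f" if "inj (%x. f (prod_decode x))"
  proof (rule injI)
   fix p q assume "f p = f q"
   then have "prod_encode p = prod_encode q" using injD[OF that, of "prod_encode p" "prod_encode q"] by simp
   then show "p = q" by simp
  qed
  moreover have "inj (%x. f (prod_decode x))" if "inj f"
   using inj_compose[OF that dec(1)] by (simp add: comp_def)
  ultimately show ?thesis using One_to_One by auto
 qed simp
 show ?thesis
 proof
  assume "reduces r I Fin2"
  then obtain f :: "nat \<times> nat => nat" where "admissible r f" "ALL B:I. f -` B \<in> Fin2"
   unfolding reduces_def by blast
  then show "redF UNIV r I" unfolding redF_def using F adm by (intro exI[of _ "%x. f (prod_decode x)"]) simp
 next
  assume "redF UNIV r I"
  then obtain f where f: "admissible r f" "ALL B:I. f -` B \<in> Fin2n" unfolding redF_def by auto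
  define f' where "f' p = f (prod_encode p)" for p
  have "(%x. f' (prod_decode x)) = f" by (auto simp: f'_def)
  then show "reduces r I Fin2" unfolding reduces_def using f F[of f'] adm[of f'] by auto
 qed
qed

text \<open>If some initial segment of a well-order is uncountable, the first such segment has
  countable initial segments. By CH it is as large as the whole, and the order is pulled back along
  a bijection.\<close>

lemma CH_well_order:
 assumes CH
 obtains lt :: "nat set => nat set => bool" where "wf {(x, y). lt x y}" "!!x y. lt x y \<or> x = y \<or> lt y x"
  "!!y. countable {x. lt x y}"
proof -
 obtain r :: "nat set rel" where r: "Well_order r" "Field r = UNIV"
  using well_ordering[where 'a = "nat set"] by (elim exE conjE) (rule that)
 let ?s = "%x y. (x, y) \<in> r & x ~= y"
 have wf: "wf (r - Id)" and tot: "!!x y. x ~= y ==> (x, y) \<in> r \<or> (y, x) \<in> r"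
  using r unfolding well_order_on_def linear_order_on_def total_on_def by auto
 show thesis
 proof (cases "ALL y. countable {x. ?s x y}")
  case True
  have "{(x, y). ?s x y} = r - Id" by auto
  then show ?thesis using that[of ?s] wf tot True by auto
 next
  case False
  then obtain y0 where y0: "y0 \<in> {y. uncountable {x. ?s x y}}" by auto
  obtain y where y': "y \<in> {y. uncountable {x. ?s x y}}"
   "!!z. (z, y) \<in> r - Id ==> z \<notin> {y. uncountable {x. ?s x y}}"
   by (rule wfE_min[OF wf y0]) (rule that)
  have y: "uncountable {x. ?s x y}" "!!z. (z, y) \<in> r - Id ==> countable {x. ?s x z}"
   using y' by auto
  have "{x. ?s x y} \<approx> (UNIV :: nat set set)"
  proof -
   obtain g :: "nat set => real" where g: "bij g"
    using nat_sets_eqpoll_reals unfolding eqpoll_def by blast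
   have inj: "inj_on g {x. ?s x y}" using g by (meson bij_is_inj inj_on_subset subset_UNIV)
   have "uncountable (g ` {x. ?s x y})" using y(1) countable_image_inj_eq[OF inj] by blast
   then have "g ` {x. ?s x y} \<approx> (UNIV :: real set)" using assms unfolding CH_def by blast
   moreover have "{x. ?s x y} \<approx> g ` {x. ?s x y}" using inj eqpoll_sym inj_on_image_eqpoll_self by blast
   ultimately have "{x. ?s x y} \<approx> (UNIV :: real set)" by (meson eqpoll_trans)
   then show ?thesis by (rule eqpoll_trans[OF _ eqpoll_sym[OF nat_sets_eqpoll_reals]])
  qed
  then obtain g where g: "bij_betw g (UNIV :: nat set set) {x. ?s x y}"
   using eqpoll_sym[of "{x. ?s x y}"] unfolding eqpoll_def by auto
  then have gi: "inj g" and gr: "range g = {x. ?s x y}" by (auto simp: bij_betw_def)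
  have gs: "?s (g x) y" for x using gr by blast
  show thesis
  proof (rule that[of "%x z. ?s (g x) (g z)"])
   have "{(x, z). ?s (g x) (g z)} = inv_image (r - Id) g" by (auto simp: inv_image_def)
   then show "wf {(x, z). ?s (g x) (g z)}" using wf by simp
   show "?s (g x) (g z) \<or> x = z \<or> ?s (g z) (g x)" for x z
    using tot[of "g x" "g z"] gi by (auto simp: inj_eq)
   show "countable {x. ?s (g x) (g z)}" for z
   proof -
    have "countable {x. ?s x (g z)}" using y(2) gs by blast
    then have "countable (g ` {x. ?s (g x) (g z)})" by (rule countable_subset[rotated]) auto
    then show ?thesis by (rule countable_image_inj_on) (rule inj_on_subset[OF gi subset_UNIV])
   qed
  qed
 qed
qed

theorem CH_redF_iff:
 assumes CH shows "~ redF UNIV r I <-> ex_ultra_not_P r I"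
proof
 assume "ex_ultra_not_P r I"
 then show "~ redF UNIV r I"
  unfolding ex_ultra_not_P_iff using redF_imp_redU[OF closed_ar_UNIV] by blast
next
 assume F: "~ redF UNIV r I"
 obtain lt :: "nat set => nat set => bool"
  where wf: "wf {(x, y). lt x y}" and lin: "!!x y. lt x y \<or> x = y \<or> lt y x" and cnt: "!!y. countable {x. lt x y}"
  using CH_well_order[OF assms] by blast
 define A where "A = wfrec {(x, y). lt x y} (%f y. SOME a. Phi UNIV r I a y (f ` {z. lt z y}))"
 have A: "A y = (SOME a. Phi UNIV r I a y (A ` {z. lt z y}))" for y
 proof -
  have "cut A {(x, y). lt x y} y ` {z. lt z y} = A ` {z. lt z y}" by (auto simp: cut_apply)
  then show ?thesis using wfrec[OF wf, of "%f y. SOME a. Phi UNIV r I a y (f ` {z. lt z y})" y]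
   unfolding A_def by simp
 qed
 have "Phi UNIV r I (A y) y (A ` {z. lt z y})" for y
  using wf
 proof (induction y rule: wf_induct_rule)
  case (less y)
  have "{z. lt z y} = {} \<or> (EX C. range (sec C) = A ` {z. lt z y})"
  proof (cases "{z. lt z y} = {}")
   case False
   let ?P = "A ` {z. lt z y}"
   have P: "?P ~= {}" "countable ?P" using False cnt by auto
   have "sec {x. dsnd x \<in> from_nat_into ?P (dfst x)} = from_nat_into ?P" by (auto simp: sec_def)
   then have "range (sec {x. dsnd x \<in> from_nat_into ?P (dfst x)}) = ?P" using range_from_nat_into[OF P] by simp
   then show ?thesis by blast
  qed simp
  then have "EX a. Phi UNIV r I a y (A ` {z \<in> UNIV. lt z y})"
   by (intro tower_step closed_ar_UNIV F) (use lin less in auto)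
  then have "EX a. Phi UNIV r I a y (A ` {z. lt z y})" by simp
  then have "Phi UNIV r I (SOME a. Phi UNIV r I a y (A ` {z. lt z y})) y (A ` {z. lt z y})"
   by (rule someI_ex)
  then show ?case by (subst A)
 qed
 then show "ex_ultra_not_P r I"
  unfolding ex_ultra_not_P_iff using tower_ultrafilter[OF closed_ar_UNIV, of lt r I A] lin by auto
qed

section \<open>Ordinals and satisfaction inside a standard model\<close>

text \<open>An upper bound for the relevant variables. Keeping the bound of the body under
  \<open>All\<close> is generous by one and saves a subtraction.\<close>

primrec fvb :: "fm => nat" where
 "fvb (Mem i j) = Suc (max i j)"
| "fvb (Eq i j) = Suc (max i j)"
| "fvb (Nand p q) = max (fvb p) (fvb q)"
| "fvb (All p) = fvb p"

lemma sat_fvb: "(!!i. i < fvb p ==> e i = e' i) ==> sat D E p e = sat D E p e'"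
proof (induction p arbitrary: e e')
 case (Nand p q)
 have "sat D E p e = sat D E p e'" "sat D E q e = sat D E q e'"
  by (rule Nand.IH, rule Nand.prems, simp)+
 then show ?case by simp
next
 case (All p)
 have "sat D E p (case_nat x e) = sat D E p (case_nat x e')" for x
  by (rule All.IH) (use All.prems in \<open>auto split: nat.splits\<close>)
 then show ?case by simp
qed auto

context set_structure
begin

lemma dfn_sat_rel:
 assumes "dtm A u" "!!i. dtm A (t i)"
 shows "dfn A (%e. sat (ext (u e)) (\<epsilon>) p (%i. t i e))"
 using assms
proof (induction p arbitrary: u t)
 case (Nand p q)
 then show ?case unfolding sat.simps by (intro dfn_nand) auto
next
 case (All p)
 let ?t = "%i. case i of 0 => (%e. e 0) | Suc i => (%e. t i (%i. e (Suc i)))"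
 have "dtm A (?t i)" for i
  by (cases i) (auto intro: dtm_var dtm_shift All.prems)
 from All.IH[OF dtm_shift[OF All.prems(1)] this]
 have "dfn A (%e. sat (ext (u (%i. e (Suc i)))) (\<epsilon>) p (%i. ?t i e))" .
 moreover have "(%i. ?t i e) = case_nat (e 0) (%i. t i (%i. e (Suc i)))" for e
  by (auto split: nat.splits)
 ultimately show ?case unfolding sat.simps by (intro dfn_ball_ext All.prems(1)) simp
qed (auto intro: dfn_mem dfn_eq)

text \<open>The version for classes that need not be sets, such as the constructible universe; it
  holds formula by formula.\<close>

lemma dfn_sat_class:
 assumes "C \<subseteq> D" "dfn A (%e. e 0 \<in> C)" "!!i. dtm A (t i)"
 shows "dfn A (%e. sat C (\<epsilon>) p (%i. t i e))"
 using assms(3)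
proof (induction p arbitrary: t)
 case (Nand p q)
 then show ?case unfolding sat.simps by (intro dfn_nand) auto
next
 case (All p)
 let ?t = "%i. case i of 0 => (%e. e 0) | Suc i => (%e. t i (%i. e (Suc i)))"
 have "dtm A (?t i)" for i
  by (cases i) (auto intro: dtm_var dtm_shift All.prems)
 from All.IH[OF this] have *: "dfn A (%e. sat C (\<epsilon>) p (%i. ?t i e))" .
 have e: "(%i. ?t i e) = case_nat (e 0) (%i. t i (%i. e (Suc i)))" for e
  by (auto split: nat.splits)
 have "dfn A (%e. ALL x:D. x \<in> C --> sat C (\<epsilon>) p (case_nat x (%i. t i e)))"
  by (intro dfn_all dfn_imp assms(2) *[unfolded e])
 then show ?case by (rule dfn_cong) (use assms(1) in auto)
qed (auto intro: dfn_mem dfn_eq)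

lemma dfn_support:
 assumes "dfn A P"
 obtains k where "!!e e'. env e ==> env e' ==> (!!i. i < k ==> e i = e' i) ==> P e = P e'"
proof -
 obtain p s where p: "!!e. env e ==> P e = sat D (\<epsilon>) p (%i. case_sum e id (s i))"
  by (rule dfnE[OF assms]) (rule that)
 define J where "J = {j. EX i<fvb p. s i = Inl j}"
 have "J \<subseteq> (%i. projl (s i)) ` {..<fvb p}" unfolding J_def by force
 then have "finite J" using finite_subset by blast
 then obtain l where l: "!!j. j \<in> J ==> j < l" using finite_nat_set_iff_bounded by auto
 have "P e = P e'" if e: "env e" "env e'" and eq: "!!i. i < l ==> e i = e' i" for e e'
 proof -
  have "case_sum e id (s i) = case_sum e' id (s i)" if "i < fvb p" for i
   using eq l that unfolding J_def by (auto split: sum.splits)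
  then have "sat D (\<epsilon>) p (%i. case_sum e id (s i)) = sat D (\<epsilon>) p (%i. case_sum e' id (s i))"
   by (rule sat_fvb)
  then show ?thesis using p e by simp
 qed
 then show thesis by (rule that)
qed

text \<open>The Tarski--Vaught criterion, extended from elements to assignments.\<close>

lemma select_env:
 assumes X: "X \<subseteq> D" "X \<inter> K ~= {}" and K: "K \<subseteq> D" "dfn X (%e. e 0 \<in> K)"
  and sel: "!!P. dfn X (%e. P (e 0)) ==> EX x:K. P x ==> EX x:X\<inter>K. P x"
  and P: "dfn X P" and ex: "ALL i. e i \<in> K" "P e"
 shows "EX e. (ALL i. e i \<in> X \<inter> K) & P e"
proof -
 have gen: "EX e. (ALL i. e i \<in> X \<inter> K) & P e"
  if "dfn X P" "ALL i. e i \<in> K" "P e"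
   "!!e e'. env e ==> env e' ==> (!!i. i < k ==> e i = e' i) ==> P e = P e'" for k P e
  using that
 proof (induction k arbitrary: P e)
  case 0
  obtain x where x: "x \<in> X \<inter> K" using X by blast
  have "P e = P (%_. x)" by (rule "0.prems"(4)) (use K X x "0.prems"(2) in \<open>auto simp: env_def\<close>)
  then show ?case using "0.prems"(3) x by (intro exI[of _ "%_. x"]) auto
 next
  case (Suc k)
  \<comment> \<open>The first variable is quantified away. The induction finds values in
    \<open>X\<close> for the others, and \<open>sel\<close> then finds the first one with these
    values as parameters.\<close>
  define Q where "Q e = (EX x:D. x \<in> K & P (case_nat x e))" for e
  have e0: "case_nat (e 0) (%i. e (Suc i)) = e" for e :: "nat => 'm" by (auto split: nat.splits)
  have "dfn X (%e. P (case_nat (e 0) (%i. e (Suc i))))" using Suc.prems(1) by (simp only: e0)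
  then have Q: "dfn X Q" unfolding Q_def by (intro dfn_ex dfn_conj K)
  have "EX e. (ALL i. e i \<in> X \<inter> K) & Q e"
  proof (rule Suc.IH[OF Q])
   show "ALL i. e (Suc i) \<in> K" using Suc.prems(2) by blast
   show "Q (%i. e (Suc i))" unfolding Q_def
    using Suc.prems(2,3) K(1) by (intro bexI[of _ "e 0"]) (auto simp only: e0)
   fix e e' assume e: "env e" "env e'" "!!i. i < k ==> e i = e' i"
   have "P (case_nat x e) = P (case_nat x e')" if "x \<in> D" for x
    by (rule Suc.prems(4)) (use e that in \<open>auto split: nat.splits\<close>)
   then show "Q e = Q e'" unfolding Q_def by auto
  qed
  then obtain e' where e': "!!i. e' i \<in> X \<inter> K" "Q e'" by blast
  have "dfn X (%e. P (case_nat (e 0) e'))"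
  proof -
   have "dtm X (%e. case_nat (e 0) e' i)" for i
    using e' K by (cases i) (auto intro!: dtm_var dtm_const)
   from dfn_subst'[OF Suc.prems(1), of "%i e. case_nat (e 0) e' i", OF this]
   show ?thesis .
  qed
  moreover have "EX x:K. P (case_nat x e')" using e'(2) unfolding Q_def by blast
  ultimately obtain x where x: "x \<in> X \<inter> K" "P (case_nat x e')"
   using sel[of "%x. P (case_nat x e')"] by blast
  show ?case
   by (rule exI[of _ "case_nat x e'"]) (use x e'(1) in \<open>auto split: nat.splits\<close>)
 qed
 obtain k where k: "!!e e'. env e ==> env e' ==> (!!i. i < k ==> e i = e' i) ==> P e = P e'"
  using dfn_support[OF P] by blast
 show ?thesis by (rule gen[OF P ex k])
qed

end

lemma sat_iso:
 assumes "inj_on f S" "!!x y. x \<in> S ==> y \<in> S ==> E (f x) (f y) = E x y" "!!i. e i \<in> S"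
 shows "sat (f ` S) E p (%i. f (e i)) = sat S E p e"
 using assms(3)
proof (induction p arbitrary: e)
 case (Eq i j)
 then show ?case using assms(1) by (auto simp: inj_on_eq_iff)
next
 case (All p)
 have "(%i. f (case_nat x e i)) = case_nat (f x) (%i. f (e i))" for x by (auto split: nat.splits)
 moreover have "sat (f ` S) E p (%i. f (case_nat x e i)) = sat S E p (case_nat x e)" if "x \<in> S" for x
  by (rule All.IH) (use that All.prems in \<open>auto split: nat.splits\<close>)
 ultimately show ?case by simp
qed (use assms(2) in auto)

text \<open>Every number codes a formula and subcodes are smaller, so satisfaction can be defined
  inside the model by iterating over the codes.\<close>

function dec :: "nat => fm" where
 "dec 0 = Eq 0 0"
| "dec (Suc m) = (if dfst m = 0 then Mem (dfst (dsnd m)) (dsnd (dsnd m))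
  else if dfst m = 1 then Eq (dfst (dsnd m)) (dsnd (dsnd m))
  else if dfst m = 2 then Nand (dec (dfst (dsnd m))) (dec (dsnd (dsnd m)))
  else All (dec (dfst (dsnd m))))"
 by pat_completeness auto

lemma dfst_le: "dfst m \<le> m" and dsnd_le: "dsnd m \<le> m"
 using le_prod_encode_1[of "dfst m" "dsnd m"] le_prod_encode_2[of "dsnd m" "dfst m"] by auto

termination dec
 by (relation less_than) (use dfst_le dsnd_le in \<open>auto simp: less_Suc_eq_le intro: le_trans\<close>)

lemma dec_surj: "EX n. dec n = p"
proof (induction p)
 case (Mem i j)
 show ?case by (rule exI[of _ "Suc (enc 0 (enc i j))"]) simp
next
 case (Eq i j)
 show ?case by (rule exI[of _ "Suc (enc 1 (enc i j))"]) simp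
next
 case (Nand p q)
 then obtain m n where "dec m = p" "dec n = q" by blast
 then show ?case by (intro exI[of _ "Suc (enc 2 (enc m n))"]) simp
next
 case (All p)
 then obtain m where "dec m = p" by blast
 then show ?case by (intro exI[of _ "Suc (enc 3 (enc m 0))"]) simp
qed

context zfm
begin

section \<open>Definite descriptions and ordinals\<close>

definition thex :: "('m => bool) => 'm" where
 "thex P = (if EX! y. y \<in> D & P y then THE y. y \<in> D & P y else mk {})"

lemma thex_eq: "P y ==> y \<in> D ==> (!!z. z \<in> D ==> P z ==> z = y) ==> thex P = y"
 unfolding thex_def by (subst if_P) blast+

lemma thex_D [simp, intro]: "thex P \<in> D"
proof (cases "EX! y. y \<in> D & P y")
 case True
 from theI'[OF this] show ?thesis unfolding thex_def using True by simp
next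
 case False
 then show ?thesis unfolding thex_def by (subst if_not_P) auto
qed

lemma dtm_thex [dfn_intros]:
 assumes "dfn A (%e. Q (e 0) (%i. e (Suc i)))" shows "dtm A (%e. thex (%y. Q y e))"
proof -
 let ?U = "%e. EX y:D. Q y e & (ALL z:D. Q z e --> z = y)"
 have Q2: "dfn A (%e. Q (e i) (%i. e (Suc (f i))))" for i f
  using dfn_term_ren[OF assms dtm_var, of i "%i. Suc (f i)"] by simp
 have "dfn A (%e. if ?U (%i. e (Suc i)) then Q (e 0) (%i. e (Suc i)) else e 0 = mk {})"
  by (intro dfn_intros Q2)
 then have "dfn A (%e. e 0 = thex (%y. Q y (%i. e (Suc i))))"
 proof (rule dfn_cong)
  fix e' assume e': "env e'"
  let ?e = "%i. e' (Suc i)"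
  show "(if ?U ?e then Q (e' 0) ?e else e' 0 = mk {}) = (e' 0 = thex (%y. Q y ?e))"
  proof (cases "?U ?e")
   case True
   then obtain y where y: "y \<in> D" "Q y ?e" "!!z. z \<in> D ==> Q z ?e ==> z = y" by blast
   have "thex (%y. Q y ?e) = y" by (rule thex_eq[of "%y. Q y ?e", OF y(2,1)]) (rule y(3))
   moreover have "Q (e' 0) ?e <-> e' 0 = y" using y e' by blast
   ultimately show ?thesis by (simp only: if_P[OF True])
  next
   case False
   then have "~ (EX! y. y \<in> D & Q y ?e)" by blast
   then have "thex (%y. Q y ?e) = mk {}" unfolding thex_def by simp
   then show ?thesis using False by (simp only: if_not_P if_False)
  qed
 qed
 then show ?thesis by (simp add: dtm_def)
qed

lemma transitive_set_iff: "transitive_set a <-> (ALL x:ext a. ext x \<subseteq> ext a)"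
 unfolding transitive_set_def sub_iff by auto

lemma ordinal_iff: "ordinal a <-> (ALL x:ext a. ext x \<subseteq> ext a) & (ALL x:ext a. ALL y:ext x. ext y \<subseteq> ext x)"
proof -
 have "(ALL x:D. x \<epsilon> a --> transitive_set x) <-> (ALL x:ext a. transitive_set x)" by auto
 then show ?thesis unfolding ordinal_def by (simp only: transitive_set_iff)
qed

lemma dfn_ordinal [dfn_intros]:
 assumes "dtm A t" shows "dfn A (%e. ordinal (t e))"
 by (rule dfn1[OF _ assms]) (unfold ordinal_iff, intro dfn_intros)

lemma ordinal_trans: "ordinal a ==> x \<in> ext a ==> y \<in> ext x ==> y \<in> ext a"
 unfolding ordinal_iff by blast

lemma ordinal_mem:
 assumes "ordinal a" "x \<in> ext a" shows "ordinal x"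
proof -
 have "ALL y:ext x. ext y \<subseteq> ext x" using assms unfolding ordinal_iff by blast
 moreover have "ALL y:ext x. ALL z:ext y. ext z \<subseteq> ext y" using assms unfolding ordinal_iff by blast
 ultimately show ?thesis unfolding ordinal_iff by blast
qed

text \<open>Double induction: if \<open>a\<close> and \<open>b\<close> were incomparable, every
  member of each would lie in the other, so they would have the same extension.\<close>

lemma ordinal_linear:
 assumes "a \<in> D" "b \<in> D" "ordinal a" "ordinal b"
 shows "a \<epsilon> b \<or> a = b \<or> b \<epsilon> a"
 using assms
proof (induction a arbitrary: b rule: mem_induct)
 case (mem a)
 have outer: "x \<epsilon> c \<or> x = c \<or> c \<epsilon> x" if "x \<in> ext a" "c \<in> D" "ordinal c" for x c
  using mem.IH[OF that(1,2)] that mem.prems ordinal_mem by blast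
 show ?case using mem.prems
 proof (induction b rule: mem_induct)
  case (mem b)
  note inner = mem.IH
  show ?case
  proof (rule ccontr)
   assume *: "~ ?thesis"
   have "ext a = ext b"
   proof (intro set_eqI iffI)
    fix x assume x: "x \<in> ext a"
    have "~ b \<epsilon> x" using ordinal_trans[OF _ x, of b] * mem by auto
    moreover have "x ~= b" using * x by auto
    ultimately show "x \<in> ext b" using outer[OF x mem.hyps mem.prems(2)] x by auto
   next
    fix y assume y: "y \<in> ext b"
    have "~ a \<epsilon> y" using ordinal_trans[OF _ y, of a] * mem \<open>a \<in> D\<close> by auto
    moreover have "y ~= a" using * y by auto
    moreover have "a \<epsilon> y \<or> a = y \<or> y \<epsilon> a"
     using inner[OF y] y mem.prems ordinal_mem[OF _ y] by auto
    ultimately show "y \<in> ext a" using y by auto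
   qed
   then have "a = b" using ext_inj[OF \<open>a \<in> D\<close> mem.hyps] by blast
   then show False using * by blast
  qed
 qed
qed

definition On :: "'m set" where "On = {a \<in> D. ordinal a}"

lemma OnI: "a \<in> D ==> ordinal a ==> a \<in> On" and On_ordinal: "a \<in> On ==> ordinal a"
 and OnD [simp]: "a \<in> On ==> a \<in> D"
 by (auto simp: On_def)

lemma dfn_On [dfn_intros]: "dtm A t ==> dfn A (%e. t e \<in> On)"
 unfolding On_def mem_Collect_eq by (intro dfn_intros)

lemma On_mem: "a \<in> On ==> x \<in> ext a ==> x \<in> On"
 by (rule OnI) (auto intro: ordinal_mem[OF On_ordinal[of a]])

lemma On_linear: "a \<in> On ==> b \<in> On ==> a \<epsilon> b \<or> a = b \<or> b \<epsilon> a"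
 by (rule ordinal_linear) (auto intro: On_ordinal)

lemma On_trans: "a \<in> On ==> b \<epsilon> a ==> c \<epsilon> b ==> b \<in> D ==> c \<in> D ==> c \<epsilon> a"
 using ordinal_trans[of a b c] On_ordinal[of a] by simp

lemma On_sub: "a \<in> On ==> b \<in> On ==> ext a \<subseteq> ext b <-> a \<epsilon> b \<or> a = b"
proof
 assume a: "a \<in> On" "b \<in> On" "ext a \<subseteq> ext b"
 have "~ b \<epsilon> a" using a mem_irrefl[of b] OnD[OF a(2)] in_ext[of b a] in_ext[of b b] by blast
 then show "a \<epsilon> b \<or> a = b" using On_linear a by blast
next
 assume "a \<in> On" "b \<in> On" "a \<epsilon> b \<or> a = b"
 then show "ext a \<subseteq> ext b" using ordinal_trans[of b a] On_ordinal[of b] by auto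
qed

lemma transitive_On:
 assumes "a \<in> D" "ext a \<subseteq> On" "!!x. x \<in> ext a ==> ext x \<subseteq> ext a" shows "a \<in> On"
proof -
 have "ALL y:ext x. ext y \<subseteq> ext x" if "x \<in> ext a" for x
  using On_ordinal[of x] that assms(2) unfolding ordinal_iff by blast
 then have "ordinal a" unfolding ordinal_iff using assms(3) by blast
 then show ?thesis by (rule OnI[OF assms(1)])
qed

definition suc :: "'m => 'm" where "suc a = mk (insert a (ext a))"

lemma ext_suc [simp]: "a \<in> D ==> ext (suc a) = insert a (ext a)"
 and suc_D [simp, intro]: "a \<in> D ==> suc a \<in> D"
 unfolding suc_def by auto

lemma dtm_suc [dfn_intros]: "dtm A t ==> dtm A (%e. suc (t e))"
 unfolding suc_def by (intro dfn_intros)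

lemma suc_On [simp, intro]:
 assumes "a \<in> On" shows "suc a \<in> On"
proof (rule transitive_On)
 have a: "a \<in> D" using assms by simp
 show "suc a \<in> D" using a by blast
 show "ext (suc a) \<subseteq> On" unfolding ext_suc[OF a] using assms On_mem[OF assms] by blast
 show "ext x \<subseteq> ext (suc a)" if "x \<in> ext (suc a)" for x
  using that ordinal_trans[OF On_ordinal[OF assms], of x] unfolding ext_suc[OF a] by blast
qed

lemma Union_On: "isset S ==> S \<subseteq> On ==> isset (\<Union>x\<in>S. ext x) & mk (\<Union>x\<in>S. ext x) \<in> On"
proof -
 assume S: "isset S" "S \<subseteq> On"
 have i: "isset (\<Union>x\<in>S. ext x)" using isset_UN[OF S(1), of "%x. x"] dtm_var by simp
 have "mk (\<Union>x\<in>S. ext x) \<in> On"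
 proof (rule transitive_On)
  show "ext (mk (\<Union>x\<in>S. ext x)) \<subseteq> On" unfolding ext_mk[OF i] using S(2) On_mem by blast
  show "ext x \<subseteq> ext (mk (\<Union>x\<in>S. ext x))" if "x \<in> ext (mk (\<Union>x\<in>S. ext x))" for x
  proof -
   have "x \<in> (\<Union>x\<in>S. ext x)" using that unfolding ext_mk[OF i] .
   then obtain a where "a \<in> S" "x \<in> ext a" by blast
   moreover then have "ext x \<subseteq> ext a" using S(2) ordinal_trans[of a x] On_ordinal[of a] by blast
   ultimately show ?thesis unfolding ext_mk[OF i] by blast
  qed
 qed (rule mk_D[OF i])
 with i show ?thesis by blast
qed

lemma nm_On [simp, intro]: "nm n \<in> On"
proof (induction n)
 case 0
 show ?case by (rule transitive_On) auto
next
 case (Suc n)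
 have "nm (Suc n) = suc (nm n)" by (simp add: suc_def)
 then show ?case using Suc by simp
qed

lemma On_least:
 assumes "a \<in> On" "P a" obtains b where "b \<in> On" "P b" "!!c. c \<in> ext b ==> ~ P c"
proof -
 have "a \<in> D" using assms by simp
 then have "EX b:On. P b & (ALL c:ext b. ~ P c)" using assms
 proof (induction a rule: mem_induct)
  case (mem a)
  then show ?case using On_mem by blast
 qed
 then show thesis using that by blast
qed

definition lst :: "('m => bool) => 'm" where
 "lst P = thex (%a. a \<in> On & P a & (ALL b:ext a. ~ P b))"

lemma dtm_lst [dfn_intros]:
 assumes "dfn A (%e. Q (e 0) (%i. e (Suc i)))" shows "dtm A (%e. lst (%y. Q y e))"
proof -
 have Q2: "dfn A (%e. Q (e i) (%i. e (Suc (f i))))" for i f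
  using dfn_term_ren[OF assms dtm_var, of i "%i. Suc (f i)"] by simp
 show ?thesis unfolding lst_def by (intro dfn_intros Q2)
qed

lemma lst:
 assumes "a \<in> On" "P a"
 shows lst_On: "lst P \<in> On" and lst_prop: "P (lst P)" and lst_min: "!!b. b \<in> ext (lst P) ==> ~ P b"
  and lst_le: "ext (lst P) \<subseteq> ext a"
proof -
 obtain b where b: "b \<in> On" "P b" "!!c. c \<in> ext b ==> ~ P c"
  by (rule On_least[of a P, OF assms]) (rule that)
 have "lst P = b"
  unfolding lst_def
 proof (rule thex_eq)
  fix z assume z: "z \<in> D" "z \<in> On & P z & (ALL b:ext z. ~ P b)"
  then have "~ z \<epsilon> b" "~ b \<epsilon> z" using b by auto
  then show "z = b" using On_linear z b by blast
 qed (use b in auto)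
 then show "lst P \<in> On" "P (lst P)" "!!b. b \<in> ext (lst P) ==> ~ P b" using b by auto
 have "~ a \<epsilon> b" using b assms by auto
 then show "ext (lst P) \<subseteq> ext a" using \<open>lst P = b\<close> On_linear[OF assms(1) b(1)] On_sub[OF b(1) assms(1)] by auto
qed

subsection \<open>Satisfaction\<close>

definition ev :: "'m => nat => 'm" where "ev s i = ap s (nm i)"

text \<open>The assignments of the model with values in \<open>X\<close>. They are infinite
  sequences, to match those of \<open>sat\<close>; the bound by the power set of the product makes
  them a set.\<close>

definition asn :: "'m => 'm" where
 "asn X = mk {s \<in> ext (mk {z \<in> D. ext z \<subseteq> ext (prd om X)}). ALL n. ap s (nm n) \<in> ext X}"

lemma dtm_asn [dfn_intros]: "dtm A t ==> dtm A (%e. asn (t e))"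
proof (rule dtm1[rotated], assumption)
 show "dtm A (%e. asn (e 0))" unfolding asn_def by (intro dfn_intros)
qed

lemma ext_asn:
 assumes "X \<in> D" shows "ext (asn X) = {s \<in> D. ext s \<subseteq> ext (prd om X) & (ALL n. ev s n \<in> ext X)}" and "asn X \<in> D"
proof -
 have "env (%_. X)" using assms by (simp add: env_def)
 have "asn X \<in> D" by (rule dtm1_D[OF dtm_asn[OF dtm_var] assms])
 have p: "isset {z \<in> D. ext z \<subseteq> ext (prd om X)}" by (rule isset_pow) (use assms in auto)
 have "isset {s \<in> ext (mk {z \<in> D. ext z \<subseteq> ext (prd om X)}). ALL n. ap s (nm n) \<in> ext X}"
  by (rule isset_sep) (intro dfn_intros assms mk_D p)+
 then show "ext (asn X) = {s \<in> D. ext s \<subseteq> ext (prd om X) & (ALL n. ev s n \<in> ext X)}" and "asn X \<in> D"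
  unfolding asn_def ev_def using p by auto
qed

lemma asn_D [simp, intro]: "X \<in> D ==> asn X \<in> D"
 by (rule ext_asn(2))

lemma lam_asn:
 assumes "X \<in> D" "dtm D (%e. F (e 0))" "!!n. F (nm n) \<in> ext X"
 shows "lam (ext om) F \<in> ext (asn X)" "ev (lam (ext om) F) n = F (nm n)"
proof -
 note l = lam_function_on[OF assms(2) om_D]
 show ev: "ev (lam (ext om) F) n = F (nm n)" for n unfolding ev_def by (rule l(3)) (simp add: ext_om)
 have "ext (lam (ext om) F) \<subseteq> ext (prd om X)"
 proof
  fix p assume "p \<in> ext (lam (ext om) F)"
  then obtain x where x: "x \<in> ext om" "p = op x (F x)" unfolding l(4) by blast
  then have "F x \<in> ext X" using assms(3) unfolding ext_om by blast
  then show "p \<in> ext (prd om X)" unfolding ext_prd[OF om_D assms(1)] using x by blast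
 qed
 then show "lam (ext om) F \<in> ext (asn X)" using l(1) ev assms(3) ext_asn(1)[OF assms(1)] by simp
qed

text \<open>The counterpart of \<open>case_nat\<close> for internal assignments.\<close>

definition cns :: "'m => 'm => 'm" where
 "cns y s = lam (ext om) (%x. if x = nm 0 then y else ap s (nm (nof x - Suc 0)))"

lemma dtm_cns [dfn_intros]: "dtm A t ==> dtm A u ==> dtm A (%e. cns (t e) (u e))"
proof (rule dtm2[rotated], assumption, assumption)
 show "dtm A (%e. cns (e 0) (e (Suc 0)))" unfolding cns_def by (intro dfn_intros)
qed

lemma cns:
 assumes "X \<in> D" "y \<in> ext X" "s \<in> ext (asn X)"
 shows "cns y s \<in> ext (asn X)" "ev (cns y s) = case_nat y (ev s)"
proof -
 let ?F = "%x. if x = nm 0 then y else ap s (nm (nof x - Suc 0))"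
 have y: "y \<in> D" "s \<in> D" using assms by auto
 have F: "dtm D (%e. ?F (e 0))" by (intro dfn_intros y)
 have FX: "?F (nm n) \<in> ext X" for n
  using assms ext_asn(1)[OF assms(1)] by (auto simp: ev_def)
 show "cns y s \<in> ext (asn X)" unfolding cns_def by (rule lam_asn(1)[OF assms(1) F FX])
 have "ev (cns y s) n = ?F (nm n)" for n unfolding cns_def by (rule lam_asn(2)[OF assms(1) F FX])
 then show "ev (cns y s) = case_nat y (ev s)"
  by (auto simp: ev_def fun_eq_iff split: nat.splits simp del: nm.simps)
qed

definition cnst :: "'m => 'm" where "cnst x = lam (ext om) (%_. x)"

lemma dtm_cnst [dfn_intros]: "dtm A t ==> dtm A (%e. cnst (t e))"
proof (rule dtm1[rotated], assumption)
 show "dtm A (%e. cnst (e 0))" unfolding cnst_def by (intro dfn_intros)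
qed

lemma cnst:
 assumes "X \<in> D" "x \<in> ext X" shows "cnst x \<in> ext (asn X)" "ev (cnst x) = (%_. x)"
proof -
 have "dtm D (%e. x)" using assms by (intro dtm_const) auto
 note l = lam_asn[OF assms(1) this assms(2)]
 show "cnst x \<in> ext (asn X)" "ev (cnst x) = (%_. x)" unfolding cnst_def using l by auto
qed

text \<open>An external assignment need not be in the model, but a formula reads only finitely many
  of its values.\<close>

lemma ex_asn:
 assumes "X \<in> D" "!!i. e i \<in> ext X" shows "EX s:ext (asn X). ALL i<k. ev s i = e i"
 using assms(2)
proof (induction k arbitrary: e)
 case 0
 then show ?case using cnst(1)[OF assms(1)] by blast
next
 case (Suc k)
 obtain s where s: "s \<in> ext (asn X)" "ALL i<k. ev s i = e (Suc i)" using Suc.IH[of "%i. e (Suc i)"] Suc.prems by blast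
 note c = cns[OF assms(1) Suc.prems[of 0] s(1)]
 show ?case using c s(2) by (intro bexI[of _ "cns (e 0) s"]) (auto simp: less_Suc_eq_0_disj)
qed

text \<open>Truth of the formula with code \<open>k\<close>, given the set \<open>T\<close> of pairs
  of a smaller code and an assignment satisfying it. The cases mirror the equations of
  \<open>dec\<close>, whose code 0 is a tautology.\<close>

definition sat1 :: "'m => 'm => nat => 'm => bool" where
 "sat1 X T k s <-> (if k = 0 then True else let m = k - Suc 0; a = dfst (dsnd m); b = dsnd (dsnd m) in
   if dfst m = 0 then ap s (nm a) \<epsilon> ap s (nm b)
   else if dfst m = 1 then ap s (nm a) = ap s (nm b)
   else if dfst m = 2 then ~ (op (nm a) s \<epsilon> T & op (nm b) s \<epsilon> T)
   else ALL y:ext X. op (nm a) (cns y s) \<epsilon> T)"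

text \<open>The state consists of the next code and the truth set for all smaller codes.\<close>

definition satstep :: "'m => 'm => 'm" where
 "satstep X p = op (nm (Suc (nof (pfst p)))) (mk (ext (psnd p) \<union>
   ext (mk {q \<in> ext (prd om (asn X)). pfst q = pfst p & sat1 X (psnd p) (nof (pfst p)) (psnd q)})))"

text \<open>After \<open>n\<close> iterations only the codes below \<open>n\<close> have been
  treated, hence \<open>Suc n\<close> of them.\<close>

definition satI :: "'m => nat => 'm => bool" where
 "satI X n s <-> op (nm n) s \<epsilon> psnd (((%p. satstep X p) ^^ Suc n) (op (nm 0) (mk {})))"

lemma dfn_step:
 assumes "dtm A t" "dtm A u" "ntm A n" "dtm A v" shows "dfn A (%e. sat1 (t e) (u e) (n e) (v e))"
proof -
 have "dfn A (%e. sat1 (e 0) (e (Suc 0)) (nof (e (Suc (Suc 0)))) (e (Suc (Suc (Suc 0)))))"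
  unfolding sat1_def Let_def by (intro dfn_intros)
 from dfn4[of A "%x y z w. sat1 x y (nof z) w", OF this assms(1,2) dtm_nm[OF assms(3)] assms(4)]
 show ?thesis by simp
qed

lemma dtm_satstep: "dtm A t ==> dtm A u ==> dtm A (%e. satstep (t e) (u e))"
proof (rule dtm2[rotated], assumption, assumption)
 show "dtm A (%e. satstep (e 0) (e (Suc 0)))" unfolding satstep_def by (intro dfn_intros dfn_step)
qed

lemma dfn_satI [dfn_intros]:
 assumes "dtm A t" "ntm A n" "dtm A u" shows "dfn A (%e. satI (t e) (n e) (u e))"
proof -
 have "dfn A (%e. satI (e 0) (nof (e (Suc 0))) (e (Suc (Suc 0))))"
  unfolding satI_def by (intro dfn_intros dtm_satstep)
 from dfn3[of A "%x y z. satI x (nof y) z", OF this assms(1) dtm_nm[OF assms(2)] assms(3)]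
 show ?thesis by simp
qed

lemma sat1_correct:
 assumes X: "X \<in> D" and s: "s \<in> ext (asn X)"
  and T: "!!i s. i < k ==> s \<in> ext (asn X) ==> op (nm i) s \<epsilon> T <-> sat (ext X) (\<epsilon>) (dec i) (ev s)"
 shows "sat1 X T k s <-> sat (ext X) (\<epsilon>) (dec k) (ev s)"
proof (cases k)
 case 0
 then show ?thesis by (simp add: sat1_def)
next
 case (Suc m)
 let ?a = "dfst (dsnd m)" and ?b = "dsnd (dsnd m)"
 have a: "?a < k" "?b < k"
  using dfst_le[of "dsnd m"] dsnd_le[of "dsnd m"] dsnd_le[of m] Suc by auto
 have "op (nm ?a) (cns y s) \<epsilon> T <-> sat (ext X) (\<epsilon>) (dec ?a) (case_nat y (ev s))" if "y \<in> ext X" for y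
  using T[OF a(1) cns(1)[OF X that s]] cns(2)[OF X that s] by simp
 then show ?thesis unfolding sat1_def Let_def Suc using T[OF a(1) s] T[OF a(2) s]
  by (simp add: ev_def)
qed

lemma satstep_iter:
 assumes X: "X \<in> D"
 shows "EX T. isset T & ((%p. satstep X p) ^^ k) (op (nm 0) (mk {})) = op (nm k) (mk T) &
  T = {op (nm i) s |i s. i < k & s \<in> ext (asn X) & sat (ext X) (\<epsilon>) (dec i) (ev s)}"
proof (induction k)
 case 0
 show ?case by (rule exI[of _ "{}"]) auto
next
 case (Suc k)
 then obtain T where T: "isset T" "((%p. satstep X p) ^^ k) (op (nm 0) (mk {})) = op (nm k) (mk T)"
  "T = {op (nm i) s |i s. i < k & s \<in> ext (asn X) & sat (ext X) (\<epsilon>) (dec i) (ev s)}" by blast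
 let ?N = "{q \<in> ext (prd om (asn X)). pfst q = nm k & sat1 X (mk T) k (psnd q)}"
 have N: "isset ?N" by (rule isset_sep) (intro dfn_intros dfn_step X nm_D mk_D T(1) prd_D om_D asn_D)+
 have TT: "op (nm i) s \<epsilon> mk T <-> sat (ext X) (\<epsilon>) (dec i) (ev s)" if "i < k" "s \<in> ext (asn X)" for i s
 proof -
  have "s \<in> D" using that by simp
  then have "op (nm i) s \<epsilon> mk T <-> op (nm i) s \<in> T" using T(1) by simp
  also have "\<dots> <-> sat (ext X) (\<epsilon>) (dec i) (ev s)"
  proof
   assume "op (nm i) s \<in> T"
   then obtain i' s' where "op (nm i) s = op (nm i') s'" "s' \<in> ext (asn X)" "sat (ext X) (\<epsilon>) (dec i') (ev s')"
    using T(3) by blast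
   then show "sat (ext X) (\<epsilon>) (dec i) (ev s)" using \<open>s \<in> D\<close> by simp
  qed (use T(3) that in blast)
  finally show ?thesis .
 qed
 have s1: "sat1 X (mk T) k s <-> sat (ext X) (\<epsilon>) (dec k) (ev s)" if "s \<in> ext (asn X)" for s
  by (rule sat1_correct[OF X that TT])
 have N': "?N = {op (nm k) s |s. s \<in> ext (asn X) & sat (ext X) (\<epsilon>) (dec k) (ev s)}"
 proof (intro set_eqI iffI)
  fix q assume q: "q \<in> ?N"
  then have "q \<in> ext (prd om (asn X))" by blast
  then obtain z s where "q = op z s" "z \<in> ext om" "s \<in> ext (asn X)"
   using ext_prd[OF om_D asn_D[OF X]] by blast
  then show "q \<in> {op (nm k) s |s. s \<in> ext (asn X) & sat (ext X) (\<epsilon>) (dec k) (ev s)}" using q s1 by auto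
 next
  fix q assume "q \<in> {op (nm k) s |s. s \<in> ext (asn X) & sat (ext X) (\<epsilon>) (dec k) (ev s)}"
  then obtain s where s: "q = op (nm k) s" "s \<in> ext (asn X)" "sat (ext X) (\<epsilon>) (dec k) (ev s)" by blast
  then have "q \<in> ext (prd om (asn X))" unfolding ext_prd[OF om_D asn_D[OF X]] by (auto simp: ext_om)
  moreover have "pfst q = nm k" "psnd q = s" using s by auto
  ultimately show "q \<in> ?N" using s s1 by blast
 qed
 have "((%p. satstep X p) ^^ Suc k) (op (nm 0) (mk {})) = satstep X (op (nm k) (mk T))" using T(2) by simp
 also have "\<dots> = op (nm (Suc k)) (mk (T \<union> ?N))"
  unfolding satstep_def using T(1) N by (simp del: nm.simps)
 finally have 1: "((%p. satstep X p) ^^ Suc k) (op (nm 0) (mk {})) = op (nm (Suc k)) (mk (T \<union> ?N))" .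
 have 2: "T \<union> ?N = {op (nm i) s |i s. i < Suc k & s \<in> ext (asn X) & sat (ext X) (\<epsilon>) (dec i) (ev s)}"
  unfolding N' by (subst T(3)) (auto simp: less_Suc_eq)
 have "isset (T \<union> ?N)" using T(1) N by (rule isset_Un)
 with 1 2 show ?case by (intro exI[of _ "T \<union> ?N"] conjI)
qed

lemma satI_iff:
 assumes X: "X \<in> D" and s: "s \<in> ext (asn X)"
 shows "satI X n s <-> sat (ext X) (\<epsilon>) (dec n) (ev s)"
proof -
 obtain T where T: "isset T" "((%p. satstep X p) ^^ Suc n) (op (nm 0) (mk {})) = op (nm (Suc n)) (mk T)"
  "T = {op (nm i) s |i s. i < Suc n & s \<in> ext (asn X) & sat (ext X) (\<epsilon>) (dec i) (ev s)}"
  using satstep_iter[OF X, of "Suc n"] by blast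
 have sD: "s \<in> D" using s by simp
 have "satI X n s <-> op (nm n) s \<in> T" unfolding satI_def T(2) using T(1) sD by (simp del: nm.simps)
 also have "\<dots> <-> sat (ext X) (\<epsilon>) (dec n) (ev s)"
 proof
  assume "op (nm n) s \<in> T"
  then obtain i' s' where "op (nm n) s = op (nm i') s'" "s' \<in> ext (asn X)" "sat (ext X) (\<epsilon>) (dec i') (ev s')"
   using T(3) by blast
  then show "sat (ext X) (\<epsilon>) (dec n) (ev s)" using sD by simp
 qed (use T(3) s in blast)
 finally show ?thesis .
qed

text \<open>The definable power set seen from outside; \<open>DefS_Defx\<close> shows that it agrees
  with the internal \<open>DefS\<close>.\<close>

definition Defx :: "'m set => 'm set set" where
 "Defx S = {Y. EX p e. (ALL i. e i \<in> S) & Y = {y \<in> S. sat S (\<epsilon>) p (case_nat y e)}}"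

definition dfs :: "'m => nat => 'm => 'm" where
 "dfs X n s = mk {y \<in> ext X. satI X n (cns y s)}"

lemma dtm_dfs [dfn_intros]:
 assumes "dtm A t" "ntm A n" "dtm A u" shows "dtm A (%e. dfs (t e) (n e) (u e))"
proof -
 have "dtm A (%e. dfs (e 0) (nof (e (Suc 0))) (e (Suc (Suc 0))))" unfolding dfs_def by (intro dfn_intros)
 from dtm3[of A "%x y z. dfs x (nof y) z", OF this assms(1) dtm_nm[OF assms(2)] assms(3)] show ?thesis by simp
qed

lemma dfs:
 assumes X: "X \<in> D" and s: "s \<in> ext (asn X)"
 shows "dfs X n s \<in> D" "ext (dfs X n s) = {y \<in> ext X. sat (ext X) (\<epsilon>) (dec n) (case_nat y (ev s))}"
proof -
 have sD: "s \<in> D" using s by simp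
 have i: "isset {y \<in> ext X. satI X n (cns y s)}"
  by (rule isset_sep) (intro dfn_intros X sD)+
 show "dfs X n s \<in> D" unfolding dfs_def using i by simp
 have "satI X n (cns y s) <-> sat (ext X) (\<epsilon>) (dec n) (case_nat y (ev s))" if "y \<in> ext X" for y
  using satI_iff[OF X cns(1)[OF X that s]] cns(2)[OF X that s] by simp
 then show "ext (dfs X n s) = {y \<in> ext X. sat (ext X) (\<epsilon>) (dec n) (case_nat y (ev s))}"
  unfolding dfs_def using i by auto
qed

definition DefS :: "'m => 'm" where
 "DefS X = mk (\<Union>n\<in>ext om. ext (mk ((%s. dfs X (nof n) s) ` ext (asn X))))"

lemma dtm_DefS [dfn_intros]: "dtm A t ==> dtm A (%e. DefS (t e))"
proof (rule dtm1[rotated], assumption)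
 show "dtm A (%e. DefS (e 0))" unfolding DefS_def by (intro dfn_intros)
qed

lemma DefS:
 assumes X: "X \<in> D"
 shows "DefS X \<in> D" "ext (DefS X) = {dfs X n s |n s. s \<in> ext (asn X)}"
proof -
 show "DefS X \<in> D" by (rule dtm1_D[OF dtm_DefS[OF dtm_var] X])
 have i: "isset ((%s. dfs X (nof n) s) ` ext (asn X))" if "n \<in> D" for n
  by (rule isset_rep) (intro dfn_intros X that asn_D)+
 have "isset (\<Union>n\<in>ext om. ext (mk ((%s. dfs X (nof n) s) ` ext (asn X))))"
  by (rule isset_UN) (intro dfn_intros X isset_ext om_D)+
 then have "ext (DefS X) = (\<Union>n\<in>ext om. (%s. dfs X (nof n) s) ` ext (asn X))"
  unfolding DefS_def using i by simp
 also have "\<dots> = (\<Union>n. (%s. dfs X n s) ` ext (asn X))" by (auto simp: ext_om)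
 finally show "ext (DefS X) = {dfs X n s |n s. s \<in> ext (asn X)}" by blast
qed

lemma DefS_Defx:
 assumes X: "X \<in> D"
 shows "ext (DefS X) = {x \<in> D. ext x \<in> Defx (ext X)}" and "!!Y. Y \<in> Defx (ext X) ==> isset Y"
proof -
 have 1: "EX n s. s \<in> ext (asn X) & ext (dfs X n s) = Y" if "Y \<in> Defx (ext X)" for Y
 proof -
  obtain p e where Y: "!!i. e i \<in> ext X" "Y = {y \<in> ext X. sat (ext X) (\<epsilon>) p (case_nat y e)}"
   using \<open>Y \<in> Defx (ext X)\<close> unfolding Defx_def by blast
  obtain s where s: "s \<in> ext (asn X)" "ALL i<fvb p. ev s i = e i"
   using ex_asn[of X e "fvb p", OF X Y(1)] by (elim bexE) (rule that)
  obtain n where n: "dec n = p" using dec_surj by blast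
  have "sat (ext X) (\<epsilon>) p (case_nat y (ev s)) = sat (ext X) (\<epsilon>) p (case_nat y e)" for y
   by (rule sat_fvb) (use s(2) in \<open>auto split: nat.splits\<close>)
  then have "ext (dfs X n s) = Y" unfolding dfs(2)[OF X s(1)] Y(2) n by simp
  then show ?thesis using s by blast
 qed
 have 2: "ext (dfs X n s) \<in> Defx (ext X)" if s: "s \<in> ext (asn X)" for n s
 proof -
  have "ALL i. ev s i \<in> ext X" using s ext_asn(1)[OF X] by auto
  then show ?thesis unfolding dfs(2)[OF X s] Defx_def by blast
 qed
 show "ext (DefS X) = {x \<in> D. ext x \<in> Defx (ext X)}"
 proof (intro set_eqI iffI)
  fix x assume "x \<in> ext (DefS X)"
  then show "x \<in> {x \<in> D. ext x \<in> Defx (ext X)}" using 2 dfs(1)[OF X] unfolding DefS(2)[OF X] by auto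
 next
  fix x assume x: "x \<in> {x \<in> D. ext x \<in> Defx (ext X)}"
  then obtain n s where s: "s \<in> ext (asn X)" "ext (dfs X n s) = ext x" using 1 by blast
  then have "dfs X n s = x" using x dfs(1)[OF X s(1)] ext_inj by blast
  then show "x \<in> ext (DefS X)" unfolding DefS(2)[OF X] using s by blast
 qed
 show "isset Y" if "Y \<in> Defx (ext X)" for Y
  using 1[OF that] dfs(1)[OF X] by (metis isset_ext)
qed

end

section \<open>The constructible hierarchy over a transitive set\<close>

context zfm
begin

lemma DefxI: "(!!i. e i \<in> S) ==> Y = {y \<in> S. sat S (\<epsilon>) p (case_nat y e)} ==> Y \<in> Defx S"
 unfolding Defx_def by (intro CollectI exI[of _ p] exI[of _ e] conjI allI)

lemma Defx_dfn:
 assumes "set_structure.dfn S mem S (%e. P (e 0))" "S ~= {}"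
 shows "{x \<in> S. P x} \<in> Defx S"
proof -
 interpret T: set_structure S mem .
 obtain d where d: "d \<in> S" using assms(2) by blast
 obtain p s where s: "!!i c. s i = Inr c ==> c \<in> S \<inter> S"
  and p: "!!e. T.env e ==> P (e 0) = sat S (\<epsilon>) p (%i. case_sum e id (s i))"
  by (rule T.dfnE[OF assms(1)]) (rule that)
 let ?g = "%i. if s i = Inl 0 then 0 else Suc i"
 \<comment> \<open>The property depends on the first variable only, so all other variables may be
   given the value \<open>d\<close>.\<close>
 let ?e = "%i. case s i of Inl j => d | Inr c => c"
 have e: "?e i \<in> S" for i using s d by (auto split: sum.splits)
 have "(%i. case_nat x ?e (?g i)) = (%i. case_sum (case_nat x (%_. d)) id (s i))" for x
  by (auto split: sum.splits nat.splits)
 moreover have "T.env (case_nat x (%_. d))" if "x \<in> S" for x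
  using that d by (auto simp: T.env_def split: nat.splits)
 ultimately have "P x = sat S (\<epsilon>) (ren ?g p) (case_nat x ?e)" if "x \<in> S" for x
  using p[of "case_nat x (%_. d)"] that by (simp add: sat_ren)
 then have "{x \<in> S. P x} = {y \<in> S. sat S (\<epsilon>) (ren ?g p) (case_nat y ?e)}" by blast
 then show ?thesis by (rule DefxI[OF e])
qed

lemma lst_On' [simp, intro]: "lst P \<in> On"
proof (cases "EX a:On. P a")
 case True
 then show ?thesis using lst_On by blast
next
 case False
 then have "~ (EX! y. y \<in> D & (y \<in> On & P y & (ALL b:ext y. ~ P b)))" by blast
 then have "lst P = mk {}" unfolding lst_def thex_def by (rule if_not_P)
 then show ?thesis using nm_On[of 0] by simp
qed

lemma On_sub_mem: "a \<in> On ==> b \<in> On ==> c \<in> On ==> ext a \<subseteq> ext b ==> b \<epsilon> c ==> a \<epsilon> c"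
 using On_sub[of a b] On_trans[of c b a] by auto

lemma On_Un:
 assumes "a \<in> On" "b \<in> On" shows "mk (ext a \<union> ext b) \<in> On" "mk (ext a \<union> ext b) = a \<or> mk (ext a \<union> ext b) = b"
proof -
 have "ext a \<subseteq> ext b \<or> ext b \<subseteq> ext a" using On_linear[OF assms] On_sub assms by blast
 then have "ext a \<union> ext b = ext a \<or> ext a \<union> ext b = ext b" by blast
 then show "mk (ext a \<union> ext b) = a \<or> mk (ext a \<union> ext b) = b" using assms by auto
 then show "mk (ext a \<union> ext b) \<in> On" using assms by metis
qed

lemma Lh_exists:
 assumes "b \<in> D" "dtm A (%_. b)"
 shows "EX F. dtm A (%e. F (e 0)) & (ALL x:D. F x = mk (ext b \<union> ext (mk (\<Union>y\<in>ext x. ext (DefS (F y))))))"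
proof -
 have "dtm A (%e. mk (ext b \<union> ext (mk (\<Union>y\<in>ext (e 0). ext (DefS (ap (e (Suc 0)) y))))))"
  by (intro dfn_intros assms)
 then obtain F where F: "dtm A (%e. F (e 0))"
   "!!x. x \<in> D ==> F x = mk (ext b \<union> ext (mk (\<Union>y\<in>ext x. ext (DefS (ap (lam (ext x) F) y)))))"
   "!!x. x \<in> D ==> lam (ext x) F \<in> D"
  by (rule mem_recursion[of A "%x f. mk (ext b \<union> ext (mk (\<Union>y\<in>ext x. ext (DefS (ap f y)))))"]) (rule that)
 have FD: "dtm D (%e. F (e 0))" by (rule dtm_mono[OF F(1)]) auto
 have "F x = mk (ext b \<union> ext (mk (\<Union>y\<in>ext x. ext (DefS (F y)))))" if x: "x \<in> D" for x
 proof -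
  have "ap (lam (ext x) F) y = F y" if "y \<in> ext x" for y
   by (rule ap_lam'[OF F(3)[OF x] isset_ext[OF x] FD that])
  then have "(\<Union>y\<in>ext x. ext (DefS (ap (lam (ext x) F) y))) = (\<Union>y\<in>ext x. ext (DefS (F y)))"
   by (intro SUP_cong) auto
  then show ?thesis using F(2)[OF x] by simp
 qed
 with F(1) show ?thesis by blast
qed

text \<open>The constructible hierarchy over \<open>b\<close>, by recursion along membership for
  every \<open>x\<close>, and used mostly for ordinals. The choice by \<open>SOME\<close> fixes the
  function only as definable from \<open>D\<close>; definability from fewer parameters is recovered
  by uniqueness in \<open>dtm_Lh\<close>.\<close>

definition Lh :: "'m => 'm => 'm" where
 "Lh b = (SOME F. dtm D (%e. F (e 0)) & (ALL x:D. F x = mk (ext b \<union> ext (mk (\<Union>y\<in>ext x. ext (DefS (F y)))))))"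

lemma Lh:
 assumes b: "b \<in> D" and x: "x \<in> D"
 shows Lh_D: "Lh b x \<in> D" and ext_Lh: "ext (Lh b x) = ext b \<union> (\<Union>y\<in>ext x. ext (DefS (Lh b y)))"
  and Lh_eq: "Lh b x = mk (ext b \<union> ext (mk (\<Union>y\<in>ext x. ext (DefS (Lh b y)))))"
proof -
 have *: "dtm D (%e. Lh b (e 0)) & (ALL x:D. Lh b x = mk (ext b \<union> ext (mk (\<Union>y\<in>ext x. ext (DefS (Lh b y))))))"
  by (rule someI_ex[OF Lh_exists[OF b dtm_const[OF b b]], folded Lh_def])
 then have d: "dtm D (%e. Lh b (e 0))" by blast
 show "Lh b x \<in> D" by (rule dtm1_D[OF d x])
 show eq: "Lh b x = mk (ext b \<union> ext (mk (\<Union>y\<in>ext x. ext (DefS (Lh b y)))))" using * x by blast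
 have "isset (\<Union>y\<in>ext x. ext (DefS (Lh b y)))"
  by (rule isset_UN) (intro isset_ext x, intro dtm_DefS d)
 then show "ext (Lh b x) = ext b \<union> (\<Union>y\<in>ext x. ext (DefS (Lh b y)))"
  by (subst eq) (use b in simp)
qed

lemma dtm_Lh:
 assumes b: "b \<in> D" "dtm A (%_. b)" and t: "dtm A t"
 shows "dtm A (%e. Lh b (t e))"
proof (rule dtm1[OF _ t])
 obtain F where F: "dtm A (%e. F (e 0))" "ALL x:D. F x = mk (ext b \<union> ext (mk (\<Union>y\<in>ext x. ext (DefS (F y)))))"
  using Lh_exists[OF b] by blast
 have "F x = Lh b x" if "x \<in> D" for x
  using that
 proof (induction x rule: mem_induct)
  case (mem x)
  have U: "(\<Union>y\<in>ext x. ext (DefS (F y))) = (\<Union>y\<in>ext x. ext (DefS (Lh b y)))"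
   by (intro SUP_cong refl) (simp only: mem.IH)
  have "F x = mk (ext b \<union> ext (mk (\<Union>y\<in>ext x. ext (DefS (F y)))))" by (rule F(2)[rule_format, OF mem.hyps])
  also have "\<dots> = mk (ext b \<union> ext (mk (\<Union>y\<in>ext x. ext (DefS (Lh b y)))))" by (simp only: U)
  also have "\<dots> = Lh b x" by (rule Lh_eq[OF b(1) mem.hyps, symmetric])
  finally show ?case .
 qed
 then show "dtm A (%e. Lh b (e 0))" using F(1) by (auto elim: dtm_cong)
qed

end

text \<open>The transitive base contains omega, so omega and all numerals belong to every
  level.\<close>

locale zfmL = zfm D mem
 for D :: "'m set" and mem :: "'m => 'm => bool"  (infix "\<epsilon>" 50) +
 fixes b :: 'm
 assumes b_D [simp, intro]: "b \<in> D" and b_trans: "!!x. x \<in> ext b ==> ext x \<subseteq> ext b" and om_b: "om \<in> ext b"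
begin

abbreviation H :: "'m => 'm" where "H \<equiv> Lh b"

lemma H_D [simp, intro]: "a \<in> D ==> H a \<in> D"
 by (rule Lh_D[OF b_D])

lemma dtm_H [dfn_intros]: "dtm D t ==> dtm D (%e. H (t e))"
 by (intro dtm_Lh b_D dtm_const)

lemma H_mono: "a \<in> D ==> c \<in> D ==> ext a \<subseteq> ext c ==> ext (H a) \<subseteq> ext (H c)"
 unfolding ext_Lh[OF b_D] by blast

lemma b_H: "a \<in> D ==> ext b \<subseteq> ext (H a)"
 unfolding ext_Lh[OF b_D] by blast

lemma DefS_H: "a \<in> D ==> c \<in> ext a ==> ext (DefS (H c)) \<subseteq> ext (H a)"
 unfolding ext_Lh[OF b_D] by blast

lemma Defx_sub: "Y \<in> Defx S ==> Y \<subseteq> S"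
 unfolding Defx_def by blast

lemma sub_DefS:
 assumes "X \<in> D" "x \<in> ext X" "ext x \<subseteq> ext X" shows "x \<in> ext (DefS X)"
proof -
 have "ext x = {y \<in> ext X. sat (ext X) (\<epsilon>) (Mem 0 1) (case_nat y (%_. x))}" using assms by auto
 then have "ext x \<in> Defx (ext X)" by (rule DefxI[OF assms(2)])
 then show ?thesis using assms DefS_Defx(1)[OF assms(1)] by auto
qed

lemma self_DefS: assumes "X \<in> D" "ext X ~= {}" shows "X \<in> ext (DefS X)"
proof -
 obtain d where d: "d \<in> ext X" using assms(2) by blast
 have "ext X = {y \<in> ext X. sat (ext X) (\<epsilon>) (Eq 0 0) (case_nat y (%_. d))}" by auto
 then have "ext X \<in> Defx (ext X)" by (rule DefxI[OF d])
 then show ?thesis using assms DefS_Defx(1)[OF assms(1)] by auto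
qed

text \<open>Transitivity and growth go together: an earlier level is transitive by induction, so
  each of its members is a definable subset of it and reappears in the later level.\<close>

lemma H_trans: "a \<in> D ==> x \<in> ext (H a) ==> ext x \<subseteq> ext (H a)"
proof (induction a arbitrary: x rule: mem_induct)
 case (mem a)
 have sub: "ext (H c) \<subseteq> ext (H a)" if c: "c \<in> ext a" for c
 proof -
  have "ext (H c) \<subseteq> ext (DefS (H c))"
  proof
   fix x assume x: "x \<in> ext (H c)"
   show "x \<in> ext (DefS (H c))" by (rule sub_DefS[OF _ x mem.IH[OF c x]]) (use c in auto)
  qed
  then show ?thesis using DefS_H[OF mem.hyps c] by blast
 qed
 consider "x \<in> ext b" | c where "c \<in> ext a" "x \<in> ext (DefS (H c))"
  using mem.prems ext_Lh[OF b_D mem.hyps] by blast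
 then show ?case
 proof cases
  case 1
  then show ?thesis using b_trans b_H[OF mem.hyps] by blast
 next
  case 2
  have "H c \<in> D" using 2 by auto
  then have "ext x \<in> Defx (ext (H c))" using 2 DefS_Defx(1) by blast
  then show ?thesis using Defx_sub sub[OF 2(1)] by blast
 qed
qed

lemma H_nonempty: "a \<in> D ==> ext (H a) ~= {}"
 using b_H[of a] om_b by blast

definition Lc :: "'m set" where "Lc = (\<Union>a\<in>On. ext (H a))"

lemma LcI: "a \<in> On ==> x \<in> ext (H a) ==> x \<in> Lc"
 unfolding Lc_def by blast

lemma Lc_D: "x \<in> Lc ==> x \<in> D"
 unfolding Lc_def by auto

lemma Lc_trans: "x \<in> Lc ==> y \<in> ext x ==> y \<in> Lc"
proof -
 assume "x \<in> Lc" "y \<in> ext x"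
 then obtain a where a: "a \<in> On" "x \<in> ext (H a)" unfolding Lc_def by blast
 then have "y \<in> ext (H a)" using H_trans[OF OnD[OF a(1)] a(2)] \<open>y \<in> ext x\<close> by blast
 then show "y \<in> Lc" by (rule LcI[OF a(1)])
qed

lemma b_Lc: "x \<in> ext b ==> x \<in> Lc"
 using LcI[OF nm_On[of 0]] b_H[of "nm 0"] by blast

lemma dfn_Lc [dfn_intros]: "dtm D t ==> dfn D (%e. t e \<in> Lc)"
proof (rule dfn1[rotated], assumption)
 have "dfn D (%e. EX a:D. a \<in> On & e 0 \<in> ext (H a))" by (intro dfn_intros)
 then show "dfn D (%e. e 0 \<in> Lc)" unfolding Lc_def by (rule dfn_cong) (use OnD in blast)
qed

lemma H_mem_mono: "a \<in> On ==> c \<in> ext a ==> ext (H c) \<subseteq> ext (H a)"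
 using ordinal_trans[OF On_ordinal] by (intro H_mono) auto

text \<open>Replacement: the first levels at which the members of \<open>T\<close> appear have a
  supremum.\<close>

lemma Lc_bound:
 assumes "isset T" "T \<subseteq> Lc" obtains a where "a \<in> On" "T \<subseteq> ext (H a)"
proof -
 let ?g = "%x. suc (lst (%a. x \<in> ext (H a)))"
 have "isset (?g ` T)" by (rule isset_image[OF assms(1)]) (intro dfn_intros)
 moreover have "?g ` T \<subseteq> On" by auto
 ultimately have U: "isset (\<Union>x\<in>?g ` T. ext x)" "mk (\<Union>x\<in>?g ` T. ext x) \<in> On" using Union_On by blast+
 have "x \<in> ext (H (mk (\<Union>x\<in>?g ` T. ext x)))" if x: "x \<in> T" for x
 proof -
  obtain a where a: "a \<in> On" "x \<in> ext (H a)" using x assms(2) unfolding Lc_def by blast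
  have l: "lst (%a. x \<in> ext (H a)) \<in> D" using OnD by blast
  have "x \<in> ext (H (lst (%a. x \<in> ext (H a))))" by (rule lst_prop[of a "%a. x \<in> ext (H a)", OF a])
  moreover have "lst (%a. x \<in> ext (H a)) \<in> ext (?g x)" using l by simp
  then have "lst (%a. x \<in> ext (H a)) \<in> (\<Union>x\<in>?g ` T. ext x)" using x by blast
  then have "lst (%a. x \<in> ext (H a)) \<in> ext (mk (\<Union>x\<in>?g ` T. ext x))" by (simp only: ext_mk[OF U(1)])
  ultimately show ?thesis using H_mem_mono[OF U(2)] by blast
 qed
 then show thesis using that[OF U(2)] by blast
qed

definition lim :: "'m => bool" where
 "lim l <-> l \<in> On & ext l ~= {} & (ALL c:ext l. suc c \<in> ext l)"

lemma lim_On: "lim l ==> l \<in> On"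
 by (simp add: lim_def)

lemma H_lim:
 assumes "lim l" shows "ext (H l) = (\<Union>c\<in>ext l. ext (H c))"
proof -
 have l: "l \<in> On" "l \<in> D" using assms by (auto simp: lim_def)
 show ?thesis
 proof
  show "ext (H l) \<subseteq> (\<Union>c\<in>ext l. ext (H c))"
  proof
   fix x assume "x \<in> ext (H l)"
   then consider "x \<in> ext b" | c where "c \<in> ext l" "x \<in> ext (DefS (H c))"
    using ext_Lh[OF b_D l(2)] by blast
   then show "x \<in> (\<Union>c\<in>ext l. ext (H c))"
   proof cases
    case 1
    obtain c where "c \<in> ext l" using assms unfolding lim_def by blast
    moreover then have "x \<in> ext (H c)" using 1 b_H[of c] by auto
    ultimately show ?thesis by blast
   next
    case 2
    have "suc c \<in> ext l" using assms 2 unfolding lim_def by blast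
    moreover have "x \<in> ext (H (suc c))"
    proof -
     have c: "c \<in> D" using 2 by simp
     then have "c \<in> ext (suc c)" by simp
     from DefS_H[OF suc_D[OF c] this] show ?thesis using 2(2) by blast
    qed
    ultimately show ?thesis by blast
   qed
  qed
 qed (use H_mem_mono[OF l(1)] in blast)
qed

lemma H_lim_finite:
 fixes e :: "nat => 'm"
 assumes l: "lim l" and e: "!!i. e i \<in> ext (H l)"
 shows "EX c:ext l. ALL i<k. e i \<in> ext (H c)"
proof (induction k)
 case 0
 then show ?case using l unfolding lim_def by blast
next
 case (Suc k)
 then obtain c where c: "c \<in> ext l" "ALL i<k. e i \<in> ext (H c)" by blast
 obtain c' where c': "c' \<in> ext l" "e k \<in> ext (H c')" using e[of k] H_lim[OF l] by blast
 have On: "c \<in> On" "c' \<in> On" using c c' On_mem[OF lim_On[OF l]] by blast+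
 consider "ext c \<subseteq> ext c'" | "ext c' \<subseteq> ext c" using On_linear[OF On] On_sub On by blast
 then show ?case
 proof cases
  case 1
  then have "ext (H c) \<subseteq> ext (H c')" using On by (intro H_mono) auto
  then show ?thesis using c c' by (intro bexI[of _ c']) (auto simp only: less_Suc_eq)
 next
  case 2
  then have "ext (H c') \<subseteq> ext (H c)" using On by (intro H_mono) auto
  then show ?thesis using c c' by (intro bexI[of _ c]) (auto simp only: less_Suc_eq)
 qed
qed

subsection \<open>Reflection\<close>

definition reflects :: "fm => 'm => bool" where
 "reflects p l <-> (ALL e. (ALL i. e i \<in> ext (H l)) --> sat Lc (\<epsilon>) p e = sat (ext (H l)) (\<epsilon>) p e)"

text \<open>Limit ordinals closed under the ordinal function \<open>h\<close>. Each formula gets a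
  function whose closure points reflect it, and finitely many functions are combined by a
  maximum.\<close>

definition closes :: "('m => 'm) => 'm => bool" where
 "closes h l <-> lim l & (ALL c:ext l. h c \<epsilon> l)"

definition ofun :: "('m => 'm) => bool" where
 "ofun h <-> dtm D (%e. h (e 0)) & (ALL a:On. h a \<in> On)"

lemma ofun_max:
 assumes "ofun h" "ofun g"
 shows "EX k. ofun k & (ALL l. closes k l --> closes h l & closes g l)"
proof -
 let ?k = "%x. mk (ext (h x) \<union> ext (g x))"
 have "ofun ?k" using assms On_Un(1) unfolding ofun_def by (auto intro!: dfn_intros)
 moreover have "closes h l & closes g l" if l: "closes ?k l" for l
 proof -
  have lO: "l \<in> On" using l by (simp add: closes_def lim_def)
  have "h c \<epsilon> l & g c \<epsilon> l" if c: "c \<in> ext l" for c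
  proof -
   have cO: "c \<in> On" using On_mem[OF lO c] .
   have hg: "h c \<in> On" "g c \<in> On" using assms cO unfolding ofun_def by blast+
   have kl: "?k c \<epsilon> l" using l c unfolding closes_def by blast
   have kO: "?k c \<in> On" by (rule On_Un(1)[OF hg])
   have i: "ext (?k c) = ext (h c) \<union> ext (g c)" using hg by simp
   show ?thesis
    using On_sub_mem[OF hg(1) kO lO _ kl] On_sub_mem[OF hg(2) kO lO _ kl] unfolding i by blast
  qed
  then show ?thesis using l unfolding closes_def by blast
 qed
 ultimately show ?thesis by blast
qed

text \<open>The limit of omega many steps, each of which goes above the values of \<open>h\<close>
  on the ordinal reached before.\<close>

lemma closes_unbounded:
 assumes h: "ofun h" and a: "a \<in> On"
 shows "EX l. closes h l & a \<in> ext l"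
proof -
 let ?S = "%c. suc (mk (ext c \<union> ext (mk (\<Union>x\<in>ext c. ext (h x)))))"
 let ?c = "%n. (?S ^^ n) (suc a)"
 have hd: "dtm D (%e. h (e 0))" and hO: "!!x. x \<in> On ==> h x \<in> On" using h unfolding ofun_def by blast+
 have aD: "a \<in> D" using a by simp
 have U: "isset (\<Union>x\<in>ext c. ext (h x)) & mk (\<Union>x\<in>ext c. ext (h x)) \<in> On" if c: "c \<in> On" for c
 proof -
  have "isset (h ` ext c)" by (rule isset_rep[OF hd]) (use c in simp)
  moreover have "h ` ext c \<subseteq> On" using hO On_mem[OF c] by blast
  ultimately show ?thesis using Union_On[of "h ` ext c"] by simp
 qed
 have cO: "?c n \<in> On" for n
 proof (induction n)
  case (Suc n)
  show ?case using suc_On[OF On_Un(1)[OF Suc conjunct2[OF U[OF Suc]]]] by (simp only: funpow.simps o_apply)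
 qed (use a in simp)
 have step: "ext (?c (Suc n)) = insert (mk (ext (?c n) \<union> ext (mk (\<Union>x\<in>ext (?c n). ext (h x)))))
   (ext (?c n) \<union> (\<Union>x\<in>ext (?c n). ext (h x)))" for n
 proof -
  have "isset (ext (?c n) \<union> (\<Union>x\<in>ext (?c n). ext (h x)))"
   by (intro isset_Un isset_ext) (use cO U[OF cO[of n]] in auto)
  then show ?thesis using U[OF cO[of n]] by simp
 qed
 let ?l = "mk (\<Union>n\<in>ext om. ext (?c (nof n)))"
 have i: "isset (\<Union>n\<in>ext om. ext (?c (nof n)))"
  by (rule isset_UN) (intro isset_ext om_D, intro dfn_intros hd aD)
 have el: "ext ?l = (\<Union>n. ext (?c n))" using i by (simp add: ext_om)
 have "isset ((%n. ?c (nof n)) ` ext om)"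
  by (rule isset_rep) (intro dfn_intros hd aD om_D)+
 then have "mk (\<Union>x\<in>(%n. ?c (nof n)) ` ext om. ext x) \<in> On" using Union_On cO by blast
 then have lO: "?l \<in> On" by simp
 have key: "suc x \<in> ext ?l & h x \<epsilon> ?l" if x: "x \<in> ext ?l" for x
 proof -
  obtain n where n: "x \<in> ext (?c n)" using x unfolding el by blast
  have xO: "x \<in> On" using On_mem[OF cO n] .
  let ?m = "mk (ext (?c n) \<union> ext (mk (\<Union>x\<in>ext (?c n). ext (h x))))"
  have mO: "?m \<in> On" using On_Un(1)[OF cO[of n]] U[OF cO[of n]] by blast
  have em: "ext ?m = ext (?c n) \<union> (\<Union>x\<in>ext (?c n). ext (h x))"
   using U[OF cO[of n]] cO[of n] by simp
  have ml: "?m \<in> ext (?c (Suc n))" using step by blast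
  have "?c (Suc n) \<in> D" using cO[of "Suc n"] by (rule OnD)
  have sub: "z \<in> ext (?c (Suc n))" if z: "z \<in> On" "ext z \<subseteq> ext ?m" for z
  proof -
   have "?m \<epsilon> ?c (Suc n)" using ml unfolding in_ext by blast
   from On_sub_mem[OF z(1) mO cO z(2) this] show ?thesis unfolding in_ext using OnD[OF z(1)] by blast
  qed
  have "ext (h x) \<subseteq> ext ?m" unfolding em using n by blast
  then have 1: "h x \<in> ext (?c (Suc n))" using sub hO xO by blast
  have "ext (suc x) \<subseteq> ext ?m"
   unfolding em using n ordinal_trans[OF On_ordinal[OF cO] n] xO by auto
  then have 2: "suc x \<in> ext (?c (Suc n))" using sub xO by blast
  have "ext (?c (Suc n)) \<subseteq> ext ?l" unfolding el by blast
  with 1 2 show ?thesis by auto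
 qed
 have "a \<in> ext (?c 0)" using aD by simp
 then have al: "a \<in> ext ?l" unfolding el by blast
 have "lim ?l" unfolding lim_def using lO al key by blast
 then have "closes h ?l" unfolding closes_def using key by blast
 with al show ?thesis by blast
qed

text \<open>In the quantifier case, \<open>w s\<close> is the first level with a counterexample for
  the assignment \<open>s\<close>, and \<open>g\<close> bounds it for all assignments into a level.
  A level closed under \<open>g\<close> thus contains a counterexample whenever there is
  one.\<close>

lemma reflect_ofun: "EX h. ofun h & (ALL l. closes h l --> reflects p l)"
proof (induction p)
 case (Mem i j)
 have "ofun (%x. x)" unfolding ofun_def by (auto intro: dfn_intros)
 then show ?case unfolding reflects_def by (intro exI[of _ "%x. x"]) simp
next
 case (Eq i j)
 have "ofun (%x. x)" unfolding ofun_def by (auto intro: dfn_intros)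
 then show ?case unfolding reflects_def by (intro exI[of _ "%x. x"]) simp
next
 case (Nand p q)
 then obtain h g where h: "ofun h" "ALL l. closes h l --> reflects p l" and g: "ofun g" "ALL l. closes g l --> reflects q l"
  by blast
 obtain k where k: "ofun k" "ALL l. closes k l --> closes h l & closes g l"
  using ofun_max[OF h(1) g(1)] by blast
 have "reflects (Nand p q) l" if "closes k l" for l
 proof -
  have "reflects p l" "reflects q l" using h g k that by blast+
  then show ?thesis unfolding reflects_def by simp
 qed
 then show ?case using k(1) by blast
next
 case (All p)
 then obtain h where h: "ofun h" "ALL l. closes h l --> reflects p l" by blast
 define w where "w s = lst (%c. EX x:ext (H c). ~ sat Lc (\<epsilon>) p (case_nat x (ev s)))" for s
 define g where "g a = mk (\<Union>s\<in>ext (asn (H a)). ext (suc (w s)))" for a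
 have sd: "dfn D (%e. sat Lc (\<epsilon>) p (case_nat (e 0) (ev (e (Suc (Suc 0))))))"
 proof -
  let ?t = "%i. case i of 0 => (%e. e 0) | Suc i => (%e. ap (e (Suc (Suc 0))) (nm i))"
  have "dtm D (?t i)" for i by (cases i) (auto intro!: dfn_intros)
  moreover have "Lc \<subseteq> D" using Lc_D by blast
  moreover have "dfn D (%e. e 0 \<in> Lc)" by (intro dfn_intros)
  ultimately have "dfn D (%e. sat Lc (\<epsilon>) p (%i. ?t i e))" by (intro dfn_sat_class)
  moreover have "(%i. ?t i e) = case_nat (e 0) (ev (e (Suc (Suc 0))))" for e
   by (auto simp: ev_def split: nat.splits)
  ultimately show ?thesis by simp
 qed
 have wd: "dtm D (%e. w (e 0))" unfolding w_def
  by (intro dtm_lst dfn_bex_ext dtm_H dtm_var dfn_not sd)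
 have gd: "dtm D (%e. g (e 0))" unfolding g_def
  by (intro dfn_intros wd)
 have gO: "isset (\<Union>s\<in>ext (asn (H a)). ext (suc (w s))) & g a \<in> On" if a: "a \<in> On" for a
 proof -
  have "isset ((%s. suc (w s)) ` ext (asn (H a)))"
   by (rule isset_rep) (intro dtm_suc wd asn_D H_D OnD[OF a])+
  moreover have "(%s. suc (w s)) ` ext (asn (H a)) \<subseteq> On" unfolding w_def by auto
  ultimately show ?thesis using Union_On[of "(%s. suc (w s)) ` ext (asn (H a))"] unfolding g_def by simp
 qed
 have "ofun g" unfolding ofun_def using gd gO by blast
 then obtain k where k: "ofun k" "ALL l. closes k l --> closes h l & closes g l"
  using ofun_max[OF h(1)] by blast
 have "reflects (All p) l" if "closes k l" for l
 proof -
  have hl: "reflects p l" and gl: "closes g l" using h k that by blast+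
  then have l: "lim l" "l \<in> On" "l \<in> D" by (auto simp: closes_def lim_def)
  show ?thesis
   unfolding reflects_def
  proof (intro allI impI)
   fix e :: "nat => 'm" assume e: "ALL i. e i \<in> ext (H l)"
   have r: "sat Lc (\<epsilon>) p (case_nat x e) = sat (ext (H l)) (\<epsilon>) p (case_nat x e)" if "x \<in> ext (H l)" for x
   proof -
    have "ALL i. case_nat x e i \<in> ext (H l)" using e that by (auto split: nat.splits)
    then show ?thesis using hl unfolding reflects_def by blast
   qed
   have sub: "ext (H l) \<subseteq> Lc" using LcI[OF l(2)] by blast
   have "EX x:ext (H l). ~ sat Lc (\<epsilon>) p (case_nat x e)" if ne: "~ sat Lc (\<epsilon>) (All p) e"
   proof -
    obtain x where x: "x \<in> Lc" "~ sat Lc (\<epsilon>) p (case_nat x e)" using ne by auto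
    obtain c where c: "c \<in> ext l" "ALL i<fvb p. e i \<in> ext (H c)"
     using H_lim_finite[OF l(1), of e "fvb p"] e by blast
    have cO: "c \<in> On" "c \<in> D" using On_mem[OF l(2) c(1)] by auto
    \<comment> \<open>Values of \<open>e\<close> that \<open>p\<close> does not read may lie outside
      level \<open>c\<close>; they are replaced by \<open>om\<close>, which is in every
      level.\<close>
    define e' where "e' i = (if i < fvb p then e i else om)" for i
    have "e' i \<in> ext (H c)" for i using c(2) subsetD[OF b_H[OF cO(2)] om_b] unfolding e'_def by simp
    then obtain s where s: "s \<in> ext (asn (H c))" "ALL i<fvb p. ev s i = e' i"
     using ex_asn[of "H c" e' "fvb p"] cO by auto
    have eq: "sat Lc (\<epsilon>) p (case_nat z (ev s)) = sat Lc (\<epsilon>) p (case_nat z e)" for z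
     by (rule sat_fvb) (use s(2) in \<open>auto simp: e'_def split: nat.splits\<close>)
    obtain a where a: "a \<in> On" "x \<in> ext (H a)" using x(1) unfolding Lc_def by blast
    let ?P = "%c. EX x:ext (H c). ~ sat Lc (\<epsilon>) p (case_nat x (ev s))"
    have "?P a" using a(2) x(2) eq by blast
    from lst_prop[of a ?P, OF a(1) this] have "?P (w s)" unfolding w_def .
    then obtain z where z: "z \<in> ext (H (w s))" "~ sat Lc (\<epsilon>) p (case_nat z (ev s))" by blast
    have wO: "w s \<in> On" unfolding w_def by simp
    have "w s \<in> ext (suc (w s))" using wO by simp
    then have "w s \<in> ext (g c)" using s(1) gO[OF cO(1)] unfolding g_def by auto
    moreover have "g c \<epsilon> l" using gl c(1) unfolding closes_def by blast
    ultimately have "w s \<in> ext l" using On_trans[OF l(2), of "g c" "w s"] gO[OF cO(1)] by auto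
    then have "z \<in> ext (H l)" using z(1) H_lim[OF l(1)] by blast
    then show ?thesis using z(2) eq by blast
   qed
   then show "sat Lc (\<epsilon>) (All p) e = sat (ext (H l)) (\<epsilon>) (All p) e" unfolding sat.simps using r sub by blast
  qed
 qed
 then show ?case using k(1) by blast
qed

lemma reflect_list:
 assumes "a \<in> On" shows "EX l. lim l & a \<in> ext l & (ALL p:set ps. reflects p l)"
proof -
 have "EX h. ofun h & (ALL l. closes h l --> (ALL p:set ps. reflects p l))"
 proof (induction ps)
  case Nil
  have "ofun (%x. x)" unfolding ofun_def by (auto intro: dfn_intros)
  then show ?case by auto
 next
  case (Cons p ps)
  then obtain h where h: "ofun h" "ALL l. closes h l --> (ALL p:set ps. reflects p l)" by blast
  obtain g where g: "ofun g" "ALL l. closes g l --> reflects p l" using reflect_ofun by blast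
  obtain k where "ofun k" "ALL l. closes k l --> closes h l & closes g l"
   using ofun_max[OF h(1) g(1)] by blast
  then show ?case using h g by (intro exI[of _ k]) auto
 qed
 then obtain h where h: "ofun h" "ALL l. closes h l --> (ALL p:set ps. reflects p l)" by blast
 then obtain l where "closes h l" "a \<in> ext l" using closes_unbounded[OF h(1) assms] by blast
 then show ?thesis using h(2) unfolding closes_def by blast
qed

end

section \<open>The constructible universe is a model of ZF\<close>

context zfmL
begin

interpretation L: set_structure Lc mem .

lemma reflectsD:
 assumes "reflects p l" "!!i. e i \<in> ext (H l)" shows "sat Lc (\<epsilon>) p e = sat (ext (H l)) (\<epsilon>) p e"
 by (rule assms(1)[unfolded reflects_def, rule_format]) (rule assms(2))

lemma L_ext: "a \<in> Lc ==> L.ext a = ext a"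
 unfolding L.ext_def ext_def using Lc_D Lc_trans[of a] by (auto simp: ext_def)

lemma Defx_Lc:
 assumes "a \<in> On" "Y \<in> Defx (ext (H a))"
 shows "isset Y" "mk Y \<in> Lc" "mk Y \<in> ext (DefS (H a))"
proof -
 have HD: "H a \<in> D" using assms by simp
 show i: "isset Y" by (rule DefS_Defx(2)[OF HD assms(2)])
 show 1: "mk Y \<in> ext (DefS (H a))" unfolding DefS_Defx(1)[OF HD] using i assms(2) by simp
 have "a \<in> ext (suc a)" using assms by simp
 from DefS_H[OF suc_D[OF OnD[OF assms(1)]] this] have "mk Y \<in> ext (H (suc a))" using 1 by blast
 then show "mk Y \<in> Lc" using LcI[of "suc a"] assms(1) by blast
qed

lemma H_Lc: "a \<in> On ==> H a \<in> Lc"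
proof -
 assume a: "a \<in> On"
 then have 1: "H a \<in> ext (DefS (H a))" by (intro self_DefS H_nonempty) auto
 have "a \<in> ext (suc a)" using a by simp
 from DefS_H[OF suc_D[OF OnD[OF a]] this] have "H a \<in> ext (H (suc a))" using 1 by blast
 then show "H a \<in> Lc" using LcI[of "suc a"] a by blast
qed

lemma Lc_bound_finite:
 assumes "finite T" "T \<subseteq> Lc" obtains a where "a \<in> On" "T \<subseteq> ext (H a)"
proof -
 have "isset T" using assms Lc_D by (intro isset_finite) auto
 then show thesis using Lc_bound[OF _ assms(2)] that by blast
qed

text \<open>The defining formula is reflected to a level that contains the set and the parameters;
  over that level the subset is definable.\<close>

lemma sepL:
 assumes P: "L.dfn Lc (%e. P (e 0))" and a: "a \<in> Lc"
 shows "EX c:Lc. ext c = {x \<in> ext a. P x}"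
proof -
 obtain p s where s: "!!i c. s i = Inr c ==> c \<in> Lc \<inter> Lc"
  and p: "!!e. L.env e ==> P (e 0) = sat Lc (\<epsilon>) p (%i. case_sum e id (s i))"
  by (rule L.dfnE[OF P]) (rule that)
 \<comment> \<open>Slots beyond the variables of \<open>p\<close> are redirected, so that only
   finitely many parameters have to be captured by a level.\<close>
 define s' where "s' i = (if i < fvb p then s i else Inl 0)" for i
 define t where "t i = (case s' i of Inl j => (%e :: nat => 'm. e 0) | Inr c => (%_. c))" for i
 define T where "T = insert a {c. EX i<fvb p. s i = Inr c}"
 have "{c. EX i<fvb p. s i = Inr c} \<subseteq> (%i. projr (s i)) ` {..<fvb p}" by force
 then have "finite {c. EX i<fvb p. s i = Inr c}" by (rule finite_subset) simp
 then have "finite T" unfolding T_def by simp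
 moreover have "T \<subseteq> Lc" unfolding T_def using a s by auto
 ultimately obtain a0 where a0: "a0 \<in> On" "T \<subseteq> ext (H a0)" by (rule Lc_bound_finite)
 obtain l where l: "lim l" "a0 \<in> ext l" "reflects p l" using reflect_list[OF a0(1), of "[p]"] by auto
 have lO: "l \<in> On" using l(1) by (rule lim_On)
 let ?S = "ext (H l)"
 interpret T: set_structure ?S mem .
 have TS: "T \<subseteq> ?S" using a0(2) H_mem_mono[OF lO l(2)] by blast
 have td: "T.dtm ?S (t i)" for i
 proof (cases "s' i")
  case (Inl j)
  then show ?thesis unfolding t_def by (simp add: T.dtm_var)
 next
  case (Inr c)
  then have "c \<in> T" unfolding T_def s'_def by (auto split: if_splits)
  then show ?thesis unfolding t_def using Inr TS by (auto intro!: T.dtm_const)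
 qed
 have aS: "a \<in> ?S" using TS unfolding T_def by blast
 have "T.dfn ?S (%e. e 0 \<epsilon> a & sat ?S (\<epsilon>) p (%i. t i e))"
  using aS by (intro T.dfn_conj T.dfn_mem T.dtm_var T.dtm_const T.dfn_sat_terms td)
 moreover have "(%i. t i e) = (%i. t i (%_. e 0))" for e unfolding t_def by (auto split: sum.splits)
 then have "sat ?S (\<epsilon>) p (%i. t i e) = sat ?S (\<epsilon>) p (%i. t i (%_. e 0))" for e by (rule arg_cong)
 ultimately have "T.dfn ?S (%e. e 0 \<epsilon> a & sat ?S (\<epsilon>) p (%i. t i (%_. e 0)))"
  by (elim T.dfn_cong) blast
 from Defx_dfn[of ?S "%x. x \<epsilon> a & sat ?S (\<epsilon>) p (%i. t i (%_. x))", OF this]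
 have Y: "{x \<in> ?S. x \<epsilon> a & sat ?S (\<epsilon>) p (%i. t i (%_. x))} \<in> Defx ?S" using aS by blast
 have SL: "?S \<subseteq> Lc" using LcI[OF lO] by blast
 have eq: "sat ?S (\<epsilon>) p (%i. t i (%_. x)) = P x" if x: "x \<in> ?S" for x
 proof -
  have "t i (%_. x) \<in> ?S" for i
   using T.dtmD[OF td, of "%_. x" i] x by (simp add: T.env_def)
  then have "sat ?S (\<epsilon>) p (%i. t i (%_. x)) = sat Lc (\<epsilon>) p (%i. t i (%_. x))"
   by (rule reflectsD[OF l(3), symmetric])
  also have "\<dots> = sat Lc (\<epsilon>) p (%i. case_sum (%_. x) id (s i))"
   by (rule sat_fvb) (auto simp: t_def s'_def split: sum.splits)
  also have "\<dots> = P x" using p[of "%_. x"] x SL by (auto simp: L.env_def)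
  finally show ?thesis .
 qed
 have sub: "ext a \<subseteq> ?S" using H_trans[OF OnD[OF lO] aS] .
 have "{x \<in> ?S. x \<epsilon> a & sat ?S (\<epsilon>) p (%i. t i (%_. x))} = {x \<in> ext a. P x}"
  using eq sub by auto
 then show ?thesis using Defx_Lc[OF lO Y] by (metis ext_mk)
qed

lemma Lc_ex_ext:
 assumes "a \<in> On" "set_structure.dfn (ext (H a)) mem (ext (H a)) (%e. P (e 0))"
  "Y = {x \<in> ext (H a). P x}"
 shows "EX c:Lc. ext c = Y"
proof -
 have "Y \<in> Defx (ext (H a))" unfolding assms(3)
  by (rule Defx_dfn[OF assms(2)]) (use H_nonempty assms in auto)
 from Defx_Lc[OF assms(1) this] show ?thesis by (metis ext_mk)
qed

lemma nm_b: "nm n \<in> ext b"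
proof -
 have "nm n \<in> ext om" by simp
 then show ?thesis using b_trans[OF om_b] by blast
qed

lemma L_ax_ext: L.extensionality
 unfolding L.extensionality_def
proof (intro ballI impI)
 fix a c assume a: "a \<in> Lc" "c \<in> Lc" and "ALL x:Lc. x \<epsilon> a <-> x \<epsilon> c"
 then have "L.ext a = L.ext c" unfolding L.ext_def by blast
 then show "a = c" using L_ext a ext_inj Lc_D by metis
qed

lemma L_ax_pair: L.pairing
 unfolding L.pairing_def
proof (intro ballI)
 fix a c assume ac: "a \<in> Lc" "c \<in> Lc"
 then obtain l where l: "l \<in> On" "{a, c} \<subseteq> ext (H l)" using Lc_bound_finite[of "{a, c}"] by auto
 interpret T: set_structure "ext (H l)" mem .
 have "T.dfn (ext (H l)) (%e. e 0 = a \<or> e 0 = c)"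
  using l by (intro T.dfn_disj T.dfn_eq T.dtm_var T.dtm_const) auto
 from Lc_ex_ext[OF l(1), of "%x. x = a \<or> x = c", OF this] l(2)
 obtain d where d: "d \<in> Lc" "ext d = {a, c}" by auto
 then have "L.upair d a c" unfolding L.upair_def using L_ext[OF d(1)] unfolding L.ext_def by auto
 then show "EX d:Lc. L.upair d a c" using d by blast
qed

lemma L_ax_union: L.union_axiom
 unfolding L.union_axiom_def
proof (intro ballI)
 fix a assume a: "a \<in> Lc"
 then obtain l where l: "l \<in> On" "a \<in> ext (H l)" unfolding Lc_def by blast
 interpret T: set_structure "ext (H l)" mem .
 have lD: "l \<in> D" using l by simp
 have "T.dfn (ext (H l)) (%e. EX y:ext (H l). y \<epsilon> a & e 0 \<epsilon> y)"
  by (intro T.dfn_ex T.dfn_conj T.dfn_mem T.dtm_var T.dtm_const l)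
 from Lc_ex_ext[OF l(1), of "%x. EX y:ext (H l). y \<epsilon> a & x \<epsilon> y", OF this]
 obtain d where d: "d \<in> Lc" "ext d = {x \<in> ext (H l). EX y:ext (H l). y \<epsilon> a & x \<epsilon> y}" by blast
 have "L.big_union d a"
  unfolding L.big_union_def
 proof (intro ballI iffI)
  fix x assume x: "x \<in> Lc" "x \<epsilon> d"
  then have "x \<in> ext d" using Lc_D by simp
  then show "EX y:Lc. y \<epsilon> a & x \<epsilon> y" unfolding d(2) using LcI[OF l(1)] by blast
 next
  fix x assume x: "x \<in> Lc" "EX y:Lc. y \<epsilon> a & x \<epsilon> y"
  then obtain y where y: "y \<in> Lc" "y \<epsilon> a" "x \<epsilon> y" by blast
  then have "y \<in> ext (H l)" using H_trans[OF lD l(2)] Lc_D[of y] by auto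
  moreover then have "x \<in> ext (H l)" using H_trans[OF lD, of y] y(3) Lc_D[OF x(1)] by auto
  ultimately have "x \<in> ext d" unfolding d(2) using y by blast
  then show "x \<epsilon> d" by simp
 qed
 then show "EX d:Lc. L.big_union d a" using d by blast
qed

text \<open>The constructible subsets of \<open>a\<close> form a set of the outer model, so one
  level contains them all, and over it their collection is definable.\<close>

lemma L_ax_pow: L.powerset_axiom
 unfolding L.powerset_axiom_def
proof (intro ballI)
 fix a assume a: "a \<in> Lc"
 have aD: "a \<in> D" using Lc_D[OF a] .
 let ?T = "{x \<in> {x \<in> D. ext x \<subseteq> ext a}. x \<in> Lc}"
 have p: "isset {x \<in> D. ext x \<subseteq> ext a}" by (rule isset_pow[OF aD])
 have "isset {x \<in> ext (mk {x \<in> D. ext x \<subseteq> ext a}). x \<in> Lc}"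
  by (rule isset_sep) (intro dfn_intros mk_D p)+
 then have T: "isset ?T" unfolding ext_mk[OF p] .
 obtain l0 where l0: "l0 \<in> On" "?T \<subseteq> ext (H l0)" by (rule Lc_bound[OF T]) auto
 have "a \<in> ?T" using a aD by simp
 then have al: "a \<in> ext (H l0)" using l0 by blast
 have l: "l0 \<in> D" using l0 by simp
 interpret T: set_structure "ext (H l0)" mem .
 have "T.dfn (ext (H l0)) (%e. ALL y:ext (H l0). y \<epsilon> e 0 --> y \<epsilon> a)"
  by (intro T.dfn_all T.dfn_imp T.dfn_mem T.dtm_var T.dtm_const al)
 from Lc_ex_ext[OF l0(1), of "%x. ALL y:ext (H l0). y \<epsilon> x --> y \<epsilon> a", OF this]
 obtain d where d: "d \<in> Lc" "ext d = {x \<in> ext (H l0). ALL y:ext (H l0). y \<epsilon> x --> y \<epsilon> a}" by blast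
 have "L.powerset_of d a"
  unfolding L.powerset_of_def
 proof (intro ballI iffI)
  fix x assume x: "x \<in> Lc" "x \<epsilon> d"
  then have "x \<in> ext d" using Lc_D by simp
  then have "x \<in> ext (H l0)" "ALL y:ext (H l0). y \<epsilon> x --> y \<epsilon> a" unfolding d(2) by blast+
  moreover have "ext x \<subseteq> ext (H l0)" using H_trans[OF l] calculation(1) by blast
  ultimately have "ext x \<subseteq> ext a" by auto
  then have "z \<epsilon> a" if "z \<in> Lc" "z \<epsilon> x" for z
   using subsetD[of "ext x" "ext a" z] Lc_D[OF that(1)] that(2) by simp
  then show "L.sub x a" unfolding L.sub_def by blast
 next
  fix x assume x: "x \<in> Lc" "L.sub x a"
  then have "ext x \<subseteq> ext a" unfolding L.sub_def using Lc_trans[OF x(1)] by auto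
  then have "x \<in> ext (H l0)" using l0(2) x(1) Lc_D by blast
  moreover have "ALL y:ext (H l0). y \<epsilon> x --> y \<epsilon> a" using \<open>ext x \<subseteq> ext a\<close> by auto
  ultimately have "x \<in> ext d" unfolding d(2) by blast
  then show "x \<epsilon> d" by simp
 qed
 then show "EX d:Lc. L.powerset_of d a" using d by blast
qed

lemma om_Lc: "om \<in> Lc" and nm_Lc: "nm n \<in> Lc"
 using b_Lc om_b nm_b by blast+

lemma L_ax_inf: L.infinity_axiom
 unfolding L.infinity_axiom_def
proof (rule bexI[OF _ om_Lc])
 have "L.is_empty (nm 0)" unfolding L.is_empty_def using Lc_D by auto
 moreover have "EX s:Lc. L.succ_of s n & s \<epsilon> om" if n: "n \<in> Lc" "n \<epsilon> om" for n
 proof -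
  obtain k where k: "n = nm k" using omE[OF Lc_D[OF n(1)] n(2)] .
  have "L.succ_of (nm (Suc k)) n"
   unfolding L.succ_of_def
  proof
   fix x assume "x \<in> Lc"
   then have "x \<epsilon> nm (Suc k) <-> x \<in> ext (nm (Suc k))" using Lc_D by simp
   also have "\<dots> <-> x = nm k \<or> x \<in> ext (nm k)" by simp
   finally show "x \<epsilon> nm (Suc k) <-> x \<epsilon> n \<or> x = n" unfolding k using \<open>x \<in> Lc\<close> Lc_D by auto
  qed
  then show ?thesis using nm_Lc nm_om by blast
 qed
 ultimately show "L.is_inductive om" unfolding L.is_inductive_def using nm_Lc nm_om by blast
qed

lemma L_ax_sep: L.separation
 unfolding L.separation_def
proof (intro allI impI ballI)
 fix p :: fm and e :: "nat => 'm" and a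
 assume e: "ALL i. e i \<in> Lc" and a: "a \<in> Lc"
 let ?t = "%i. case i of 0 => (%e. e 0) | Suc i => (%_. e i)"
 have "L.dtm Lc (?t i)" for i using e by (cases i) (auto intro: L.dtm_var L.dtm_const)
 then have "L.dfn Lc (%e. sat Lc (\<epsilon>) p (%i. ?t i e))" by (rule L.dfn_sat_terms)
 then have "L.dfn Lc (%e'. sat Lc (\<epsilon>) p (case_nat (e' 0) e))"
  by (rule L.dfn_cong) (rule arg_cong[of _ _ "sat Lc (\<epsilon>) p"], auto split: nat.splits)
 from sepL[of "%x. sat Lc (\<epsilon>) p (case_nat x e)", OF this a]
 obtain c where c: "c \<in> Lc" "ext c = {x \<in> ext a. sat Lc (\<epsilon>) p (case_nat x e)}" by blast
 have "x \<epsilon> c <-> x \<epsilon> a & sat Lc (\<epsilon>) p (case_nat x e)" if x: "x \<in> Lc" for x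
 proof -
  have "x \<epsilon> c <-> x \<in> ext c" using Lc_D[OF x] by simp
  then show ?thesis unfolding c(2) using Lc_D[OF x] by simp
 qed
 then show "EX c:Lc. ALL x:Lc. x \<epsilon> c <-> x \<epsilon> a & sat Lc (\<epsilon>) p (case_nat x e)" using c(1) by blast
qed

text \<open>The image is formed by replacement in the outer model, enclosed in a level, and cut out
  there by \<open>sepL\<close>.\<close>

lemma L_ax_rep: L.replacement
 unfolding L.replacement_def
proof (intro allI impI ballI)
 fix p :: fm and e :: "nat => 'm" and a
 let ?Q = "%x y. sat Lc (\<epsilon>) p (case_nat x (case_nat y e))"
 assume e: "ALL i. e i \<in> Lc" and a: "a \<in> Lc" and f: "ALL x:Lc. x \<epsilon> a --> (EX! y. y \<in> Lc & ?Q x y)"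
 have aD: "a \<in> D" using Lc_D[OF a] .
 let ?f = "%x. thex (%y. y \<in> Lc & ?Q x y)"
 have fe: "?f x \<in> Lc & ?Q x (?f x) & (ALL y:Lc. ?Q x y --> y = ?f x)" if x: "x \<in> ext a" for x
 proof -
  have "x \<in> Lc" using Lc_trans[OF a x] .
  then have "EX! y. y \<in> Lc & ?Q x y" using f x by simp
  then obtain y where y: "y \<in> Lc & ?Q x y" "!!z. z \<in> Lc & ?Q x z ==> z = y" by blast
  have "?f x = y" by (rule thex_eq) (use y Lc_D in blast)+
  then show ?thesis using y by blast
 qed
 have Qd: "dfn D (%e'. e' 0 \<in> Lc & ?Q (e' (Suc 0)) (e' 0))"
 proof -
  let ?t = "%i. case i of 0 => (%e. e (Suc 0)) | Suc 0 => (%e. e 0) | Suc (Suc i) => (%_. e i)"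
  have "dtm D (?t i)" for i using e Lc_D by (auto intro: dtm_var dtm_const split: nat.splits)
  then have "dfn D (%e. sat Lc (\<epsilon>) p (%i. ?t i e))"
   using Lc_D by (intro dfn_sat_class dfn_Lc dtm_var) auto
  moreover have "(%i. ?t i e') = case_nat (e' (Suc 0)) (case_nat (e' 0) e)" for e' by (auto split: nat.splits)
  ultimately show ?thesis by (intro dfn_conj dfn_Lc dtm_var) simp
 qed
 have fd: "dtm D (%e'. ?f (e' 0))" by (rule dtm_thex) (rule Qd)
 have "isset (?f ` ext a)" by (rule isset_rep[OF fd aD])
 moreover have "?f ` ext a \<subseteq> Lc" using fe by blast
 ultimately obtain l where l: "l \<in> On" "?f ` ext a \<subseteq> ext (H l)" by (rule Lc_bound)
 have LQ: "L.dfn Lc (%e'. EX x:Lc. x \<epsilon> a & ?Q x (e' 0))"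
 proof (rule L.dfn_ex, intro L.dfn_conj L.dfn_mem L.dtm_var L.dtm_const a)
  let ?t = "%i. case i of 0 => (%e. e 0) | Suc 0 => (%e. e (Suc 0)) | Suc (Suc i) => (%_. e i)"
  have "L.dtm Lc (?t i)" for i using e by (auto intro: L.dtm_var L.dtm_const split: nat.splits)
  then have "L.dfn Lc (%e. sat Lc (\<epsilon>) p (%i. ?t i e))" by (rule L.dfn_sat_terms)
  moreover have "(%i. ?t i e') = case_nat (e' 0) (case_nat (e' (Suc 0)) e)" for e' by (auto split: nat.splits)
  ultimately show "L.dfn Lc (%e'. ?Q (e' 0) (e' (Suc 0)))" by simp
 qed
 from sepL[of "%y. EX x:Lc. x \<epsilon> a & ?Q x y", OF this H_Lc[OF l(1)]]
 obtain c where c: "c \<in> Lc" "ext c = {y \<in> ext (H l). EX x:Lc. x \<epsilon> a & ?Q x y}" by blast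
 have "y \<epsilon> c <-> (EX x:Lc. x \<epsilon> a & ?Q x y)" if y: "y \<in> Lc" for y
 proof -
  have "y \<epsilon> c <-> y \<in> ext c" using Lc_D[OF y] by simp
  also have "\<dots> <-> (EX x:Lc. x \<epsilon> a & ?Q x y)"
  proof
   assume "EX x:Lc. x \<epsilon> a & ?Q x y"
   then obtain x where x: "x \<in> Lc" "x \<epsilon> a" "?Q x y" by blast
   then have xa: "x \<in> ext a" using Lc_D by simp
   then have "y = ?f x" using fe[OF xa] y x(3) by blast
   then have "y \<in> ext (H l)" using l(2) xa by blast
   then show "y \<in> ext c" unfolding c(2) using x by blast
  qed (simp only: c(2) mem_Collect_eq)
  finally show ?thesis .
 qed
 then show "EX c:Lc. ALL y:Lc. y \<epsilon> c <-> (EX x:Lc. x \<epsilon> a & ?Q x y)" using c(1) by blast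
qed

lemma L_wf: "wfP (%x y. x \<in> Lc & y \<in> Lc & x \<epsilon> y)"
 by (rule wfp_subset[OF wf_mem]) (use Lc_D in auto)

theorem zfm_Lc: "zfm Lc mem"
proof (rule zfm.intro)
 show "Lc ~= {}" using om_Lc by blast
qed (rule L_ax_ext L_ax_pair L_ax_union L_ax_pow L_ax_inf L_ax_sep L_ax_rep L_wf)+

text \<open>Being an ordinal is absolute for transitive sets, so the ordinals of level
  \<open>a\<close> are definable over it. They form an ordinal that is at least \<open>a\<close> and
  belongs to the next level.\<close>

lemma On_suc_H: "a \<in> On ==> a \<in> ext (H (suc a))"
proof -
 assume "a \<in> On"
 then have "a \<in> D" by simp
 then show ?thesis using \<open>a \<in> On\<close>
 proof (induction a rule: mem_induct)
  case (mem a)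
  have aH: "ext a \<subseteq> ext (H a)"
  proof
   fix c assume c: "c \<in> ext a"
   have cO: "c \<in> On" using On_mem[OF mem.prems c] .
   have "ext (suc c) \<subseteq> ext a" using c cO ordinal_trans[OF On_ordinal[OF mem.prems] c] by auto
   then have "ext (H (suc c)) \<subseteq> ext (H a)" using cO mem.hyps by (intro H_mono) auto
   then show "c \<in> ext (H a)" using mem.IH[OF c cO] by blast
  qed
  let ?S = "ext (H a)"
  have tr: "x \<in> ?S ==> ext x \<subseteq> ?S" for x using H_trans[OF mem.hyps] .
  have trD: "x \<in> ?S ==> y \<in> D ==> y \<epsilon> x ==> y \<in> ?S" for x y using tr[of x] by auto
  interpret T: set_structure ?S mem .
  let ?P = "%x. (ALL y:?S. y \<epsilon> x --> (ALL z:?S. z \<epsilon> y --> z \<epsilon> x)) &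
    (ALL y:?S. y \<epsilon> x --> (ALL z:?S. z \<epsilon> y --> (ALL w:?S. w \<epsilon> z --> w \<epsilon> y)))"
  have "T.dfn ?S (%e. ?P (e 0))"
   by (intro T.dfn_conj T.dfn_all T.dfn_imp T.dfn_mem T.dtm_var)
  from Defx_dfn[of ?S ?P, OF this] have Y: "{x \<in> ?S. ?P x} \<in> Defx ?S" using H_nonempty[OF mem.hyps] by blast
  have PO: "?P x <-> x \<in> On" if x: "x \<in> ?S" for x
  proof
   assume P: "?P x"
   note P1 = conjunct1[OF P, rule_format] and P2 = conjunct2[OF P, rule_format]
   have "ordinal x" unfolding ordinal_iff
   proof (intro conjI ballI subsetI)
    fix y z assume y: "y \<in> ext x" and z: "z \<in> ext y"
    have yS: "y \<in> ?S" using tr[OF x] y by blast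
    have zS: "z \<in> ?S" using tr[OF yS] z by blast
    show "z \<in> ext x" using P1[OF yS _ zS] y z by simp
   next
    fix y z w assume y: "y \<in> ext x" and z: "z \<in> ext y" and w: "w \<in> ext z"
    have yS: "y \<in> ?S" using tr[OF x] y by blast
    have zS: "z \<in> ?S" using tr[OF yS] z by blast
    have wS: "w \<in> ?S" using tr[OF zS] w by blast
    show "w \<in> ext y" using P2[OF yS _ zS _ wS] y z w by simp
   qed
   then show "x \<in> On" using x by (intro OnI) auto
  next
   assume "x \<in> On"
   then have o: "ordinal x" by (rule On_ordinal)
   show "?P x"
   proof (intro conjI ballI impI)
    fix y z assume "y \<in> ?S" "y \<epsilon> x" "z \<in> ?S" "z \<epsilon> y"
    then show "z \<epsilon> x" using ordinal_trans[OF o, of y z] by simp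
   next
    fix y z w assume "y \<in> ?S" "y \<epsilon> x" "z \<in> ?S" "z \<epsilon> y" "w \<in> ?S" "w \<epsilon> z"
    then show "w \<epsilon> y" using ordinal_trans[OF ordinal_mem[OF o, of y], of z w] by simp
   qed
  qed
  let ?g = "mk {x \<in> ?S. ?P x}"
  have g: "isset {x \<in> ?S. ?P x}" "?g \<in> ext (DefS (H a))" using Defx_Lc[OF mem.prems Y] by blast+
  have eg: "ext ?g = {x \<in> ?S. ?P x}" by (rule ext_mk[OF g(1)])
  have eg': "ext ?g = ?S \<inter> On" unfolding eg using PO by blast
  have gO: "?g \<in> On"
  proof (rule transitive_On)
   show "ext x \<subseteq> ext ?g" if "x \<in> ext ?g" for x
    using that tr[of x] On_mem[of x] unfolding eg' by blast
  qed (use g(1) eg' in auto)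
  have "ext a \<subseteq> ext ?g" unfolding eg' using aH On_mem[OF mem.prems] by blast
  then have ag: "a \<epsilon> ?g \<or> a = ?g" using On_sub[OF mem.prems gO] by blast
  have asa: "a \<in> ext (suc a)" using mem.hyps by simp
  have gH: "?g \<in> ext (H (suc a))" using DefS_H[OF suc_D[OF mem.hyps] asa] g(2) by blast
  from ag show ?case
  proof
   assume "a \<epsilon> ?g"
   then show ?thesis using H_trans[OF suc_D[OF mem.hyps] gH] mem.hyps by auto
  qed (use gH in simp)
 qed
qed

lemma On_Lc: "On \<subseteq> Lc"
 using On_suc_H LcI[OF suc_On] by blast

interpretation LZ: zfm Lc mem by (rule zfm_Lc)

lemma L_mk:
 assumes "c \<in> Lc" "ext c = S" shows "L.mk S = mk S" "L.isset S" "L.mk S = c"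
proof -
 have e: "L.ext c = S" using L_ext assms by simp
 have "L.mk (L.ext c) = c" using assms(1) by (rule LZ.mk_ext)
 then show c: "L.mk S = c" using e by simp
 show "L.isset S" using LZ.isset_ext[OF assms(1)] e by simp
 show "L.mk S = mk S" using c mk_ext[OF Lc_D[OF assms(1)]] assms(2) by simp
qed

lemma L_nm: "LZ.nm n = nm n"
proof (induction n)
 case 0
 have "L.mk {} = nm 0" by (rule L_mk(3)[OF nm_Lc]) simp
 then show ?case by simp
next
 case (Suc n)
 have "L.mk (insert (nm n) (ext (nm n))) = nm (Suc n)" by (rule L_mk(3)[OF nm_Lc]) simp
 then show ?case using Suc L_ext[OF nm_Lc] by (simp del: nm.simps)
qed

lemma L_om: "LZ.om = om"
proof -
 have "L.mk (range nm) = om" by (rule L_mk(3)[OF om_Lc ext_om])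
 moreover have "LZ.nm = nm" using L_nm by blast
 ultimately show ?thesis unfolding LZ.om_def by simp
qed

lemma zfmL_Lc: "zfmL Lc mem b"
proof (rule zfmL.intro[OF zfm_Lc], rule zfmL_axioms.intro)
 have "H (nm 0) = b"
 proof (rule ext_inj)
  show "ext (H (nm 0)) = ext b" unfolding ext_Lh[OF b_D nm_D] by simp
 qed auto
 then show b: "b \<in> Lc" using H_Lc[OF nm_On] by metis
 show "LZ.om \<in> L.ext b" unfolding L_om L_ext[OF b] by (rule om_b)
 show "L.ext x \<subseteq> L.ext b" if "x \<in> L.ext b" for x
  using that b_trans[of x] L_ext[OF b] L_ext[OF b_Lc[of x]] by simp
qed

lemma L_On: "LZ.On = On"
proof -
 have "L.ordinal x <-> ordinal x" if x: "x \<in> Lc" for x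
 proof -
  have e: "L.ext y = ext y" if "y \<in> ext x" for y using L_ext[OF Lc_trans[OF x that]] .
  have e2: "L.ext z = ext z" if "y \<in> ext x" "z \<in> ext y" for y z
   using L_ext[OF Lc_trans[OF Lc_trans[OF x that(1)] that(2)]] .
  have 1: "(ALL y:ext x. L.ext y \<subseteq> ext x) <-> (ALL y:ext x. ext y \<subseteq> ext x)"
   by (rule ball_cong[OF refl]) (simp only: e)
  have 2: "(ALL y:ext x. ALL z:L.ext y. L.ext z \<subseteq> L.ext y) <-> (ALL y:ext x. ALL z:ext y. ext z \<subseteq> ext y)"
  proof (rule ball_cong[OF refl])
   fix y assume y: "y \<in> ext x"
   show "(ALL z:L.ext y. L.ext z \<subseteq> L.ext y) <-> (ALL z:ext y. ext z \<subseteq> ext y)"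
    unfolding e[OF y] by (rule ball_cong[OF refl]) (simp only: e2[OF y])
  qed
  show ?thesis unfolding LZ.ordinal_iff ordinal_iff L_ext[OF x] 1 2 ..
 qed
 then show ?thesis unfolding LZ.On_def using On_Lc On_ordinal OnI Lc_D by blast
qed

text \<open>The hierarchy is absolute because, by \<open>DefS_Defx\<close>, the definable power set
  depends only on the extension of the level.\<close>

lemma L_Lh: "a \<in> On ==> LZ.Lh b a = H a"
proof -
 interpret LL: zfmL Lc mem b by (rule zfmL_Lc)
 assume "a \<in> On"
 then have "a \<in> D" by simp
 then show ?thesis using \<open>a \<in> On\<close>
 proof (induction a rule: mem_induct)
  case (mem a)
  have aL: "a \<in> Lc" using On_Lc mem.prems by blast
  have "L.ext (LZ.DefS (LZ.Lh b c)) = ext (DefS (H c))" if c: "c \<in> ext a" for c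
  proof -
   have cO: "c \<in> On" using On_mem[OF mem.prems c] .
   have e: "LZ.Lh b c = H c" by (rule mem.IH[OF c cO])
   have HL: "H c \<in> Lc" by (rule H_Lc[OF cO])
   have HD: "H c \<in> D" using Lc_D[OF HL] .
   have csc: "c \<in> ext (suc c)" using cO by simp
   have "ext (DefS (H c)) \<subseteq> Lc"
    using DefS_H[OF suc_D csc] LcI[OF suc_On[OF cO]] cO by auto
   then show ?thesis
    unfolding e LZ.DefS_Defx(1)[OF HL] DefS_Defx(1)[OF HD] L_ext[OF HL]
    using L_ext Lc_D unfolding DefS_Defx(1)[OF HD] by auto
  qed
  then have "L.ext (LZ.Lh b a) = ext (H a)"
   unfolding LZ.ext_Lh[OF LL.b_D aL] ext_Lh[OF b_D mem.hyps] L_ext[OF aL] L_ext[OF LL.b_D] by simp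
  moreover have "LZ.Lh b a \<in> Lc" by (rule LZ.Lh_D[OF LL.b_D aL])
  ultimately show ?case using L_ext ext_inj[of "LZ.Lh b a" "H a"] Lc_D mem.hyps by simp
 qed
qed

theorem V_eq_L: "Lc = (\<Union>a\<in>LZ.On. L.ext (LZ.Lh b a))"
proof -
 have "(\<Union>a\<in>On. L.ext (LZ.Lh b a)) = (\<Union>a\<in>On. ext (H a))"
  by (rule SUP_cong[OF refl]) (simp only: L_Lh L_ext[OF H_Lc])
 then show ?thesis by (simp only: L_On Lc_def[symmetric])
qed

end

section \<open>Consequences of constructibility\<close>

context zfm
begin

text \<open>Countability inside the model, for external sets of elements. The map is only required
  to cover \<open>S\<close>, which makes subsets and definable images immediate.\<close>

definition cnt :: "'m set => bool" where
 "cnt S <-> (EX f:D. ALL x:S. EX n. ap f (nm n) = x)"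

lemma cnt_subset: "cnt T ==> S \<subseteq> T ==> cnt S"
 unfolding cnt_def by blast

lemma cnt_image:
 assumes "cnt S" "dtm D (%e. g (e 0))" shows "cnt (g ` S)"
proof -
 obtain f where f: "f \<in> D" "ALL x:S. EX n. ap f (nm n) = x" using assms(1) unfolding cnt_def by blast
 have "dtm D (%e. g (ap f (e 0)))" by (rule dtm1[OF assms(2)]) (intro dfn_intros f)
 note l = lam_function_on[OF this om_D]
 have "EX n. ap (lam (ext om) (%x. g (ap f x))) (nm n) = y" if y: "y \<in> g ` S" for y
 proof -
  obtain x where x: "x \<in> S" "y = g x" using y by blast
  then obtain n where "ap f (nm n) = x" using f by blast
  then show ?thesis using l(3)[of "nm n"] x by auto
 qed
 then show ?thesis unfolding cnt_def using l(1) by blast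
qed

end

text \<open>The universe is constructible from the real \<open>x0\<close>. The base is omega with
  \<open>om\<close> and \<open>x0\<close> added, so all its members are definable from
  \<open>x0\<close>, and the collapse in the condensation argument fixes them.\<close>

locale zfmVL = zfmL D mem b
 for D :: "'m set" and mem :: "'m => 'm => bool"  (infix "\<epsilon>" 50) and b +
 fixes x0 :: 'm
 assumes VL: "D = (\<Union>a\<in>On. ext (Lh b a))"
  and x0_D [simp, intro]: "x0 \<in> D" and x0_om: "ext x0 \<subseteq> ext om"
  and ext_b: "ext b = insert om (insert x0 (ext om))"
begin

lemma Lc_eq_D: "Lc = D"
 unfolding Lc_def by (rule VL[symmetric])

lemma dtm_b: "x0 \<in> A ==> dtm A (%_. b)"
proof -
 assume A: "x0 \<in> A"
 have "dtm A (%_. mk (insert om (ext (mk (insert x0 (ext om))))))" by (intro dfn_intros A x0_D)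
 moreover have "mk (insert om (ext (mk (insert x0 (ext om))))) = b"
  using ext_b mk_ext[OF b_D] by simp
 ultimately show ?thesis by simp
qed

lemma dtm_HA: "x0 \<in> A ==> dtm A t ==> dtm A (%e. H (t e))"
 by (intro dtm_Lh b_D dtm_b)

lemma x0_H: "a \<in> D ==> x0 \<in> ext (H a)"
 using b_H[of a] ext_b by blast

text \<open>Makes a relation that is definable over the whole model from \<open>x0\<close> available
  inside every level that reflects its formula.\<close>

lemma reflect_dfn:
 assumes "dfn {x0} P"
 obtains p where "!!l. l \<in> D ==> reflects p l ==> set_structure.dfn (ext (H l)) mem {x0} P"
proof -
 obtain p s where s: "!!i c. s i = Inr c ==> c \<in> {x0} \<inter> D"
  and p: "!!e. env e ==> P e = sat D (\<epsilon>) p (%i. case_sum e id (s i))"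
  by (rule dfnE[OF assms]) (rule that)
 have "set_structure.dfn (ext (H l)) mem {x0} P" if l: "l \<in> D" "reflects p l" for l
 proof -
  interpret T: set_structure "ext (H l)" mem .
  show ?thesis
  proof (rule T.dfnI[of s _ _ p])
   show "s i = Inr c ==> c \<in> {x0}" for i c using s[of i c] by blast
   show "s i = Inr c ==> c \<in> ext (H l)" for i c using s[of i c] x0_H[OF l(1)] by blast
   fix e assume e: "T.env e"
   then have e': "env e" unfolding T.env_def env_def by auto
   have "case_sum e id (s i) \<in> ext (H l)" for i
    using e s[of i] x0_H[OF l(1)] unfolding T.env_def by (cases "s i") auto
   from reflectsD[OF l(2) this] show "P e = sat (ext (H l)) (\<epsilon>) p (%i. case_sum e id (s i))"
    using p[OF e'] unfolding Lc_eq_D by simp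
  qed
 qed
 then show thesis by (rule that)
qed

text \<open>The pair of \<open>a\<close> and \<open>n\<close> is a name of \<open>x\<close>: formula
  number \<open>n\<close> defines \<open>x\<close> over level \<open>a\<close> from
  \<open>x0\<close>.\<close>

definition nmd :: "'m => nat => 'm => bool" where
 "nmd a n x <-> x \<in> ext (H a) & (ALL y:ext (H a). satI (H a) n (cns y (cnst x0)) <-> y = x)"

lemma dfn_nmd:
 assumes "x0 \<in> A" "dtm A t" "ntm A n" "dtm A u" shows "dfn A (%e. nmd (t e) (n e) (u e))"
proof -
 have "dfn A (%e. nmd (e 0) (nof (e (Suc 0))) (e (Suc (Suc 0))))"
  unfolding nmd_def by (intro dfn_intros dtm_HA assms(1) x0_D)
 from dfn3[of A "%x y z. nmd x (nof y) z", OF this assms(2) dtm_nm[OF assms(3)] assms(4)] show ?thesis by simp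
qed

lemma nmd_unique: "nmd a n x ==> nmd a n y ==> x = y"
 unfolding nmd_def by blast

text \<open>A definition over the model is reflected to a level and becomes a name there.\<close>

lemma definable_named:
 assumes x: "dtm {x0} (%_. x)" shows "EX a:On. EX n. nmd a n x"
proof -
 obtain d where "env d" using ex_env by blast
 then have xD: "x \<in> D" using dtmD[OF x] by blast
 have "dfn {x0} (%e. e 0 = x)" using x by (simp add: dtm_def)
 then obtain p s where s: "!!i c. s i = Inr c ==> c \<in> {x0} \<inter> D"
  and p: "!!e. env e ==> (e 0 = x) = sat D (\<epsilon>) p (%i. case_sum e id (s i))"
  by (rule dfnE) (rule that)
 define g where "g i = (if s i = Inl 0 then 0 else Suc 0)" for i
 have g: "(%i. case_nat y (%_. x0) (g i)) = (%i. case_sum (case_nat y (%_. x0)) id (s i))" for y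
 proof
  fix i show "case_nat y (%_. x0) (g i) = case_sum (case_nat y (%_. x0)) id (s i)"
   using s[of i] unfolding g_def by (auto split: sum.splits nat.splits)
 qed
 have q: "sat D (\<epsilon>) (ren g p) (case_nat y (%_. x0)) <-> y = x" if "y \<in> D" for y
 proof -
  have "env (case_nat y (%_. x0))" using that by (auto simp: env_def split: nat.splits)
  from p[OF this] show ?thesis unfolding sat_ren g by simp
 qed
 obtain a where a: "a \<in> On" "x \<in> ext (H a)" using xD VL by blast
 obtain l where l: "lim l" "a \<in> ext l" "reflects (ren g p) l" using reflect_list[OF a(1), of "[ren g p]"] by auto
 have lO: "l \<in> On" by (rule lim_On[OF l(1)])
 have HD: "H l \<in> D" using lO by simp
 have xl: "x \<in> ext (H l)" using H_mem_mono[OF lO l(2)] a(2) by blast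
 have x0l: "x0 \<in> ext (H l)" using x0_H lO by simp
 obtain n where n: "dec n = ren g p" using dec_surj by blast
 have "satI (H l) n (cns y (cnst x0)) <-> y = x" if y: "y \<in> ext (H l)" for y
 proof -
  note c = cnst[OF HD x0l] and cc = cns[OF HD y cnst(1)[OF HD x0l]]
  have "satI (H l) n (cns y (cnst x0)) <-> sat (ext (H l)) (\<epsilon>) (ren g p) (case_nat y (%_. x0))"
   unfolding satI_iff[OF HD cc(1)] n cc(2) c(2) ..
  also have "\<dots> <-> sat Lc (\<epsilon>) (ren g p) (case_nat y (%_. x0))"
   by (rule reflectsD[OF l(3), symmetric]) (use y x0l in \<open>auto split: nat.splits\<close>)
  also have "\<dots> <-> y = x" unfolding Lc_eq_D by (rule q) (use y in simp)
  finally show ?thesis .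
 qed
 then have "nmd l n x" unfolding nmd_def using xl by blast
 then show ?thesis using lO by blast
qed

definition Df :: "'m set" where "Df = {x \<in> D. dtm {x0} (%_. x)}"

lemma dfn_Df: "dfn Df P ==> dfn {x0} P"
 by (drule dfn_subst[of Df P "{x0}" "%i e. e i"]) (auto simp: Df_def intro: dtm_var)

lemma x0_Df: "x0 \<in> Df"
 unfolding Df_def by (auto intro: dtm_const)

text \<open>A least unnamed set would be definable from a least tuple of ordinals, hence definable
 without parameters, hence named in some level by reflection.\<close>

lemma named:
 assumes "x \<in> D" shows "EX a:On. EX n. nmd a n x"
proof (rule ccontr)
 define K where "K x <-> ~ (EX a:On. EX n. nmd a n x)" for x
 assume "~ ?thesis"
 then have Kx: "K x" unfolding K_def .
 have Kd: "dfn A (%e. K (t e))" if "x0 \<in> A" "dtm A t" for A t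
 proof (rule dfn1[OF _ that(2)])
  have "dfn A (%e. ~ (EX a:D. a \<in> On & (EX n. nmd a n (e 0))))" by (intro dfn_intros dfn_nmd that(1))
  then show "dfn A (%e. K (e 0))" unfolding K_def by (rule dfn_cong) (use OnD in blast)
 qed
 have DfK: "~ K x" if "x \<in> Df" for x
  using definable_named[of x] that unfolding K_def Df_def by blast
 obtain a0 where "a0 \<in> On" "x \<in> ext (H a0)" using assms VL by blast
 then obtain a where a: "a \<in> On" "EX x:ext (H a). K x" "!!c. c \<in> ext a ==> ~ (EX x:ext (H c). K x)"
  using On_least[of a0 "%a. EX x:ext (H a). K x"] Kx by blast
 obtain z where z: "z \<in> ext (H a)" "K z" using a(2) by blast
 have "z \<notin> ext b"
 proof
  assume "z \<in> ext b"
  then consider "z = om" | "z = x0" | "z \<in> ext om" unfolding ext_b by blast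
  then have "z \<in> Df"
  proof cases
   case 1
   then show ?thesis unfolding Df_def using dtm_om by simp
  next
   case 2
   then show ?thesis using x0_Df by simp
  next
   case 3
   then obtain n where "z = nm n" using omE by auto
   moreover have "dtm {x0} (%_. nm n)" by (intro dfn_intros)
   ultimately show ?thesis unfolding Df_def by simp
  qed
  then show False using DfK z(2) by blast
 qed
 then obtain c where c: "c \<in> ext a" "z \<in> ext (DefS (H c))"
  using z(1) ext_Lh[OF b_D, of a] a(1) by auto
 have cO: "c \<in> On" using On_mem[OF a(1) c(1)] .
 have HD: "H c \<in> D" using cO by simp
 have zD: "z \<in> D" using z(1) by simp
 have "ext z \<in> Defx (ext (H c))" using c(2) DefS_Defx(1)[OF HD] by blast
 then obtain q e where e: "!!i. e i \<in> ext (H c)"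
  and q: "ext z = {y \<in> ext (H c). sat (ext (H c)) (\<epsilon>) q (case_nat y e)}"
  unfolding Defx_def by blast
 \<comment> \<open>The unnamed \<open>z\<close> is defined over level \<open>c\<close> with
   parameters that are named, by minimality of \<open>a\<close>. Replacing each parameter by the
   ordinal of its name, with the formula number kept fixed, leaves only ordinal parameters.\<close>
 have "ALL i. EX an. fst an \<in> On & nmd (fst an) (snd an) (e i)"
 proof
  fix i
  have "~ K (e i)" using a(3)[OF c(1)] e by blast
  then obtain a n where "a \<in> On" "nmd a n (e i)" unfolding K_def by blast
  then show "EX an. fst an \<in> On & nmd (fst an) (snd an) (e i)" by (intro exI[of _ "(a, n)"]) simp
 qed
 then obtain an where an: "!!i. fst (an i) \<in> On" "!!i. nmd (fst (an i)) (snd (an i)) (e i)"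
  using choice[of "%i an. fst an \<in> On & nmd (fst an) (snd an) (e i)"] by auto
 define F where "F i u = thex (%x. nmd u (snd (an i)) x)" for i u
 have F: "F i (fst (an i)) = e i" for i
  unfolding F_def by (rule thex_eq) (use an(2) e nmd_unique in auto)
 have Fd: "dtm A (%e. F i (t e))" if "x0 \<in> A" "dtm A t" for A i t
  unfolding F_def by (intro dtm_thex dfn_nmd that dtm_shift dtm_var ntm_const)
 define S where "S w y = sat (ext (H (w 0))) (\<epsilon>) q (case_nat y (%i. F i (w (Suc i))))" for w y
 \<comment> \<open>The tuple of ordinals \<open>w\<close> produces an unnamed set. Least ordinals
   are definable, so a tuple of this kind exists among the definable ordinals, and the set that it
   produces is definable after all.\<close>
 define P where "P w <-> (EX x:D. K x & (ALL y:D. y \<epsilon> x <-> y \<in> ext (H (w 0)) & S w y))" for w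
 have Pd: "dfn Df P"
 proof -
  let ?t = "%i. case i of 0 => (%e. e 0) | Suc i => (%e. F i (e (Suc (Suc (Suc i)))))"
  have "dtm Df (?t i)" for i using x0_Df by (auto intro: dtm_var Fd split: nat.splits)
  moreover have "dtm Df (%e. H (e (Suc (Suc 0))))" using x0_Df by (intro dtm_HA dtm_var)
  ultimately have "dfn Df (%e. sat (ext (H (e (Suc (Suc 0))))) (\<epsilon>) q (%i. ?t i e))"
   by (intro dfn_sat_rel)
  then have "dfn Df (%e. S (%i. e (Suc (Suc i))) (e 0))"
   by (rule dfn_cong) (auto simp: S_def intro!: arg_cong[of _ _ "sat _ (\<epsilon>) q"] split: nat.splits)
  then show ?thesis unfolding P_def
   by (intro dfn_ex dfn_conj dfn_all dfn_iff dfn_mem dfn_in_ext dtm_var dtm_HA Kd x0_Df)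
 qed
 have Pt: "P (case_nat c (%i. fst (an i)))"
  unfolding P_def S_def
 proof (rule bexI[OF _ zD], intro conjI ballI)
  show "K z" by (rule z(2))
  fix y assume "y \<in> D"
  then show "y \<epsilon> z <-> y \<in> ext (H (case_nat c (%i. fst (an i)) 0)) &
    sat (ext (H (case_nat c (%i. fst (an i)) 0))) (\<epsilon>) q
     (case_nat y (%i. F i (case_nat c (%i. fst (an i)) (Suc i))))"
   using q F in_ext[of y z] by simp
 qed
 have "EX w. (ALL i. w i \<in> Df \<inter> On) & P w"
 proof (rule select_env[of Df On])
  show "Df \<subseteq> D" unfolding Df_def by blast
  show "Df \<inter> On ~= {}" using dtm_empty[of "{x0}"] nm_On[of 0] unfolding Df_def by auto
  show "On \<subseteq> D" using OnD by blast
  show "dfn Df (%e. e 0 \<in> On)" by (intro dfn_intros)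
  show "dfn Df P" by (rule Pd)
  show "P (case_nat c (%i. fst (an i)))" by (rule Pt)
  show "ALL i. case_nat c (%i. fst (an i)) i \<in> On" using cO an by (auto split: nat.splits)
  fix Q assume Q: "dfn Df (%e. Q (e 0))" "EX x:On. Q x"
  then obtain x where "x \<in> On" "Q x" by blast
  note l = lst_On[of x Q, OF this] lst_prop[of x Q, OF this]
  have "dtm {x0} (%e. lst (%y. Q y))" by (rule dtm_lst) (rule dfn_Df[OF Q(1)])
  then have "lst (%y. Q y) \<in> Df" unfolding Df_def using l(1) by simp
  then show "EX x:Df \<inter> On. Q x" using l by blast
 qed
 then obtain w where w: "!!i. w i \<in> Df" "!!i. w i \<in> On" "P w" by blast
 have wd: "dtm {x0} (%_. w i)" for i using w(1)[of i] unfolding Df_def by blast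
 obtain x where x: "x \<in> D" "K x" "ALL y:D. y \<epsilon> x <-> y \<in> ext (H (w 0)) & S w y" using w(3) unfolding P_def by blast
 have "dtm {x0} (%_. mk {y \<in> ext (H (w 0)). S w y})"
 proof (rule dtm_sep)
  show "dtm {x0} (%e. H (w 0))" by (rule dtm_HA[OF singletonI wd])
  let ?t = "%i. case i of 0 => (%e. e 0) | Suc i => (%_. F i (w (Suc i)))"
  have "dtm {x0} (?t i)" for i by (auto intro: dtm_var Fd[OF singletonI wd] split: nat.splits)
  moreover have "dtm {x0} (%_. H (w 0))" by (rule dtm_HA[OF singletonI wd])
  ultimately have "dfn {x0} (%e. sat (ext (H (w 0))) (\<epsilon>) q (%i. ?t i e))"
   by (intro dfn_sat_rel)
  then show "dfn {x0} (%e. S w (e 0))"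
   by (rule dfn_cong) (auto simp: S_def intro!: arg_cong[of _ _ "sat _ (\<epsilon>) q"] split: nat.splits)
 qed
 moreover have "mk {y \<in> ext (H (w 0)). S w y} = x"
 proof -
  have "ext x = {y \<in> ext (H (w 0)). S w y}" using x(3) by auto
  then show ?thesis using mk_ext[OF x(1)] by simp
 qed
 ultimately have "x \<in> Df" unfolding Df_def using x(1) by simp
 then show False using DfK x(2) by blast
qed

definition th :: "'m => 'm" where "th x = lst (%a. EX n. nmd a n x)"

text \<open>Compares the first levels with a name and then the least formula numbers in them; the
  second clause expresses this comparison without taking minima.\<close>

definition wlt :: "'m => 'm => bool" where
 "wlt x y <-> th x \<epsilon> th y \<or> (th x = th y & (EX n. nmd (th x) n x & (ALL m. m \<le> n --> ~ nmd (th y) m y)))"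

lemma dtm_th: "x0 \<in> A ==> dtm A t ==> dtm A (%e. th (t e))"
proof (rule dtm1[rotated], assumption)
 assume "x0 \<in> A"
 then show "dtm A (%e. th (e 0))" unfolding th_def by (intro dfn_intros dfn_nmd)
qed

lemma dfn_wlt:
 assumes "x0 \<in> A" "dtm A t" "dtm A u" shows "dfn A (%e. wlt (t e) (u e))"
 by (rule dfn2[OF _ assms(2,3)]) (unfold wlt_def, intro dfn_intros dfn_nmd dtm_th assms(1))

lemma th: "x \<in> D ==> th x \<in> On" "x \<in> D ==> EX n. nmd (th x) n x"
proof -
 assume "x \<in> D"
 then obtain a where "a \<in> On" "EX n. nmd a n x" using named by blast
 then show "EX n. nmd (th x) n x" unfolding th_def using lst_prop[of a "%a. EX n. nmd a n x"] by blast
qed (simp add: th_def)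

lemma wlt_linear:
 assumes "x \<in> D" "y \<in> D" "x ~= y" shows "wlt x y \<or> wlt y x"
proof -
 consider "th x \<epsilon> th y" | "th y \<epsilon> th x" | "th x = th y" using On_linear th(1) assms by blast
 then show ?thesis
 proof cases
  case 3
  let ?m = "LEAST n. nmd (th x) n x" and ?n = "LEAST n. nmd (th x) n y"
  have m: "nmd (th x) ?m x" using th(2)[OF assms(1)] by (rule LeastI_ex)
  have n: "nmd (th x) ?n y" using th(2)[OF assms(2)] unfolding 3[symmetric] by (rule LeastI_ex)
  have "?m ~= ?n" using m n nmd_unique assms(3) by metis
  then consider "?m < ?n" | "?n < ?m" by linarith
  then show ?thesis
  proof cases
   case 1
   have "~ nmd (th x) k y" if "k \<le> ?m" for k
    by (rule not_less_Least[of k "%n. nmd (th x) n y"]) (rule le_less_trans[OF that 1])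
   then show ?thesis unfolding wlt_def 3[symmetric] using m by blast
  next
   case 2
   have "~ nmd (th x) k x" if "k \<le> ?n" for k
    by (rule not_less_Least[of k "%n. nmd (th x) n x"]) (rule le_less_trans[OF that 2])
   then show ?thesis unfolding wlt_def 3[symmetric] using n by blast
  qed
 qed (auto simp: wlt_def)
qed

lemma wlt_least:
 assumes "P x" "x \<in> D" obtains y where "y \<in> D" "P y" "!!z. z \<in> D ==> P z ==> ~ wlt z y"
proof -
 obtain a where a: "a \<in> On" "EX x:D. P x & th x = a" "!!c. c \<in> ext a ==> ~ (EX x:D. P x & th x = c)"
  using On_least[of "th x" "%a. EX x:D. P x & th x = a"] th(1)[OF assms(2)] assms by blast
 let ?Q = "%n. EX x:D. P x & th x = a & nmd a n x"
 have "EX n. ?Q n" using a(2) th(2) by blast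
 from LeastI_ex[OF this] obtain y where y: "y \<in> D" "P y" "th y = a" "nmd a (LEAST n. ?Q n) y" by blast
 have "~ wlt z y" if z: "z \<in> D" "P z" for z
 proof
  assume "wlt z y"
  moreover have "~ th z \<epsilon> a" using a(3)[of "th z"] z th(1)[OF z(1)] by auto
  ultimately obtain n where n: "th z = a" "nmd a n z" "ALL m. m \<le> n --> ~ nmd a m y"
   unfolding wlt_def y(3) by metis
  then have "?Q n" using z by blast
  then have "(LEAST n. ?Q n) \<le> n" by (rule Least_le)
  then show False using n(3) y(4) by blast
 qed
 then show thesis using that y by blast
qed

text \<open>The choice set collects the \<open>wlt\<close>-least member of each set in the
  family.\<close>

theorem VL_choice: choice
 unfolding choice_def
proof (intro ballI impI)
 fix a assume aD: "a \<in> D" and dis: "(ALL x:D. x \<epsilon> a --> ~ is_empty x) &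
  (ALL x:D. ALL y:D. x \<epsilon> a & y \<epsilon> a & x ~= y --> ~ (EX z:D. z \<epsilon> x & z \<epsilon> y))"
 note h = conjunct1[OF dis, rule_format] conjunct2[OF dis, rule_format]
 have ne: "EX z:D. z \<epsilon> x" if "x \<in> ext a" for x
  using h(1)[of x] that unfolding is_empty_def by auto
 have dj: "x = y" if "x \<in> ext a" "y \<in> ext a" "z \<in> D" "z \<epsilon> x" "z \<epsilon> y" for x y z
  using h(2)[of x y] that by auto
 let ?Q = "%z u. z \<epsilon> u & (ALL y:D. y \<epsilon> u --> ~ wlt y z)"
 have U: "isset (\<Union>x\<in>ext a. ext x)" by (rule isset_union[OF aD])
 have "isset {z \<in> ext (mk (\<Union>x\<in>ext a. ext x)). EX u:ext a. ?Q z u}"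
  by (rule isset_sep) (intro dfn_intros dfn_wlt mk_D U aD x0_D)+
 then have i: "isset {z \<in> (\<Union>x\<in>ext a. ext x). EX u:ext a. ?Q z u}" unfolding ext_mk[OF U] .
 let ?c = "mk {z \<in> (\<Union>x\<in>ext a. ext x). EX u:ext a. ?Q z u}"
 have c: "z \<epsilon> ?c <-> (EX u:ext a. ?Q z u)" if "z \<in> D" for z
  using mem_mkD[OF i that] that by auto
 have "EX! z. z \<in> D & z \<epsilon> x & z \<epsilon> ?c" if x: "x \<in> D" "x \<epsilon> a" for x
 proof -
  have xa: "x \<in> ext a" using x by simp
  obtain z0 where "z0 \<in> D" "z0 \<epsilon> x" using ne[OF xa] by blast
  then obtain z where z: "z \<in> D" "z \<epsilon> x" "!!y. y \<in> D ==> y \<epsilon> x ==> ~ wlt y z"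
   using wlt_least[of "%z. z \<epsilon> x" z0] by blast
  have zc: "z \<epsilon> ?c" unfolding c[OF z(1)] using z xa by blast
  have "z' = z" if z': "z' \<in> D" "z' \<epsilon> x" "z' \<epsilon> ?c" for z'
  proof -
   obtain u where u: "u \<in> ext a" "?Q z' u" using z'(3) unfolding c[OF z'(1)] by blast
   then have "u = x" using dj[OF u(1) xa z'(1)] z'(2) by blast
   then have "~ wlt z z'" "~ wlt z' z" using u(2) z z' by blast+
   then show ?thesis using wlt_linear[OF z'(1) z(1)] by blast
  qed
  then show ?thesis using z(1,2) zc by blast
 qed
 then show "EX c:D. ALL x:D. x \<epsilon> a --> (EX! z. z \<in> D & z \<epsilon> x & z \<epsilon> c)"
  by (intro bexI[of _ ?c] mk_D i) blast
qed

end

context zfmVL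
begin

text \<open>Condensation: the elementary hull of \<open>{y}\<close> in a reflecting level collapses onto a countable
 level containing the real \<open>y\<close>.\<close>

theorem real_in_countable_level:
 assumes yD: "y \<in> D" and yom: "ext y \<subseteq> ext om"
 shows "EX g:On. y \<in> ext (H g) & cnt (ext (H g))"
proof -
 have x0A: "x0 \<in> {x0}" by blast
 \<comment> \<open>Five notions are reflected, to be definable inside the level: the hierarchy, the
   well-order, membership in the definable power set of a level, omega, and the first level
   containing a given set.\<close>
 have "dfn {x0} (%e. e 0 = H (e (Suc 0)))" by (intro dfn_eq dtm_var dtm_HA x0A)
 then obtain p1 where p1: "!!l. l \<in> D ==> reflects p1 l ==>
   set_structure.dfn (ext (H l)) mem {x0} (%e. e 0 = H (e (Suc 0)))" by (rule reflect_dfn) (rule that)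
 have "dfn {x0} (%e. wlt (e 0) (e (Suc 0)))" by (intro dfn_wlt dtm_var x0A)
 then obtain p2 where p2: "!!l. l \<in> D ==> reflects p2 l ==>
   set_structure.dfn (ext (H l)) mem {x0} (%e. wlt (e 0) (e (Suc 0)))" by (rule reflect_dfn) (rule that)
 have "dfn {x0} (%e. e 0 \<in> ext (DefS (H (e (Suc 0)))))" by (intro dfn_intros dtm_HA x0A)
 then obtain p3 where p3: "!!l. l \<in> D ==> reflects p3 l ==>
   set_structure.dfn (ext (H l)) mem {x0} (%e. e 0 \<in> ext (DefS (H (e (Suc 0)))))" by (rule reflect_dfn) (rule that)
 have "dfn {x0} (%e. e 0 = om)" by (intro dfn_intros)
 then obtain p4 where p4: "!!l. l \<in> D ==> reflects p4 l ==>
   set_structure.dfn (ext (H l)) mem {x0} (%e. e 0 = om)" by (rule reflect_dfn) (rule that)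
 have "dfn {x0} (%e. e 0 = lst (%a. e (Suc 0) \<in> ext (H a)))" by (intro dfn_intros dtm_HA x0A)
 then obtain p5 where p5: "!!l. l \<in> D ==> reflects p5 l ==>
   set_structure.dfn (ext (H l)) mem {x0} (%e. e 0 = lst (%a. e (Suc 0) \<in> ext (H a)))" by (rule reflect_dfn) (rule that)
 obtain a0 where a0: "a0 \<in> On" "y \<in> ext (H a0)" using yD VL by blast
 obtain l where l: "lim l" "a0 \<in> ext l" and "ALL p:set [p1, p2, p3, p4, p5]. reflects p l"
  using reflect_list[OF a0(1), of "[p1, p2, p3, p4, p5]"] by blast
 then have rl: "reflects p1 l" "reflects p2 l" "reflects p3 l" "reflects p4 l" "reflects p5 l" by simp_all
 have lO: "l \<in> On" and lD: "l \<in> D" using lim_On[OF l(1)] by auto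
 define S where "S = ext (H l)"
 have HlD: "H l \<in> D" using lD by blast
 interpret T: set_structure S mem .
 note q1 = p1[OF lD rl(1), folded S_def] and q2 = p2[OF lD rl(2), folded S_def]
  and q3 = p3[OF lD rl(3), folded S_def] and q4 = p4[OF lD rl(4), folded S_def]
  and q5 = p5[OF lD rl(5), folded S_def]
 have SD: "x \<in> S ==> x \<in> D" for x unfolding S_def by simp
 have tr: "x \<in> S ==> ext x \<subseteq> S" for x unfolding S_def by (rule H_trans[OF lD])
 have Text: "T.ext u = ext u" if "u \<in> S" for u
  unfolding T.ext_def using tr[OF that] SD by (auto simp: ext_def)
 have lS: "a \<in> S" if "a \<in> ext l" for a
 proof -
  have aO: "a \<in> On" using On_mem[OF lO that] .
  have "suc a \<in> ext l" using l(1) that unfolding lim_def by blast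
  then show ?thesis unfolding S_def using On_suc_H[OF aO] H_mem_mono[OF lO] by blast
 qed
 have HS: "ext (H a) \<subseteq> S" "H a \<in> S" if "a \<in> ext l" for a
 proof -
  have aO: "a \<in> On" using On_mem[OF lO that] .
  show "ext (H a) \<subseteq> S" unfolding S_def by (rule H_mem_mono[OF lO that])
  have "H a \<in> ext (DefS (H a))" using aO by (intro self_DefS H_nonempty) auto
  then show "H a \<in> S" unfolding S_def using DefS_H[OF lD that] by blast
 qed
 have yS: "y \<in> S" using HS(1)[OF l(2)] a0(2) by blast
 have bS: "ext b \<subseteq> S" unfolding S_def by (rule b_H[OF lD])
 have x0S: "x0 \<in> S" using bS ext_b by blast
 define A where "A = {x0, y}"
 have AS: "A \<subseteq> S" unfolding A_def using x0S yS by blast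
 define X where "X = {x \<in> S. T.dtm A (%_. x)}"
 have XS: "X \<subseteq> S" unfolding X_def by blast
 have XD: "x \<in> X ==> x \<in> D" for x using XS SD by blast
 have AX: "A \<subseteq> X" unfolding X_def using AS by (auto intro: T.dtm_const)
 have cX: "T.dtm X (%_. x)" if "x \<in> X" for x using that XS by (intro T.dtm_const) auto
 have XA: "T.dfn A P" if "T.dfn X P" for P
  using T.dfn_subst[OF that, of A "%i e. e i"] by (auto simp: X_def intro: T.dtm_var)
 have MX: "z \<in> X" if z: "z \<in> S" "T.dfn X (%e. e 0 = z)" for z
  using XA[OF z(2)] z(1) unfolding X_def T.dtm_def by simp
 have x0X: "{x0} \<inter> S \<subseteq> X" using AX unfolding A_def by blast
 note r1 = T.dfn_mono[OF q1 x0X] and r2 = T.dfn_mono[OF q2 x0X] and r3 = T.dfn_mono[OF q3 x0X]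
  and r4 = T.dfn_mono[OF q4 x0X] and r5 = T.dfn_mono[OF q5 x0X]
 \<comment> \<open>The Tarski-Vaught criterion: the \<open>wlt\<close>-least witness is definable
   and hence in \<open>X\<close>.\<close>
 have sel: "EX x:X. P x" if P: "T.dfn X (%e. P (e 0))" and ex: "x \<in> S" "P x" for P x
 proof -
  obtain z where z: "z \<in> D" "z \<in> S & P z" "!!w. w \<in> D ==> w \<in> S & P w ==> ~ wlt w z"
   using wlt_least[of "%x. x \<in> S & P x" x] ex SD by blast
  have P2: "T.dfn X (%e. P (e i))" for i by (rule T.dfn1[OF P T.dtm_var])
  have w2: "T.dfn X (%e. wlt (e i) (e j))" for i j by (rule T.dfn2[OF r2 T.dtm_var T.dtm_var])
  have "T.dfn X (%e. P (e 0) & (ALL w:S. P w --> ~ wlt w (e 0)))"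
   by (intro T.dfn_conj T.dfn_all T.dfn_imp T.dfn_not P2 w2)
  then have "T.dfn X (%e. e 0 = z)"
  proof (rule T.dfn_cong)
   fix e assume "T.env e"
   then have e: "e 0 \<in> S" by blast
   show "(P (e 0) & (ALL w:S. P w --> ~ wlt w (e 0))) = (e 0 = z)"
   proof
    assume *: "P (e 0) & (ALL w:S. P w --> ~ wlt w (e 0))"
    then have "~ wlt (e 0) z" "~ wlt z (e 0)" using z e SD by blast+
    then show "e 0 = z" using wlt_linear[of "e 0" z] e z(1) SD by blast
   qed (use z SD in blast)
  qed
  then have "z \<in> X" using MX z by blast
  then show ?thesis using z by blast
 qed
 have ne: "X \<inter> S ~= {}" using AX AS unfolding A_def by blast
 let ?nx = "%n x. ALL z:ext (H l). satI (H l) n (cns z (cns y (cnst x0))) <-> z = x"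
 have sy: "satI (H l) n (cns z (cns y (cnst x0))) <-> sat S (\<epsilon>) (dec n) (case_nat z (case_nat y (%_. x0)))"
  if "z \<in> S" for n z
 proof -
  have m: "x0 \<in> ext (H l)" "y \<in> ext (H l)" "z \<in> ext (H l)" using x0S yS that unfolding S_def by blast+
  note c1 = cnst[OF HlD m(1)]
  note c2 = cns[OF HlD m(2) c1(1)]
  note c3 = cns[OF HlD m(3) c2(1)]
  show ?thesis unfolding satI_iff[OF HlD c3(1)] c3(2) c2(2) c1(2) S_def ..
 qed
 \<comment> \<open>Definability over the level is expressed by internal satisfaction. This shows
   that \<open>X\<close> is a set of the model and that formula numbers enumerate it there.\<close>
 have Xn: "x \<in> X <-> (EX n. ?nx n x)" if xS: "x \<in> S" for x
 proof
  assume "x \<in> X"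
  then have "T.dfn A (%e. e 0 = x)" unfolding X_def T.dtm_def by simp
  then obtain p s where s: "!!i c. s i = Inr c ==> c \<in> A \<inter> S"
   and p: "!!e. T.env e ==> (e 0 = x) = sat S (\<epsilon>) p (%i. case_sum e id (s i))"
   by (rule T.dfnE) (rule that)
  define g where "g i = (case s i of Inl 0 => 0 | Inl (Suc j) => Suc (Suc 0) | Inr c => if c = y then Suc 0 else Suc (Suc 0))" for i
  have g: "(%i. case_nat z (case_nat y (%_. x0)) (g i)) = (%i. case_sum (case_nat z (%_. x0)) id (s i))" for z
  proof
   fix i show "case_nat z (case_nat y (%_. x0)) (g i) = case_sum (case_nat z (%_. x0)) id (s i)"
    using s[of i] unfolding g_def A_def by (auto split: sum.splits nat.splits)
  qed
  obtain n where n: "dec n = ren g p" using dec_surj by blast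
  have "satI (H l) n (cns z (cns y (cnst x0))) <-> z = x" if z: "z \<in> ext (H l)" for z
  proof -
   have zS: "z \<in> S" using z unfolding S_def .
   have "T.env (case_nat z (%_. x0))" using zS x0S by (auto simp: T.env_def split: nat.splits)
   from p[OF this] show ?thesis unfolding sy[OF zS] n sat_ren g by simp
  qed
  then show "EX n. ?nx n x" by blast
 next
  assume "EX n. ?nx n x"
  then obtain n where n: "?nx n x" by blast
  let ?t = "%i. case i of 0 => (%e. e 0) | Suc 0 => (%_. y) | Suc (Suc i) => (%_. x0)"
  have "T.dtm A (?t i)" for i using AS unfolding A_def by (auto intro: T.dtm_var T.dtm_const split: nat.splits)
  then have "T.dfn A (%e. sat S (\<epsilon>) (dec n) (%i. ?t i e))" by (rule T.dfn_sat_terms)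
  then have "T.dfn A (%e. e 0 = x)"
  proof (rule T.dfn_cong)
   fix e assume "T.env e"
   then have e: "e 0 \<in> S" by blast
   have "(%i. ?t i e) = case_nat (e 0) (case_nat y (%_. x0))" by (auto split: nat.splits)
   then show "sat S (\<epsilon>) (dec n) (%i. ?t i e) = (e 0 = x)"
    using sy[OF e, of n] n e unfolding S_def by simp
  qed
  then show "x \<in> X" using xS unfolding X_def T.dtm_def by simp
 qed
 have "isset {x \<in> ext (H l). EX n. ?nx n x}"
  by (rule isset_sep) (intro dfn_intros HlD yD x0_D)+
 moreover have "{x \<in> ext (H l). EX n. ?nx n x} = X" using Xn XS unfolding S_def by blast
 ultimately have iX: "isset X" by simp
 have cntX: "cnt X"
 proof -
  have "dtm D (%e. thex (%x. x \<in> ext (H l) & ?nx (nof (e 0)) x))" by (intro dfn_intros HlD yD x0_D)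
  note f = lam_function_on[OF this om_D]
  have "EX n. ap (lam (ext om) (%k. thex (%x. x \<in> ext (H l) & ?nx (nof k) x))) (nm n) = x" if x: "x \<in> X" for x
  proof -
   have xS: "x \<in> ext (H l)" using x XS unfolding S_def by blast
   obtain n where n: "?nx n x" using Xn x XS by blast
   have "thex (%x. x \<in> ext (H l) & ?nx n x) = x"
   proof (rule thex_eq)
    show "x \<in> D" using XD x by blast
    show "x \<in> ext (H l) & ?nx n x" using xS n by blast
    fix z assume z: "z \<in> ext (H l) & ?nx n z"
    then show "z = x" using n xS by metis
   qed
   then show ?thesis using f(3)[of "nm n"] by auto
  qed
  then show ?thesis unfolding cnt_def using f(1) by blast
 qed
 \<comment> \<open>\<open>\<pi>\<close> is the transitive collapse of \<open>X\<close>\<close>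
 define Xm where "Xm = mk X"
 have Xm: "Xm \<in> D" "ext Xm = X" unfolding Xm_def using iX by auto
 have "dtm D (%e. mk ((%z. ap (e (Suc 0)) z) ` ext (mk {z \<in> ext (e 0). z \<in> ext Xm})))"
  by (intro dfn_intros Xm)
 then obtain \<pi> where \<pi>d: "dtm D (%e. \<pi> (e 0))"
  and \<pi>0: "!!x. x \<in> D ==> \<pi> x = mk ((%z. ap (lam (ext x) \<pi>) z) ` ext (mk {z \<in> ext x. z \<in> ext Xm}))"
  and \<pi>l: "!!x. x \<in> D ==> lam (ext x) \<pi> \<in> D"
  by (rule mem_recursion[of D "%x f. mk ((%z. ap f z) ` ext (mk {z \<in> ext x. z \<in> ext Xm}))"]) (rule that)
 have \<pi>D: "\<pi> x \<in> D" if "x \<in> D" for x by (rule dtm1_D[OF \<pi>d that])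
 have iXx: "isset (X \<inter> ext x)" if "x \<in> D" for x
 proof -
  have "isset {z \<in> ext x. z \<in> ext Xm}" by (rule isset_sep) (intro dfn_intros Xm that)+
  moreover have "{z \<in> ext x. z \<in> ext Xm} = X \<inter> ext x" unfolding Xm(2) by blast
  ultimately show ?thesis by simp
 qed
 have e\<pi>: "ext (\<pi> x) = \<pi> ` (X \<inter> ext x)" if x: "x \<in> D" for x
 proof -
  have 1: "{z \<in> ext x. z \<in> ext Xm} = X \<inter> ext x" unfolding Xm(2) by blast
  have "ap (lam (ext x) \<pi>) z = \<pi> z" if "z \<in> X \<inter> ext x" for z
   by (rule ap_lam'[OF \<pi>l[OF x] isset_ext[OF x] \<pi>d]) (use that in blast)
  then have "(%z. ap (lam (ext x) \<pi>) z) ` (X \<inter> ext x) = \<pi> ` (X \<inter> ext x)" by (rule image_cong[OF refl])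
  then have "\<pi> x = mk (\<pi> ` (X \<inter> ext x))" using \<pi>0[OF x] unfolding 1 ext_mk[OF iXx[OF x]] by simp
  then show ?thesis using ext_mk[OF isset_image[OF iXx[OF x] \<pi>d]] by simp
 qed
 \<comment> \<open>By \<open>sel\<close>, two different members of \<open>X\<close> are separated by
   a member of \<open>X\<close>; injectivity of the collapse depends on this.\<close>
 have extX: "x = x'" if x: "x \<in> X" "x' \<in> X" and eq: "X \<inter> ext x = X \<inter> ext x'" for x x'
 proof (rule ccontr)
  assume "x ~= x'"
  then have "ext x ~= ext x'" using ext_inj XD x by blast
  then obtain z where z: "z \<in> ext x & z \<notin> ext x' \<or> z \<in> ext x' & z \<notin> ext x" by blast
  then have zS: "z \<in> S" using tr x XS by blast
  have "T.dfn X (%e. ~ (e 0 \<epsilon> x <-> e 0 \<epsilon> x'))"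
   by (intro T.dfn_not T.dfn_iff T.dfn_mem T.dtm_var cX x)
  from sel[of "%z. ~ (z \<epsilon> x <-> z \<epsilon> x')", OF this zS]
  obtain w where "w \<in> X" "~ (w \<epsilon> x <-> w \<epsilon> x')" using z by auto
  then show False using eq XD by auto
 qed
 have \<pi>inj: "x = x'" if "x \<in> X" "x' \<in> X" "\<pi> x = \<pi> x'" for x x'
 proof -
  have "x \<in> D" using XD that by blast
  then show ?thesis using that
  proof (induction x arbitrary: x' rule: mem_induct)
   case (mem x)
   have x'D: "x' \<in> D" using XD mem.prems by blast
   have im: "\<pi> ` (X \<inter> ext x) = \<pi> ` (X \<inter> ext x')" using mem.prems(3) e\<pi> mem.hyps x'D by metis
   have "X \<inter> ext x = X \<inter> ext x'"
   proof (intro set_eqI iffI)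
    fix z assume z: "z \<in> X \<inter> ext x"
    then have "\<pi> z \<in> \<pi> ` (X \<inter> ext x')" using im by blast
    then obtain z' where z': "z' \<in> X \<inter> ext x'" "\<pi> z = \<pi> z'" by blast
    then have "z = z'" using mem.IH[of z z'] z by blast
    then show "z \<in> X \<inter> ext x'" using z' by blast
   next
    fix z assume z: "z \<in> X \<inter> ext x'"
    then have "\<pi> z \<in> \<pi> ` (X \<inter> ext x)" using im by blast
    then obtain z' where z': "z' \<in> X \<inter> ext x" "\<pi> z = \<pi> z'" by blast
    then have "z' = z" using mem.IH[of z' z] z by auto
    then show "z \<in> X \<inter> ext x" using z' by blast
   qed
   then show ?case using extX mem.prems by blast
  qed
 qed
 have \<pi>mem: "\<pi> x \<epsilon> \<pi> z <-> x \<epsilon> z" if "x \<in> X" "z \<in> X" for x z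
 proof -
  have "\<pi> x \<epsilon> \<pi> z <-> \<pi> x \<in> ext (\<pi> z)" using \<pi>D XD that(1) by simp
  also have "\<dots> <-> x \<in> X \<inter> ext z" unfolding e\<pi>[OF XD[OF that(2)]] using \<pi>inj that(1) by blast
  finally show ?thesis using that XD by simp
 qed
 have nmX: "nm n \<in> X" for n
 proof (induction n)
  case 0
  have S0: "nm 0 \<in> S" using nm_b bS by blast
  have "T.dfn X (%e. ALL z:S. ~ z \<epsilon> e 0)" by (intro T.dfn_all T.dfn_not T.dfn_mem T.dtm_var)
  then have "T.dfn X (%e. e 0 = nm 0)"
  proof (rule T.dfn_cong)
   fix e assume "T.env e"
   then have e: "e 0 \<in> S" by blast
   have "(ALL z:S. ~ z \<epsilon> e 0) <-> ext (e 0) = {}" using tr[OF e] SD unfolding ext_def by blast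
   then show "(ALL z:S. ~ z \<epsilon> e 0) = (e 0 = nm 0)" using ext_eq_iff[OF SD[OF e] nm_D[of 0]] by simp
  qed
  then show ?case by (rule MX[OF S0])
 next
  case (Suc n)
  have SS: "nm (Suc n) \<in> S" using nm_b bS by blast
  have "T.dfn X (%e. ALL z:S. z \<epsilon> e 0 <-> z = nm n \<or> z \<epsilon> nm n)"
   by (intro T.dfn_all T.dfn_iff T.dfn_disj T.dfn_eq T.dfn_mem T.dtm_var cX Suc)
  then have "T.dfn X (%e. e 0 = nm (Suc n))"
  proof (rule T.dfn_cong)
   fix e assume "T.env e"
   then have e: "e 0 \<in> S" by blast
   have sub: "insert (nm n) (ext (nm n)) \<subseteq> S" using Suc XS tr by blast
   have "(ALL z:S. z \<epsilon> e 0 <-> z = nm n \<or> z \<epsilon> nm n) <-> ext (e 0) = insert (nm n) (ext (nm n))"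
   proof
    assume *: "ALL z:S. z \<epsilon> e 0 <-> z = nm n \<or> z \<epsilon> nm n"
    show "ext (e 0) = insert (nm n) (ext (nm n))"
     using * tr[OF e] sub SD by (intro set_eqI) (metis in_ext insert_iff subsetD)
   next
    assume *: "ext (e 0) = insert (nm n) (ext (nm n))"
    have "z \<epsilon> e 0 <-> z \<in> ext (e 0)" if "z \<in> S" for z using SD[OF that] by simp
    then show "ALL z:S. z \<epsilon> e 0 <-> z = nm n \<or> z \<epsilon> nm n" unfolding * using SD by simp
   qed
   also have "\<dots> <-> e 0 = nm (Suc n)" using ext_eq_iff[OF SD[OF e] nm_D[of "Suc n"]] by simp
   finally show "(ALL z:S. z \<epsilon> e 0 <-> z = nm n \<or> z \<epsilon> nm n) = (e 0 = nm (Suc n))" .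
  qed
  then show ?case by (rule MX[OF SS])
 qed
 have omX: "om \<in> X" using MX[OF _ r4] om_b bS by blast
 have bX: "ext b \<subseteq> X"
 proof -
  have "ext om \<subseteq> X" unfolding ext_om using nmX by blast
  then show ?thesis unfolding ext_b using omX AX unfolding A_def by blast
 qed
 \<comment> \<open>Subsets of the base are fixed, because the base is a transitive part of
   \<open>X\<close>. This covers \<open>y\<close>, a subset of omega.\<close>
 have \<pi>fix: "\<pi> x = x" if "x \<in> D" "ext x \<subseteq> ext b" for x
  using that
 proof (induction x rule: mem_induct)
  case (mem x)
  have "\<pi> z = z" if "z \<in> ext x" for z
   by (rule mem.IH[OF that]) (use that mem.prems b_trans in blast)
  then have "\<pi> ` (X \<inter> ext x) = X \<inter> ext x" by simp
  also have "\<dots> = ext x" using mem.prems bX by blast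
  finally have "ext (\<pi> x) = ext x" unfolding e\<pi>[OF mem.hyps] .
  then show ?case using ext_inj \<pi>D mem.hyps by blast
 qed
 have \<pi>y: "\<pi> y = y" by (rule \<pi>fix[OF yD]) (use yom ext_b in blast)
 have \<pi>On: "\<pi> a \<in> On" if "a \<in> On" for a
 proof -
  have "a \<in> D" using that by simp
  then show ?thesis using that
  proof (induction a rule: mem_induct)
   case (mem a)
   show ?case
   proof (rule transitive_On)
    show "\<pi> a \<in> D" by (rule \<pi>D[OF mem.hyps])
    show "ext (\<pi> a) \<subseteq> On" unfolding e\<pi>[OF mem.hyps] using mem.IH On_mem[OF mem.prems] by blast
    fix z assume "z \<in> ext (\<pi> a)"
    then obtain c where c: "c \<in> X" "c \<in> ext a" "z = \<pi> c" unfolding e\<pi>[OF mem.hyps] by blast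
    have "ext c \<subseteq> ext a" using ordinal_trans[OF On_ordinal[OF mem.prems] c(2)] by blast
    then show "ext z \<subseteq> ext (\<pi> a)" unfolding c(3) e\<pi>[OF mem.hyps] e\<pi>[OF XD[OF c(1)]] by blast
   qed
  qed
 qed
 have HX: "H a \<in> X" if "a \<in> X" "a \<in> ext l" for a
  by (rule MX[OF HS(2)[OF that(2)]]) (rule T.dfn2[OF r1 T.dtm_var cX[OF that(1)]])
 \<comment> \<open>If the index \<open>c\<close> is in \<open>X\<close>, the part of level
   \<open>c\<close> lying in \<open>X\<close> is elementary in the level.\<close>
 have elem: "sat (X \<inter> ext (H c)) (\<epsilon>) p e = sat (ext (H c)) (\<epsilon>) p e"
  if c: "c \<in> X" "c \<in> ext l" and e: "!!i. e i \<in> X \<inter> ext (H c)" for c p e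
  using e
 proof (induction p arbitrary: e)
  case (All p)
  have ih: "sat (X \<inter> ext (H c)) (\<epsilon>) p (case_nat x e) = sat (ext (H c)) (\<epsilon>) p (case_nat x e)"
   if "x \<in> X \<inter> ext (H c)" for x
   by (rule All.IH) (use that All.prems in \<open>auto split: nat.splits\<close>)
  have "EX x:X \<inter> ext (H c). ~ sat (ext (H c)) (\<epsilon>) p (case_nat x e)"
   if x: "x \<in> ext (H c)" "~ sat (ext (H c)) (\<epsilon>) p (case_nat x e)" for x
  proof -
   let ?t = "%i. case i of 0 => (%e. e 0) | Suc i => (%_. e i)"
   have HcX: "H c \<in> X" by (rule HX[OF c])
   have td: "T.dtm X (?t i)" for i using All.prems by (cases i) (auto intro: T.dtm_var cX)
   have "T.dfn X (%w. sat (T.ext (H c)) (\<epsilon>) p (%i. ?t i w))"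
    by (rule T.dfn_sat_rel[OF cX[OF HcX] td])
   then have "T.dfn X (%w. sat (ext (H c)) (\<epsilon>) p (case_nat (w 0) e))"
    unfolding Text[OF subsetD[OF XS HcX]]
    by (rule T.dfn_cong) (auto intro!: arg_cong[of _ _ "sat _ (\<epsilon>) p"] split: nat.splits)
   then have "T.dfn X (%w. w 0 \<epsilon> H c & ~ sat (ext (H c)) (\<epsilon>) p (case_nat (w 0) e))"
    by (intro T.dfn_conj T.dfn_not T.dfn_mem T.dtm_var cX HcX)
   from sel[of "%x. x \<epsilon> H c & ~ sat (ext (H c)) (\<epsilon>) p (case_nat x e)", OF this, of x]
   have "EX x:X. x \<epsilon> H c & ~ sat (ext (H c)) (\<epsilon>) p (case_nat x e)"
    using x HS(1)[OF c(2)] by auto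
   then show ?thesis using XD by auto
  qed
  then show ?case unfolding sat.simps using ih by blast
 qed auto
 \<comment> \<open>The collapse of a level is a level, by induction on \<open>a\<close>. Definitions
   over level \<open>c\<close> and over its collapse correspond by \<open>elem\<close> and
   \<open>sat_iso\<close>, so the definable power sets correspond as well.\<close>
 have level: "ext (H (\<pi> a)) = \<pi> ` (X \<inter> ext (H a))" if aX: "a \<in> X" "a \<in> ext l" for a
 proof -
  have "a \<in> D" using XD aX by blast
  then show ?thesis using aX
  proof (induction a rule: mem_induct)
   case (mem a)
   have aO: "a \<in> On" using On_mem[OF lO mem.prems(2)] .
   have \<pi>aD: "\<pi> a \<in> D" by (rule \<pi>D[OF mem.hyps])
   have al: "c \<in> ext l" if "c \<in> ext a" for c
    using ordinal_trans[OF On_ordinal[OF lO] mem.prems(2) that] .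
   have HaS: "ext (H a) \<subseteq> S" by (rule HS(1)[OF mem.prems(2)])
   show ?case
   proof (intro set_eqI iffI)
    fix z assume "z \<in> ext (H (\<pi> a))"
    then have zD: "z \<in> D" by simp
    from \<open>z \<in> ext (H (\<pi> a))\<close> consider "z \<in> ext b" | g where "g \<in> ext (\<pi> a)" "z \<in> ext (DefS (H g))"
     unfolding ext_Lh[OF b_D \<pi>aD] by blast
    then show "z \<in> \<pi> ` (X \<inter> ext (H a))"
    proof cases
     case 1
     then have "\<pi> z = z" using \<pi>fix[OF zD] b_trans by blast
     then show ?thesis using 1 bX b_H[OF mem.hyps] by (metis IntI imageI subsetD)
    next
     case 2
     then obtain c where c: "c \<in> X" "c \<in> ext a" "g = \<pi> c" unfolding e\<pi>[OF mem.hyps] by blast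
     have cl: "c \<in> ext l" by (rule al[OF c(2)])
     have cO: "c \<in> On" using On_mem[OF lO cl] .
     have IH: "ext (H g) = \<pi> ` (X \<inter> ext (H c))" unfolding c(3) by (rule mem.IH[OF c(2) c(1) cl])
     have gD: "H g \<in> D" using 2(1) by auto
     have "ext z \<in> Defx (ext (H g))" using 2(2) DefS_Defx(1)[OF gD] by blast
     then obtain q e where e: "!!i. e i \<in> ext (H g)"
      and q: "ext z = {v \<in> ext (H g). sat (ext (H g)) (\<epsilon>) q (case_nat v e)}"
      unfolding Defx_def by blast
     have "ALL i. EX u. u \<in> X \<inter> ext (H c) & e i = \<pi> u" using e unfolding IH by blast
     then have "EX e'. ALL i. e' i \<in> X \<inter> ext (H c) & e i = \<pi> (e' i)" by (rule Hilbert_Choice.choice)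
     then obtain e' where e': "!!i. e' i \<in> X \<inter> ext (H c)" "!!i. e i = \<pi> (e' i)" by blast
     \<comment> \<open>The formula that defines \<open>z\<close>, with its parameters pulled back
       along the collapse, defines the preimage of \<open>z\<close>.\<close>
     let ?Y = "{w \<in> ext (H c). sat (ext (H c)) (\<epsilon>) q (case_nat w e')}"
     have "?Y \<in> Defx (ext (H c))" by (rule DefxI[of e']) (use e' in auto)
     note d = Defx_Lc[OF cO this]
     let ?d = "mk ?Y"
     have dHa: "?d \<in> ext (H a)" using DefS_H[OF mem.hyps c(2)] d(3) by blast
     have dS: "?d \<in> S" using dHa HaS by blast
     have HcX: "H c \<in> X" by (rule HX[OF c(1) cl])
     have dX: "?d \<in> X"
     proof (rule MX[OF dS])
      let ?t = "%i. case i of 0 => (%e. e 0) | Suc i => (%_. e' i)"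
      have td: "T.dtm X (?t i)" for i using e' by (cases i) (auto intro: T.dtm_var cX)
      have "T.dfn X (%w. sat (T.ext (H c)) (\<epsilon>) q (%i. ?t i w))"
       by (rule T.dfn_sat_rel[OF cX[OF HcX] td])
      then have "T.dfn X (%w. sat (ext (H c)) (\<epsilon>) q (case_nat (w 0) e'))"
       unfolding Text[OF subsetD[OF XS HcX]]
       by (rule T.dfn_cong) (auto intro!: arg_cong[of _ _ "sat _ (\<epsilon>) q"] split: nat.splits)
      then have "T.dfn X (%e. ALL w:S. w \<epsilon> e 0 <-> w \<epsilon> H c & sat (ext (H c)) (\<epsilon>) q (case_nat w e'))"
       by (intro T.dfn_all T.dfn_iff T.dfn_conj T.dfn_mem T.dtm_var cX HcX)
      then show "T.dfn X (%e. e 0 = ?d)"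
      proof (rule T.dfn_cong)
       fix e assume "T.env e"
       then have e: "e 0 \<in> S" by blast
       have YS: "?Y \<subseteq> S" using HS(1)[OF cl] by blast
       have "(ALL w:S. w \<epsilon> e 0 <-> w \<epsilon> H c & sat (ext (H c)) (\<epsilon>) q (case_nat w e')) <-> ext (e 0) = ?Y"
       proof
        assume *: "ALL w:S. w \<epsilon> e 0 <-> w \<epsilon> H c & sat (ext (H c)) (\<epsilon>) q (case_nat w e')"
        have "w \<in> ext (e 0) <-> w \<in> ?Y" if "w \<in> S" for w using bspec[OF * that] SD[OF that] by simp
        then show "ext (e 0) = ?Y" using tr[OF e] YS by blast
       next
        assume *: "ext (e 0) = ?Y"
        show "ALL w:S. w \<epsilon> e 0 <-> w \<epsilon> H c & sat (ext (H c)) (\<epsilon>) q (case_nat w e')"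
        proof
         fix w assume w: "w \<in> S"
         have "w \<epsilon> e 0 <-> w \<in> ext (e 0)" using SD[OF w] by simp
         then show "w \<epsilon> e 0 <-> w \<epsilon> H c & sat (ext (H c)) (\<epsilon>) q (case_nat w e')"
          unfolding * using SD[OF w] by simp
        qed
       qed
       also have "\<dots> <-> e 0 = ?d"
        using ext_eq_iff[OF SD[OF e] mk_D[OF d(1)]] unfolding ext_mk[OF d(1)] .
       finally show "(ALL w:S. w \<epsilon> e 0 <-> w \<epsilon> H c & sat (ext (H c)) (\<epsilon>) q (case_nat w e')) = (e 0 = ?d)" .
      qed
     qed
     have sq: "sat (ext (H g)) (\<epsilon>) q (case_nat (\<pi> w) e) = sat (ext (H c)) (\<epsilon>) q (case_nat w e')"
      if w: "w \<in> X \<inter> ext (H c)" for w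
     proof -
      have "case_nat (\<pi> w) e = (%i. \<pi> (case_nat w e' i))" using e'(2) by (auto split: nat.splits)
      moreover have "sat (\<pi> ` (X \<inter> ext (H c))) (\<epsilon>) q (%i. \<pi> (case_nat w e' i)) = sat (X \<inter> ext (H c)) (\<epsilon>) q (case_nat w e')"
       by (rule sat_iso) (use \<pi>inj \<pi>mem w e'(1) in \<open>auto simp: inj_on_def split: nat.splits\<close>)
      moreover have "sat (X \<inter> ext (H c)) (\<epsilon>) q (case_nat w e') = sat (ext (H c)) (\<epsilon>) q (case_nat w e')"
       by (rule elem[OF c(1) cl]) (use w e'(1) in \<open>auto split: nat.splits\<close>)
      ultimately show ?thesis unfolding IH by simp
     qed
     have "ext (\<pi> ?d) = \<pi> ` (X \<inter> ?Y)" unfolding e\<pi>[OF mk_D[OF d(1)]] ext_mk[OF d(1)] ..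
     also have "\<dots> = ext z" unfolding q IH
     proof (intro set_eqI iffI)
      fix v assume "v \<in> \<pi> ` (X \<inter> ?Y)"
      then obtain w where w: "w \<in> X \<inter> ?Y" "v = \<pi> w" by blast
      then show "v \<in> {v \<in> \<pi> ` (X \<inter> ext (H c)). sat (\<pi> ` (X \<inter> ext (H c))) (\<epsilon>) q (case_nat v e)}"
       using sq[of w] unfolding IH by blast
     next
      fix v assume v: "v \<in> {v \<in> \<pi> ` (X \<inter> ext (H c)). sat (\<pi> ` (X \<inter> ext (H c))) (\<epsilon>) q (case_nat v e)}"
      then obtain w where w: "w \<in> X \<inter> ext (H c)" "v = \<pi> w" by blast
      then show "v \<in> \<pi> ` (X \<inter> ?Y)" using sq[of w] v unfolding IH by blast
     qed
     finally have "\<pi> ?d = z" using ext_inj[OF \<pi>D[OF mk_D[OF d(1)]] zD] by blast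
     then show ?thesis using dX dHa by blast
    qed
   next
    fix z assume "z \<in> \<pi> ` (X \<inter> ext (H a))"
    then obtain x where x: "x \<in> X" "x \<in> ext (H a)" "z = \<pi> x" by blast
    have xD: "x \<in> D" using XD x(1) by blast
    show "z \<in> ext (H (\<pi> a))"
    proof (cases "x \<in> ext b")
     case True
     then have "\<pi> x = x" using \<pi>fix[OF xD] b_trans by blast
     then show ?thesis using True x(3) b_H[OF \<pi>aD] by auto
    next
     case False
     then obtain c0 where c0: "c0 \<in> ext a" "x \<in> ext (DefS (H c0))"
      using x(2) unfolding ext_Lh[OF b_D mem.hyps] by blast
     have "c0 \<in> S" using lS[OF al[OF c0(1)]] .
     \<comment> \<open>For the converse, both the level over which \<open>x\<close> is defined and
       the parameters of the definition have to be found in \<open>X\<close>; \<open>sel\<close>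
       gives the former and \<open>select_env\<close> the latter.\<close>
     have "T.dfn X (%e. e 0 \<epsilon> a & x \<in> ext (DefS (H (e 0))))"
     proof (intro T.dfn_conj T.dfn_mem T.dtm_var cX mem.prems(1))
      show "T.dfn X (%e. x \<in> ext (DefS (H (e 0))))"
       using T.dfn2[of X "%x c. x \<in> ext (DefS (H c))", OF r3 cX[OF x(1)] T.dtm_var] .
     qed
     from sel[of "%c. c \<epsilon> a & x \<in> ext (DefS (H c))", OF this \<open>c0 \<in> S\<close>]
     obtain c where c: "c \<in> X" "c \<epsilon> a" "x \<in> ext (DefS (H c))" using c0 by auto
     have ca: "c \<in> ext a" using c XD by simp
     have cl: "c \<in> ext l" by (rule al[OF ca])
     have cO: "c \<in> On" using On_mem[OF lO cl] .
     have HcD: "H c \<in> D" using cO by simp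
     have HcX: "H c \<in> X" by (rule HX[OF c(1) cl])
     have IH: "ext (H (\<pi> c)) = \<pi> ` (X \<inter> ext (H c))" by (rule mem.IH[OF ca c(1) cl])
     have "ext x \<in> Defx (ext (H c))" using c(3) DefS_Defx(1)[OF HcD] by blast
     then obtain q e0 where e0: "!!i. e0 i \<in> ext (H c)"
      and q0: "ext x = {v \<in> ext (H c). sat (ext (H c)) (\<epsilon>) q (case_nat v e0)}"
      unfolding Defx_def by blast
     define P where "P e <-> (ALL w:S. w \<epsilon> x <-> w \<epsilon> H c & sat (ext (H c)) (\<epsilon>) q (case_nat w e))" for e
     have "EX e. (ALL i. e i \<in> X \<inter> ext (H c)) & P e"
     proof (rule T.select_env[of X "ext (H c)" P e0])
      show "X \<subseteq> S" by (rule XS)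
      show "X \<inter> ext (H c) ~= {}" using AX x0_H[of c] cO unfolding A_def by auto
      show "ext (H c) \<subseteq> S" by (rule HS(1)[OF cl])
      have "T.dfn X (%e. e 0 \<epsilon> H c)" by (intro T.dfn_mem T.dtm_var cX HcX)
      then show Hd: "T.dfn X (%e. e 0 \<in> ext (H c))" by (rule T.dfn_cong) (use SD in auto)
      show "EX x:X \<inter> ext (H c). Q x" if Q: "T.dfn X (%e. Q (e 0))" "EX x:ext (H c). Q x" for Q
      proof -
       obtain v where v: "v \<in> ext (H c)" "Q v" using Q(2) by blast
       have "T.dfn X (%e. e 0 \<in> ext (H c) & Q (e 0))" by (intro T.dfn_conj Hd Q(1))
       from sel[of "%x. x \<in> ext (H c) & Q x", OF this, of v]
       show ?thesis using v HS(1)[OF cl] by blast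
      qed
      let ?t = "%i. case i of 0 => (%e. e 0) | Suc i => (%e. e (Suc i))"
      have td: "T.dtm X (?t i)" for i by (cases i) (auto intro: T.dtm_var)
      have "T.dfn X (%w. sat (T.ext (H c)) (\<epsilon>) q (%i. ?t i w))"
       by (rule T.dfn_sat_rel[OF cX[OF HcX] td])
      then have "T.dfn X (%w. sat (ext (H c)) (\<epsilon>) q (case_nat (w 0) (%i. w (Suc i))))"
       unfolding Text[OF subsetD[OF XS HcX]]
       by (rule T.dfn_cong) (auto intro!: arg_cong[of _ _ "sat _ (\<epsilon>) q"] split: nat.splits)
      then show "T.dfn X P" unfolding P_def
       by (intro T.dfn_all T.dfn_iff T.dfn_conj T.dfn_mem T.dtm_var cX HcX x(1))
      show "ALL i. e0 i \<in> ext (H c)" using e0 by blast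
      show "P e0" unfolding P_def
      proof
       fix w assume w: "w \<in> S"
       have "w \<epsilon> x <-> w \<in> ext x" using SD[OF w] by simp
       then show "w \<epsilon> x <-> w \<epsilon> H c & sat (ext (H c)) (\<epsilon>) q (case_nat w e0)"
        unfolding q0 using SD[OF w] by simp
      qed
     qed
     then obtain e where e: "!!i. e i \<in> X \<inter> ext (H c)" and P: "P e" by blast
     have xS: "ext x \<subseteq> S" using tr x(1) XS by blast
     have q: "ext x = {v \<in> ext (H c). sat (ext (H c)) (\<epsilon>) q (case_nat v e)}"
     proof (intro set_eqI iffI)
      fix v assume v: "v \<in> ext x"
      then have "v \<in> S" using xS by blast
      then show "v \<in> {v \<in> ext (H c). sat (ext (H c)) (\<epsilon>) q (case_nat v e)}"
       using P[unfolded P_def, rule_format, of v] v by simp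
     next
      fix v assume v: "v \<in> {v \<in> ext (H c). sat (ext (H c)) (\<epsilon>) q (case_nat v e)}"
      then have "v \<in> S" using HS(1)[OF cl] by blast
      then show "v \<in> ext x" using P[unfolded P_def, rule_format, of v] v by simp
     qed
     have sq: "sat (\<pi> ` (X \<inter> ext (H c))) (\<epsilon>) q (case_nat (\<pi> w) (%i. \<pi> (e i))) = sat (ext (H c)) (\<epsilon>) q (case_nat w e)"
      if w: "w \<in> X \<inter> ext (H c)" for w
     proof -
      have "case_nat (\<pi> w) (%i. \<pi> (e i)) = (%i. \<pi> (case_nat w e i))" by (auto split: nat.splits)
      moreover have "sat (\<pi> ` (X \<inter> ext (H c))) (\<epsilon>) q (%i. \<pi> (case_nat w e i)) = sat (X \<inter> ext (H c)) (\<epsilon>) q (case_nat w e)"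
       by (rule sat_iso) (use \<pi>inj \<pi>mem w e in \<open>auto simp: inj_on_def split: nat.splits\<close>)
      moreover have "sat (X \<inter> ext (H c)) (\<epsilon>) q (case_nat w e) = sat (ext (H c)) (\<epsilon>) q (case_nat w e)"
       by (rule elem[OF c(1) cl]) (use w e in \<open>auto split: nat.splits\<close>)
      ultimately show ?thesis by simp
     qed
     have "ext z = {v \<in> ext (H (\<pi> c)). sat (ext (H (\<pi> c))) (\<epsilon>) q (case_nat v (%i. \<pi> (e i)))}"
      unfolding x(3) e\<pi>[OF xD] IH
     proof (intro set_eqI iffI)
      fix v assume "v \<in> \<pi> ` (X \<inter> ext x)"
      then obtain w where w: "w \<in> X" "w \<in> ext x" "v = \<pi> w" by blast
      then show "v \<in> {v \<in> \<pi> ` (X \<inter> ext (H c)). sat (\<pi> ` (X \<inter> ext (H c))) (\<epsilon>) q (case_nat v (%i. \<pi> (e i)))}"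
       using sq[of w] q by blast
     next
      fix v assume v: "v \<in> {v \<in> \<pi> ` (X \<inter> ext (H c)). sat (\<pi> ` (X \<inter> ext (H c))) (\<epsilon>) q (case_nat v (%i. \<pi> (e i)))}"
      then obtain w where w: "w \<in> X \<inter> ext (H c)" "v = \<pi> w" by blast
      then show "v \<in> \<pi> ` (X \<inter> ext x)" using sq[of w] v q by blast
     qed
     then have "ext z \<in> Defx (ext (H (\<pi> c)))"
      by (rule DefxI[rotated]) (use e IH in blast)
     moreover have "H (\<pi> c) \<in> D" using \<pi>D XD c(1) by blast
     ultimately have "z \<in> ext (DefS (H (\<pi> c)))" using DefS_Defx(1) \<pi>D[OF xD] x(3) by blast
     moreover have "\<pi> c \<in> ext (\<pi> a)" unfolding e\<pi>[OF mem.hyps] using c(1) ca by blast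
     ultimately show ?thesis using DefS_H[OF \<pi>aD] by blast
    qed
   qed
  qed
 qed
 \<comment> \<open>The first level containing \<open>y\<close> has an index definable from
   \<open>y\<close>, so the index is in \<open>X\<close> and \<open>level\<close> applies to
   it.\<close>
 define a where "a = lst (%a. y \<in> ext (H a))"
 note al = lst[of a0 "%a. y \<in> ext (H a)", OF a0, folded a_def]
 have aD: "a \<in> D" using al(1) by simp
 have a0O: "a0 \<in> On" by (rule a0(1))
 have "a \<epsilon> l" using On_sub_mem[OF al(1) a0O lO al(4)] l(2) by simp
 then have al': "a \<in> ext l" using aD by simp
 have yX: "y \<in> X" using AX unfolding A_def by blast
 have "T.dfn X (%e. e 0 = lst (%a. y \<in> ext (H a)))"
  using T.dfn2[of X "%z y. z = lst (%a. y \<in> ext (H a))", OF r5 T.dtm_var cX[OF yX]] .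
 then have aX: "a \<in> X" using MX[OF lS[OF al']] unfolding a_def by blast
 have lev: "ext (H (\<pi> a)) = \<pi> ` (X \<inter> ext (H a))" by (rule level[OF aX al'])
 have "y \<in> ext (H (\<pi> a))" unfolding lev using yX al(2) \<pi>y by (metis IntI imageI)
 moreover have "cnt (ext (H (\<pi> a)))" unfolding lev
  by (rule cnt_image[OF cnt_subset[OF cntX Int_lower1] \<pi>d])
 ultimately show ?thesis using \<pi>On[OF al(1)] by blast
qed

end

subsection \<open>Well-orders of the reals with countable initial segments\<close>

context zfm
begin

lemma image_recursion:
 assumes R: "dfn D (%e. R (e 0) (e (Suc 0)))" and sl: "!!x. x \<in> D ==> isset {y \<in> D. R y x}"
  and ind: "!!P x. dfn D (%e. P (e 0)) ==> (!!x. x \<in> D ==> (!!y. y \<in> D ==> R y x ==> P y) ==> P x) ==> x \<in> D ==> P x"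
  and G: "dtm D (%e. G (e 0) (e (Suc 0)))"
 obtains F where "dtm D (%e. F (e 0))" "!!x. x \<in> D ==> F x = G x (mk (F ` {y \<in> D. R y x}))"
proof -
 let ?pr = "%x. mk {y \<in> D. R y x}"
 have pr: "dtm D (%e. ?pr (e 0))"
 proof (rule dtm_mk)
  have "dfn D (%e. e 0 \<in> D & R (e 0) (e (Suc 0)))" by (intro dfn_intros R)
  then show "dfn D (%e. e 0 \<in> {y \<in> D. R y (e (Suc 0))})" by simp
 qed (use sl in blast)
 have g: "dtm D (%e. G (e 0) (mk ((%z. ap (e (Suc 0)) z) ` ext (?pr (e 0)))))"
  by (rule dtm2[OF G]) (intro dfn_intros dtm1[OF pr])+
 obtain F where F: "dtm D (%e. F (e 0))"
  "!!x. x \<in> D ==> F x = G x (mk ((%z. ap (lam {y \<in> D. R y x} F) z) ` ext (?pr x)))"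
  "!!x. x \<in> D ==> lam {y \<in> D. R y x} F \<in> D"
 proof (rule recursion[of D R "%x f. G x (mk ((%z. ap f z) ` ext (?pr x)))", OF R _ _ g])
  show "P x" if "dfn D (%e. P (e 0))" "!!x. x \<in> D ==> (!!y. y \<in> D ==> R y x ==> P y) ==> P x" "x \<in> D" for P x by (rule ind[OF that])
 qed (rule sl | assumption | rule that)+
 have "F x = G x (mk (F ` {y \<in> D. R y x}))" if x: "x \<in> D" for x
 proof -
  have "ap (lam {y \<in> D. R y x} F) z = F z" if "z \<in> {y \<in> D. R y x}" for z
   by (rule ap_lam'[OF F(3)[OF x] sl[OF x] F(1) that])
  then have "(%z. ap (lam {y \<in> D. R y x} F) z) ` {y \<in> D. R y x} = F ` {y \<in> D. R y x}" by (rule image_cong[OF refl])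
  then show ?thesis using F(2)[OF x] sl[OF x] by simp
 qed
 then show thesis using that F(1) by blast
qed

lemma app_ap:
 assumes "function_on f a" "f \<in> D" "a \<in> D" "x \<in> D" "y \<in> D"
 shows "app f x y <-> x \<in> ext a & y = ap f x"
proof
 assume "app f x y"
 then obtain p where p: "p \<in> D" "opair p x y" "p \<epsilon> f" unfolding app_def by blast
 then obtain x' y' where "x' \<in> D" "y' \<in> D" "x' \<epsilon> a" "opair p x' y'" using assms(1) unfolding function_on_def by blast
 then have "x \<in> ext a" using p(1,2) assms opair_iff op_inject by auto
 then show "x \<in> ext a & y = ap f x" using function_on_ap[OF assms(1,2,3) _ assms(5)] \<open>app f x y\<close> by blast
qed (use function_on_ap[OF assms(1,2,3) _ assms(5)] in blast)

lemma function_iffs: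
 assumes f: "function_on f a" "f \<in> D" "a \<in> D" "b \<in> D"
 shows function_into_iff: "function_into f a b <-> ap f ` ext a \<subseteq> ext b"
  and injective_iff: "injective f <-> inj_on (ap f) (ext a)"
  and bijection_iff: "bijection f a b <-> bij_betw (ap f) (ext a) (ext b)"
proof -
 note A = app_ap[OF f(1,2,3)]
 show 1: "function_into f a b <-> ap f ` ext a \<subseteq> ext b" unfolding function_into_def image_subset_iff Ball_def in_ext using f A by auto
 show 2: "injective f <-> inj_on (ap f) (ext a)" unfolding injective_def inj_on_def using A by (auto simp: f)
 have "(EX x:D. x \<epsilon> a & app f x y) <-> y \<in> ap f ` ext a" if "y \<in> D" for y
  using A[OF _ that] by (auto simp: image_iff)
 then have "(ALL y:D. y \<epsilon> b --> (EX x:D. x \<epsilon> a & app f x y)) <-> (ALL y:D. y \<epsilon> b --> y \<in> ap f ` ext a)" by simp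
 also have "\<dots> <-> ext b \<subseteq> ap f ` ext a" by (auto simp: subset_iff)
 finally have 3: "(ALL y:D. y \<epsilon> b --> (EX x:D. x \<epsilon> a & app f x y)) <-> ext b \<subseteq> ap f ` ext a" .
 then show "bijection f a b <-> bij_betw (ap f) (ext a) (ext b)" unfolding bijection_def bij_betw_def 1 2 3 by blast
qed

lemma lam_iffs:
 assumes F: "dtm D (%e. F (e 0))" and "a \<in> D" "b \<in> D"
 shows "function_into (lam (ext a) F) a b <-> F ` ext a \<subseteq> ext b" "injective (lam (ext a) F) <-> inj_on F (ext a)"
  "bijection (lam (ext a) F) a b <-> bij_betw F (ext a) (ext b)"
proof -
 note l = lam_function_on[OF F assms(2)]
 note i = function_iffs[OF l(2,1) assms(2,3)]
 show "function_into (lam (ext a) F) a b <-> F ` ext a \<subseteq> ext b" "injective (lam (ext a) F) <-> inj_on F (ext a)"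
  "bijection (lam (ext a) F) a b <-> bij_betw F (ext a) (ext b)"
  unfolding i using image_cong[OF refl l(3), of "ext a"] inj_on_cong[of "ext a", OF l(3)] bij_betw_cong[of "ext a", OF l(3)]
  by simp_all
qed

lemma countable_in_iff:
 assumes a: "a \<in> D" shows "countable_in om a <-> cnt (ext a)"
proof
 assume "countable_in om a"
 then obtain f where f: "f \<in> D" "function_into f a om" "injective f" unfolding countable_in_def by blast
 then have fo: "function_on f a" unfolding function_into_def by blast
 note fi = f(2)[unfolded function_into_iff[OF fo f(1) a om_D]] f(3)[unfolded injective_iff[OF fo f(1) a om_D]]
 have d: "dtm D (%e. thex (%x. x \<in> ext a & ap f x = e 0))" by (intro dfn_intros a f)
 note l = lam_function_on[OF d om_D]
 have "EX n. ap (lam (ext om) (%k. thex (%x. x \<in> ext a & ap f x = k))) (nm n) = x" if x: "x \<in> ext a" for x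
 proof -
  have "ap f x \<in> ext om" using fi(1) x by blast
  then obtain n where n: "ap f x = nm n" unfolding ext_om by blast
  have "thex (%x. x \<in> ext a & ap f x = nm n) = x"
   by (rule thex_eq) (use x n inj_onD[OF fi(2)] in auto)
  then show ?thesis using l(3)[of "nm n"] by auto
 qed
 then show "cnt (ext a)" unfolding cnt_def using l(1) by blast
next
 assume "cnt (ext a)"
 then obtain g where g: "g \<in> D" "!!x. x \<in> ext a ==> EX n. ap g (nm n) = x" unfolding cnt_def by blast
 let ?F = "%x. lst (%k. k \<in> ext om & ap g k = x)"
 have d: "dtm D (%e. ?F (e 0))" by (intro dfn_intros g)
 have F: "?F x \<in> ext om" "ap g (?F x) = x" if x: "x \<in> ext a" for x
 proof -
  obtain n where n: "ap g (nm n) = x" using g(2)[OF x] by blast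
  have "?F x \<in> ext om & ap g (?F x) = x"
   by (rule lst_prop[of "nm n"]) (use n nm_On in auto)
  then show "?F x \<in> ext om" "ap g (?F x) = x" by blast+
 qed
 have "inj_on ?F (ext a)" by (rule inj_on_inverseI[of _ "ap g"]) (rule F(2))
 moreover have "?F ` ext a \<subseteq> ext om" using F(1) by blast
 ultimately have "function_into (lam (ext a) ?F) a om" "injective (lam (ext a) ?F)"
  unfolding lam_iffs(1)[OF d a om_D] lam_iffs(2)[OF d a om_D] by blast+
 then show "countable_in om a" unfolding countable_in_def using lam_function_on(1)[OF d a] by blast
qed

abbreviation PP :: 'm where "PP \<equiv> mk {x \<in> D. ext x \<subseteq> ext om}"

lemma ext_PP [simp]: "ext PP = {x \<in> D. ext x \<subseteq> ext om}"
 using isset_pow[OF om_D] by simp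

lemma PP_D [simp, intro]: "PP \<in> D"
 using isset_pow[OF om_D] by simp

lemma CH_in_iff: "CH_in <-> (ALL A:D. ext A \<subseteq> ext PP --> cnt (ext A) \<or> (EX f:D. bijection f A PP))"
proof -
 have "powerset_of P om <-> P = PP" if "P \<in> D" for P
  using ext_eq_iff[OF that PP_D] unfolding powerset_of_iff by simp
 then have "CH_in <-> (ALL A:D. sub A PP --> countable_in om A \<or> (EX f:D. bijection f A PP))"
  unfolding CH_in_def using omega_iff om_D PP_D by blast
 then show ?thesis unfolding sub_iff using countable_in_iff by simp
qed

end

text \<open>A definable well-order of the reals of a model with countable initial segments.
  Constructibility provides one, from which CH follows; choice with CH provides one, along which the
  tower is built.\<close>

locale zfmW = zfm D mem for D :: "'m set" and mem :: "'m => 'm => bool"  (infix "\<epsilon>" 50) +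
 fixes lt :: "'m => 'm => bool"
 assumes dfn_lt: "dfn D (%e. lt (e 0) (e (Suc 0)))"
  and lt_linear: "x \<in> ext PP ==> y \<in> ext PP ==> lt x y \<or> x = y \<or> lt y x"
  and lt_least: "x \<in> ext PP ==> Q x ==> EX z:ext PP. Q z & (ALL y:ext PP. lt y z --> ~ Q y)"
  and lt_cnt: "z \<in> ext PP ==> cnt {y \<in> ext PP. lt y z}"
begin

lemma lt_recursion:
 assumes A: "A \<in> D" "ext A \<subseteq> ext PP" and G: "dtm D (%e. G (e 0) (e (Suc 0)))"
 obtains F where "dtm D (%e. F (e 0))" "!!x. x \<in> ext A ==> F x = G x (mk (F ` {y \<in> ext A. lt y x}))"
  "!!x. x \<in> ext A ==> isset (F ` {y \<in> ext A. lt y x})"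
proof -
 let ?R = "%y x. x \<in> ext A & y \<in> ext A & lt y x"
 have R: "dfn D (%e. ?R (e 0) (e (Suc 0)))" by (intro dfn_intros dfn_lt A)
 have e: "{y \<in> D. ?R y x} = {y \<in> ext A. ?R y x}" for x by auto
 have l1: "dfn D (%e. lt (e 0) x)" if "x \<in> D" for x
  by (rule dfn2[OF dfn_lt]) (intro dfn_intros that)+
 have sl: "isset {y \<in> D. ?R y x}" if x: "x \<in> D" for x
  unfolding e by (rule isset_sep) (intro dfn_intros l1 A x)+
 obtain F where F: "dtm D (%e. F (e 0))" "!!x. x \<in> D ==> F x = G x (mk (F ` {y \<in> D. ?R y x}))"
 proof (rule image_recursion[of ?R G, OF R sl _ G])
  fix P x assume P: "!!x. x \<in> D ==> (!!y. y \<in> D ==> ?R y x ==> P y) ==> P x" and x: "x \<in> D"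
  show "P x"
  proof (cases "x \<in> ext A")
   case True
   show ?thesis
   proof (rule ccontr)
    assume "~ P x"
    then obtain z where z: "z \<in> ext PP" "z \<in> ext A & ~ P z" "ALL y:ext PP. lt y z --> ~ (y \<in> ext A & ~ P y)"
     using lt_least[of x "%z. z \<in> ext A & ~ P z"] True A by blast
    have "P z" by (rule P) (use z A in auto)
    then show False using z by blast
   qed
  qed (use P[OF x] in blast)
 qed (assumption, rule that)
 have 1: "{y \<in> D. ?R y x} = {y \<in> ext A. lt y x}" if "x \<in> ext A" for x using that by auto
 show thesis
 proof (rule that[OF F(1)])
  fix x assume x: "x \<in> ext A"
  then have xD: "x \<in> D" by simp
  show "F x = G x (mk (F ` {y \<in> ext A. lt y x}))" using F(2)[OF xD] unfolding 1[OF x] .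
  show "isset (F ` {y \<in> ext A. lt y x})" using isset_image[OF sl[OF xD] F(1)] unfolding 1[OF x] .
 qed
qed

lemma lt_CH_in: CH_in
 unfolding CH_in_iff
proof (intro ballI impI)
 fix A assume A: "A \<in> D" "ext A \<subseteq> ext PP"
 show "cnt (ext A) \<or> (EX f:D. bijection f A PP)"
 proof (cases "cnt (ext A)")
  case False
  let ?Q = "%s y. y \<in> ext PP & y \<notin> ext s & (ALL z:ext PP. lt z y --> z \<in> ext s)"
  have l: "dfn D (%e. lt (e i) (e j))" for i j by (rule dfn2[OF dfn_lt]) (intro dfn_intros)+
  have "dtm D (%e. thex (?Q (e (Suc 0))))" by (intro dfn_intros l PP_D)
  then obtain F where Fd: "dtm D (%e. F (e 0))"
   and F: "!!x. x \<in> ext A ==> F x = thex (?Q (mk (F ` {y \<in> ext A. lt y x})))"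
   and ist: "!!x. x \<in> ext A ==> isset (F ` {y \<in> ext A. lt y x})"
   by (rule lt_recursion[of A "%x s. thex (?Q s)", OF A]) (rule that)
  have FQ: "?Q (mk (F ` {y \<in> ext A. lt y x})) (F x)" if x: "x \<in> ext A" for x
  proof -
   let ?S = "F ` {y \<in> ext A. lt y x}"
   have "cnt {y \<in> ext A. lt y x}" by (rule cnt_subset[OF lt_cnt[of x]]) (use x A in auto)
   then have "cnt ?S" by (rule cnt_image[OF _ Fd])
   then have "~ ext PP \<subseteq> ?S" using False cnt_subset A by blast
   then obtain y where "y \<in> ext PP" "y \<notin> ?S" by blast
   then obtain z where z: "z \<in> ext PP" "z \<notin> ?S" "ALL y:ext PP. lt y z --> y \<in> ?S"
    using lt_least[of y "%y. y \<notin> ?S"] by blast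
   have "F x = z" unfolding F[OF x] ext_mk[OF ist[OF x]]
   proof (rule thex_eq)
    show "z \<in> D" using z(1) by simp
    fix w assume w: "w \<in> ext PP & w \<notin> ?S & (ALL z:ext PP. lt z w --> z \<in> ?S)"
    then show "w = z" using z lt_linear[of w z] by blast
   qed (use z in blast)
   then show ?thesis using z unfolding ext_mk[OF ist[OF x]] by blast
  qed
  have inP: "F x \<in> ext PP" and new: "F x \<notin> F ` {y \<in> ext A. lt y x}" and below: "!!z. z \<in> ext PP ==> lt z (F x) ==> z \<in> F ` ext A"
   if x: "x \<in> ext A" for x using FQ[OF x] unfolding ext_mk[OF ist[OF x]] by blast+
  have inj: "inj_on F (ext A)"
  proof (rule inj_onI)
   fix x y assume *: "x \<in> ext A" "y \<in> ext A" "F x = F y"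
   have "~ lt u v" if "u \<in> ext A" "v \<in> ext A" "F u = F v" for u v
    using new[OF that(2)] imageI[of u "{y \<in> ext A. lt y v}" F] that by auto
   then have "~ lt x y" "~ lt y x" using * by simp_all
   then show "x = y" using lt_linear[of x y] * A(2) by blast
  qed
  have "y \<in> F ` ext A" if y: "y \<in> ext PP" for y
  proof (rule ccontr)
   assume n: "y \<notin> F ` ext A"
   have "F ` ext A \<subseteq> {z \<in> ext PP. lt z y}"
   proof clarify
    fix x assume x: "x \<in> ext A"
    have "F x ~= y" "~ lt y (F x)" using n x below[OF x y] by blast+
    then show "F x \<in> ext PP & lt (F x) y" using lt_linear[OF inP[OF x] y] inP[OF x] by blast
   qed
   then have c: "cnt (F ` ext A)" by (rule cnt_subset[OF lt_cnt[OF y]])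
   let ?g = "%y. thex (%x. x \<in> ext A & F x = y)"
   have gd: "dtm D (%e. ?g (e 0))" by (intro dfn_intros dtm1[OF Fd] A)
   have "?g (F x) = x" if "x \<in> ext A" for x
    by (rule thex_eq) (use that inj_onD[OF inj] in auto)
   then have "?g ` (F ` ext A) = ext A" by (simp add: image_image)
   then show False using cnt_image[OF c gd] False by simp
  qed
  then have "bij_betw F (ext A) (ext PP)" unfolding bij_betw_def using inj inP by blast
  then show ?thesis using lam_iffs(3)[OF Fd A(1) PP_D] lam_function_on(1)[OF Fd A(1)] by blast
 qed simp
qed

end

context zfmVL
begin

text \<open>Reals are ordered by the first level containing them and then by \<open>wlt\<close>. A
  real in a countable level is then preceded only by members of that level.\<close>

theorem VL_CH_in: CH_in
proof -
 define gm where "gm y = lst (%a. y \<in> ext (H a))" for y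
 define lt where "lt y z <-> gm y \<epsilon> gm z \<or> gm y = gm z & wlt y z" for y z
 have gm: "gm y \<in> On" "y \<in> ext (H (gm y))" "!!a. a \<in> On ==> y \<in> ext (H a) ==> ext (gm y) \<subseteq> ext a" if yD: "y \<in> D" for y
 proof -
  obtain a0 where "a0 \<in> On" "y \<in> ext (H a0)" using yD VL by blast
  note l = lst[of a0 "%a. y \<in> ext (H a)", OF this, folded gm_def]
  show "gm y \<in> On" "y \<in> ext (H (gm y))" by (fact l(1), fact l(2))
  show "ext (gm y) \<subseteq> ext a" if "a \<in> On" "y \<in> ext (H a)" for a
   using lst_le[of a "%a. y \<in> ext (H a)", OF that] unfolding gm_def .
 qed
 have x0D: "x0 \<in> D" by simp
 have gd: "dtm D (%e. gm (e i))" for i unfolding gm_def by (intro dfn_intros dtm_HA x0D)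
 interpret W: zfmW D mem lt
 proof
  show "dfn D (%e. lt (e 0) (e (Suc 0)))" unfolding lt_def by (intro dfn_intros gd dfn_wlt x0D)
  show "lt x y \<or> x = y \<or> lt y x" if "x \<in> ext PP" "y \<in> ext PP" for x y
  proof -
   have "x \<in> D" "y \<in> D" using that by auto
   then show ?thesis unfolding lt_def using On_linear[of "gm x" "gm y"] gm(1) wlt_linear[of x y] by metis
  qed
  show "EX z:ext PP. Q z & (ALL y:ext PP. lt y z --> ~ Q y)" if x: "x \<in> ext PP" "Q x" for x Q
  proof -
   have xD: "x \<in> D" using x by simp
   obtain a where a: "a \<in> On" "EX x:ext PP. Q x & gm x = a" "!!c. c \<in> ext a ==> ~ (EX x:ext PP. Q x & gm x = c)"
    using On_least[of "gm x" "%a. EX x:ext PP. Q x & gm x = a"] gm(1)[OF xD] x by blast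
   then obtain x' where x': "x' \<in> ext PP" "Q x'" "gm x' = a" by blast
   then have "x' \<in> D" by simp
   then obtain z where z: "z \<in> D" "z \<in> ext PP & Q z & gm z = a"
    "!!w. w \<in> D ==> w \<in> ext PP & Q w & gm w = a ==> ~ wlt w z"
    using wlt_least[of "%z. z \<in> ext PP & Q z & gm z = a" x'] x' by blast
   have "~ Q y" if y: "y \<in> ext PP" "lt y z" for y
   proof
    assume q: "Q y"
    have yD: "y \<in> D" using y by simp
    have "gm y \<notin> ext a" using a(3) q y(1) by blast
    then have "~ gm y \<epsilon> a" using gm(1)[OF yD] by simp
    then have "gm y = a" "wlt y z" using y(2) z(2) unfolding lt_def by blast+
    then show False using z(3)[OF yD] y(1) q by blast
   qed
   then show ?thesis using z by blast
  qed
  show "cnt {y \<in> ext PP. lt y z}" if z: "z \<in> ext PP" for z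
  proof -
   have zD: "z \<in> D" "ext z \<subseteq> ext om" using z by auto
   obtain g where g: "g \<in> On" "z \<in> ext (H g)" "cnt (ext (H g))" using real_in_countable_level[OF zD] by blast
   have "{y \<in> ext PP. lt y z} \<subseteq> ext (H g)"
   proof clarify
    fix y assume y: "y \<in> ext PP" "lt y z"
    then have yD: "y \<in> D" by simp
    have gD: "g \<in> D" and O: "gm y \<in> On" "gm z \<in> On" using g(1) gm(1) yD zD by auto
    have "ext (gm z) \<subseteq> ext g" using gm(3)[OF zD(1) g(1,2)] .
    moreover have "ext (gm y) \<subseteq> ext (gm z)" using y(2) On_sub[OF O] unfolding lt_def by blast
    ultimately have "gm y \<epsilon> g \<or> gm y = g" using On_sub[OF O(1) g(1)] by blast
    then have "ext (H (gm y)) \<subseteq> ext (H g)" using H_mem_mono[OF g(1), of "gm y"] O by auto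
    then show "y \<in> ext (H g)" using gm(2)[OF yD] by blast
   qed
   then show ?thesis by (rule cnt_subset[OF g(3)])
  qed
 qed
 show ?thesis by (rule W.lt_CH_in)
qed

end

context zfm
begin

text \<open>The axiom speaks of disjoint families, so each member \<open>s\<close> is replaced by
  the set of pairs with first component \<open>s\<close>.\<close>

lemma choice_function:
 assumes choice "a \<in> D" and ne: "!!s. s \<in> ext a ==> ext s ~= {}"
 obtains c where "c \<in> D" "!!s. s \<in> ext a ==> ap c s \<in> ext s"
proof -
 let ?t = "%s. mk ((%x. op s x) ` ext s)"
 let ?T = "mk (?t ` ext a)"
 have iT: "isset (?t ` ext a)" by (rule isset_rep) (intro dfn_intros assms(2))+
 have et: "ext (?t s) = (%x. op s x) ` ext s" if "s \<in> D" for s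
  by (rule ext_mk, rule isset_rep) (intro dfn_intros that)+
 have tT: "?t s \<in> D" "?t s \<epsilon> ?T" if "s \<in> ext a" for s
 proof -
  show "?t s \<in> D" by (rule mk_D, rule isset_rep) (use that in \<open>auto intro!: dfn_intros\<close>)
  have "?t s \<in> ext ?T" using that unfolding ext_mk[OF iT] by blast
  then show "?t s \<epsilon> ?T" by simp
 qed
 have Te: "EX s:ext a. x = ?t s" if "x \<in> D" "x \<epsilon> ?T" for x
 proof -
  have "x \<in> ext ?T" using that by simp
  then show ?thesis unfolding ext_mk[OF iT] by blast
 qed
 have opt: "EX x:ext s. z = op s x" if "s \<in> ext a" "z \<in> D" "z \<epsilon> ?t s" for s z
 proof -
  have sD: "s \<in> D" using that by simp
  have "z \<in> ext (?t s)" using that by simp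
  then show ?thesis unfolding et[OF sD] by blast
 qed
 have "EX c:D. ALL x:D. x \<epsilon> ?T --> (EX! z. z \<in> D & z \<epsilon> x & z \<epsilon> c)"
 proof (rule assms(1)[unfolded choice_def, rule_format, OF mk_D[OF iT]], intro conjI ballI impI)
  fix x assume "x \<in> D" "x \<epsilon> ?T"
  then obtain s where s: "s \<in> ext a" "x = ?t s" using Te by blast
  then have sD: "s \<in> D" by simp
  obtain y where "y \<in> ext s" using ne[OF s(1)] by blast
  then have "op s y \<in> ext x" unfolding s(2) et[OF sD] by blast
  then show "~ is_empty x" unfolding is_empty_def by auto
 next
  fix x y assume x: "x \<in> D" and y: "y \<in> D" and *: "x \<epsilon> ?T & y \<epsilon> ?T & x ~= y"
  obtain s where s: "s \<in> ext a" "x = ?t s" using Te[OF x] * by blast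
  obtain u where u: "u \<in> ext a" "y = ?t u" using Te[OF y] * by blast
  have D: "s \<in> D" "u \<in> D" using s u by auto
  show "~ (EX z:D. z \<epsilon> x & z \<epsilon> y)"
  proof
   assume "EX z:D. z \<epsilon> x & z \<epsilon> y"
   then obtain z where z: "z \<in> D" "z \<epsilon> x" "z \<epsilon> y" by blast
   obtain v w where "v \<in> ext s" "z = op s v" "w \<in> ext u" "z = op u w"
    using opt[OF s(1) z(1)] opt[OF u(1) z(1)] z s u by blast
   then have "s = u" using op_inject D by auto
   then show False using * s u by blast
  qed
 qed
 then obtain c where c: "c \<in> D" and cu: "ALL x:D. x \<epsilon> ?T --> (EX! z. z \<in> D & z \<epsilon> x & z \<epsilon> c)" by (rule bexE)
 let ?F = "%s. thex (%x. x \<in> ext s & op s x \<epsilon> c)"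
 have d: "dtm D (%e. ?F (e 0))" by (intro dfn_intros c)
 note l = lam_function_on[OF d assms(2)]
 have "ap (lam (ext a) ?F) s \<in> ext s" if s: "s \<in> ext a" for s
 proof -
  have sD: "s \<in> D" using s by simp
  from bspec[OF cu tT(1)[OF s]] tT(2)[OF s] have "EX! z. z \<in> D & z \<epsilon> ?t s & z \<epsilon> c" by (rule mp)
  then obtain z where z: "z \<in> D & z \<epsilon> ?t s & z \<epsilon> c"
   and zu: "ALL w. w \<in> D & w \<epsilon> ?t s & w \<epsilon> c --> w = z" by (rule ex1E)
  obtain x where x: "x \<in> ext s" "z = op s x" using opt[OF s] z by blast
  have "?F s = x"
  proof (rule thex_eq)
   fix y assume y: "y \<in> D" "y \<in> ext s & op s y \<epsilon> c"
   then have "op s y \<in> ext (?t s)" unfolding et[OF sD] by blast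
   then have "op s y = z" using zu y by simp
   then show "y = x" using x y sD op_inject by auto
  qed (use x z in auto)
  then show ?thesis using l(3)[OF s] x by simp
 qed
 then show thesis using that l(1) by blast
qed

lemma On_not_isset: "~ isset On"
proof
 assume i: "isset On"
 have "mk On \<in> On"
 proof (rule transitive_On)
  show "ext x \<subseteq> ext (mk On)" if "x \<in> ext (mk On)" for x
   using that On_mem unfolding ext_mk[OF i] by blast
 qed (use i in auto)
 then have "mk On \<in> ext (mk On)" unfolding ext_mk[OF i] .
 then show False using mem_irrefl[of "mk On"] by auto
qed

lemma zfmW_of_rank:
 assumes d: "dtm D (%e. \<rho> (e 0))" and O: "!!y. y \<in> ext PP ==> \<rho> y \<in> On" and inj: "inj_on \<rho> (ext PP)"
  and c: "!!z. z \<in> ext PP ==> cnt {y \<in> ext PP. \<rho> y \<epsilon> \<rho> z}"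
 shows "zfmW D mem (%y z. \<rho> y \<epsilon> \<rho> z)"
proof
 show "dfn D (%e. \<rho> (e 0) \<epsilon> \<rho> (e (Suc 0)))" by (intro dfn_intros dtm1[OF d])
 show "\<rho> x \<epsilon> \<rho> y \<or> x = y \<or> \<rho> y \<epsilon> \<rho> x" if "x \<in> ext PP" "y \<in> ext PP" for x y
  using On_linear[OF O[OF that(1)] O[OF that(2)]] inj_onD[OF inj _ that] by blast
 show "EX z:ext PP. Q z & (ALL y:ext PP. \<rho> y \<epsilon> \<rho> z --> ~ Q y)" if x: "x \<in> ext PP" "Q x" for x Q
 proof -
  obtain a where a: "a \<in> On" "EX x:ext PP. Q x & \<rho> x = a" "!!c. c \<in> ext a ==> ~ (EX x:ext PP. Q x & \<rho> x = c)"
   using On_least[of "\<rho> x" "%a. EX x:ext PP. Q x & \<rho> x = a"] O[OF x(1)] x by blast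
  then obtain z where z: "z \<in> ext PP" "Q z" "\<rho> z = a" by blast
  have "~ Q y" if y: "y \<in> ext PP" "\<rho> y \<epsilon> \<rho> z" for y
  proof -
   have "\<rho> y \<in> ext a" using y(2) O[OF y(1)] unfolding z(3) by simp
   then show ?thesis using a(3) y(1) by blast
  qed
  then show ?thesis using z by blast
 qed
qed (rule c)

text \<open>Zermelo's argument: new reals are chosen along the ordinals, and if this never exhausted
  the reals, replacement along the inverse map would make the ordinals a set.\<close>

lemma choice_rank:
 assumes choice
 obtains \<rho> where "dtm D (%e. \<rho> (e 0))" "!!y. y \<in> ext PP ==> \<rho> y \<in> On" "inj_on \<rho> (ext PP)"
proof -
 let ?a = "mk {s \<in> ext (mk {s \<in> D. ext s \<subseteq> ext PP}). ext s ~= {}}"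
 have "isset {s \<in> ext (mk {s \<in> D. ext s \<subseteq> ext PP}). ~ ext s \<subseteq> ext (mk {})}"
  by (rule isset_sep) (intro dfn_intros mk_D isset_pow PP_D)+
 then have ia: "isset {s \<in> ext (mk {s \<in> D. ext s \<subseteq> ext PP}). ext s ~= {}}" by simp
 have ea: "ext ?a = {s \<in> D. ext s \<subseteq> ext PP & ext s ~= {}}"
  using ext_mk[OF ia] ext_mk[OF isset_pow[OF PP_D]] by blast
 obtain c where c: "c \<in> D" "!!s. s \<in> ext ?a ==> ap c s \<in> ext s"
  by (rule choice_function[OF assms mk_D[OF ia]]) (use ea in blast, rule that)
 have G: "dtm D (%e. ap c (mk {z \<in> ext PP. z \<notin> ext (e (Suc 0))}))" by (intro dfn_intros c PP_D)
 obtain g where gd: "dtm D (%e. g (e 0))"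
  and g0: "!!x. x \<in> D ==> g x = ap c (mk {z \<in> ext PP. z \<notin> ext (mk (g ` {y \<in> D. y \<epsilon> x}))})"
 proof (rule image_recursion[of "%y x. y \<epsilon> x" "%x v. ap c (mk {z \<in> ext PP. z \<notin> ext v})", OF _ _ _ G])
  show "dfn D (%e. e 0 \<epsilon> e (Suc 0))" by (intro dfn_intros)
  show "isset {y \<in> D. y \<epsilon> x}" if "x \<in> D" for x using isset_ext[OF that] unfolding ext_def .
  show "P x" if P: "!!x. x \<in> D ==> (!!y. y \<in> D ==> y \<epsilon> x ==> P y) ==> P x" and "x \<in> D" for P x
   using that(2)
  proof (induction x rule: mem_induct)
   case (mem x)
   then show ?case using P[OF mem.hyps] by simp
  qed
 qed (rule that)
 have g: "g x \<in> ext PP" "g x \<notin> g ` ext x" if x: "x \<in> D" and n: "~ ext PP \<subseteq> g ` ext x" for x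
 proof -
  let ?s = "mk {z \<in> ext PP. z \<notin> ext (mk (g ` ext x))}"
  have i: "isset (g ` ext x)" by (rule isset_rep[OF gd x])
  have j: "isset {z \<in> ext PP. z \<notin> ext (mk (g ` ext x))}"
   by (rule isset_sep) (intro dfn_intros PP_D mk_D i)+
  have s: "?s \<in> D" "ext ?s = ext PP - g ` ext x" using mk_D[OF j] ext_mk[OF j] ext_mk[OF i] by blast+
  have "?s \<in> ext ?a" unfolding ea using s n by blast
  then have "ap c ?s \<in> ext PP - g ` ext x" using c(2) s(2) by blast
  moreover have "g x = ap c ?s" using g0[OF x] unfolding ext_def[of x, symmetric] .
  ultimately show "g x \<in> ext PP" "g x \<notin> g ` ext x" by simp_all
 qed
 have "EX a:On. ext PP \<subseteq> g ` ext a"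
 proof (rule ccontr)
  assume n: "~ ?thesis"
  then have G: "g a \<in> ext PP" "g a \<notin> g ` ext a" if "a \<in> On" for a using g[of a] that by auto
  have inj: "inj_on g On"
  proof (rule inj_onI)
   fix a b assume *: "a \<in> On" "b \<in> On" "g a = g b"
   have "~ u \<epsilon> v" if "u \<in> On" "v \<in> On" "g u = g v" for u v
    using G(2)[OF that(2)] that imageI[of u "ext v" g] by auto
   then have "~ a \<epsilon> b" "~ b \<epsilon> a" using * by simp_all
   then show "a = b" using On_linear *(1,2) by blast
  qed
  let ?k = "%y. thex (%a. a \<in> On & g a = y)"
  have k: "?k (g a) = a" if "a \<in> On" for a by (rule thex_eq) (use that inj_onD[OF inj] in auto)
  have "isset {y \<in> ext PP. EX a:D. a \<in> On & g a = y}" by (rule isset_sep) (intro dfn_intros dtm1[OF gd] PP_D)+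
  moreover have "{y \<in> ext PP. EX a:D. a \<in> On & g a = y} = g ` On" using G(1) by auto
  ultimately have "isset (g ` On)" by simp
  then have "isset (?k ` (g ` On))" by (rule isset_image) (intro dfn_intros dtm1[OF gd])
  moreover have "?k ` (g ` On) = On" unfolding image_image using k by simp
  ultimately show False using On_not_isset by simp
 qed
 then obtain \<theta> where \<theta>: "\<theta> \<in> On" "ext PP \<subseteq> g ` ext \<theta>" by blast
 let ?r = "%y. lst (%a. g a = y)"
 have r: "?r y \<in> On" "g (?r y) = y" if yP: "y \<in> ext PP" for y
 proof -
  obtain a where a: "a \<in> ext \<theta>" "g a = y" using yP \<theta>(2) by blast
  show "?r y \<in> On" "g (?r y) = y"
   using lst_On[of a "%a. g a = y"] lst_prop[of a "%a. g a = y"] On_mem[OF \<theta>(1) a(1)] a(2) by blast+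
 qed
 show thesis
 proof (rule that[of ?r])
  show "dtm D (%e. ?r (e 0))" by (intro dfn_intros dtm1[OF gd])
  show "inj_on ?r (ext PP)" by (rule inj_on_inverseI[of _ g]) (rule r(2))
 qed (rule r(1))
qed

text \<open>The internal form of \<open>CH_well_order\<close>: the order is pulled back from the
  first uncountable initial segment along a bijection provided by CH.\<close>

lemma choice_CH_wo:
 assumes choice CH_in obtains lt where "zfmW D mem lt"
proof -
 obtain \<rho> where \<rho>: "dtm D (%e. \<rho> (e 0))" "!!y. y \<in> ext PP ==> \<rho> y \<in> On" "inj_on \<rho> (ext PP)"
  by (rule choice_rank[OF assms(1)]) (rule that)
 show thesis
 proof (cases "ALL z:ext PP. cnt {y \<in> ext PP. \<rho> y \<epsilon> \<rho> z}")
  case True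
  then show thesis using that zfmW_of_rank[OF \<rho>] by blast
 next
  case False
  then obtain z1 where z1: "z1 \<in> ext PP" "~ cnt {y \<in> ext PP. \<rho> y \<epsilon> \<rho> z1}" by blast
  obtain a where a: "a \<in> On" "EX x:ext PP. ~ cnt {y \<in> ext PP. \<rho> y \<epsilon> \<rho> x} & \<rho> x = a"
   "!!c. c \<in> ext a ==> ~ (EX x:ext PP. ~ cnt {y \<in> ext PP. \<rho> y \<epsilon> \<rho> x} & \<rho> x = c)"
   using On_least[of "\<rho> z1" "%a. EX x:ext PP. ~ cnt {y \<in> ext PP. \<rho> y \<epsilon> \<rho> x} & \<rho> x = a"] \<rho>(2)[OF z1(1)] z1 by blast
  then have nc: "~ cnt {y \<in> ext PP. \<rho> y \<epsilon> a}" by blast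
  let ?A = "mk {y \<in> ext PP. \<rho> y \<epsilon> a}"
  have aD: "a \<in> D" using a(1) by simp
  have iA: "isset {y \<in> ext PP. \<rho> y \<epsilon> a}" by (rule isset_sep) (intro dfn_intros dtm1[OF \<rho>(1)] aD PP_D)+
  note AD = mk_D[OF iA] and eA = ext_mk[OF iA]
  have "ext ?A \<subseteq> ext PP" unfolding eA by blast
  then have "cnt (ext ?A) \<or> (EX f:D. bijection f ?A PP)" using assms(2)[unfolded CH_in_iff] AD by blast
  then obtain f where f: "f \<in> D" "bijection f ?A PP" using nc unfolding eA by blast
  then have "function_on f ?A" unfolding bijection_def function_into_def by blast
  note bij = f(2)[unfolded bijection_iff[OF this f(1) AD PP_D] eA]
  define k where "k y = thex (%x. x \<in> ext ?A & ap f x = y)" for y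
  have kd: "dtm D (%e. k (e 0))" unfolding k_def by (intro dfn_intros f AD)
  have k: "k y \<in> ext PP" "\<rho> (k y) \<in> ext a" "ap f (k y) = y" if y: "y \<in> ext PP" for y
  proof -
   have "y \<in> ap f ` {y \<in> ext PP. \<rho> y \<epsilon> a}" unfolding bij_betw_imp_surj_on[OF bij] by (rule y)
   then obtain x where x0: "x \<in> {y \<in> ext PP. \<rho> y \<epsilon> a}" "y = ap f x" by (rule imageE) (rule that)
   then have x: "x \<in> ext PP" "\<rho> x \<epsilon> a" "ap f x = y" by simp_all
   have "k y = x" unfolding k_def
   proof (rule thex_eq)
    show "x \<in> D" using x(1) by simp
    show "x \<in> ext ?A & ap f x = y" unfolding eA using x0 by simp
    fix w assume w: "w \<in> ext ?A & ap f w = y"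
    show "w = x" by (rule inj_onD[OF bij_betw_imp_inj_on[OF bij] _ _ x0(1)]) (use w x(3) in \<open>unfold eA, simp_all\<close>)
   qed
   then show "k y \<in> ext PP" "\<rho> (k y) \<in> ext a" "ap f (k y) = y" using x \<rho>(2)[OF x(1)] by auto
  qed
  have "zfmW D mem (%y z. \<rho> (k y) \<epsilon> \<rho> (k z))"
  proof (rule zfmW_of_rank)
   show "dtm D (%e. \<rho> (k (e 0)))" by (rule dtm1[OF \<rho>(1) kd])
   show "\<rho> (k y) \<in> On" if "y \<in> ext PP" for y using \<rho>(2) k(1)[OF that] by blast
   show "inj_on (%y. \<rho> (k y)) (ext PP)"
   proof (rule inj_onI)
    fix y z assume *: "y \<in> ext PP" "z \<in> ext PP" "\<rho> (k y) = \<rho> (k z)"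
    have e: "k y = k z" by (intro inj_onD[OF \<rho>(3) *(3)] k(1) *(1,2))
    show "y = z" by (rule box_equals[OF arg_cong[OF e, of "ap f"] k(3)[OF *(1)] k(3)[OF *(2)]])
   qed
   fix z assume z: "z \<in> ext PP"
   have "cnt {y \<in> ext PP. \<rho> y \<epsilon> \<rho> (k z)}" using a(3)[OF k(2)[OF z]] k(1)[OF z] by blast
   then have "cnt (ap f ` {y \<in> ext PP. \<rho> y \<epsilon> \<rho> (k z)})" by (rule cnt_image) (intro dfn_intros f)
   then show "cnt {y \<in> ext PP. \<rho> (k y) \<epsilon> \<rho> (k z)}"
   proof (rule cnt_subset)
    show "{y \<in> ext PP. \<rho> (k y) \<epsilon> \<rho> (k z)} \<subseteq> ap f ` {y \<in> ext PP. \<rho> y \<epsilon> \<rho> (k z)}"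
    proof clarify
     fix y assume y: "y \<in> ext PP" "\<rho> (k y) \<epsilon> \<rho> (k z)"
     then have ky: "k y \<in> {y \<in> ext PP. \<rho> y \<epsilon> \<rho> (k z)}" using k(1) by blast
     then show "y \<in> ap f ` {y \<in> ext PP. \<rho> y \<epsilon> \<rho> (k z)}" using imageI[OF ky, of "ap f"] k(3)[OF y(1)] by simp
    qed
   qed
  qed
  then show thesis by (rule that)
 qed
qed

end

subsection \<open>Reals of a model\<close>

context zfm
begin

declare nm.simps [simp del] num.simps [simp del]

text \<open>As omega is standard, arithmetic relations between external numbers are definable
  inside; hence the reals of a model satisfy \<open>closed_ar\<close>.\<close>

lemma ar_dfn: "ar reals P ==> dfn D (%e. P (%i. nof (e i)))"
proof (induction rule: ar.induct)
 case (ar_mem_var B i)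
 then show ?case by (intro dfn_intros)
next
 case (ar_all' P)
 have "dfn D (%e. P (case_nat (nof (e 0)) (%i. nof (e (Suc i)))))"
  by (rule dfn_cong[OF ar_all'.IH]) (rule arg_cong[of _ _ P], auto split: nat.splits)
 then show ?case by (rule dfn_all_nat)
next
 case (ar_card' P i j)
 have "dfn D (%e. P (case_nat (nof (e 0)) (%i. nof (e (Suc i)))))"
  by (rule dfn_cong[OF ar_card'.IH]) (rule arg_cong[of _ _ P], auto split: nat.splits)
 from ntm_card[OF ntm_nof[OF dtm_var] this] show ?case by (rule dfn_nat_eq[OF ntm_nof[OF dtm_var]])
next
 case (ar_nand P Q)
 then show ?case by (intro dfn_not dfn_conj)
qed (intro dfn_intros)+

lemma closed_reals: "closed_ar reals"
 unfolding closed_ar_def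
proof (intro allI impI)
 fix P :: "(nat => nat) => bool" and e assume "ar reals P"
 then have d: "dfn D (%e. P (%i. nof (e i)))" by (rule ar_dfn)
 have "dtm D (%w. case i of 0 => w 0 | Suc j => nm (e j))" for i
  by (cases i) (auto intro: dfn_intros)
 from dfn_subst'[OF d this] have "dfn D (%w. P (case_nat (nof (w 0)) e))"
  by (rule dfn_cong) (rule arg_cong[of _ _ P], auto split: nat.splits)
 then show "{n. P (case_nat n e)} \<in> reals" by (rule realsI)
qed

lemma all_rl: "(ALL A:D. ext A \<subseteq> ext om --> Q A) <-> (ALL B:reals. Q (rl B))"
 using rl_rof rof_reals rl_D ext_rl_om by metis

lemma rl_PP: "B \<in> reals ==> rl B \<in> ext PP"
 using ext_rl_om by simp

lemma rl_sub: "A \<in> reals ==> B \<in> reals ==> ext (rl A) \<subseteq> ext (rl B) <-> A \<subseteq> B"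
 by (auto simp: ext_rl)

lemma mem_rl: "B \<in> reals ==> nm n \<epsilon> rl B <-> n \<in> B"
 using rof_rl[of B] unfolding rof_def by blast

lemma finite_in_iff:
 assumes a: "a \<in> D" shows "finite_in om a <-> finite (ext a)"
proof
 assume "finite_in om a"
 then obtain n f where n: "n \<in> D" "n \<epsilon> om" and f: "f \<in> D" "bijection f n a" unfolding finite_in_def by blast
 then have "function_on f n" unfolding bijection_def function_into_def by blast
 note b = f(2)[unfolded bijection_iff[OF this f(1) n(1) a]]
 obtain k where "n = nm k" using n by (rule omE)
 then have "finite (ext n)" by (simp add: ext_nm)
 then show "finite (ext a)" using bij_betw_finite[OF b] by blast
next
 assume fin: "finite (ext a)"
 then obtain h where h: "bij_betw h {..<card (ext a)} (ext a)"
  using ex_bij_betw_nat_finite atLeast0LessThan by metis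
 let ?n = "card (ext a)" and ?F = "%k. if k < card (ext a) then h k else a"
 let ?g = "mk ((%k. op (nm k) (?F k)) ` {..?n})"
 have F: "?F k \<in> D" for k using bij_betwE[OF h] a by auto
 have g: "?g \<in> D" "!!k. k < ?n ==> ap ?g (nm k) = h k"
  using ap_finite[of _ ?n ?F] F by (auto intro: mk_D)
 have "bij_betw (nof) (ext (nm ?n)) {..<?n}"
  by (rule bij_betw_byWitness[of _ nm]) (auto simp: ext_nm)
 then have "bij_betw (h \<circ> nof) (ext (nm ?n)) (ext a)" using h by (rule bij_betw_trans)
 then have b: "bij_betw (ap ?g) (ext (nm ?n)) (ext a)"
  by (subst bij_betw_cong[of _ _ "h \<circ> nof"]) (auto simp: ext_nm g)
 have d: "dtm D (%e. ap ?g (e 0))" by (intro dfn_intros g)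
 have "bijection (lam (ext (nm ?n)) (ap ?g)) (nm ?n) a"
  unfolding lam_iffs(3)[OF d nm_D a] by (rule b)
 then show "finite_in om a" unfolding finite_in_def
  using lam_function_on(1)[OF d nm_D] nm_om[of ?n] nm_D[of ?n] by blast
qed

definition fof :: "'m => nat => nat" where
 "fof f n = nof (ap f (nm n))"

lemma graph_fof: "f \<in> D ==> graph (fof f) \<in> reals"
 unfolding graph_def fof_def by (rule realsI) (intro dfn_intros)

lemma fof_eq:
 assumes "f \<in> D" "function_into f om om" shows "ap f (nm n) = nm (fof f n)"
proof -
 have "function_on f om" using assms(2) unfolding function_into_def by blast
 from assms(2)[unfolded function_into_iff[OF this assms(1) om_D om_D]]
 have "ap f (nm n) \<in> ext om" by (rule subsetD) (rule imageI, simp add: nm_om)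
 then show ?thesis unfolding fof_def by (simp add: nm_nof)
qed

lemma ex_fof:
 assumes "graph \<phi> \<in> reals" obtains f where "f \<in> D" "function_into f om om" "fof f = \<phi>"
proof -
 have "dfn D (%e. enc (nof (e (Suc 0))) (nof (e 0)) \<in> graph \<phi>)" by (intro dfn_intros assms)
 then have "dfn D (%e. nof (e 0) = \<phi> (nof (e (Suc 0))))" by (rule dfn_cong) auto
 then have "ntm D (%e. \<phi> (nof (e 0)))" by (rule ntmI)
 then have d: "dtm D (%e. nm (\<phi> (nof (e 0))))" by (rule dtm_nm)
 note l = lam_function_on[OF d om_D]
 show thesis
 proof (rule that[OF l(1)])
  show "function_into (lam (ext om) (%x. nm (\<phi> (nof x)))) om om"
   unfolding lam_iffs(1)[OF d om_D om_D] by auto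
  show "fof (lam (ext om) (%x. nm (\<phi> (nof x)))) = \<phi>"
   unfolding fof_def using l(3)[of "nm _"] by auto
 qed
qed

lemma preimage_of_iff:
 assumes f: "f \<in> D" "function_into f om om" and B: "B \<in> D" "C \<in> D"
 shows "preimage_of C om f B <-> C = rl (fof f -` rof B)"
proof -
 have fo: "function_on f om" using f(2) unfolding function_into_def by blast
 have R: "fof f -` rof B \<in> reals"
  using closed_vimage[OF closed_reals rof_reals[OF B(1)] graph_fof[OF f(1)]] .
 have 1: "(EX y:D. y \<epsilon> B & app f x y) <-> nof x \<in> fof f -` rof B" if x: "x \<in> D" "x \<epsilon> om" for x
 proof -
  obtain n where n: "x = nm n" using x by (rule omE)
  show ?thesis unfolding n using app_ap[OF fo f(1) om_D nm_D[of n]] fof_eq[OF f, of n] by (auto simp: rof_def)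
 qed
 have "preimage_of C om f B <-> (ALL x:D. x \<epsilon> C <-> x \<in> nm ` (fof f -` rof B))"
  unfolding preimage_of_def
 proof (rule ball_cong[OF refl])
  fix x assume x: "x \<in> D"
  show "(x \<epsilon> C <-> x \<epsilon> om & (EX y:D. y \<epsilon> B & app f x y)) <-> (x \<epsilon> C <-> x \<in> nm ` (fof f -` rof B))"
   unfolding in_nm_image[OF x] using 1[OF x] by (cases "x \<epsilon> om") simp_all
 qed
 also have "\<dots> <-> ext C = nm ` (fof f -` rof B)" unfolding ext_def by auto
 also have "\<dots> <-> C = rl (fof f -` rof B)" using ext_eq_iff[OF B(2) rl_D[OF R]] unfolding ext_rl[OF R] .
 finally show ?thesis .
qed

lemma admissible_in_iff:
 assumes f: "f \<in> D" "function_into f om om" shows "admissible_in r om f <-> admissible r (fof f)"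
proof (cases r)
 case Katetov_Blass
 have R: "fof f -` rof B \<in> reals" if "B \<in> D" for B
  using closed_vimage[OF closed_reals rof_reals[OF that] graph_fof[OF f(1)]] .
 have s: "rof (mk {nm k}) = {k}" for k unfolding rof_def by auto
 have fin: "finite_in om (rl (fof f -` rof B)) <-> finite (fof f -` rof B)" if "B \<in> D" for B
  using finite_in_iff[OF rl_D[OF R[OF that]]] unfolding ext_rl[OF R[OF that]]
  by (simp add: finite_image_iff inj_on_def)
 have "admissible_in r om f <-> (ALL k. finite_in om (rl (fof f -` rof (mk {nm k}))))"
 proof
  assume L: "admissible_in r om f"
  show "ALL k. finite_in om (rl (fof f -` rof (mk {nm k})))"
  proof
   fix k
   have s: "mk {nm k} \<in> D" by simp
   note RD = rl_D[OF R[OF s]]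
   have "upair (mk {nm k}) (nm k) (nm k)" by (simp add: upair_iff)
   moreover have "preimage_of (rl (fof f -` rof (mk {nm k}))) om f (mk {nm k})"
    unfolding preimage_of_iff[OF f s RD] ..
   ultimately show "finite_in om (rl (fof f -` rof (mk {nm k})))"
    using L[unfolded Katetov_Blass admissible_in.simps, THEN bspec[OF _ nm_D[of k]], THEN bspec[OF _ s], THEN bspec[OF _ RD]]
     nm_om[of k] by blast
  qed
 next
  assume Rt: "ALL k. finite_in om (rl (fof f -` rof (mk {nm k})))"
  show "admissible_in r om f" unfolding Katetov_Blass admissible_in.simps
  proof (intro ballI impI)
   fix y s C assume D: "y \<in> D" "s \<in> D" "C \<in> D" and *: "y \<epsilon> om & upair s y y & preimage_of C om f s"
   obtain k where k: "y = nm k" using omE[of y] D * by blast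
   have "s = mk {nm k}" using * D k by (simp add: upair_iff)
   then show "finite_in om C" using Rt * preimage_of_iff[OF f D(2,3)] by simp
  qed
 qed
 moreover have "finite_in om (rl (fof f -` rof (mk {nm k}))) <-> finite (fof f -` {k})" for k
  using fin[of "mk {nm k}"] s by simp
 ultimately show ?thesis unfolding Katetov_Blass by simp
next
 case One_to_One
 have "function_on f om" using f(2) unfolding function_into_def by blast
 note i = injective_iff[OF this f(1) om_D om_D]
 show ?thesis unfolding One_to_One admissible_in.simps admissible.simps i
  unfolding inj_on_def ext_om using fof_eq[OF f] by auto
qed simp

lemma cnt_om: "cnt (ext om)"
proof -
 have "dtm D (%e. e 0)" by (intro dfn_intros)
 note l = lam_function_on[OF this om_D]
 show ?thesis unfolding cnt_def using l(1) l(3)[of "nm _"] unfolding ext_om by auto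
qed

subsection \<open>The Borel code in a model\<close>

lemma represents_iff:
 assumes "t \<in> D"
 shows "represents (Basic k) t <-> t = op (nm 0) (nm k)"
  "represents (Nor f) t <-> (EX F:D. t = op (nm 1) F & function_on F om & (ALL i. represents (f i) (ap F (nm i))))"
proof -
 show "represents (Basic k) t <-> t = op (nm 0) (nm k)"
  using assms by (auto simp: num_iff opair_iff)
 have A: "function_on F om ==> F \<in> D ==> y \<in> D ==> app F (nm i) y <-> y = ap F (nm i)" for F i y
  using app_ap[of F om "nm i" y] by simp
 show "represents (Nor f) t <-> (EX F:D. t = op (nm 1) F & function_on F om & (ALL i. represents (f i) (ap F (nm i))))"
  (is "_ <-> ?R")
 proof
  assume "represents (Nor f) t"
  then obtain F where "F \<in> D" "t = op (nm 1) F" "function_on F om"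
   "ALL i. EX n:D. EX y:D. num i n & app F n y & represents (f i) y"
   using assms by (auto simp: num_iff opair_iff omega_iff)
  moreover then have "represents (f i) (ap F (nm i))" for i using A[of F _ i] by (metis num_iff)
  ultimately show ?R by blast
 next
  assume ?R
  then obtain F where F: "F \<in> D" "t = op (nm 1) F" "function_on F om" "!!i. represents (f i) (ap F (nm i))" by blast
  have "EX n:D. EX y:D. num i n & app F n y & represents (f i) y" for i
   using F A[of F "ap F (nm i)" i] num_iff[of "nm i" i] nm_D[of i] ap_D[of F "nm i"] by blast
  then show "represents (Nor f) t" unfolding represents.simps
   using F assms num_iff[of "nm 1" 1] omega_iff[OF om_D] opair_iff[of t "nm 1" F] nm_D[of 1] om_D by blast
 qed
qed

text \<open>Evaluates all subcodes at once: \<open>T\<close> is the set of subcodes of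
  \<open>m\<close>, and the recursive function \<open>F\<close> sends each of them to the set of
  reals of the model in its Borel set. The induction behind the recursion is that on the external
  code.\<close>

lemma represents_set:
 assumes m: "m \<in> D" "represents c m"
 obtains J T F where "J \<in> D" "ext J = rl ` (borel_set c \<inter> reals)" "T \<in> D" "m \<in> ext T"
  "!!t. t \<in> ext T ==> EX c. represents c t"
  "!!t G n. t \<in> ext T ==> t = op (nm 1) G ==> G \<in> D ==> function_on G om ==> ap G (nm n) \<in> ext T"
  "dtm D (%e. F (e 0))" "!!t c. t \<in> ext T ==> represents c t ==> ext (F t) = rl ` (borel_set c \<inter> reals)"
proof -
 let ?pr = "%t. if pfst t = nm 1 then mk ((%n. ap (psnd t) n) ` ext om) else mk {}"
 have prd: "dtm D (%e. ?pr (e 0))" by (intro dfn_intros)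
 define T where "T = tcl ?pr m"
 have TD: "T \<in> D" and mT: "m \<in> ext T" unfolding T_def by (rule tcl_D[OF prd m(1)], rule tcl_self[OF prd m(1)])
 have epr: "ext (?pr t) = (if pfst t = nm 1 then range (%n. ap (psnd t) (nm n)) else {})" if "t \<in> D" for t
 proof -
  have "isset ((%n. ap (psnd t) n) ` ext om)" by (rule isset_rep) (intro dfn_intros om_D that dtm_psnd)+
  then show ?thesis unfolding ext_om by (auto simp: image_image)
 qed
 have "ext T \<subseteq> {t \<in> D. EX c. represents c t}" unfolding T_def
 proof (rule tcl_least[OF prd m(1)])
  fix t assume t: "t \<in> {t \<in> D. EX c. represents c t}" and tD: "t \<in> D"
  then obtain c where c: "represents c t" by blast
  show "ext (?pr t) \<subseteq> {t \<in> D. EX c. represents c t}"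
  proof (cases c)
   case (Nor f)
   then obtain G where "G \<in> D" "t = op (nm 1) G" "!!i. represents (f i) (ap G (nm i))"
    using c represents_iff(2)[OF tD] by blast
   then show ?thesis unfolding epr[OF tD] by auto
  qed (use c represents_iff(1)[OF tD] epr[OF tD] in auto)
 qed (use m in blast)
 then have Trep: "EX c. represents c t" if "t \<in> ext T" for t using that by blast
 have Tcl: "y \<in> ext T" if "t \<in> ext T" "y \<in> ext (?pr t)" for t y
  using that unfolding T_def by (rule tcl_closed[OF prd m(1)])
 let ?R = "%s t. t \<in> ext T & s \<in> ext (?pr t)"
 let ?G = "%t s. if pfst t = nm 0 then mk {x \<in> ext PP. psnd t \<epsilon> x} else mk {x \<in> ext PP. ALL y:ext s. x \<notin> ext y}"
 obtain F where Fd: "dtm D (%e. F (e 0))" and F: "!!t. t \<in> D ==> F t = ?G t (mk (F ` {s \<in> D. ?R s t}))"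
 proof (rule image_recursion[of ?R ?G])
  show "dfn D (%e. e (Suc 0) \<in> ext T & e 0 \<in> ext (?pr (e (Suc 0))))" by (intro dfn_intros TD)
  show "dtm D (%e. ?G (e 0) (e (Suc 0)))" by (intro dfn_intros PP_D)
  show "isset {s \<in> D. ?R s t}" if t: "t \<in> D" for t
  proof -
   have "isset {s \<in> ext (?pr t). t \<in> ext T}" by (rule isset_sep) (intro dfn_intros TD t dtm1_D[OF prd t])+
   moreover have "{s \<in> ext (?pr t). t \<in> ext T} = {s \<in> D. ?R s t}" using in_ext by blast
   ultimately show ?thesis by simp
  qed
  fix P t assume P: "!!x. x \<in> D ==> (!!y. y \<in> D ==> ?R y x ==> P y) ==> P x" and t: "t \<in> D"
  have rep: "!!t. t \<in> D ==> represents c t ==> P t" for c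
  proof (induction c)
   case (Basic k)
   show ?case by (rule P[OF Basic(1)]) (use Basic represents_iff(1) epr in auto)
  next
   case (Nor f)
   obtain G where G: "G \<in> D" "t = op (nm 1) G" "!!i. represents (f i) (ap G (nm i))"
    using Nor.prems represents_iff(2) by blast
   show ?case
   proof (rule P[OF Nor.prems(1)])
    have pe: "ext (?pr t) = range (%n. ap G (nm n))" unfolding epr[OF Nor.prems(1)] using G(1,2) by simp
    fix y assume "?R y t"
    then obtain n where "y = ap G (nm n)" unfolding pe by blast
    then show "P y" using Nor.IH[of "f n"] G(3) by blast
   qed
  qed
  show "P t"
  proof (cases "t \<in> ext T")
   case True
   then show ?thesis using Trep rep t by blast
  qed (use P[OF t] in blast)
 qed (rule that)
 have FJ: "!!t. t \<in> ext T ==> represents c t ==> ext (F t) = rl ` (borel_set c \<inter> reals)" for c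
 proof (induction c)
  case (Basic k)
  have tD: "t \<in> D" using Basic by simp
  have t: "t = op (nm 0) (nm k)" using Basic represents_iff(1)[OF tD] by blast
  have i: "isset {x \<in> ext PP. nm k \<epsilon> x}" by (rule isset_sep) (intro dfn_intros PP_D)+
  have "F t = mk {x \<in> ext PP. nm k \<epsilon> x}" using F[OF tD] t by simp
  then have "ext (F t) = {x \<in> ext PP. nm k \<epsilon> x}" using ext_mk[OF i] by simp
  also have "\<dots> = rl ` ({x. k \<in> x} \<inter> reals)"
  proof (intro set_eqI iffI)
   fix x assume "x \<in> {x \<in> ext PP. nm k \<epsilon> x}"
   then have "x \<in> D" "ext x \<subseteq> ext om" "k \<in> rof x" by (auto simp: rof_def)
   then show "x \<in> rl ` ({x. k \<in> x} \<inter> reals)" using rl_rof rof_reals by (intro image_eqI[of _ _ "rof x"]) auto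
  qed (use rl_PP mem_rl in auto)
  finally show ?case by simp
 next
  case (Nor f)
  have tD: "t \<in> D" using Nor by simp
  obtain G where G: "G \<in> D" "t = op (nm 1) G" "!!i. represents (f i) (ap G (nm i))"
   using Nor.prems represents_iff(2)[OF tD] by blast
  have pe: "ext (?pr t) = range (%n. ap G (nm n))" using epr[OF tD] G by simp
  have s: "{s \<in> D. ?R s t} = range (%n. ap G (nm n))" using Nor.prems(1) unfolding pe by auto
  have FS: "F ` {s \<in> D. ?R s t} = range (%n. F (ap G (nm n)))" unfolding s by (simp add: image_image)
  have "isset ((%n. F (ap G n)) ` ext om)" by (rule isset_rep) (intro dfn_intros dtm1[OF Fd] G om_D)+
  then have iS: "isset (F ` {s \<in> D. ?R s t})" unfolding FS by (simp add: ext_om image_image)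
  have im: "ext (mk (F ` {s \<in> D. ?R s t})) = range (%n. F (ap G (nm n)))" using ext_mk[OF iS] unfolding FS .
  have Fn: "ext (F (ap G (nm n))) = rl ` (borel_set (f n) \<inter> reals)" for n
  proof (rule Nor.IH[of "f n"])
   show "ap G (nm n) \<in> ext T" by (rule Tcl[OF Nor.prems(1)]) (use pe in blast)
  qed (use G(3) in auto)
  let ?s = "mk (F ` {s \<in> D. ?R s t})"
  have sD: "?s \<in> D" by (rule mk_D[OF iS])
  have i: "isset {x \<in> ext PP. ALL y:ext ?s. x \<notin> ext y}" by (rule isset_sep) (intro dfn_intros PP_D sD)+
  have "F t = mk {x \<in> ext PP. ALL y:ext ?s. x \<notin> ext y}" using F[OF tD] G(1,2) by simp
  then have "ext (F t) = {x \<in> ext PP. ALL y:ext ?s. x \<notin> ext y}" using ext_mk[OF i] by simp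
  also have "\<dots> = {x \<in> ext PP. ALL n. x \<notin> rl ` (borel_set (f n) \<inter> reals)}" unfolding im using Fn by blast
  also have "\<dots> = rl ` (borel_set (Nor f) \<inter> reals)"
  proof (intro set_eqI iffI)
   fix x assume x: "x \<in> {x \<in> ext PP. ALL n. x \<notin> rl ` (borel_set (f n) \<inter> reals)}"
   then have xD: "x \<in> D" and xr: "rl (rof x) = x" using rl_rof by auto
   have "rof x \<notin> borel_set (f n)" for n
    using x xr rof_reals[OF xD] by (metis (mono_tags, lifting) IntI image_eqI mem_Collect_eq)
   then show "x \<in> rl ` (borel_set (Nor f) \<inter> reals)" using xr rof_reals[OF xD] by (intro image_eqI[of _ _ "rof x"]) auto
  next
   fix x assume "x \<in> rl ` (borel_set (Nor f) \<inter> reals)"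
   then obtain B where B: "B \<in> reals" "x = rl B" "!!n. B \<notin> borel_set (f n)" by auto
   then have "x \<notin> rl ` (borel_set (f n) \<inter> reals)" for n using rl_inj by auto
   then show "x \<in> {x \<in> ext PP. ALL n. x \<notin> rl ` (borel_set (f n) \<inter> reals)}" using rl_PP B by blast
  qed
  finally show ?case .
 qed
 have cl: "ap G (nm n) \<in> ext T" if "t \<in> ext T" "t = op (nm 1) G" "G \<in> D" "function_on G om" for t G n
 proof (rule Tcl[OF that(1)])
  have "t \<in> D" using that(1) by simp
  then show "ap G (nm n) \<in> ext (?pr t)" unfolding epr[OF \<open>t \<in> D\<close>] using that(2,3) by auto
 qed
 show thesis
  by (rule that[OF dtm1_D[OF Fd m(1)] FJ[OF mT m(2)] TD mT Trep cl Fd FJ])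
qed

text \<open>Membership in a coded set is absolute. Any evaluation agrees with the truth by induction
  on the code, and one exists because it can be separated from \<open>T\<close> by means of
  \<open>F\<close>.\<close>

lemma in_coded_iff:
 assumes m: "m \<in> D" "represents c m" and B: "B \<in> reals"
 shows "in_coded om m (rl B) <-> B \<in> borel_set c"
proof -
 note xD = rl_D[OF B]
 have b: "basic_in om t k <-> (EX n. k = nm n & t = op (nm 0) (nm n))" if "t \<in> D" "k \<in> D" for t k
  unfolding basic_in_def using that omE[of k] by (auto simp: num_iff opair_iff)
 have nr: "nor_in om t F <-> function_on F om & t = op (nm 1) F" if "t \<in> D" "F \<in> D" for t F
  unfolding nor_in_def using that by (auto simp: num_iff opair_iff)
 have app: "app F n s <-> (EX i. n = nm i) & s = ap F n" if "function_on F om" "F \<in> D" "n \<in> D" "s \<in> D" for F n s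
  using app_ap[OF that(1,2) om_D that(3,4)] unfolding ext_om by auto
 obtain J T F where T: "T \<in> D" "m \<in> ext T"
  and Trep: "!!t. t \<in> ext T ==> EX c. represents c t"
  and Tcl: "!!t G n. t \<in> ext T ==> t = op (nm 1) G ==> G \<in> D ==> function_on G om ==> ap G (nm n) \<in> ext T"
  and Fd: "dtm D (%e. F (e 0))" and F: "!!t c. t \<in> ext T ==> represents c t ==> ext (F t) = rl ` (borel_set c \<inter> reals)"
  by (rule represents_set[OF m]) (rule that)
 have Fc: "rl B \<in> ext (F t) <-> B \<in> borel_set c" if "t \<in> ext T" "represents c t" for t c
  unfolding F[OF that] using B rl_inj by auto
 show ?thesis
 proof
  assume "in_coded om m (rl B)"
  then obtain T v where Tv: "T \<in> D" "v \<in> D" "m \<epsilon> T" "evaluates om T v (rl B)" "m \<epsilon> v" unfolding in_coded_def by blast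
  have "!!t. t \<in> D ==> t \<epsilon> T ==> represents c t ==> t \<epsilon> v <-> B \<in> borel_set c" for c
  proof (induction c)
   case (Basic k)
   then have t: "t = op (nm 0) (nm k)" using represents_iff(1) by blast
   then have "t \<epsilon> v <-> nm k \<epsilon> rl B" using Tv(4) Basic(1,2) b[OF Basic(1) nm_D[of k]] nm_D[of k] unfolding evaluates_def by blast
   then show ?case using mem_rl[OF B] by simp
  next
   case (Nor f)
   obtain G where G: "G \<in> D" "t = op (nm 1) G" "function_on G om" "!!i. represents (f i) (ap G (nm i))"
    using Nor.prems represents_iff(2) by blast
   have e: "(ALL n:D. ALL s:D. app G n s --> s \<epsilon> T) & (t \<epsilon> v <-> (ALL n:D. ALL s:D. app G n s --> ~ s \<epsilon> v))"
    using Tv(4) Nor.prems(1,2) G(1) nr[OF Nor.prems(1) G(1)] G(2,3) unfolding evaluates_def by blast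
   have a: "ap G (nm i) \<epsilon> T" for i using e app[OF G(3,1) nm_D[of i] ap_D[of G "nm i"]] nm_D[of i] ap_D[of G "nm i"] by blast
   have "(ALL n:D. ALL s:D. app G n s --> ~ s \<epsilon> v) <-> (ALL i. ~ ap G (nm i) \<epsilon> v)" using app[OF G(3,1)] by auto
   also have "\<dots> <-> (ALL i. B \<notin> borel_set (f i))" using Nor.IH[OF rangeI ap_D a G(4)] by simp
   finally show ?case using e by simp
  qed
  then show "B \<in> borel_set c" using Tv m by blast
 next
  assume Bc: "B \<in> borel_set c"
  let ?v = "mk {t \<in> ext T. rl B \<in> ext (F t)}"
  have i: "isset {t \<in> ext T. rl B \<in> ext (F t)}" by (rule isset_sep) (intro dfn_intros dtm1[OF Fd] T xD)+
  note vD = mk_D[OF i] and ev = ext_mk[OF i]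
  have v: "t \<epsilon> ?v <-> t \<in> ext T & rl B \<in> ext (F t)" if "t \<in> D" for t
  proof -
   have "t \<epsilon> ?v <-> t \<in> ext ?v" using that by simp
   then show ?thesis unfolding ev by blast
  qed
  have "evaluates om T ?v (rl B)" unfolding evaluates_def
  proof (intro conjI ballI impI; elim conjE)
   fix t k assume t: "t \<in> D" "k \<in> D" "t \<epsilon> T" "basic_in om t k"
   then obtain n where n: "k = nm n" "t = op (nm 0) (nm n)" using b by blast
   have tT: "t \<in> ext T" using t by simp
   have "represents (Basic n) t" using represents_iff(1)[OF t(1)] n by blast
   from Fc[OF tT this] show "t \<epsilon> ?v <-> k \<epsilon> rl B" unfolding v[OF t(1)] n(1) mem_rl[OF B] using tT by simp
  next
   fix t G n s assume t: "t \<in> D" "G \<in> D" "t \<epsilon> T" "nor_in om t G" and n: "n \<in> D" "s \<in> D" "app G n s"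
   have G: "function_on G om" "t = op (nm 1) G" using t nr by blast+
   have "t \<in> ext T" using t by simp
   from Tcl[OF this G(2) t(2) G(1)] show "s \<epsilon> T" using app[OF G(1) t(2) n(1,2)] n(3) by auto
  next
   fix t G assume t: "t \<in> D" "G \<in> D" "t \<epsilon> T" "nor_in om t G"
   have G: "function_on G om" "t = op (nm 1) G" using t nr by blast+
   have tT: "t \<in> ext T" using t by simp
   then obtain c' where c': "represents c' t" using Trep by blast
   then obtain f where f: "c' = Nor f" using represents_iff(1)[OF t(1)] G(2) t(2) op_inject by (cases c') auto
   then have r: "represents (f i) (ap G (nm i))" for i using c' represents_iff(2)[OF t(1)] G(2) t(2) op_inject by auto
   have "(ALL n:D. ALL s:D. app G n s --> ~ s \<epsilon> ?v) <-> (ALL i. ~ ap G (nm i) \<epsilon> ?v)" using app[OF G(1) t(2)] by auto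
   also have "\<dots> <-> (ALL i. B \<notin> borel_set (f i))" unfolding v[OF ap_D] using Fc[OF Tcl[OF tT G(2) t(2) G(1)] r] Tcl[OF tT G(2) t(2) G(1)] by blast
   also have "\<dots> <-> t \<epsilon> ?v" unfolding v[OF t(1)] using Fc[OF tT c'] tT f by simp
   finally show "t \<epsilon> ?v <-> (ALL n:D. ALL s:D. app G n s --> ~ s \<epsilon> ?v)" by simp
  qed
  moreover have "m \<epsilon> ?v" unfolding v[OF m(1)] using T(2) Fc[OF T(2) m(2)] Bc by blast
  ultimately show "in_coded om m (rl B)" unfolding in_coded_def sub_iff
   using ext_rl_om[OF B] T vD m(1) by auto
 qed
qed

end

context zfm
begin

section \<open>Ultrafilters of a model seen from outside\<close>

definition Uf :: "'m => nat set set" where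
 "Uf U = {A \<in> reals. rl A \<in> ext U}"

lemma all_Uf:
 assumes "U \<in> D" "ext U \<subseteq> ext PP"
 shows "(ALL A:D. A \<epsilon> U --> Q A) <-> (ALL A:Uf U. Q (rl A))"
proof
 assume R: "ALL A:Uf U. Q (rl A)"
 show "ALL A:D. A \<epsilon> U --> Q A"
 proof (intro ballI impI)
  fix A assume A: "A \<in> D" "A \<epsilon> U"
  then have AU: "A \<in> ext U" by simp
  then have "A \<in> ext PP" using assms(2) by blast
  then have "rl (rof A) = A" "rof A \<in> reals" using rl_rof[of A] A by auto
  then show "Q A" using R AU unfolding Uf_def by force
 qed
qed (auto simp: Uf_def)

lemma inter_rl: "A \<in> reals ==> B \<in> reals ==> C \<in> D ==> inter_of C (rl A) (rl B) <-> C = rl (A \<inter> B)"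
proof -
 assume *: "A \<in> reals" "B \<in> reals" "C \<in> D"
 have "nm ` A \<inter> nm ` B = nm ` (A \<inter> B)" by auto
 then show ?thesis using * ext_eq_iff[of C "rl (A \<inter> B)"] closed_inter[OF closed_reals, of A B]
  unfolding inter_of_iff by (simp add: ext_rl)
qed

lemma diff_rl: "A \<in> reals ==> C \<in> D ==> diff_of C om (rl A) <-> C = rl (- A)"
proof -
 assume A: "A \<in> reals" and C: "C \<in> D"
 have "ext om - ext (rl A) = nm ` (- A)" unfolding ext_om ext_rl[OF A] by auto
 then show ?thesis using ext_eq_iff[OF C rl_D[OF closed_compl[OF closed_reals A]]]
  unfolding diff_of_iff ext_rl[OF closed_compl[OF closed_reals A]] by simp
qed

lemma finite_rl: "A \<in> reals ==> finite_in om (rl A) <-> finite A"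
 using finite_in_iff[of "rl A"] by (simp add: ext_rl finite_image_iff inj_on_def)

lemma in_Uf: "U \<in> D ==> A \<in> reals ==> rl A \<epsilon> U <-> A \<in> Uf U"
 unfolding Uf_def by simp

lemma ultrafilter_in_iff:
 assumes U: "U \<in> D" "ext U \<subseteq> ext PP"
 shows "ultrafilter_in om U <-> UF reals (Uf U)"
proof -
 note a = all_Uf[OF U] and i = in_Uf[OF U(1)] and r = closed_compl[OF closed_reals] closed_inter[OF closed_reals]
 have Ur: "A \<in> reals" if "A \<in> Uf U" for A using that unfolding Uf_def by blast
 have c1: "(ALL A:D. A \<epsilon> U --> sub A om & ~ is_empty A) <-> {} \<notin> Uf U"
 proof -
  have "sub (rl A) om & ~ is_empty (rl A) <-> A ~= {}" if "A \<in> Uf U" for A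
  proof -
   have "is_empty (rl A) <-> ext (rl A) = {}" unfolding is_empty_def by auto
   then show ?thesis unfolding sub_iff using ext_rl_om[OF Ur[OF that]] by (simp add: ext_rl[OF Ur[OF that]])
  qed
  then show ?thesis unfolding a by blast
 qed
 have "(ALL A:D. ALL B:D. A \<epsilon> U & sub A B & sub B om --> B \<epsilon> U) <->
   (ALL A:D. A \<epsilon> U --> (ALL B:D. ext B \<subseteq> ext om --> (sub A B --> B \<epsilon> U)))" unfolding sub_iff by blast
 also have "\<dots> <-> (ALL A:Uf U. ALL B:reals. A \<subseteq> B --> B \<in> Uf U)"
  unfolding a all_rl sub_iff by (intro ball_cong refl) (simp add: i rl_sub Ur)
 finally have c2: "(ALL A:D. ALL B:D. A \<epsilon> U & sub A B & sub B om --> B \<epsilon> U) <-> (ALL A:Uf U. ALL B:reals. A \<subseteq> B --> B \<in> Uf U)" .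
 have "(ALL A:D. ALL B:D. ALL C:D. A \<epsilon> U & B \<epsilon> U & inter_of C A B --> C \<epsilon> U) <->
   (ALL A:D. A \<epsilon> U --> (ALL B:D. B \<epsilon> U --> (ALL C:D. inter_of C A B --> C \<epsilon> U)))" by blast
 also have "\<dots> <-> (ALL A:Uf U. ALL B:Uf U. A \<inter> B \<in> Uf U)"
  unfolding a by (intro ball_cong refl) (use rl_D r i Ur in \<open>auto simp: inter_rl\<close>)
 finally have c3: "(ALL A:D. ALL B:D. ALL C:D. A \<epsilon> U & B \<epsilon> U & inter_of C A B --> C \<epsilon> U) <-> (ALL A:Uf U. ALL B:Uf U. A \<inter> B \<in> Uf U)" .
 have "(ALL A:D. ALL C:D. sub A om & diff_of C om A --> A \<epsilon> U \<or> C \<epsilon> U) <->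
   (ALL A:D. ext A \<subseteq> ext om --> (ALL C:D. diff_of C om A --> A \<epsilon> U \<or> C \<epsilon> U))" unfolding sub_iff by blast
 also have "\<dots> <-> (ALL A:reals. A \<in> Uf U \<or> - A \<in> Uf U)"
  unfolding all_rl by (intro ball_cong refl) (use rl_D r i in \<open>auto simp: diff_rl\<close>)
 finally have c4: "(ALL A:D. ALL C:D. sub A om & diff_of C om A --> A \<epsilon> U \<or> C \<epsilon> U) <-> (ALL A:reals. A \<in> Uf U \<or> - A \<in> Uf U)" .
 have "(ALL A:D. ALL C:D. sub A om & diff_of C om A & finite_in om C --> A \<epsilon> U) <->
   (ALL A:D. ext A \<subseteq> ext om --> (ALL C:D. diff_of C om A --> finite_in om C --> A \<epsilon> U))" unfolding sub_iff by blast
 also have "\<dots> <-> (ALL A:reals. finite (- A) --> A \<in> Uf U)"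
  unfolding all_rl by (intro ball_cong refl) (use rl_D r i in \<open>auto simp: diff_rl finite_rl\<close>)
 finally have c5: "(ALL A:D. ALL C:D. sub A om & diff_of C om A & finite_in om C --> A \<epsilon> U) <-> (ALL A:reals. finite (- A) --> A \<in> Uf U)" .
 have "Uf U \<subseteq> reals" using Ur by blast
 then show ?thesis unfolding ultrafilter_in_def UF_def c1 c2 c3 c4 c5 by simp
qed

lemma ultrafilter_in_PP: "ultrafilter_in om U ==> ext U \<subseteq> ext PP"
proof
 fix A assume U: "ultrafilter_in om U" and A: "A \<in> ext U"
 from U have "ALL A:D. A \<epsilon> U --> sub A om & ~ is_empty A" unfolding ultrafilter_in_def by (rule conjunct1)
 then show "A \<in> ext PP" using A unfolding sub_iff by simp
qed

lemma in_dual_rl: "U \<in> D ==> A \<in> reals ==> in_dual om U (rl A) <-> - A \<in> Uf U"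
 unfolding in_dual_def sub_iff using ext_rl_om[of A] in_Uf[of U "- A"] closed_compl[OF closed_reals, of A] rl_D[of "- A"]
 by (auto simp: diff_rl)

lemma reduces_in_iff:
 assumes m: "m \<in> D" "represents c m" and U: "U \<in> D"
 shows "reduces_in r om m U <-> redU reals r (borel_set c) (Uf U)"
proof -
 have 1: "(ALL B:D. in_coded om m B --> (EX C:D. preimage_of C om f B & in_dual om U C)) <->
   (ALL B:borel_set c \<inter> reals. - (fof f -` B) \<in> Uf U)" if f: "f \<in> D" "function_into f om om" for f
 proof -
  have "(ALL B:D. in_coded om m B --> (EX C:D. preimage_of C om f B & in_dual om U C)) <->
   (ALL B:D. ext B \<subseteq> ext om --> (in_coded om m B --> (EX C:D. preimage_of C om f B & in_dual om U C)))"
   unfolding in_coded_def sub_iff by blast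
  also have "\<dots> <-> (ALL B:reals. B \<in> borel_set c --> - (fof f -` B) \<in> Uf U)"
   unfolding all_rl
  proof (rule ball_cong[OF refl])
   fix B assume B: "B \<in> reals"
   have v: "fof f -` B \<in> reals" by (rule closed_vimage[OF closed_reals B graph_fof[OF f(1)]])
   have "(EX C:D. preimage_of C om f (rl B) & in_dual om U C) <-> - (fof f -` B) \<in> Uf U"
    using preimage_of_iff[OF f rl_D[OF B]] in_dual_rl[OF U v] rl_D[OF v] unfolding rof_rl[OF B] by blast
   then show "(in_coded om m (rl B) --> (EX C:D. preimage_of C om f (rl B) & in_dual om U C)) <->
    (B \<in> borel_set c --> - (fof f -` B) \<in> Uf U)" unfolding in_coded_iff[OF m B] by blast
  qed
  finally show ?thesis by blast
 qed
 show ?thesis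
 proof
  assume "reduces_in r om m U"
  then obtain f where f: "f \<in> D" "function_into f om om" "admissible_in r om f"
   "ALL B:D. in_coded om m B --> (EX C:D. preimage_of C om f B & in_dual om U C)" unfolding reduces_in_def by blast
  show "redU reals r (borel_set c) (Uf U)" unfolding redU_def
   by (rule exI[of _ "fof f"]) (use f graph_fof admissible_in_iff[OF f(1,2)] 1[OF f(1,2)] in simp)
 next
  assume "redU reals r (borel_set c) (Uf U)"
  then obtain \<phi> where \<phi>: "graph \<phi> \<in> reals" "admissible r \<phi>" "ALL B:borel_set c \<inter> reals. - (\<phi> -` B) \<in> Uf U"
   unfolding redU_def by blast
  obtain f where f: "f \<in> D" "function_into f om om" "fof f = \<phi>" by (rule ex_fof[OF \<phi>(1)]) (rule that)
  show "reduces_in r om m U" unfolding reduces_in_def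
   by (rule bexI[OF _ f(1)]) (use f \<phi> admissible_in_iff[OF f(1,2)] 1[OF f(1,2)] in simp)
 qed
qed

lemma P_point_in_iff:
 assumes U: "U \<in> D" "ext U \<subseteq> ext PP" "ultrafilter_in om U"
 shows "P_point_in om U <-> PU reals (Uf U)"
proof -
 note UF = U(3)[unfolded ultrafilter_in_iff[OF U(1,2)]]
 have fin: "(EX C:D. inter_of C (rl A) (rl B) & finite_in om C) <-> finite (A \<inter> B)" if "A \<in> reals" "B \<in> reals" for A B
  using inter_rl[OF that] rl_D[of "A \<inter> B"] finite_rl[of "A \<inter> B"] closed_inter[OF closed_reals that] by auto
 have dualR: "A \<in> reals & - A \<in> Uf U" if "in_dual om U (rl A)" "A \<in> reals" for A using that in_dual_rl U(1) by blast
 have UR: "B \<in> reals" if "B \<in> Uf U" for B using that unfolding Uf_def by blast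
 show ?thesis
 proof
  assume P: "P_point_in om U"
  show "PU reals (Uf U)" unfolding PU_def
  proof (intro ballI impI)
   fix C assume C: "C \<in> reals" "ALL n. - sec C n \<in> Uf U"
   note sR = closed_sec[OF closed_reals C(1)]
   have d: "dtm D (%e. rl (sec C (nof (e 0))))"
   proof (rule dtm_rl)
    have "dfn D (%e. enc (nof (e (Suc 0))) (nof (e 0)) \<in> C)" by (intro dfn_intros C)
    then show "dfn D (%e. nof (e 0) \<in> sec C (nof (e (Suc 0))))" by simp
   qed (rule sR)
   let ?S = "(%x. rl (sec C (nof x))) ` ext om"
   have i: "isset ?S" by (rule isset_rep[OF d om_D])
   have S: "?S = range (%n. rl (sec C n))" unfolding ext_om by (simp add: image_image)
   note eS = trans[OF ext_mk[OF i] S]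
   have "cnt ?S" by (rule cnt_image[OF cnt_om d])
   then have "countable_in om (mk ?S)" unfolding countable_in_iff[OF mk_D[OF i]] ext_mk[OF i] .
   moreover have "in_dual om U A" if "A \<in> D" "A \<epsilon> mk ?S" for A
   proof -
    have "A \<in> ext (mk ?S)" using that by simp
    then show ?thesis unfolding eS using in_dual_rl[OF U(1) sR] C(2) by blast
   qed
   ultimately obtain B where B: "B \<in> D" "B \<epsilon> U" "ALL A:D. A \<epsilon> mk ?S --> (EX C:D. inter_of C A B & finite_in om C)"
    using P mk_D[OF i] unfolding P_point_in_def by blast
   have "B \<in> ext U" using B by simp
   then have Bo: "B \<in> ext PP" using U(2) by blast
   then have Br: "rl (rof B) = B" "rof B \<in> reals" using rl_rof[of B] B(1) by auto
   have "finite (sec C n \<inter> rof B)" for n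
   proof -
    have "rl (sec C n) \<in> ext (mk ?S)" unfolding eS by blast
    then have "EX E:D. inter_of E (rl (sec C n)) (rl (rof B)) & finite_in om E" unfolding Br(1) using B(3) by simp
    then show ?thesis unfolding fin[OF sR Br(2)] .
   qed
   moreover have "rof B \<in> Uf U" using in_Uf[OF U(1) Br(2)] Br(1) B(2) by simp
   ultimately show "EX B:Uf U. ALL n. finite (sec C n \<inter> B)" by blast
  qed
 next
  assume P: "PU reals (Uf U)"
  show "P_point_in om U" unfolding P_point_in_def
  proof (intro conjI ballI impI U(3); elim conjE)
   fix S assume S: "S \<in> D" "ALL A:D. A \<epsilon> S --> in_dual om U A" "countable_in om S"
   then obtain g where g: "g \<in> D" "!!x. x \<in> ext S ==> EX n. ap g (nm n) = x" unfolding countable_in_iff[OF S(1)] cnt_def by blast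
   let ?C = "{x. ap g (nm (dfst x)) \<epsilon> S & dsnd x \<in> rof (ap g (nm (dfst x)))}"
   have C: "?C \<in> reals" by (rule realsI) (intro dfn_intros g S)
   have sec: "sec ?C n = (if ap g (nm n) \<epsilon> S then rof (ap g (nm n)) else {})" for n by auto
   have Sr: "rl (rof A) = A & rof A \<in> reals" if "A \<in> D" "A \<epsilon> S" for A
    using S(2) that rl_rof[OF that(1)] unfolding in_dual_def sub_iff by blast
   have "UNIV \<in> reals" using closed_compl[OF closed_reals, of "{}"] realsI[of "%_. False"] dfn_const by simp
   then have UU: "UNIV \<in> Uf U" using UF_D(6)[OF UF, of UNIV] by simp
   have "- sec ?C n \<in> Uf U" for n
   proof (cases "ap g (nm n) \<epsilon> S")
    case True
    then show ?thesis unfolding sec using Sr[OF ap_D True] S(2) in_dual_rl[OF U(1)] by (metis ap_D)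
   qed (use UU sec in simp)
   then obtain B where B: "B \<in> Uf U" "!!n. finite (sec ?C n \<inter> B)" using P C unfolding PU_def by blast
   show "EX B:D. B \<epsilon> U & (ALL A:D. A \<epsilon> S --> (EX C:D. inter_of C A B & finite_in om C))"
   proof (rule bexI[of _ "rl B"], intro conjI ballI impI)
    show "rl B \<in> D" "rl B \<epsilon> U" using UR[OF B(1)] in_Uf[OF U(1)] B(1) by auto
    fix A assume A: "A \<in> D" "A \<epsilon> S"
    then have "A \<in> ext S" by simp
    then obtain n where n: "ap g (nm n) = A" using g(2) by blast
    have "finite (rof A \<inter> B)" using B(2)[of n] unfolding sec n using A(2) by simp
    then show "EX C:D. inter_of C A (rl B) & finite_in om C" using fin[of "rof A" B] Sr[OF A] UR[OF B(1)] by simp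
   qed
  qed
 qed
qed

lemma ex_ultra_not_P_in_iff:
 assumes m: "m \<in> D" "represents c m"
 shows "ex_ultra_not_P_in r m <->
  (EX U. isset (rl ` U) & UF reals U & ~ redU reals r (borel_set c) U & ~ PU reals U)"
proof
 assume "ex_ultra_not_P_in r m"
 then obtain U where U: "U \<in> D" "ultrafilter_in om U" "~ reduces_in r om m U" "~ P_point_in om U"
  unfolding ex_ultra_not_P_in_def using omega_iff by blast
 note P = ultrafilter_in_PP[OF U(2)]
 have "rl ` Uf U = ext U"
 proof (intro set_eqI iffI)
  fix x assume x: "x \<in> ext U"
  then have "x \<in> ext PP" using P by blast
  then have "rl (rof x) = x" "rof x \<in> reals" using rl_rof[of x] by auto
  then show "x \<in> rl ` Uf U" unfolding Uf_def using x by (intro image_eqI[of _ _ "rof x"]) auto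
 qed (auto simp: Uf_def)
 then have "isset (rl ` Uf U)" using isset_ext U(1) by simp
 then show "EX U. isset (rl ` U) & UF reals U & ~ redU reals r (borel_set c) U & ~ PU reals U"
  using U(2-4) unfolding ultrafilter_in_iff[OF U(1) P] reduces_in_iff[OF m U(1)] P_point_in_iff[OF U(1) P U(2)] by blast
next
 assume "EX U. isset (rl ` U) & UF reals U & ~ redU reals r (borel_set c) U & ~ PU reals U"
 then obtain V where V: "isset (rl ` V)" "UF reals V" "~ redU reals r (borel_set c) V" "~ PU reals V" by blast
 let ?U = "mk (rl ` V)"
 have VR: "V \<subseteq> reals" by (rule UF_D(1)[OF V(2)])
 have D: "?U \<in> D" by (rule mk_D[OF V(1)])
 have P: "ext ?U \<subseteq> ext PP" unfolding ext_mk[OF V(1)] using VR rl_PP by (intro image_subsetI) (rule rl_PP, rule subsetD)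
 have "Uf ?U = V" unfolding Uf_def ext_mk[OF V(1)] using VR rl_inj by auto
 then have "ultrafilter_in om ?U" "~ reduces_in r om m ?U" "~ P_point_in om ?U"
  using V(2-4) ultrafilter_in_iff[OF D P] reduces_in_iff[OF m D] P_point_in_iff[OF D P] by simp_all
 then show "ex_ultra_not_P_in r m" unfolding ex_ultra_not_P_in_def using D omega_iff[OF om_D] om_D by blast
qed

lemma ex_in_imp_not_redF:
 assumes "m \<in> D" "represents c m" "ex_ultra_not_P_in r m" shows "~ redF reals r (borel_set c)"
 using assms redF_imp_redU[OF closed_reals] unfolding ex_ultra_not_P_in_iff[OF assms(1,2)] by blast

end

text \<open>Finiteness of sets of numbers is boundedness, which makes the ideal
  arithmetical.\<close>

lemma Fin2n_iff: "A \<in> Fin2n <-> (EX m. ALL n>=m. EX j. ALL k. enc n k \<in> A --> k < j)"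
proof -
 have "finite {n. ~ (EX j. ALL k. enc n k \<in> A --> k < j)} <-> (EX m. ALL n>=m. EX j. ALL k. enc n k \<in> A --> k < j)"
  unfolding finite_nat_set_iff_bounded mem_Collect_eq Ball_def by (meson not_le)
 moreover have "infinite (sec A n) <-> ~ (EX j. ALL k. enc n k \<in> A --> k < j)" for n
  unfolding finite_nat_set_iff_bounded Ball_def in_sec ..
 ultimately show ?thesis unfolding Fin2n_def by simp
qed

text \<open>Admissibility as an arithmetic property of the graph, for use inside models.\<close>

primrec adm :: "reduction => nat set => bool" where
 "adm Katetov y <-> True"
| "adm Katetov_Blass y <-> (ALL n. EX j. ALL k. enc k n \<in> y --> k < j)"
| "adm One_to_One y <-> (ALL k l n. enc k n \<in> y & enc l n \<in> y --> k = l)"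

lemma adm_graph: "admissible r f <-> adm r (graph f)"
 by (cases r) (auto simp: finite_nat_set_iff_bounded inj_def vimage_def)

text \<open>Removes the quantifier over HOL functions, so that the last clause of \<open>Phi\<close>
  becomes definable.\<close>

lemma all_graph:
 "(ALL f. graph f = y --> admissible r f --> (EX B:S. A \<subseteq> f -` B)) <->
  ((ALL m. EX n. enc m n \<in> y & (ALL l. enc m l \<in> y --> l = n)) --> adm r y -->
   (EX B:S. ALL k n. k \<in> A --> enc k n \<in> y --> n \<in> B))"
proof (cases "EX f. graph f = y")
 case True
 then obtain f where f: "y = graph f" by blast
 have "graph g = y <-> g = f" for g unfolding f using graph_inj by blast
 then show ?thesis unfolding adm_graph by (auto simp: f subset_iff)
next
 case False
 have "~ (ALL m. EX n. enc m n \<in> y & (ALL l. enc m l \<in> y --> l = n))"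
 proof
  assume "ALL m. EX n. enc m n \<in> y & (ALL l. enc m l \<in> y --> l = n)"
  then obtain f where f: "!!m. enc m (f m) \<in> y & (ALL l. enc m l \<in> y --> l = f m)" by metis
  have "x \<in> graph f <-> x \<in> y" for x
   using f[of "dfst x"] unfolding graph_def mem_Collect_eq by (metis prod.collapse prod_decode_inverse)
  then have "graph f = y" by blast
  then show False using False by blast
 qed
 then show ?thesis using False by blast
qed

context zfm
begin

lemma dfn_Fin2n:
 assumes "dfn A (%e. Q (nof (e 0)) (%i. e (Suc i)))" shows "dfn A (%e. {n. Q n e} \<in> Fin2n)"
proof -
 have 1: "dfn A (%e. Q (enc (nof (e (Suc (Suc 0)))) (nof (e 0))) (%i. e (Suc (Suc (Suc (Suc i))))))"
  using dfn_term_ren[OF assms, of "%e. nm (enc (nof (e (Suc (Suc 0)))) (nof (e 0)))" "%i. Suc (Suc (Suc (Suc i)))"]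
  by (simp add: dfn_intros)
 show ?thesis unfolding Fin2n_iff mem_Collect_eq by (intro dfn_intros 1)
qed

lemma dfn_Phi:
 assumes J: "J \<in> D" "ext J = rl ` (I \<inter> reals)"
 shows "dfn D (%e. Phi reals r I (rof (e 0)) (rof (e (Suc 0))) (rof ` ext (e (Suc (Suc 0)))))"
proof -
 have ad: "dfn D (%e. adm r (rof (e i)))" for i by (cases r; simp; intro dfn_intros)
 have 1: "(EX B:I \<inter> reals. Q B) <-> (EX b:ext J. Q (rof b))" for Q unfolding J by auto
 have 2: "A - Z = {n. n \<in> A & n \<notin> Z}" for A Z :: "nat set" by auto
 have 3: "A \<inter> y = {} <-> (ALL n. n \<in> A --> n \<notin> y)" "A \<subseteq> y <-> (ALL n. n \<in> A --> n \<in> y)" for A y :: "nat set" by auto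
 have "dfn D (%e. {n. n \<in> rof (e 0)} \<notin> Fin2n & (ALL z:ext (e (Suc (Suc 0))). rof (e 0) - rof z \<in> Fin2n) &
   (rof (e 0) \<subseteq> rof (e (Suc 0)) \<or> rof (e 0) \<inter> rof (e (Suc 0)) = {}) &
   (ALL f. graph f = rof (e (Suc 0)) --> admissible r f --> (EX B:I\<inter>reals. rof (e 0) \<subseteq> f -` B)))"
  unfolding all_graph unfolding 1 2 3 by (intro dfn_intros dfn_Fin2n ad J)
 then show ?thesis by (rule dfn_cong) (auto simp: Phi_def)
qed

end

context zfmW
begin

text \<open>The construction of \<open>CH_redF_iff\<close> inside the model. Each step takes the
  \<open>lt\<close>-least suitable real, so the tower is definable and the ultrafilter is a set of
  the model.\<close>

theorem ex_ultra_not_P_inI: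
 assumes m: "m \<in> D" "represents c m" and nF: "~ redF reals r (borel_set c)"
 shows "ex_ultra_not_P_in r m"
proof -
 let ?I = "borel_set c"
 obtain J where J: "J \<in> D" "ext J = rl ` (?I \<inter> reals)" by (rule represents_set[OF m]) (rule that)
 define Ph where "Ph a x s <-> Phi reals r ?I (rof a) (rof x) (rof ` ext s)" for a x s
 have Phd: "dfn D (%e. Ph (e i) (e j) (e k))" for i j k
  unfolding Ph_def by (rule dfn3[OF dfn_Phi[OF J]]) (intro dfn_intros)+
 have ltd: "dfn D (%e. lt (e i) (e j))" for i j by (rule dfn2[OF dfn_lt]) (intro dfn_intros)+
 let ?Q = "%x s a. a \<in> ext PP & Ph a x s & (ALL b:ext PP. lt b a --> ~ Ph b x s)"
 have "dtm D (%e. thex (?Q (e 0) (e (Suc 0))))" by (intro dfn_intros ltd Phd PP_D)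
 then obtain F where Fd: "dtm D (%e. F (e 0))"
  and F0: "!!x. x \<in> ext PP ==> F x = thex (?Q x (mk (F ` {y \<in> ext PP. lt y x})))"
  and ist: "!!x. x \<in> ext PP ==> isset (F ` {y \<in> ext PP. lt y x})"
  by (rule lt_recursion[of PP "%x s. thex (?Q x s)", OF PP_D order_refl]) (rule that)
 define A where "A y = rof (F (rl y))" for y
 let ?lt = "%x y. lt (rl x) (rl y)"
 have pr: "A ` {z \<in> reals. ?lt z y} = rof ` F ` {w \<in> ext PP. lt w (rl y)}" for y
 proof (intro set_eqI iffI)
  fix a assume "a \<in> A ` {z \<in> reals. ?lt z y}"
  then obtain z where z: "z \<in> reals" "?lt z y" "a = A z" by blast
  then have "rl z \<in> {w \<in> ext PP. lt w (rl y)}" using rl_PP by blast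
  then show "a \<in> rof ` F ` {w \<in> ext PP. lt w (rl y)}" unfolding z(3) A_def by (intro imageI)
 next
  fix a assume "a \<in> rof ` F ` {w \<in> ext PP. lt w (rl y)}"
  then obtain w where w: "w \<in> ext PP" "lt w (rl y)" "a = rof (F w)" by blast
  then have "rl (rof w) = w" "rof w \<in> reals" using rl_rof[of w] by auto
  then show "a \<in> A ` {z \<in> reals. ?lt z y}" using w(2,3) by (intro image_eqI[of _ _ "rof w"]) (auto simp: A_def)
 qed
 have lin: "?lt x y \<or> x = y \<or> ?lt y x" if "x \<in> reals" "y \<in> reals" for x y
  using lt_linear[OF rl_PP[OF that(1)] rl_PP[OF that(2)]] rl_inj[OF that] by blast
 have key: "F (rl y) \<in> ext PP & Phi reals r ?I (A y) y (A ` {z \<in> reals. ?lt z y})"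
  if y: "y \<in> reals" and IH: "!!z. z \<in> reals ==> ?lt z y ==> F (rl z) \<in> ext PP & Phi reals r ?I (A z) z (A ` {w \<in> reals. ?lt w z})" for y
 proof -
  let ?x = "rl y" and ?S = "{w \<in> ext PP. lt w (rl y)}"
  note xP = rl_PP[OF y]
  have C: "{z \<in> reals. ?lt z y} = {} \<or> (EX C:reals. range (sec C) = A ` {z \<in> reals. ?lt z y})"
  proof (cases "?S = {}")
   case True
   then show ?thesis using rl_PP by blast
  next
   case False
   then obtain w0 where w0: "w0 \<in> ext PP" "lt w0 ?x" by blast
   then have w0D: "w0 \<in> D" and xD: "?x \<in> D" using y by auto
   obtain g where g: "g \<in> D" "!!w. w \<in> ?S ==> EX n. ap g (nm n) = w" using lt_cnt[OF xP] unfolding cnt_def by blast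
   \<comment> \<open>Values of \<open>g\<close> that are not predecessors are replaced by
     \<open>w0\<close>, so that \<open>h\<close> lists exactly the predecessors.\<close>
   define h where "h n = (if ap g (nm n) \<in> ext PP & lt (ap g (nm n)) ?x then ap g (nm n) else w0)" for n
   have ltx: "dfn D (%e. lt (ap g (nm (dfst (nof (e i))))) ?x)" for i
    by (rule dfn2[OF dfn_lt]) (intro dfn_intros g xD)+
   have "dtm D (%e. F (h (dfst (nof (e 0)))))" unfolding h_def
    by (rule dtm1[OF Fd]) (intro dfn_intros g w0D PP_D ltx)
   then have C: "{x. dsnd x \<in> rof (F (h (dfst x)))} \<in> reals" (is "?C \<in> _")
    by (intro realsI dfn_in_rof) (intro dfn_intros)+
   have "h n \<in> ?S" for n unfolding h_def using w0 by simp
   moreover have "w \<in> range h" if w: "w \<in> ?S" for w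
   proof -
    obtain n where "ap g (nm n) = w" using g(2)[OF w] by blast
    then have "h n = w" using w unfolding h_def by simp
    then show ?thesis by blast
   qed
   ultimately have h: "range h = ?S" by blast
   have "range (sec ?C) = (%n. rof (F (h n))) ` UNIV" by (rule image_cong[OF refl]) auto
   also have "\<dots> = rof ` F ` ?S" unfolding h[symmetric] image_image ..
   finally show ?thesis using C unfolding pr by blast
  qed
  obtain a where a: "Phi reals r ?I a y (A ` {z \<in> reals. ?lt z y})"
   using tower_step[OF closed_reals nF y lin _ C] IH by blast
  then have aR: "a \<in> reals" unfolding Phi_def by blast
  have P: "Ph b ?x (mk (F ` ?S)) <-> Phi reals r ?I (rof b) y (A ` {z \<in> reals. ?lt z y})" for b
   unfolding Ph_def ext_mk[OF ist[OF xP]] pr rof_rl[OF y] ..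
  have "Ph (rl a) ?x (mk (F ` ?S))" unfolding P rof_rl[OF aR] by (rule a)
  then obtain b where b: "b \<in> ext PP" "Ph b ?x (mk (F ` ?S))" "ALL d:ext PP. lt d b --> ~ Ph d ?x (mk (F ` ?S))"
   using lt_least[OF rl_PP[OF aR], of "%b. Ph b ?x (mk (F ` ?S))"] by blast
  have "F ?x = b" unfolding F0[OF xP]
  proof (rule thex_eq)
   show "b \<in> D" using b(1) by simp
   fix d assume d: "?Q ?x (mk (F ` ?S)) d"
   then show "d = b" using b lt_linear[of d b] by blast
  qed (use b in blast)
  then show ?thesis using b(1,2) unfolding P A_def by simp
 qed
 have Ph: "F (rl y) \<in> ext PP & Phi reals r ?I (A y) y (A ` {z \<in> reals. ?lt z y})" if y: "y \<in> reals" for y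
 proof (rule ccontr)
  let ?B = "%x. ~ (F x \<in> ext PP & Phi reals r ?I (A (rof x)) (rof x) (A ` {z \<in> reals. ?lt z (rof x)}))"
  assume "~ ?thesis"
  then have "?B (rl y)" using rof_rl[OF y] by simp
  then obtain x where x: "x \<in> ext PP" "?B x" "ALL z:ext PP. lt z x --> ~ ?B z"
   using lt_least[OF rl_PP[OF y], of ?B] by blast
  then have xr: "rl (rof x) = x" "rof x \<in> reals" using rl_rof[of x] by auto
  have "F (rl z) \<in> ext PP & Phi reals r ?I (A z) z (A ` {w \<in> reals. ?lt w z})" if "z \<in> reals" "?lt z (rof x)" for z
   using x(3)[rule_format, OF rl_PP[OF that(1)]] that(2) unfolding xr rof_rl[OF that(1)] by blast
  from key[OF xr(2) this] x(2) show False unfolding xr(1) by blast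
 qed
 have AP: "Phi reals r ?I (A y) y (A ` {z \<in> reals. ?lt z y})" if "y \<in> reals" for y using Ph[OF that] by blast
 define U where "U = {X \<in> reals. EX y:reals. A y - X \<in> Fin2n}"
 note tu = tower_ultrafilter[of reals ?lt r ?I A, OF closed_reals lin AP, folded U_def]
 have s: "{n. n \<in> B & n \<notin> X} = B - X" for B X :: "nat set" by blast
 have "dfn D (%e. EX y:ext PP. {n. n \<in> rof (F y) & n \<notin> rof (e 0)} \<in> Fin2n)"
  by (intro dfn_intros dfn_Fin2n dtm1[OF Fd] PP_D)
 then have "isset {x \<in> ext PP. EX y:ext PP. {n. n \<in> rof (F y) & n \<notin> rof x} \<in> Fin2n}"
  using PP_D by (rule isset_sep)
 moreover have "{x \<in> ext PP. EX y:ext PP. {n. n \<in> rof (F y) & n \<notin> rof x} \<in> Fin2n} = rl ` U"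
  unfolding s
 proof (intro set_eqI iffI)
  fix x assume "x \<in> {x \<in> ext PP. EX y:ext PP. rof (F y) - rof x \<in> Fin2n}"
  then obtain y where x: "x \<in> ext PP" and y: "y \<in> ext PP" "rof (F y) - rof x \<in> Fin2n" by blast
  have r: "rl (rof x) = x" "rof x \<in> reals" "rl (rof y) = y" "rof y \<in> reals" using x y(1) rl_rof by auto
  then have "rof x \<in> U" unfolding U_def A_def using y(2) by (auto intro!: bexI[of _ "rof y"])
  then show "x \<in> rl ` U" using r(1) by (metis image_eqI)
 next
  fix x assume "x \<in> rl ` U"
  then obtain X y where X: "X \<in> reals" "x = rl X" "y \<in> reals" "A y - X \<in> Fin2n" unfolding U_def by blast
  then have "rl y \<in> ext PP" "rof (F (rl y)) - rof x \<in> Fin2n" "x \<in> ext PP" using rl_PP[of y] rl_PP[of X] rof_rl[of X] unfolding A_def by auto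
  then show "x \<in> {x \<in> ext PP. EX y:ext PP. rof (F y) - rof x \<in> Fin2n}" by blast
 qed
 ultimately have "isset (rl ` U)" by simp
 then show ?thesis unfolding ex_ultra_not_P_in_iff[OF m] using tu by blast
qed

end

lemma (in zfm) CH_redF_imp_ex_in:
 assumes choice CH_in "m \<in> D" "represents c m" "~ redF reals r (borel_set c)"
 shows "ex_ultra_not_P_in r m"
 by (rule choice_CH_wo[OF assms(1,2)]) (rule zfmW.ex_ultra_not_P_inI[OF _ assms(3-5)])

subsection \<open>Branches of trees of finite sequences\<close>

context zfm
begin

lemma no_descent: "~ (ALL n. s n \<in> D & s (Suc n) \<epsilon> s n)"
proof
 assume *: "ALL n. s n \<in> D & s (Suc n) \<epsilon> s n"
 have "wf {(x, y). x \<in> D & y \<in> D & x \<epsilon> y}" using wf_mem unfolding wfp_def .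
 then have "~ (EX f. ALL i. (f (Suc i), f i) \<in> {(x, y). x \<in> D & y \<in> D & x \<epsilon> y})"
  unfolding wf_iff_no_infinite_down_chain .
 then show False by (rule notE) (rule exI[of _ s], use * in simp)
qed

text \<open>The first \<open>n\<close> values of \<open>g\<close>, with the length stored to make
  equality of nodes easy to read off.\<close>

definition node :: "'m => nat => 'm" where
 "node g n = op (nm n) (lam (ext (nm n)) (ap g))"

lemma dtm_node [dfn_intros]: "dtm A t ==> ntm A n ==> dtm A (%e. node (t e) (n e))"
 unfolding node_def by (intro dfn_intros dtm_shift)

lemma node_lam:
 assumes "g \<in> D" shows "lam (ext (nm n)) (ap g) \<in> D" "i < n ==> ap (lam (ext (nm n)) (ap g)) (nm i) = ap g (nm i)"
  "ext (lam (ext (nm n)) (ap g)) = (%i. op (nm i) (ap g (nm i))) ` {..<n}"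
proof -
 have "dtm D (%e. ap g (e 0))" by (intro dfn_intros assms)
 note l = lam_function_on[OF this nm_D]
 show "lam (ext (nm n)) (ap g) \<in> D" by (rule l(1))
 show "i < n ==> ap (lam (ext (nm n)) (ap g)) (nm i) = ap g (nm i)" by (rule l(3)) (simp add: ext_nm)
 show "ext (lam (ext (nm n)) (ap g)) = (%i. op (nm i) (ap g (nm i))) ` {..<n}"
  using l(4)[of n] image_image[of "%x. op x (ap g x)" nm "{..<n}"] ext_nm[of n] by metis
qed

lemma node_eq:
 assumes "g \<in> D" "h \<in> D"
 shows "node g n = node h m <-> n = m & (ALL i<n. ap g (nm i) = ap h (nm i))"
proof
 assume *: "node g n = node h m"
 then have 1: "n = m" "lam (ext (nm n)) (ap g) = lam (ext (nm n)) (ap h)"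
  unfolding node_def using node_lam(1) assms op_inject by auto
 then show "n = m & (ALL i<n. ap g (nm i) = ap h (nm i))" using node_lam(2)[OF assms(1)] node_lam(2)[OF assms(2)] by metis
next
 assume *: "n = m & (ALL i<n. ap g (nm i) = ap h (nm i))"
 have "lam (ext (nm n)) (ap g) = lam (ext (nm n)) (ap h)" by (rule lam_cong[OF refl]) (use * in \<open>auto simp: ext_nm\<close>)
 then show "node g n = node h m" unfolding node_def using * by simp
qed

text \<open>Well-foundedness of trees is absolute: if the model had no branch, it would have a rank
  function on the nodes, and its values would descend along the external branch \<open>b\<close>.
  The premise \<open>cong\<close> says that \<open>Cd\<close> at \<open>n\<close> depends only on
  the first \<open>n\<close> values.\<close>

theorem branch:
 assumes choice and Y: "Y \<in> D" and Cd: "dfn D (%e. Cd (e 0) (nof (e (Suc 0))))"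
  and cong: "!!g h n. g \<in> D ==> h \<in> D ==> (ALL i<n. ap g (nm i) = ap h (nm i)) ==> Cd g n ==> Cd h n"
  and b: "!!i. b i \<in> ext Y" and bC: "!!g n. g \<in> D ==> (ALL i<n. ap g (nm i) = b i) ==> Cd g n"
 obtains g where "g \<in> D" "!!i. ap g (nm i) \<in> ext Y" "!!n. Cd g n"
proof -
 have bD: "b i \<in> D" for i using b[of i] by simp
 define N where "N s <-> (EX g:D. EX n. s = node g n & (ALL i<n. ap g (nm i) \<in> ext Y) & Cd g n)" for s
 have Cd2: "dfn D (%e. Cd (e i) (nof (e j)))" for i j by (rule dfn2[OF Cd]) (intro dfn_intros)+
 have Nd: "dfn D (%e. N (e i))" for i unfolding N_def by (intro dfn_intros Cd2 Y)
 let ?W = "prd om (mk {x \<in> D. ext x \<subseteq> ext (prd om Y)})"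
 have pY: "prd om Y \<in> D" "ext (prd om Y) = {op x y |x y. x \<in> ext om & y \<in> ext Y}" using prd_D[OF om_D Y] ext_prd[OF om_D Y] by auto
 note iP = isset_pow[OF pY(1)]
 have NW: "s \<in> ext ?W" if s: "N s" for s
 proof -
  obtain g n where g: "g \<in> D" "s = node g n" "ALL i<n. ap g (nm i) \<in> ext Y" using s unfolding N_def by blast
  have "op (nm i) (ap g (nm i)) \<in> ext (prd om Y)" if "i < n" for i
   unfolding pY(2) using g(3) that nm_om by (intro CollectI exI conjI refl) auto
  then have "(%i. op (nm i) (ap g (nm i))) ` {..<n} \<subseteq> ext (prd om Y)" by blast
  then have "lam (ext (nm n)) (ap g) \<in> {x \<in> D. ext x \<subseteq> ext (prd om Y)}"
   using node_lam(1)[OF g(1)] unfolding node_lam(3)[OF g(1)] mem_Collect_eq by blast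
  then have "lam (ext (nm n)) (ap g) \<in> ext (mk {x \<in> D. ext x \<subseteq> ext (prd om Y)})" unfolding ext_mk[OF iP] .
  then show ?thesis unfolding ext_prd[OF om_D mk_D[OF iP]] g(2) node_def using nm_om by force
 qed
 have WD: "?W \<in> D" using prd_D[OF om_D mk_D[OF iP]] .
 have iN: "isset {s \<in> D. N s}"
 proof -
  have "isset {s \<in> ext ?W. N s}" by (rule isset_sep[OF Nd WD])
  moreover have "{s \<in> ext ?W. N s} = {s \<in> D. N s}" using NW by auto
  ultimately show ?thesis by simp
 qed
 define C where "C t s <-> (EX g:D. EX n. s = node g n & t = node g (Suc n))" for t s
 have Cdf: "dfn D (%e. C (e i) (e j))" for i j unfolding C_def by (intro dfn_intros)
 have subN: "x \<in> D ==> isset (ext x \<inter> {s \<in> D. Q s})" if "dfn D (%e. Q (e 0))" for x Q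
 proof -
  assume "x \<in> D"
  then have "isset {s \<in> ext x. Q s}" by (rule isset_sep[OF that])
  moreover have "{s \<in> ext x. Q s} = ext x \<inter> {s \<in> D. Q s}" by auto
  ultimately show ?thesis by simp
 qed
 \<comment> \<open>the nodes of \<open>good\<close> are those from which an infinite descent is possible inside the model\<close>
 define good where "good s <-> (EX X:D. s \<in> ext X & (ALL t:ext X. N t & (EX u:ext X. C u t)))" for s
 have gd: "dfn D (%e. good (e i))" for i unfolding good_def by (intro dfn_intros Nd Cdf)
 have gN: "N s" if "good s" for s using that unfolding good_def by blast
 have gC: "EX u:D. good u & C u s" if gs: "good s" for s
 proof -
  obtain X where X: "X \<in> D" "s \<in> ext X" "ALL t:ext X. N t & (EX u:ext X. C u t)" using gs unfolding good_def by blast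
  then obtain u where u: "u \<in> ext X" "C u s" by blast
  then have "good u" unfolding good_def using X by blast
  then show ?thesis using u by auto
 qed
 have iG: "isset {s \<in> D. good s}"
 proof -
  have "isset (ext (mk {s \<in> D. N s}) \<inter> {s \<in> D. good s})" by (rule subN[OF gd mk_D[OF iN]])
  moreover have "ext (mk {s \<in> D. N s}) \<inter> {s \<in> D. good s} = {s \<in> D. good s}" unfolding ext_mk[OF iN] using gN by blast
  ultimately show ?thesis by simp
 qed
 let ?G = "mk {s \<in> D. good s}"
 note GD = mk_D[OF iG] and eG = ext_mk[OF iG]
 \<comment> \<open>Coinduction: if every node of a definable class is in the tree and has a
   successor that is in the class or good, the class consists of good nodes.\<close>
 have goodI: "good s" if Q: "dfn D (%e. Q (e 0))" and s: "s \<in> D" "Q s"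
  and st: "!!t. t \<in> D ==> Q t ==> N t & (EX u:D. (Q u \<or> good u) & C u t)" for Q s
 proof -
  have "dfn D (%e. Q (e 0) \<or> good (e 0))" by (intro dfn_intros Q gd)
  note i = subN[OF this mk_D[OF iN], unfolded ext_mk[OF iN]]
  let ?X = "mk ({s \<in> D. N s} \<inter> {s \<in> D. Q s \<or> good s})"
  have X: "ext ?X = {s \<in> D. Q s \<or> good s}" unfolding ext_mk[OF i] using st gN by blast
  show ?thesis unfolding good_def
  proof (rule bexI[of _ ?X], intro conjI ballI)
   show "s \<in> ext ?X" unfolding X using s by blast
   fix t assume "t \<in> ext ?X"
   then have t: "t \<in> D" "Q t \<or> good t" unfolding X by blast+
   show "N t" using st gN t by blast
   show "EX u:ext ?X. C u t" unfolding X using st[OF t(1)] gC[of t] t(2) by blast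
  qed (rule mk_D[OF i])
 qed
 have n0: "node (nm 0) 0 \<in> D" unfolding node_def using node_lam(1)[of "nm 0" 0] by auto
 show thesis
 proof (cases "good (node (nm 0) 0)")
  case True
  \<comment> \<open>Dependent choice inside the model along good nodes; the branch \<open>g\<close>
    is read off from the last entries.\<close>
  let ?ch = "%s. mk {u \<in> ext ?G. C u s}"
  have ich: "isset {u \<in> ext ?G. C u s}" if s: "s \<in> D" for s
  proof -
   have "dfn D (%e. C (e 0) s)" using dfn2[OF Cdf[of 0 "Suc 0"] dtm_var[of D 0] dtm_const[of s D]] s by simp
   then show ?thesis by (rule isset_sep[OF _ GD])
  qed
  have chd: "dtm D (%e. ?ch (e 0))" by (intro dfn_intros Cdf GD)
  have iF: "isset (?ch ` ext ?G)" by (rule isset_rep[OF chd GD])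
  obtain c where c: "c \<in> D" "!!s. s \<in> ext (mk (?ch ` ext ?G)) ==> ap c s \<in> ext s"
  proof (rule choice_function[OF assms(1) mk_D[OF iF]])
   fix x assume "x \<in> ext (mk (?ch ` ext ?G))"
   then obtain s where s: "s \<in> ext ?G" "x = ?ch s" unfolding ext_mk[OF iF] by blast
   then have "s \<in> D" by simp
   then show "ext x ~= {}" unfolding s(2) ext_mk[OF ich[OF \<open>s \<in> D\<close>]] using gC s(1) unfolding eG by blast
  qed (rule that)
  define st where "st s = ap c (?ch s)" for s
  define S where "S n = (st ^^ n) (node (nm 0) 0)" for n
  have S_Suc: "S (Suc n) = st (S n)" for n unfolding S_def by simp
  have stp: "st s \<in> ext ?G & C (st s) s" if s: "s \<in> ext ?G" for s
  proof -
   have sD: "s \<in> D" using s by simp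
   have "?ch s \<in> ext (mk (?ch ` ext ?G))" unfolding ext_mk[OF iF] using s by blast
   from c(2)[OF this] show ?thesis unfolding st_def ext_mk[OF ich[OF sD]] by blast
  qed
  have SG: "S n \<in> ext ?G" for n
  proof (induction n)
   case 0
   show ?case unfolding eG S_def using True n0 by simp
  qed (use stp in \<open>simp add: S_Suc\<close>)
  have SC: "C (S (Suc n)) (S n)" for n unfolding S_Suc using stp[OF SG[of n]] by blast
  define g where "g = lam (ext om) (%x. ap (psnd (S (Suc (nof x)))) x)"
  have "dtm D (%e. ap (psnd (S (Suc (nof (e 0))))) (e 0))"
   unfolding S_def st_def by (intro dfn_intros dtm_funpow Cdf GD c n0)
  note l = lam_function_on[OF this om_D, folded g_def]
  have gD: "g \<in> D" by (rule l(1))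
  have gap: "ap g (nm n) = ap (psnd (S (Suc n))) (nm n)" for n using l(3)[of "nm n"] nm_om by simp
  have SN: "S n = node g n" for n
  proof (induction n)
   case 0
   show ?case using node_eq[OF nm_D[of 0] gD, of 0 0] unfolding S_def by simp
  next
   case (Suc n)
   obtain h k where h: "h \<in> D" "S n = node h k" "S (Suc n) = node h (Suc k)" using SC[of n] unfolding C_def by blast
   have "node g n = node h k" using Suc h(2) by simp
   then have k: "k = n" "ALL i<n. ap h (nm i) = ap g (nm i)" unfolding node_eq[OF gD h(1)] by auto
   have "psnd (S (Suc n)) = lam (ext (nm (Suc n))) (ap h)" unfolding h(3) k(1) node_def using node_lam(1)[OF h(1), of "Suc n"] by simp
   then have "ap g (nm n) = ap h (nm n)" using gap[of n] node_lam(2)[OF h(1), of n "Suc n"] by simp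
   then have "ALL i<Suc n. ap h (nm i) = ap g (nm i)" using k(2) by (auto simp: less_Suc_eq)
   then show ?case unfolding h(3) k(1) node_eq[OF h(1) gD] by blast
  qed
  have Ng: "(ALL i<n. ap g (nm i) \<in> ext Y) & Cd g n" for n
  proof -
   have "N (S n)" using SG[of n] gN unfolding eG by blast
   then obtain h k where h: "h \<in> D" "node g n = node h k" "ALL i<k. ap h (nm i) \<in> ext Y" "Cd h k"
    unfolding SN N_def by blast
   then have k: "k = n" "ALL i<n. ap g (nm i) = ap h (nm i)" using node_eq[OF gD h(1)] by auto
   then show ?thesis using h cong[OF h(1) gD, of n] by auto
  qed
  show thesis
  proof (rule that[OF gD])
   show "ap g (nm i) \<in> ext Y" for i using Ng[of "Suc i"] by simp
  qed (use Ng in blast)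
 next
  case False
  \<comment> \<open>the model has a rank function on the remaining nodes, which is decreasing along \<open>b\<close>\<close>
  let ?R = "%t s. t \<in> D & s \<in> D & N t & N s & ~ good s & C t s"
  have Rd: "dfn D (%e. ?R (e 0) (e (Suc 0)))" by (intro dfn_intros Nd gd Cdf)
  have Rsl: "isset {t \<in> D. ?R t s}" if s: "s \<in> D" for s
  proof -
   have C1: "dfn D (%e. C (e 0) s)" using dfn2[OF Cdf[of 0 "Suc 0"] dtm_var[of D 0] dtm_const[of s D]] s by simp
   have "dfn D (%e. e 0 \<in> D & (N s & ~ good s) & N (e 0) & C (e 0) s)" by (intro dfn_intros Nd C1)
   from subN[OF this mk_D[OF iN], unfolded ext_mk[OF iN]] show ?thesis
    by (rule back_subst[of isset]) (use s in blast)
  qed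
  obtain F where Fd: "dtm D (%e. F (e 0))"
   and F: "!!x. x \<in> D ==> F x = mk (\<Union>v\<in>ext (mk (F ` {y \<in> D. ?R y x})). ext (suc v))"
  proof (rule image_recursion[of ?R "%x s. mk (\<Union>v\<in>ext s. ext (suc v))", OF Rd Rsl])
   show "dtm D (%e. mk (\<Union>v\<in>ext (e (Suc 0)). ext (suc v)))" by (intro dfn_intros)
   fix P x assume Pd: "dfn D (%e. P (e 0))" and P: "!!x. x \<in> D ==> (!!y. y \<in> D ==> ?R y x ==> P y) ==> P x" and x: "x \<in> D"
   show "P x"
   proof (rule ccontr)
    assume nP: "~ P x"
    let ?Q = "%t. N t & ~ P t & ~ good t"
    have Qd: "dfn D (%e. ?Q (e 0))" by (intro dfn_intros Nd Pd gd)
    have ex: "EX y:D. ?R y t & ~ P y" if "t \<in> D" "~ P t" for t using P[OF that(1)] that(2) by blast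
    have "?Q x" using ex[OF x nP] nP by blast
    then have "good x"
    proof (rule goodI[OF Qd x])
     fix t assume t: "t \<in> D" "?Q t"
     obtain y where "y \<in> D" "?R y t" "~ P y" using ex[OF t(1)] t(2) by blast
     then show "N t & (EX u:D. (?Q u \<or> good u) & C u t)" using t(2) by blast
    qed
    then show False using \<open>?Q x\<close> by blast
   qed
  qed (assumption | rule that)+
  have FD: "F x \<in> D" if "x \<in> D" for x by (rule dtm1_D[OF Fd that])
  have iI: "isset (F ` {y \<in> D. ?R y x})" if "x \<in> D" for x by (rule isset_image[OF Rsl[OF that] Fd])
  have FR: "F y \<epsilon> F x" if r: "?R y x" for x y
  proof -
   have x: "x \<in> D" and y: "y \<in> D" using r by blast+
   have "F y \<in> ext (suc (F y))" using FD[OF y] by simp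
   moreover have "F y \<in> F ` {y \<in> D. ?R y x}" using r y by blast
   moreover have "isset (\<Union>v\<in>F ` {y \<in> D. ?R y x}. ext (suc v))"
    by (rule isset_UN[OF iI[OF x]]) (intro dfn_intros)
   ultimately have "F y \<in> ext (F x)" unfolding F[OF x] ext_mk[OF iI[OF x]] by (subst ext_mk) auto
   then show ?thesis by simp
  qed
  \<comment> \<open>The branch \<open>b\<close> itself may be missing from the model, but each of
    its finite initial segments is there.\<close>
  define g where "g n = mk ((%k. op (nm k) (b k)) ` {..n})" for n
  have g: "g n \<in> D" "i < n ==> ap (g n) (nm i) = b i" for n i
   unfolding g_def using ap_finite[of i n b] ap_finite(2)[of n n b] bD by auto
  let ?s = "%n. node (g n) n"
  have sD: "?s n \<in> D" for n unfolding node_def using node_lam(1)[OF g(1)] by auto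
  have sN: "N (?s n)" for n unfolding N_def by (intro bexI[of _ "g n"] exI[of _ n] conjI refl) (use g bC b in auto)
  have sC: "C (?s (Suc n)) (?s n)" for n unfolding C_def
   by (rule bexI[of _ "g (Suc n)"], rule exI[of _ n]) (use g node_eq[OF g(1) g(1)] in auto)
  have ng: "~ good (?s n)" for n
  proof (induction n)
   case 0
   have "?s 0 = node (nm 0) 0" using node_eq[OF g(1) nm_D] by simp
   then show ?case using False by simp
  next
   case (Suc n)
   show ?case
   proof
    assume gS: "good (?s (Suc n))"
    have "dfn D (%e. e 0 = ?s n)" by (intro dfn_intros sD)
    then have "good (?s n)" by (rule goodI[OF _ sD refl]) (use sN sC gS sD in blast)
    then show False using Suc by blast
   qed
  qed
  have "F (?s (Suc n)) \<epsilon> F (?s n)" for n by (rule FR) (intro conjI sD sN ng sC)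
  then show thesis using no_descent[of "%n. F (?s n)"] FD[OF sD] by simp
 qed
qed

end

text \<open>Finite sequences are coded by \<open>0\<close> and \<open>Suc (enc s a)\<close> (append \<open>a\<close> to \<open>s\<close>); such codes also
 serve as the positions in a Borel code.\<close>

definition par :: "nat => nat" where "par s = dfst (s - 1)"
text \<open>Counts the iterates of \<open>par\<close> before 0 is reached. The bound by
  \<open>s\<close> loses nothing, since parents decrease, and it brings the count into the form
  handled by \<open>ntm_card\<close>.\<close>

definition len :: "nat => nat" where "len s = card {k. k < s & (par ^^ k) s ~= 0}"
text \<open>Entry \<open>i\<close> is the last entry of the ancestor of length
  \<open>Suc i\<close>.\<close>

definition ent :: "nat => nat => nat" where "ent s i = dsnd ((par ^^ (len s - Suc i)) s - 1)"
abbreviation ch :: "nat => nat => nat" where "ch s a \<equiv> Suc (enc s a)"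

lemma par_ch [simp]: "par (ch s a) = s"
 by (simp add: par_def)

lemma ch_cases: "s = 0 \<or> s = ch (par s) (dsnd (s - 1))"
 by (cases s) (simp_all add: par_def)

lemma par_less: "s ~= 0 ==> par s < s"
 unfolding par_def using dfst_le[of "s - 1"] by linarith

lemma less_ch: "s < ch s a"
 using le_prod_encode_1[of s a] by simp

lemma par_pow: "(par ^^ k) s \<le> s - k"
proof (induction k)
 case (Suc k)
 have "par x \<le> x - 1" for x unfolding par_def by (rule dfst_le)
 from this[of "(par ^^ k) s"] show ?case using Suc by simp
qed simp

lemma len_0 [simp]: "len 0 = 0"
 by (simp add: len_def)

lemma len_ch [simp]: "len (ch s a) = Suc (len s)"
proof -
 have "{k. k < ch s a & (par ^^ k) (ch s a) ~= 0} = insert 0 (Suc ` {k. k < s & (par ^^ k) s ~= 0})" (is "?A = ?B")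
 proof (intro set_eqI)
  fix k show "k \<in> ?A <-> k \<in> ?B"
  proof (cases k)
   case (Suc j)
   have "(par ^^ k) (ch s a) = (par ^^ j) s" unfolding Suc by (simp only: funpow_Suc_right o_apply par_ch)
   moreover have "(par ^^ j) s ~= 0 ==> j < s" using par_pow[of j s] by linarith
   ultimately show ?thesis using less_ch[of s a] unfolding Suc by auto
  qed simp
 qed
 then show ?thesis unfolding len_def by (simp add: card_image)
qed

lemma ent_ch: "i \<le> len s ==> ent (ch s a) i = (if i = len s then a else ent s i)"
proof (cases "i = len s")
 case True
 then show ?thesis by (simp add: ent_def)
next
 case False
 moreover assume "i \<le> len s"
 ultimately have "len s - i = Suc (len s - Suc i)" by simp
 then have "(par ^^ (len (ch s a) - Suc i)) (ch s a) = (par ^^ (len s - Suc i)) s"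
  by (simp del: funpow.simps add: funpow_Suc_right)
 then show ?thesis using False by (simp add: ent_def)
qed

lemma len_le: "len s \<le> s"
 unfolding len_def using card_mono[of "{..<s}" "{k. k < s & (par ^^ k) s ~= 0}"] by auto

section \<open>Positions in a Borel code and trees of attempts\<close>

primrec scode :: "(nat => nat) => nat => nat" where
 "scode z 0 = 0" | "scode z (Suc n) = ch (scode z n) (z n)"

lemma scode: "len (scode z n) = n" "i < n ==> ent (scode z n) i = z i"
proof -
 show l: "len (scode z n) = n" for n by (induction n) simp_all
 show "i < n ==> ent (scode z n) i = z i"
  by (induction n) (auto simp: ent_ch l less_Suc_eq)
qed

text \<open>The subcode at a position. A path that has reached a leaf \<open>Basic k\<close> stays
  at this leaf.\<close>

function cd :: "borel_code => nat => borel_code" where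
 "cd c 0 = c" | "cd c (Suc n) = (case cd c (dfst n) of Basic k => Basic k | Nor f => f (dsnd n))"
 by pat_completeness auto
termination by (relation "Wellfounded.measure snd") (simp_all add: dfst_le less_Suc_eq_le)

text \<open>The code as a function on numbers: label 0 marks a \<open>Nor\<close> node and label
  \<open>Suc k\<close> a leaf \<open>Basic k\<close>.\<close>

definition lab :: "borel_code => nat => nat" where
 "lab c s = (case cd c s of Basic k => Suc k | Nor f => 0)"

abbreviation (input) "c0 x \<equiv> dfst x"
abbreviation (input) "c1 x \<equiv> dfst (dsnd x)"
abbreviation (input) "c2 x \<equiv> dfst (dsnd (dsnd x))"
abbreviation (input) "c3 x \<equiv> dfst (dsnd (dsnd (dsnd x)))"
abbreviation (input) "c4 x \<equiv> dsnd (dsnd (dsnd (dsnd x)))"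

text \<open>\<open>Tc l f z n\<close>: no contradiction below \<open>n\<close> in the claim that \<open>z\<close> describes a set \<open>B\<close> (by \<open>c0\<close>)
 in the Borel set with labels \<open>l\<close> (evaluated by \<open>c1\<close>, with \<open>c2\<close> choosing true subcodes) such that
 \<open>f\<inverse>[B]\<close> has, as shown by \<open>c3\<close> and \<open>c4\<close>, infinitely many infinite sections.\<close>

definition Tc :: "(nat => nat) => (nat => nat) => (nat => nat) => nat => bool" where
 "Tc l f z n <-> (ALL i. i < n -->
   (i = 0 --> c1 (z i) = 1) &
   (l i ~= 0 --> l i - 1 < n --> (c1 (z i) = 1 <-> c0 (z (l i - 1)) = 1)) &
   (l i = 0 --> (ALL a. ch i a < n --> c1 (z i) = 1 --> c1 (z (ch i a)) ~= 1)) &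
   (l i = 0 --> c1 (z i) ~= 1 --> ch i (c2 (z i)) < n --> c1 (z (ch i (c2 (z i)))) = 1) &
   dfst i \<le> c3 (z (dfst i)) & dsnd i \<le> c4 (z i) &
   (enc (c3 (z (dfst i))) (c4 (z i)) < n --> f (enc (c3 (z (dfst i))) (c4 (z i))) < n -->
    c0 (z (f (enc (c3 (z (dfst i))) (c4 (z i))))) = 1))"

lemma Tc_cong:
 assumes f: "!!i. i < n ==> f i = f' i" and z: "!!i. i < n ==> z i = z' i" and T: "Tc l f z n"
 shows "Tc l f' z' n"
 unfolding Tc_def
proof (intro allI impI)
 fix i assume i: "i < n"
 then have d: "dfst i < n" using dfst_le[of i] by linarith
 let ?x = "enc (c3 (z' (dfst i))) (c4 (z' i))"
 note T' = T[unfolded Tc_def, rule_format, OF i, unfolded z[OF i] z[OF d]]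
 have "c0 (z' (f' ?x)) = 1" if "?x < n" "f' ?x < n" using T' f[OF that(1)] z[OF that(2)] that by simp
 moreover have "c0 (z' (l i - 1)) = c0 (z (l i - 1))" if "l i - 1 < n" using z[OF that] by simp
 moreover have "c1 (z' (ch i a)) = c1 (z (ch i a))" if "ch i a < n" for a using z[OF that] by simp
 ultimately show "(i = 0 --> c1 (z' i) = 1) &
   (l i ~= 0 --> l i - 1 < n --> (c1 (z' i) = 1 <-> c0 (z' (l i - 1)) = 1)) &
   (l i = 0 --> (ALL a. ch i a < n --> c1 (z' i) = 1 --> c1 (z' (ch i a)) ~= 1)) &
   (l i = 0 --> c1 (z' i) ~= 1 --> ch i (c2 (z' i)) < n --> c1 (z' (ch i (c2 (z' i)))) = 1) &
   dfst i \<le> c3 (z' (dfst i)) & dsnd i \<le> c4 (z' i) & (?x < n --> f' ?x < n --> c0 (z' (f' ?x)) = 1)"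
  using T' by simp
qed

lemma Tc_mono:
 assumes T: "Tc l f z n" and m: "m \<le> n" shows "Tc l f z m"
 unfolding Tc_def
proof (rule allI, rule impI)
 fix i assume "i < m"
 then have i: "i < n" using m by simp
 have le: "k < m ==> k < n" for k using m by simp
 note T[unfolded Tc_def, rule_format, OF i]
 then show "(i = 0 --> c1 (z i) = 1) &
   (l i ~= 0 --> l i - 1 < m --> (c1 (z i) = 1 <-> c0 (z (l i - 1)) = 1)) &
   (l i = 0 --> (ALL a. ch i a < m --> c1 (z i) = 1 --> c1 (z (ch i a)) ~= 1)) &
   (l i = 0 --> c1 (z i) ~= 1 --> ch i (c2 (z i)) < m --> c1 (z (ch i (c2 (z i)))) = 1) &
   dfst i \<le> c3 (z (dfst i)) & dsnd i \<le> c4 (z i) &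
   (enc (c3 (z (dfst i))) (c4 (z i)) < m --> f (enc (c3 (z (dfst i))) (c4 (z i))) < m -->
    c0 (z (f (enc (c3 (z (dfst i))) (c4 (z i))))) = 1)"
  using le by blast
qed

text \<open>Induction on the subcode shows that the guessed truth values are the true ones. The
  remaining clauses exhibit arbitrarily late columns, each with arbitrarily late points of the
  preimage.\<close>

lemma Tc_sound:
 assumes T: "!!n. Tc (lab c) f z n"
 shows "{k. c0 (z k) = 1} \<in> borel_set c" "f -` {k. c0 (z k) = 1} \<notin> Fin2n"
proof -
 let ?B = "{k. c0 (z k) = 1}"
 have v: "!!s. cd c s = d ==> c1 (z s) = 1 <-> ?B \<in> borel_set d" for d
 proof (induction d)
  case (Basic k)
  then have "lab c s = Suc k" by (simp add: lab_def)
  then have "c1 (z s) = 1 <-> c0 (z k) = 1" using T[of "Suc (max s k)"] unfolding Tc_def by force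
  then show ?case by simp
 next
  case (Nor g)
  then have l: "lab c s = 0" by (simp add: lab_def)
  have cg: "c1 (z (ch s a)) = 1 <-> ?B \<in> borel_set (g a)" for a by (rule Nor.IH) (use Nor.prems in auto)
  have "c1 (z (ch s a)) ~= 1" if "c1 (z s) = 1" for a
   using T[of "Suc (ch s a)"] less_ch[of s a] l that unfolding Tc_def by auto
  moreover have "c1 (z (ch s (c2 (z s)))) = 1" if "c1 (z s) ~= 1"
   using T[of "Suc (ch s (c2 (z s)))"] less_ch[of s "c2 (z s)"] l that unfolding Tc_def by auto
  ultimately show ?case unfolding borel_set.simps mem_Collect_eq cg[symmetric] by blast
 qed
 have "c1 (z 0) = 1" using T[of 1] unfolding Tc_def by simp
 then show "?B \<in> borel_set c" using v[of 0 c] by simp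
 have w: "j \<le> c3 (z j)" "i \<le> c4 (z (enc j i))" "enc (c3 (z j)) (c4 (z (enc j i))) \<in> f -` ?B" for i j
 proof -
  let ?x = "enc (c3 (z j)) (c4 (z (enc j i)))"
  have "ALL k. k < Suc (max (enc j i) (max ?x (f ?x))) --> dfst k \<le> c3 (z (dfst k)) & dsnd k \<le> c4 (z k) &
   (enc (c3 (z (dfst k))) (c4 (z k)) < Suc (max (enc j i) (max ?x (f ?x))) -->
    f (enc (c3 (z (dfst k))) (c4 (z k))) < Suc (max (enc j i) (max ?x (f ?x))) -->
    c0 (z (f (enc (c3 (z (dfst k))) (c4 (z k))))) = 1)"
   using T[of "Suc (max (enc j i) (max ?x (f ?x)))"] unfolding Tc_def by blast
  from this[rule_format, of "enc j i"] show "j \<le> c3 (z j)" "i \<le> c4 (z (enc j i))" "?x \<in> f -` ?B" by (auto simp: le_max_iff_disj)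
 qed
 show "f -` ?B \<notin> Fin2n" unfolding Fin2n_iff
 proof
  assume "EX m. ALL n>=m. EX j. ALL k. enc n k \<in> f -` ?B --> k < j"
  then obtain m j where "ALL k. enc (c3 (z m)) k \<in> f -` ?B --> k < j" using w(1) by blast
  then show False using w(2,3)[of j m] w(3)[of m j] w(2)[of j m] by fastforce
 qed
qed

lemma Tc_complete:
 assumes B: "B \<in> borel_set c" "f -` B \<notin> Fin2n"
 obtains z where "!!n. Tc (lab c) f z n"
proof -
 have "ALL m. EX n>=m. ALL j. EX k. enc n k \<in> f -` B & j \<le> k" using B(2) unfolding Fin2n_iff by (meson not_le)
 then obtain u where u: "!!m. m \<le> u m" "!!m j. EX k. enc (u m) k \<in> f -` B & j \<le> k" by metis
 then obtain t where t: "!!m j. enc (u m) (t m j) \<in> f -` B" "!!m j. j \<le> t m j" by metis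
 define v where "v s = (if B \<in> borel_set (cd c s) then 1 else 0 :: nat)" for s
 define w where "w s = (SOME a. B \<in> borel_set (cd c (ch s a)))" for s
 \<comment> \<open>One sequence packs the characteristic function of \<open>B\<close>, the truth
   values of the subcodes, the choices of true subcodes, the large columns, and the points in
   them.\<close>
 define z where "z i = enc (if i \<in> B then 1 else 0) (enc (v i) (enc (w i) (enc (u i) (t (dfst i) (dsnd i)))))" for i
 have z: "c0 (z i) = 1 <-> i \<in> B" "c1 (z i) = 1 <-> B \<in> borel_set (cd c i)" "c2 (z i) = w i" "c3 (z i) = u i"
  "c4 (z i) = t (dfst i) (dsnd i)" for i by (auto simp: z_def v_def)
 have w: "B \<in> borel_set (cd c (ch s (w s)))" if s: "lab c s = 0" "B \<notin> borel_set (cd c s)" for s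
 proof -
  obtain g where "cd c s = Nor g" using s(1) by (auto simp: lab_def split: borel_code.splits)
  then have "EX a. B \<in> borel_set (cd c (ch s a))" using s(2) by simp
  then show ?thesis unfolding w_def by (rule someI_ex)
 qed
 have "Tc (lab c) f z n" for n unfolding Tc_def z
 proof (intro allI impI conjI)
  fix i
  show "i = 0 ==> B \<in> borel_set (cd c i)" using B(1) by simp
  show "lab c i ~= 0 ==> B \<in> borel_set (cd c i) <-> lab c i - 1 \<in> B" by (auto simp: lab_def split: borel_code.splits)
  show "lab c i = 0 ==> B \<in> borel_set (cd c i) ==> B \<notin> borel_set (cd c (ch i a))" for a
   by (auto simp: lab_def split: borel_code.splits)
  show "dfst i \<le> u (dfst i)" "dsnd i \<le> t (dfst i) (dsnd i)" by (rule u t)+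
  show "f (enc (u (dfst i)) (t (dfst i) (dsnd i))) \<in> B" using t(1) by simp
 qed (rule w)
 then show thesis by (rule that)
qed

text \<open>Admissibility as a closed condition, checked on initial segments and so suitable for a
  tree. In the finite-to-one case \<open>h\<close> bounds each fibre.\<close>

primrec adml :: "reduction => (nat => nat) => (nat => nat) => nat => bool" where
 "adml Katetov f h n <-> True"
| "adml Katetov_Blass f h n <-> (ALL k. k < n --> f k < n --> k < h (f k))"
| "adml One_to_One f h n <-> (ALL k l. k < n --> l < n --> f k = f l --> k = l)"

lemma adml_sound: "(!!n. adml r f h n) ==> admissible r f"
proof (cases r)
 case Katetov_Blass
 assume a: "!!n. adml r f h n"
 have kh: "k < h (f k)" for k using a[of "Suc (max k (f k))"] unfolding Katetov_Blass by simp
 have "finite (f -` {x})" for x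
 proof (rule finite_subset)
  show "f -` {x} \<subseteq> {..<h x}"
  proof
   fix k assume "k \<in> f -` {x}"
   then have "f k = x" by simp
   then show "k \<in> {..<h x}" using kh[of k] by simp
  qed
 qed simp
 then show ?thesis unfolding Katetov_Blass by simp
next
 case One_to_One
 assume a: "!!n. adml r f h n"
 have "k = l" if "f k = f l" for k l using a[of "Suc (max k l)"] that unfolding One_to_One by simp
 then show ?thesis unfolding One_to_One by (simp add: inj_def)
qed simp

lemma adml_complete:
 assumes "admissible r f" obtains h where "!!n. adml r f h n"
proof (cases r)
 case Katetov_Blass
 then have "ALL x. EX h. ALL k:f -` {x}. k < h" using assms finite_nat_set_iff_bounded by simp
 then obtain h where "!!x k. k \<in> f -` {x} ==> k < h x" by metis
 then show thesis using that[of h] Katetov_Blass by simp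
next
 case One_to_One
 then show thesis using that[of f] assms by (simp add: inj_def)
qed (use that in simp)

lemma adml_cong:
 "(!!i. i < n ==> f i = f' i) ==> (!!i. i < n ==> h i = h' i) ==> adml r f h n <-> adml r f' h' n"
 by (cases r) simp_all

context zfm
begin

lemma ntm_graph: "graph \<phi> \<in> reals ==> ntm D t ==> ntm D (%e. \<phi> (t e))"
proof -
 assume g: "graph \<phi> \<in> reals" and t: "ntm D t"
 have "dfn D (%e. enc (t (%i. e (Suc i))) (nof (e 0)) \<in> graph \<phi>)" by (intro dfn_intros g ntm_shift[OF t])
 then have "dfn D (%e. nof (e 0) = \<phi> (t (%i. e (Suc i))))" by (rule dfn_cong) auto
 then show ?thesis by (rule ntmI)
qed

lemma ntm_diff [dfn_intros]: "ntm A t ==> ntm A u ==> ntm A (%e. t e - u e)"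
proof -
 assume *: "ntm A t" "ntm A u"
 have "((%x. x - Suc 0) ^^ k) m = m - k" for k m :: nat by (induction k) simp_all
 moreover have "ntm A (%e. ((%x. x - Suc 0) ^^ u e) (t e))" by (intro dfn_intros *)
 ultimately show ?thesis by simp
qed

lemma ntm_par [dfn_intros]: "ntm A t ==> ntm A (%e. par (t e))"
 unfolding par_def by (intro dfn_intros)

lemma ntm_len [dfn_intros]: "ntm A t ==> ntm A (%e. len (t e))"
 unfolding len_def by (intro dfn_intros ntm_shift)

lemma ntm_ent [dfn_intros]: "ntm A t ==> ntm A u ==> ntm A (%e. ent (t e) (u e))"
 unfolding ent_def by (intro dfn_intros)

text \<open>The model computes the label of a position by following it down the code
  \<open>m\<close>.\<close>

lemma graph_lab:
 assumes m: "m \<in> D" "represents c m" shows "graph (lab c) \<in> reals"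
proof -
 let ?st = "%t a. if pfst t = nm 1 then ap (psnd t) (nm a) else t"
 have "dtm D (%e. if nof (e 0) = 0 then m else ?st (ap (e (Suc 0)) (nm (par (nof (e 0))))) (dsnd (nof (e 0) - 1)))"
  by (intro dfn_intros m nm_D)
 then obtain F where Fd: "dtm D (%e. F (e 0))"
  and F: "!!x. x \<in> D ==> F x = (if nof x = 0 then m else ?st (ap (lam (ext x) F) (nm (par (nof x)))) (dsnd (nof x - 1)))"
  and Fl: "!!x. x \<in> D ==> lam (ext x) F \<in> D"
  by (rule mem_recursion[of D "%x f. if nof x = 0 then m else ?st (ap f (nm (par (nof x)))) (dsnd (nof x - 1))"]) (rule that)
 have F0: "F (nm 0) = m" using F[of "nm 0"] by simp
 have FS: "F (nm (ch s a)) = ?st (F (nm s)) a" for s a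
 proof -
  have "ap (lam (ext (nm (ch s a))) F) (nm s) = F (nm s)"
   by (rule ap_lam'[OF Fl isset_ext Fd]) (use less_ch[of s a] in \<open>auto simp: ext_nm\<close>)
  then show ?thesis using F[of "nm (ch s a)"] by simp
 qed
 have rep: "represents (cd c s) (F (nm s))" for s
 proof (induction s rule: less_induct)
  case (less s)
  show ?case
  proof (cases s)
   case (Suc n)
   let ?t = "F (nm (dfst n))"
   have FD: "?t \<in> D" by (rule dtm1_D[OF Fd nm_D])
   have IH: "represents (cd c (dfst n)) ?t" by (rule less) (use dfst_le[of n] Suc in simp)
   have Fn: "F (nm s) = ?st ?t (dsnd n)" using FS[of "dfst n" "dsnd n"] Suc by simp
   show ?thesis
   proof (cases "cd c (dfst n)")
    case (Basic k)
    then have "?t = op (nm 0) (nm k)" using IH represents_iff(1)[OF FD] by simp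
    then have "F (nm s) = ?t" using Fn by simp
    then show ?thesis using IH Basic Suc by simp
   next
    case (Nor g)
    then obtain G where "G \<in> D" "?t = op (nm 1) G" "ALL i. represents (g i) (ap G (nm i))"
     using IH represents_iff(2)[OF FD] by auto
    then show ?thesis using Fn Nor Suc by simp
   qed
  qed (use F0 m in simp)
 qed
 have l: "lab c s = (if pfst (F (nm s)) = nm 1 then 0 else Suc (nof (psnd (F (nm s)))))" for s
 proof -
  have FD: "F (nm s) \<in> D" by (rule dtm1_D[OF Fd nm_D])
  show ?thesis
  proof (cases "cd c s")
   case (Basic k)
   then have "F (nm s) = op (nm 0) (nm k)" using rep[of s] represents_iff(1)[OF FD] by simp
   then show ?thesis using Basic by (simp add: lab_def)
  next
   case (Nor g)
   then obtain G where "G \<in> D" "F (nm s) = op (nm 1) G" using rep[of s] represents_iff(2)[OF FD] by auto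
   then show ?thesis using Nor by (simp add: lab_def)
  qed
 qed
 show ?thesis unfolding graph_def l by (rule realsI) (intro dfn_intros dtm1[OF Fd] nm_D)
qed

lemma dfn_Tc:
 assumes l: "graph l \<in> reals" and f: "ntm D (%e. f (nof (e 0)) (%i. e (Suc i)))"
  and z: "ntm D (%e. z (nof (e 0)) (%i. e (Suc i)))" and n: "ntm D n"
 shows "dfn D (%e. Tc l (%i. f i e) (%i. z i e) (n e))"
proof -
 have sub: "ntm D (%e. g (t e) (%i. e (s i)))" if g: "ntm D (%e. g (nof (e 0)) (%i. e (Suc i)))" and t: "ntm D t" for g t s
  using dtm_term_ren[OF g[unfolded ntm_def] dtm_nm[OF t], of s] unfolding ntm_def by simp
 note f1 = sub[OF f, of _ Suc] and z1 = sub[OF z, of _ Suc] and z2 = sub[OF z, of _ "%i. Suc (Suc i)"]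
 show ?thesis unfolding Tc_def by (intro dfn_intros ntm_graph[OF l] f1 z1 z2 ntm_ren[OF n, of Suc] ntm_ren[OF n, of "%i. Suc (Suc i)"])
qed

lemma dfn_adml:
 assumes f: "ntm D (%e. f (nof (e 0)) (%i. e (Suc i)))" and h: "ntm D (%e. h (nof (e 0)) (%i. e (Suc i)))" and n: "ntm D n"
 shows "dfn D (%e. adml r (%i. f i e) (%i. h i e) (n e))"
proof -
 have sub: "ntm D (%e. g (t e) (%i. e (s i)))" if g: "ntm D (%e. g (nof (e 0)) (%i. e (Suc i)))" and t: "ntm D t" for g t s
  using dtm_term_ren[OF g[unfolded ntm_def] dtm_nm[OF t], of s] unfolding ntm_def by simp
 note f1 = sub[OF f, of _ Suc] and h1 = sub[OF h, of _ Suc] and f2 = sub[OF f, of _ "%i. Suc (Suc i)"]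
 show ?thesis
  by (cases r; simp only: adml.simps; intro dfn_intros f1 h1 f2 ntm_ren[OF n, of Suc] ntm_ren[OF n, of "%i. Suc (Suc i)"])
qed

end

subsection \<open>Absoluteness of the reduction\<close>

lemma Tc_cong_z: "(!!i. i < n ==> z i = z' i) ==> Tc l f z n ==> Tc l f z' n"
 by (rule Tc_cong[where f = f and z = z]) simp_all

text \<open>The attempts in an infinite descent extend each other, so together they satisfy
  \<open>Tc\<close> at every length and yield a member of the Borel set with positive
  preimage.\<close>

lemma wf_child:
 assumes f: "!!B. B \<in> borel_set c ==> f -` B \<in> Fin2n"
 shows "wf {(t, s). t ~= 0 & par t = s & Tc (lab c) f (ent t) (len t)}"
 unfolding wf_iff_no_infinite_down_chain
proof
 assume "EX s. ALL n. (s (Suc n), s n) \<in> {(t, s). t ~= 0 & par t = s & Tc (lab c) f (ent t) (len t)}"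
 then obtain s where "ALL n. (s (Suc n), s n) \<in> {(t, s). t ~= 0 & par t = s & Tc (lab c) f (ent t) (len t)}" by (rule exE)
 then have "s (Suc n) ~= 0 & par (s (Suc n)) = s n & Tc (lab c) f (ent (s (Suc n))) (len (s (Suc n)))" for n by simp
 then have s: "!!n. s (Suc n) ~= 0" "!!n. par (s (Suc n)) = s n" "!!n. Tc (lab c) f (ent (s (Suc n))) (len (s (Suc n)))"
  by (rule conjunct1, rule conjunct1[OF conjunct2], rule conjunct2[OF conjunct2])
 define a where "a n = dsnd (s (Suc n) - 1)" for n
 have sS: "s (Suc n) = ch (s n) (a n)" for n using ch_cases[of "s (Suc n)"] s(1)[of n] unfolding s(2) a_def by blast
 \<comment> \<open>The descent may begin at any node, hence the offset
   \<open>len (s 0)\<close>.\<close>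
 have l: "len (s n) = len (s 0) + n" for n
 proof (induction n)
  case (Suc n)
  then show ?case unfolding sS by simp
 qed simp
 have e: "ent (s (n + d)) i = ent (s n) i" if "i < len (s n)" for n d i
 proof (induction d)
  case (Suc d)
  have "i < len (s (n + d))" using that l[of n] l[of "n + d"] by simp
  then show ?case using Suc unfolding add_Suc_right sS by (simp add: ent_ch)
 qed simp
 define z where "z i = ent (s (Suc i)) i" for i
 have z: "ent (s n) i = z i" if "i < len (s n)" for n i
  using e[OF that, of "Suc i"] e[of i "Suc i" n] l[of "Suc i"] unfolding z_def by (simp add: add.commute)
 have "Tc (lab c) f z n" for n
 proof (rule Tc_cong_z[of _ "ent (s (Suc n))"])
  show "Tc (lab c) f (ent (s (Suc n))) n" by (rule Tc_mono[OF s(3)]) (simp add: l[of "Suc n"])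
  show "ent (s (Suc n)) i = z i" if "i < n" for i by (rule z) (use that in \<open>simp add: l[of "Suc n"]\<close>)
 qed
 from Tc_sound[OF this] show False using f by blast
qed

context zfm
begin

text \<open>The union of the given ordinals is a countable well-order, so \<open>standard\<close>
  provides an ordinal of the model of its type, and this ordinal bounds them. The sequence
  \<open>e\<close> is external, so replacement in the model cannot be applied to it.\<close>

lemma countable_sup:
 fixes e :: "nat => 'm"
 assumes std: standard and e: "!!n. e n \<in> On" "!!n. countable (ext (e n))"
 obtains a where "a \<in> On" "countable (ext a)" "!!n. e n \<epsilon> a"
proof -
 define Z where "Z = (\<Union>n. insert (e n) (ext (e n)))"
 have ZO: "z \<in> On" if "z \<in> Z" for z using that e(1) On_mem unfolding Z_def by blast
 have Ztr: "y \<in> Z" if zy: "z \<in> Z" "y \<in> ext z" for y z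
 proof -
  obtain n where n: "z = e n \<or> z \<in> ext (e n)" using zy(1) unfolding Z_def by blast
  have "y \<in> D" "y \<epsilon> z" using zy(2) by auto
  then have "y \<epsilon> e n" using n On_trans[OF e(1), of z n y] by auto
  then show ?thesis unfolding Z_def using \<open>y \<in> D\<close> by auto
 qed
 have Zc: "countable Z" unfolding Z_def by (intro countable_UN countable_insert e(2)) simp
 let ?k = "to_nat_on Z"
 have inj: "?k x = ?k y <-> x = y" if "x \<in> Z" "y \<in> Z" for x y
  by (rule inj_on_eq_iff[OF inj_on_to_nat_on[OF Zc] that])
 define r where "r = {(?k x, ?k y) |x y. x \<in> Z & y \<in> Z & (x \<epsilon> y \<or> x = y)}"
 have rI: "(?k x, ?k y) \<in> r <-> x \<epsilon> y \<or> x = y" if "x \<in> Z" "y \<in> Z" for x y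
  unfolding r_def using that inj by blast
 have rE: "EX x:Z. EX y:Z. i = ?k x & j = ?k y & (x \<epsilon> y \<or> x = y)" if "(i, j) \<in> r" for i j
  using that unfolding r_def by blast
 have Fr: "Field r = ?k ` Z" unfolding Field_def r_def by blast
 have irr: "~ x \<epsilon> x" if "x \<in> Z" for x using mem_irrefl ZO[OF that] by simp
 have tr: "x \<epsilon> z" if "x \<in> Z" "y \<in> Z" "z \<in> Z" "x \<epsilon> y" "y \<epsilon> z" for x y z
  using On_trans[OF ZO[OF that(3)] that(5,4)] ZO that(1,2) by simp
 have "Well_order r"
  unfolding well_order_on_def linear_order_on_def partial_order_on_def preorder_on_def
 proof (intro conjI)
  show "refl_on (Field r) r" by (rule refl_onI) (use rI in \<open>auto simp: Fr\<close>)
  show "trans r"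
  proof (rule transI)
   fix i j k assume ij: "(i, j) \<in> r" and jk: "(j, k) \<in> r"
   obtain x y where x: "x \<in> Z" "y \<in> Z" "i = ?k x" "j = ?k y" "x \<epsilon> y \<or> x = y" using rE[OF ij] by blast
   obtain u w where u: "u \<in> Z" "w \<in> Z" "j = ?k u" "k = ?k w" "u \<epsilon> w \<or> u = w" using rE[OF jk] by blast
   have "y = u" using x u inj by simp
   then have "x \<epsilon> w \<or> x = w" using x u tr by blast
   then show "(i, k) \<in> r" using rI x u by simp
  qed
  show "antisym r"
  proof (rule antisymI)
   fix i j assume ij: "(i, j) \<in> r" and ji: "(j, i) \<in> r"
   obtain x y where x: "x \<in> Z" "y \<in> Z" "i = ?k x" "j = ?k y" "x \<epsilon> y \<or> x = y" using rE[OF ij] by blast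
   then show "i = j" using ji rI[OF x(2,1)] tr[OF x(1,2,1)] irr[OF x(1)] by blast
  qed
  show "total_on (Field r) r"
  proof (rule total_onI)
   fix i j assume "i \<in> Field r" "j \<in> Field r"
   then obtain x y where x: "x \<in> Z" "y \<in> Z" "i = ?k x" "j = ?k y" unfolding Fr by blast
   then show "(i, j) \<in> r \<or> (j, i) \<in> r" using rI[OF x(1,2)] rI[OF x(2,1)] On_linear[OF ZO[OF x(1)] ZO[OF x(2)]] by blast
  qed
  have "wf (inv_image {(x, y). x \<in> D & y \<in> D & x \<epsilon> y} (from_nat_into Z))"
   using wf_mem unfolding wfp_def by (rule wf_inv_image)
  then show "wf (r - Id)"
  proof (rule wf_subset, intro subrelI)
   fix i j assume ij: "(i, j) \<in> r - Id"
   then obtain x y where x: "x \<in> Z" "y \<in> Z" "i = ?k x" "j = ?k y" "x \<epsilon> y \<or> x = y" using rE by blast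
   then show "(i, j) \<in> inv_image {(x, y). x \<in> D & y \<in> D & x \<epsilon> y} (from_nat_into Z)"
    using ij from_nat_into_to_nat_on[OF Zc] ZO by auto
  qed
 qed (use r_def Fr in auto)
 then obtain a h where a: "a \<in> D" "ordinal a" and h: "bij_betw h (Field r) {x \<in> D. x \<epsilon> a}"
  and hr: "ALL i:Field r. ALL j:Field r. (i, j) \<in> r & i ~= j <-> h i \<epsilon> h j"
  using std unfolding standard_def by blast
 have aO: "a \<in> On" using a by (intro OnI)
 define f where "f z = h (?k z)" for z
 have fa: "f z \<in> D & f z \<epsilon> a" if "z \<in> Z" for z using bij_betwE[OF h] that unfolding f_def Fr by blast
 have fm: "x \<epsilon> y ==> f x \<epsilon> f y" if "x \<in> Z" "y \<in> Z" for x y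
  using hr[rule_format, of "?k x" "?k y"] rI[OF that] inj[OF that] irr that unfolding f_def Fr by blast
 \<comment> \<open>The order preserving map \<open>f\<close> moves no point down, so every point of
   \<open>Z\<close> is below \<open>a\<close>.\<close>
 have nf: "z \<in> Z ==> ~ f z \<epsilon> z" if "z \<in> D" for z using that
 proof (induction z rule: mem_induct)
  case (mem z)
  show ?case
  proof
   assume fz: "f z \<epsilon> z"
   then have fe: "f z \<in> ext z" using fa[OF mem.prems] by simp
   have fZ: "f z \<in> Z" by (rule Ztr[OF mem.prems fe])
   show False using mem.IH[OF fe fZ] fm[OF fZ mem.prems fz] by blast
  qed
 qed
 have Za: "z \<epsilon> a" if z: "z \<in> Z" for z
 proof -
  have zD: "z \<in> D" using ZO[OF z] by simp
  have n: "~ f z \<epsilon> z" by (rule nf[OF zD z])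
  have "~ a \<epsilon> z" using On_trans[OF ZO[OF z], of a "f z"] n fa[OF z] a(1) by blast
  then show ?thesis using On_linear[OF ZO[OF z] aO] n fa[OF z] by blast
 qed
 have "countable (ext a)"
 proof -
  have "ext a = h ` Field r" using bij_betw_imp_surj_on[OF h] unfolding ext_def by simp
  then show ?thesis by simp
 qed
 then show thesis using that aO Za unfolding Z_def by blast
qed

text \<open>The external rank function takes its values in ordinals of the model. Countability of
  the values is carried along, so that \<open>countable_sup\<close> applies at every node.\<close>

lemma countable_rank:
 assumes std: standard and W: "wf (W :: (nat \<times> nat) set)"
 obtains \<rho> a where "a \<in> On" "!!s. \<rho> s \<in> On" "!!s. \<rho> s \<epsilon> a" "!!s t. (t, s) \<in> W ==> \<rho> t \<epsilon> \<rho> s"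
proof -
 define P where "P g s a <-> a \<in> On & countable (ext a) & (ALL t. (t, s) \<in> W --> g t \<epsilon> a)" for g s a
 define \<rho> where "\<rho> = wfrec W (%g s. SOME a. P g s a)"
 have \<rho>: "P \<rho> s (\<rho> s)" for s using W
 proof (induction s rule: wf_induct_rule)
  case (less s)
  have eq: "P (cut \<rho> W s) s = P \<rho> s" unfolding P_def by (auto simp: cut_apply fun_eq_iff)
  have "\<rho> s = (SOME a. P \<rho> s a)" unfolding eq[symmetric] unfolding \<rho>_def by (rule wfrec[OF W])
  moreover have "EX a. P \<rho> s a"
  proof -
   define e where "e t = (if (t, s) \<in> W then \<rho> t else nm 0)" for t
   have "e n \<in> On" "countable (ext (e n))" for n using less unfolding e_def P_def by (auto simp: nm_On ext_nm)
   then obtain a where "a \<in> On" "countable (ext a)" "!!n. e n \<epsilon> a" by (rule countable_sup[OF std]) (rule that)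
   moreover have "\<rho> t \<epsilon> a" if "(t, s) \<in> W" for t using \<open>e t \<epsilon> a\<close> that unfolding e_def by simp
   ultimately show ?thesis unfolding P_def by blast
  qed
  ultimately show ?case using someI_ex[of "P \<rho> s"] by simp
 qed
 then have "\<rho> n \<in> On" "countable (ext (\<rho> n))" for n unfolding P_def by blast+
 then obtain a where "a \<in> On" "countable (ext a)" "!!n. \<rho> n \<epsilon> a" by (rule countable_sup[OF std]) (rule that)
 then show thesis using that[of a \<rho>] \<rho> unfolding P_def by blast
qed

text \<open>The same function works in the universe: a counterexample there is a branch of a tree of
  the model, which by \<open>branch\<close> has a branch in the model, and this would be a
  counterexample among its reals.\<close>

theorem redF_reals_imp_UNIV:
 assumes ch: choice and m: "m \<in> D" "represents c m" and F: "redF reals r (borel_set c)"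
 shows "redF UNIV r (borel_set c)"
proof -
 obtain f where f: "graph f \<in> reals" "admissible r f" "!!B. B \<in> borel_set c ==> B \<in> reals ==> f -` B \<in> Fin2n"
  using F unfolding redF_def by blast
 have "f -` B \<in> Fin2n" if B: "B \<in> borel_set c" for B
 proof (rule ccontr)
  assume nB: "f -` B \<notin> Fin2n"
  obtain z where z: "!!n. Tc (lab c) f z n" by (rule Tc_complete[OF B nB]) (rule that)
  obtain g where g: "g \<in> D" "!!n. Tc (lab c) f (fof g) n"
  proof (rule branch[OF ch om_D, of "%g n. Tc (lab c) f (fof g) n" "%i. nm (z i)"])
   show "dfn D (%e. Tc (lab c) f (fof (e 0)) (nof (e (Suc 0))))"
   proof (rule dfn_Tc[OF graph_lab[OF m]])
    show "ntm D (%e. f (nof (e 0)))" by (rule ntm_graph[OF f(1)]) (intro dfn_intros)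
    show "ntm D (%e. fof (e (Suc 0)) (nof (e 0)))" unfolding fof_def by (intro dfn_intros)
   qed (intro dfn_intros)
   show "Tc (lab c) f (fof h) n" if "ALL i<n. ap g (nm i) = ap h (nm i)" "Tc (lab c) f (fof g) n" for g h n
    by (rule Tc_cong_z[OF _ that(2)]) (use that(1) in \<open>simp add: fof_def\<close>)
   show "Tc (lab c) f (fof g) n" if "ALL i<n. ap g (nm i) = nm (z i)" for g n
    by (rule Tc_cong_z[OF _ z]) (use that in \<open>simp add: fof_def\<close>)
   show "nm (z i) \<in> ext om" for i by (simp add: nm_om)
  qed (rule that)
  have "{k. c0 (fof g k) = 1} \<in> reals" unfolding fof_def by (rule realsI) (intro dfn_intros g)
  then show False using Tc_sound[OF g(2)] f(3) by blast
 qed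
 then show ?thesis unfolding redF_def using f(2) by blast
qed

text \<open>Shoenfield's tree: a branch carries the function, bounds for its admissibility, and
  ranks for the attempts to refute it. The external ranks stay below one ordinal \<open>a\<close> of
  the model, so the tree can be formed inside and \<open>branch\<close> applies.\<close>

theorem redF_UNIV_imp_reals:
 assumes ch: choice and std: standard and m: "m \<in> D" "represents c m" and F: "redF UNIV r (borel_set c)"
 shows "redF reals r (borel_set c)"
proof -
 obtain f0 where f0: "admissible r f0" "!!B. B \<in> borel_set c ==> f0 -` B \<in> Fin2n" using F unfolding redF_def by blast
 obtain h0 where h0: "!!n. adml r f0 h0 n" by (rule adml_complete[OF f0(1)]) (rule that)
 obtain \<rho> a where a: "a \<in> On" and \<rho>: "!!s. \<rho> s \<in> On" "!!s. \<rho> s \<epsilon> a"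
  and W: "!!s t. (t, s) \<in> {(t, s). t ~= 0 & par t = s & Tc (lab c) f0 (ent t) (len t)} ==> \<rho> t \<epsilon> \<rho> s"
  by (rule countable_rank[OF std wf_child[of c f0, OF f0(2)]]) (assumption, rule that)
 have aD: "a \<in> D" and \<rho>D: "\<rho> s \<in> D" for s using a \<rho>(1) by auto
 define Fn where "Fn g i = nof (pfst (ap g (nm i)))" for g i
 define Hn where "Hn g i = nof (pfst (psnd (ap g (nm i))))" for g i
 define Rk where "Rk g i = psnd (psnd (ap g (nm i)))" for g i
 define Cd where "Cd g n <-> adml r (Fn g) (Hn g) n &
  (ALL s. s < n --> s ~= 0 --> Tc (lab c) (Fn g) (ent s) (len s) --> Rk g s \<epsilon> Rk g (par s))" for g n
 have CdI: "Cd h n" if c: "!!i. i < n ==> F' i = Fn h i & H' i = Hn h i & R' i = Rk h i"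
  and a: "adml r F' H' n" and t: "!!s. s < n ==> s ~= 0 ==> Tc (lab c) F' (ent s) (len s) ==> R' s \<epsilon> R' (par s)"
  for h n F' H' and R' :: "nat => 'm"
  unfolding Cd_def
 proof (intro conjI allI impI)
  show "adml r (Fn h) (Hn h) n" using a c adml_cong[of n F' "Fn h" H' "Hn h" r] by blast
  fix s assume s: "s < n" "s ~= 0" and T: "Tc (lab c) (Fn h) (ent s) (len s)"
  have "Tc (lab c) F' (ent s) (len s)"
  proof (rule Tc_cong[where f = "Fn h" and z = "ent s"])
   show "Fn h i = F' i" if "i < len s" for i using c[of i] that len_le[of s] s(1) by simp
  qed (rule refl, rule T)
  then show "Rk h s \<epsilon> Rk h (par s)" using t[OF s] c[OF s(1)] c[of "par s"] par_less[OF s(2)] s(1) by simp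
 qed
 let ?Y = "prd om (prd om a)"
 have YD: "?Y \<in> D" using aD by auto
 have eY: "ext ?Y = {op x y |x y. x \<in> ext om & y \<in> {op x y |x y. x \<in> ext om & y \<in> ext a}}"
  using ext_prd[OF om_D prd_D[OF om_D aD]] ext_prd[OF om_D aD] by simp
 obtain g where g: "g \<in> D" "!!i. ap g (nm i) \<in> ext ?Y" "!!n. Cd g n"
 proof (rule branch[OF ch YD, of Cd "%i. op (nm (f0 i)) (op (nm (h0 i)) (\<rho> i))"])
  have Fd: "ntm D (%e. Fn (e i) (nof (e j)))" and Hd: "ntm D (%e. Hn (e i) (nof (e j)))" for i j
   unfolding Fn_def Hn_def by (intro dfn_intros)+
  have R1: "dtm D (%e. Rk (e i) (t e))" if "ntm D t" for i t unfolding Rk_def by (intro dfn_intros that)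
  have Td: "dfn D (%e. Tc (lab c) (Fn (e (Suc 0))) (ent (nof (e 0))) (len (nof (e 0))))"
   by (rule dfn_Tc[OF graph_lab[OF m]]) (rule Fd, (intro dfn_intros)+)
  have ad: "dfn D (%e. adml r (Fn (e 0)) (Hn (e 0)) (nof (e (Suc 0))))"
   by (rule dfn_adml) (rule Fd, rule Hd, intro dfn_intros)
  show "dfn D (%e. Cd (e 0) (nof (e (Suc 0))))" unfolding Cd_def
   by (intro dfn_conj dfn_all_nat dfn_imp ad Td) (intro dfn_intros R1)+
  show "Cd h n" if "ALL i<n. ap g (nm i) = ap h (nm i)" "Cd g n" for g h n
   by (rule CdI[of n "Fn g" _ "Hn g" "Rk g"]) (use that in \<open>auto simp: Cd_def Fn_def Hn_def Rk_def\<close>)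
  show "op (nm (f0 i)) (op (nm (h0 i)) (\<rho> i)) \<in> ext ?Y" for i
   unfolding eY using \<rho>(2) \<rho>D nm_om by (intro CollectI exI conjI refl) auto
  show "Cd g n" if "ALL i<n. ap g (nm i) = op (nm (f0 i)) (op (nm (h0 i)) (\<rho> i))" for g n
  proof (rule CdI[of n f0 _ h0 \<rho>])
   show "f0 i = Fn g i & h0 i = Hn g i & \<rho> i = Rk g i" if "i < n" for i
    using \<open>ALL i<n. _ i = _ i\<close> that \<rho>D unfolding Fn_def Hn_def Rk_def by auto
  qed (use h0 W in auto)
 qed (rule that)
 have RD: "Rk g i \<in> D" for i
 proof -
  obtain x y w where "x \<in> ext om" "y \<in> ext om" "w \<in> ext a" "ap g (nm i) = op x (op y w)" using g(2)[of i] unfolding eY by blast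
  then show ?thesis unfolding Rk_def by simp
 qed
 \<comment> \<open>Refuting the function found in the model would make the ranks on the branch
   descend, and they belong to the model.\<close>
 have "Fn g -` B \<in> Fin2n" if B: "B \<in> borel_set c" for B
 proof (rule ccontr)
  assume nB: "Fn g -` B \<notin> Fin2n"
  obtain z where z: "!!n. Tc (lab c) (Fn g) z n" by (rule Tc_complete[OF B nB]) (rule that)
  have "Rk g (scode z (Suc n)) \<epsilon> Rk g (scode z n)" for n
  proof -
   let ?s = "scode z (Suc n)"
   have "Tc (lab c) (Fn g) (ent ?s) (len ?s)" by (rule Tc_cong_z[OF _ z]) (simp add: scode del: scode.simps)
   then show ?thesis using g(3)[of "Suc ?s"] unfolding Cd_def by auto
  qed
  then show False using no_descent[of "%n. Rk g (scode z n)"] RD by blast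
 qed
 moreover have "graph (Fn g) \<in> reals" unfolding graph_def Fn_def by (rule realsI) (intro dfn_intros g)
 moreover have "admissible r (Fn g)" by (rule adml_sound[of r _ "Hn g"]) (use g(3) in \<open>simp add: Cd_def\<close>)
 ultimately show ?thesis unfolding redF_def by blast
qed

end

context zfm
begin

text \<open>Rebuilds an element representing \<open>c\<close> from its labels, by recursion from the
  leaves up. The constructible universe contains the real of labels, but the given element
  \<open>m\<close> may lie outside.\<close>

lemma code_of_lab:
 assumes l: "graph (lab c) \<in> reals" shows "EX m:D. represents c m"
proof -
 have ln: "ntm D (%e. lab c (t e))" if "ntm D t" for t by (rule ntm_graph[OF l that])
 let ?R = "%y x. x \<in> ext om & lab c (nof x) = 0 & (EX n. y = nm (ch (nof x) n))"
 let ?G = "%x f. if lab c (nof x) ~= 0 then op (nm 0) (nm (lab c (nof x) - 1))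
  else op (nm 1) (lam (ext om) (%n. ap f (nm (ch (nof x) (nof n)))))"
 have Rs: "isset {y \<in> D. ?R y x}" if x: "x \<in> D" for x
 proof -
  have "isset {y \<in> ext om. ?R y x}" by (rule isset_sep) (intro dfn_intros ln x om_D)+
  moreover have "{y \<in> ext om. ?R y x} = {y \<in> D. ?R y x}" using nm_om by auto
  ultimately show ?thesis by simp
 qed
 obtain F where Fd: "dtm D (%e. F (e 0))" and F: "!!x. x \<in> D ==> F x = ?G x (lam {y \<in> D. ?R y x} F)"
  and Fl: "!!x. x \<in> D ==> lam {y \<in> D. ?R y x} F \<in> D"
 proof (rule recursion[of D ?R ?G])
  show "dfn D (%e. ?R (e 0) (e (Suc 0)))" by (intro dfn_intros ln)
  show "dtm D (%e. ?G (e 0) (e (Suc 0)))" by (intro dfn_intros ln nm_D)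
  fix P x assume P: "!!x. x \<in> D ==> (!!y. y \<in> D ==> ?R y x ==> P y) ==> P x" and x: "x \<in> D"
  have Pn: "!!s. cd c s = d ==> P (nm s)" for d
  proof (induction d)
   case (Basic k)
   then show ?case by (intro P[OF nm_D]) (simp add: lab_def)
  next
   case (Nor g)
   show ?case
   proof (rule P[OF nm_D])
    fix y assume "?R y (nm s)"
    then obtain n where "y = nm (ch s n)" by auto
    moreover have "P (nm (ch s n))" by (rule Nor.IH[of "g n"]) (use Nor.prems in auto)
    ultimately show "P y" by simp
   qed
  qed
  show "P x"
  proof (cases "x \<in> ext om")
   case True
   then obtain s where "x = nm s" unfolding ext_om by blast
   then show ?thesis using Pn[OF refl, of s] by simp
  qed (use P[OF x] in blast)
 qed (rule Rs | assumption | rule that)+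
 have "!!s. cd c s = d ==> represents d (F (nm s))" for d
 proof (induction d)
  case (Basic k)
  then have "F (nm s) = op (nm 0) (nm k)" using F[of "nm s"] by (simp add: lab_def)
  then show ?case using represents_iff(1)[of "F (nm s)"] dtm1_D[OF Fd nm_D] by simp
 next
  case (Nor g)
  have l0: "lab c s = 0" using Nor.prems by (simp add: lab_def)
  let ?f = "lam {y \<in> D. ?R y (nm s)} F"
  let ?L = "%n. ap ?f (nm (ch s (nof n)))"
  have fD: "?f \<in> D" by (rule Fl) simp
  have "dtm D (%e. ?L (e 0))" by (intro dfn_intros fD)
  note L = lam_function_on[OF this om_D]
  have Fs: "F (nm s) = op (nm 1) (lam (ext om) ?L)" using F[of "nm s"] l0 by simp
  have "represents (g i) (ap (lam (ext om) ?L) (nm i))" for i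
  proof -
   have "ap (lam (ext om) ?L) (nm i) = ap ?f (nm (ch s i))" using L(3)[of "nm i"] nm_om by simp
   also have "\<dots> = F (nm (ch s i))"
    by (rule ap_lam'[OF fD Rs Fd]) (use l0 nm_om in auto)
   finally show ?thesis using Nor.IH[of "g i" "ch s i"] Nor.prems by simp
  qed
  then show ?case using represents_iff(2)[of "F (nm s)" g] dtm1_D[OF Fd nm_D] L(1,2) Fs by blast
 qed
 from this[of 0 c] show ?thesis using dtm1_D[OF Fd nm_D] by auto
qed

section \<open>Models containing a code and the final equivalence\<close>

lemma foundationI: foundation
 unfolding foundation_def
proof (intro ballI impI)
 fix a assume a: "a \<in> D" "~ is_empty a"
 then obtain z where z: "z \<in> D" "z \<epsilon> a" unfolding is_empty_def by blast
 show "EX x:D. x \<epsilon> a & ~ (EX y:D. y \<epsilon> x & y \<epsilon> a)"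
 proof (rule ccontr)
  assume n: "~ ?thesis"
  have "~ z \<epsilon> a" using z(1)
  proof (induction z rule: mem_induct)
   case (mem x)
   then show ?case using n by auto
  qed
  then show False using z by blast
 qed
qed

lemma ZFC_iff: "ZFC <-> choice"
 unfolding ZFC_def using nonempty ax_ext foundationI ax_pair ax_union ax_pow ax_inf ax_sep ax_rep by blast

end

lemma model_with_code_iff:
 "set_structure.model_with_code D E c m <->
  zfm D E & set_structure.choice D E & set_structure.standard D E & m \<in> D & set_structure.represents D E c m"
proof -
 interpret set_structure D E .
 have "zfm D E" if ZFC standard using that unfolding ZFC_def standard_def by unfold_locales blast+
 then show ?thesis unfolding model_with_code_def using zfm.ZFC_iff by blast
qed

text \<open>The constructible universe over the real of labels. It keeps all ordinals of the model,
  so it is again standard, and the code is rebuilt in it from the labels.\<close>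

lemma constructible_model:
 assumes M: "set_structure.model_with_code D E c m"
 obtains D' m' where "set_structure.model_with_code D' E c m'" "set_structure.CH_in D' E"
proof -
 note M' = M[unfolded model_with_code_iff]
 interpret zfm D E using M' by blast
 have m: "m \<in> D" "represents c m" and std: standard using M' by blast+
 define x0 where "x0 = rl (graph (lab c))"
 define b where "b = mk (insert om (insert x0 (ext om)))"
 have xr: "graph (lab c) \<in> reals" by (rule graph_lab[OF m])
 have x0: "x0 \<in> D" "ext x0 \<subseteq> ext om" unfolding x0_def using xr ext_rl_om by auto
 have bD: "b \<in> D" and eb: "ext b = insert om (insert x0 (ext om))" unfolding b_def using x0(1) by auto
 interpret zfmL D E b
 proof
  have "ext x \<subseteq> ext om" if "x \<in> ext om" for x using that unfolding ext_om by (auto simp: ext_nm)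
  then show "ext x \<subseteq> ext b" if "x \<in> ext b" for x using that x0(2) unfolding eb by blast
 qed (use bD eb in auto)
 interpret L: set_structure Lc E .
 interpret LZ: zfm Lc E by (rule zfm_Lc)
 have x0L: "x0 \<in> Lc" and bL: "b \<in> Lc"
  using b_Lc eb zfmL.b_D[OF zfmL_Lc] by auto
 note e = L_ext[OF x0L] L_ext[OF bL] L_ext[OF om_Lc]
 interpret V: zfmVL Lc E b x0
 proof (rule zfmVL.intro[OF zfmL_Lc], rule zfmVL_axioms.intro)
  show "Lc = (\<Union>a\<in>LZ.On. L.ext (LZ.Lh b a))" by (rule V_eq_L)
 qed (use x0L x0(2) eb in \<open>simp_all only: L_om e\<close>)
 have "LZ.rof x0 = graph (lab c)" unfolding LZ.rof_def L_nm x0_def using mem_rl[OF xr] by auto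
 then have "graph (lab c) \<in> LZ.reals" using LZ.rof_reals[OF x0L] by simp
 then obtain m' where m': "m' \<in> Lc" "L.represents c m'" using LZ.code_of_lab by blast
 have "L.standard" unfolding L.standard_def
 proof (intro conjI allI impI)
  show "wfP (%x y. x \<in> Lc & y \<in> Lc & E x y)" by (rule LZ.wf_mem)
  fix r :: "(nat \<times> nat) set" assume "Well_order r"
  then obtain a h where a: "a \<in> D" "ordinal a" and h: "bij_betw h (Field r) {x \<in> D. E x a}"
   "ALL i:Field r. ALL j:Field r. ((i, j) \<in> r & i ~= j) = E (h i) (h j)"
   using std unfolding standard_def by blast
  then have "a \<in> On" by (intro OnI)
  then have aL: "a \<in> Lc" "a \<in> LZ.On" using On_Lc L_On by auto
  have "{x \<in> Lc. E x a} = {x \<in> D. E x a}" using L_ext[OF aL(1)] unfolding L.ext_def ext_def .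
  moreover have "L.ordinal a" by (rule LZ.On_ordinal[OF aL(2)])
  ultimately show "EX a:Lc. L.ordinal a & (EX h. bij_betw h (Field r) {x \<in> Lc. E x a} &
    (ALL i:Field r. ALL j:Field r. ((i, j) \<in> r & i ~= j) = E (h i) (h j)))"
   using h by (intro bexI[OF _ aL(1)] conjI exI[of _ h]) simp_all
 qed
 then have "L.model_with_code c m'" unfolding model_with_code_iff using LZ.zfm_axioms V.VL_choice m' by blast
 then show thesis using that V.VL_CH_in by blast
qed

lemma redF_model_iff:
 assumes "set_structure.model_with_code D E c m"
 shows "redF UNIV r (borel_set c) <-> redF (zfm.reals D E) r (borel_set c)"
proof -
 note M = assms[unfolded model_with_code_iff]
 interpret zfm D E using M by blast
 show ?thesis using M redF_reals_imp_UNIV[of m c r] redF_UNIV_imp_reals[of m c r] by blast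
qed

text \<open>Both sides amount to the failure of \<open>redF\<close> in the universe, by
  absoluteness. The premise supplies a model with the code, and its constructible universe shows
  that the clause about models of CH is not vacuous.\<close>

lemma consistent_iff_under_CH:
 assumes "ZFC_consistent c"
 shows "consistent_ex_ultra_not_P r c <-> under_CH_ex_ultra_not_P r c"
proof
 assume "consistent_ex_ultra_not_P r c"
 then obtain D :: "nat set set" and E m where M: "set_structure.model_with_code D E c m"
  and ex: "set_structure.ex_ultra_not_P_in D E r m" unfolding consistent_ex_ultra_not_P_def by blast
 note M' = M[unfolded model_with_code_iff]
 have "~ redF (zfm.reals D E) r (borel_set c)" by (rule zfm.ex_in_imp_not_redF[OF _ _ _ ex]) (use M' in blast)+
 then have n: "~ redF UNIV r (borel_set c)" unfolding redF_model_iff[OF M] .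
 have "set_structure.ex_ultra_not_P_in D' E' r m'"
  if N: "set_structure.model_with_code D' E' c m'" and CHN: "set_structure.CH_in D' E'" for D' :: "nat set set" and E' m'
 proof -
  note N' = N[unfolded model_with_code_iff]
  have "~ redF (zfm.reals D' E') r (borel_set c)" using n unfolding redF_model_iff[OF N] .
  then show ?thesis using zfm.CH_redF_imp_ex_in[of D' E' m' c r] N' CHN by blast
 qed
 then show "under_CH_ex_ultra_not_P r c" unfolding under_CH_ex_ultra_not_P_def using CH_redF_iff n by blast
next
 assume U: "under_CH_ex_ultra_not_P r c"
 obtain D :: "nat set set" and E m where "set_structure.model_with_code D E c m"
  using assms unfolding ZFC_consistent_def by blast
 then obtain D' m' where "set_structure.model_with_code D' E c m'" "set_structure.CH_in D' E"
  by (rule constructible_model)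
 then show "consistent_ex_ultra_not_P r c"
  using U unfolding under_CH_ex_ultra_not_P_def consistent_ex_ultra_not_P_def by blast
qed

theorem theorem7p3:
  fixes I :: "nat set set"
  assumes "ideal_on I"
  shows "(CH \<longrightarrow> (\<forall>r. \<not> reduces r I Fin2 \<longleftrightarrow> ex_ultra_not_P r I)) \<and>
    (tall I \<and> borel_family I \<longrightarrow>
      (\<forall>c. borel_set c = I \<and> ZFC_consistent c \<longrightarrow>
        (\<forall>r. consistent_ex_ultra_not_P r c \<longleftrightarrow> under_CH_ex_ultra_not_P r c)))"
 using CH_redF_iff consistent_iff_under_CH by (simp add: reduces_Fin2_iff)

end
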